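(* Given an SR instance $I$ with $n$ agents, we can find all its stable cycles, $SC(I)$, in $O(n_1^2(n^2+n_1))=O(n^4)$ time, where $n_2=\vert A(\mathcal{O}_I)\vert$ and $n_1=n-n_2$.
   Context: An SR (Stable Roommates) instance $I=(A,\succ)$ consists of an even number $n$ of agents, each with a strict complete preference ranking over the other agents. A stable partition is a permutation $\Pi$ of $A$ such that (T1) every agent weakly prefers its successor to its predecessor, and (T2) no two distinct agents $a_i,a_j$ satisfy $a_j \succ_i \Pi^{-1}(a_i)$ and $a_i \succ_j \Pi^{-1}(a_j)$. $SC(I)$ is the set of all cycles contained in some stable partition of $I$. $\mathcal{O}_I$ denotes the odd-length cycles, which are invariant across all stable partitions of $I$, and $A(\mathcal{O}_I)$ the set of agents in them. *)

theory Defs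
  imports Main "HOL-Combinatorics.Combinatorics"
begin

section \<open>Stable Roommates instances, stable partitions and stable cycles\<close>

text \<open>\<^term>\<open>P a\<close> lists the agents other than \<^term>\<open>a\<close>, from most to least preferred by \<^term>\<open>a\<close>.\<close>

definition sr_instance :: "'a set \<Rightarrow> ('a \<Rightarrow> 'a list) \<Rightarrow> bool" where
  "sr_instance A P \<longleftrightarrow>
     finite A \<and> even (card A) \<and> (\<forall>a\<in>A. distinct (P a) \<and> set (P a) = A - {a})"

text \<open>An agent may be a fixed point of a stable partition, so its predecessor may be the agent
  itself. As usual, every agent ranks itself below all other agents.\<close>

definition prefers :: "('a \<Rightarrow> 'a list) \<Rightarrow> 'a \<Rightarrow> 'a \<Rightarrow> 'a \<Rightarrow> bool" where
  "prefers P a x y \<longleftrightarrow>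
     (\<exists>i j. i < j \<and> j < length (P a @ [a]) \<and> (P a @ [a]) ! i = x \<and> (P a @ [a]) ! j = y)"

definition stable_partition :: "'a set \<Rightarrow> ('a \<Rightarrow> 'a list) \<Rightarrow> ('a \<Rightarrow> 'a) \<Rightarrow> bool" where
  "stable_partition A P \<pi> \<longleftrightarrow>
     \<pi> permutes A \<and>
     (\<forall>a\<in>A. prefers P a (\<pi> a) (inv \<pi> a) \<or> \<pi> a = inv \<pi> a) \<and>
     (\<forall>a\<in>A. \<forall>b\<in>A. a \<noteq> b \<longrightarrow> \<not> (prefers P a b (inv \<pi> a) \<and> prefers P b a (inv \<pi> b)))"

text \<open>A cycle is represented by its set of arcs \<open>(x, \<pi> x)\<close>. In this way lists that are rotations of
  each other denote the same cycle, the direction of a cycle matters, a fixed point \<open>a\<close> is the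
  cycle \<open>{(a, a)}\<close>, and the cardinality of the set is the length of the cycle.\<close>

type_synonym 'a cycle = "('a \<times> 'a) set"

definition cycle_at :: "('a \<Rightarrow> 'a) \<Rightarrow> 'a \<Rightarrow> 'a cycle" where
  "cycle_at \<pi> a = {(x, \<pi> x) | x. x \<in> orbit \<pi> a}"

definition stable_cycles :: "'a set \<Rightarrow> ('a \<Rightarrow> 'a list) \<Rightarrow> 'a cycle set" where
  "stable_cycles A P = {cycle_at \<pi> a | \<pi> a. stable_partition A P \<pi> \<and> a \<in> A}"

definition odd_cycles :: "'a set \<Rightarrow> ('a \<Rightarrow> 'a list) \<Rightarrow> 'a cycle set" where
  "odd_cycles A P = {C \<in> stable_cycles A P. odd (card C)}"

definition odd_agents :: "'a set \<Rightarrow> ('a \<Rightarrow> 'a list) \<Rightarrow> 'a set" where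
  "odd_agents A P = \<Union> (Field ` odd_cycles A P)"


section \<open>A unit-cost word RAM\<close>

text \<open>A program is a fixed piece of structured code, independent of the input. It uses registers
  (numbered by constants in the program text) and a memory with indirect addressing. The
  parameter \<open>W\<close> of the semantics is the word bound: a program gets stuck (has no execution) as soon
  as it computes a number that is at least \<open>W\<close>. With \<open>W\<close> polynomial in the input size, words
  have logarithmic length, which rules out packing large amounts of data into one number. \<open>Sub\<close> is
  truncated subtraction.\<close>

type_synonym reg = nat

datatype test = Less reg reg | Equal reg reg

datatype com =
    Skip
  | Const reg nat
  | Copy reg reg
  | Add reg reg reg
  | Sub reg reg reg
  | Mult reg reg reg
  | Load reg reg
  | Store reg reg
  | Seq com com
  | If test com com
  | While test com

type_synonym state = "(reg \<Rightarrow> nat) \<times> (nat \<Rightarrow> nat)"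

fun holds :: "test \<Rightarrow> (reg \<Rightarrow> nat) \<Rightarrow> bool" where
  "holds (Less x y) r \<longleftrightarrow> r x < r y"
| "holds (Equal x y) r \<longleftrightarrow> r x = r y"

text \<open>\<open>exec W c s t s'\<close>: started in state \<open>s\<close>, program \<open>c\<close> halts after \<open>t\<close> steps in state
  \<open>s'\<close>. Every instruction and every evaluation of a test costs one step.\<close>

inductive exec :: "nat \<Rightarrow> com \<Rightarrow> state \<Rightarrow> nat \<Rightarrow> state \<Rightarrow> bool" for W :: nat where
  Skip: "exec W Skip s 1 s"
| Const: "k < W \<Longrightarrow> exec W (Const x k) (r, m) 1 (r(x := k), m)"
| Copy: "exec W (Copy x y) (r, m) 1 (r(x := r y), m)"
| Add: "r y + r z < W \<Longrightarrow> exec W (Add x y z) (r, m) 1 (r(x := r y + r z), m)"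
| Sub: "exec W (Sub x y z) (r, m) 1 (r(x := r y - r z), m)"
| Mult: "r y * r z < W \<Longrightarrow> exec W (Mult x y z) (r, m) 1 (r(x := r y * r z), m)"
| Load: "exec W (Load x y) (r, m) 1 (r(x := m (r y)), m)"
| Store: "exec W (Store x y) (r, m) 1 (r, m(r x := r y))"
| Seq: "exec W c s t s' \<Longrightarrow> exec W d s' u s'' \<Longrightarrow> exec W (Seq c d) s (t + u) s''"
| IfTrue: "holds b (fst s) \<Longrightarrow> exec W c s t s' \<Longrightarrow> exec W (If b c d) s (Suc t) s'"
| IfFalse: "\<not> holds b (fst s) \<Longrightarrow> exec W d s t s' \<Longrightarrow> exec W (If b c d) s (Suc t) s'"
| WhileFalse: "\<not> holds b (fst s) \<Longrightarrow> exec W (While b c) s 1 s"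
| WhileTrue: "holds b (fst s) \<Longrightarrow> exec W c s t s' \<Longrightarrow> exec W (While b c) s' u s'' \<Longrightarrow>
    exec W (While b c) s (Suc (t + u)) s''"

inductive_cases exec_elims:
  "exec W Skip s t s'" "exec W (Const x k) s t s'" "exec W (Copy x y) s t s'"
  "exec W (Add x y z) s t s'" "exec W (Sub x y z) s t s'" "exec W (Mult x y z) s t s'"
  "exec W (Load x y) s t s'" "exec W (Store x y) s t s'" "exec W (Seq c d) s t s'"
  "exec W (If b c d) s t s'" "exec W (While b c) s t s'"

text \<open>Executions are unique, so asserting that a suitable execution exists is a statement about
  the only execution of the program.\<close>

lemma exec_deterministic:
  "exec W c s t s' \<Longrightarrow> exec W c s u s'' \<Longrightarrow> u = t \<and> s'' = s'"
proof (induction arbitrary: u s'' rule: exec.induct)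
  case (Seq c s t s' d v s1)
  from Seq.prems obtain t2 u2 r where "exec W c s t2 r" "exec W d r u2 s''" "u = t2 + u2"
    by (rule exec_elims)
  with Seq.IH show ?case by blast
next
  case (IfTrue b s c t s' d)
  from IfTrue.prems IfTrue.hyps obtain v where "exec W c s v s''" "u = Suc v"
    by (auto elim: exec_elims)
  with IfTrue.IH show ?case by blast
next
  case (IfFalse b s d t s' c)
  from IfFalse.prems IfFalse.hyps obtain v where "exec W d s v s''" "u = Suc v"
    by (auto elim: exec_elims)
  with IfFalse.IH show ?case by blast
next
  case (WhileFalse b s c)
  then show ?case by (auto elim: exec_elims)
next
  case (WhileTrue b s c t s' v s1)
  from WhileTrue.prems WhileTrue.hyps(1) obtain t2 u2 r
    where "exec W c s t2 r" "exec W (While b c) r u2 s''" "u = Suc (t2 + u2)"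
    by (cases rule: exec_elims(11)) auto
  with WhileTrue.IH show ?case by blast
qed (auto elim: exec_elims)


section \<open>Input and output conventions\<close>

text \<open>For agents \<open>0, \<dots>, n - 1\<close> the memory initially contains \<open>n\<close>, followed by the preference lists
  of the agents, one after the other; all other cells and all registers are zero.\<close>

definition input_words :: "nat \<Rightarrow> (nat \<Rightarrow> nat list) \<Rightarrow> nat list" where
  "input_words n P = n # concat (map P [0..<n])"

definition initial_state :: "nat list \<Rightarrow> state" where
  "initial_state ws = (\<lambda>_. 0, \<lambda>i. if i < length ws then ws ! i else 0)"

definition arcs_of :: "'a list \<Rightarrow> 'a cycle" where
  "arcs_of c = {(c ! i, c ! (Suc i mod length c)) | i. i < length c}"

text \<open>The list \<open>L\<close> contains every cycle of the set exactly once, each written as the sequence of the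
  agents on it.\<close>

definition enumerates_cycles :: "'a list list \<Rightarrow> 'a cycle set \<Rightarrow> bool" where
  "enumerates_cycles L \<C> \<longleftrightarrow>
     (\<forall>c\<in>set L. c \<noteq> [] \<and> distinct c) \<and> distinct (map arcs_of L) \<and> set (map arcs_of L) = \<C>"

text \<open>A list of cycles is written to memory as the number of cycles followed by the cycles, each
  preceded by its length. At the end of the computation register 0 holds the address at which the
  output starts.\<close>

definition output_words :: "nat list list \<Rightarrow> nat list" where
  "output_words L = length L # concat (map (\<lambda>c. length c # c) L)"

definition outputs :: "state \<Rightarrow> nat list \<Rightarrow> bool" where
  "outputs s ws \<longleftrightarrow> (\<forall>i<length ws. snd s (fst s 0 + i) = ws ! i)"

end

theory Submission
  imports Defs
begin

text \<open>Let every agent act once as a man and once as a woman. The stable marriages of this symmetric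
  instance form a lattice, on which inversion reverses the order. A stable partition \<open>\<pi>\<close> is a
  stable marriage above its inverse, and a stable marriage that is clamped between \<open>inv \<pi>\<close> and
  \<open>\<pi>\<close> gives every agent its successor or its predecessor. This choice propagates along a cycle in
  steps of two, so on an odd cycle it is constant; hence the odd cycles are the same for all stable
  partitions. Reversing \<open>\<pi>\<close> on an even cycle \<open>C\<close> gives another stable marriage. Conversely, \<open>C\<close>
  is stable as soon as some stable marriage that reverses \<open>C\<close> passes a test of quadratic cost. If a
  stable cycle passes through the arc \<open>(a, b)\<close>, such a marriage is the greatest stable marriage in
  which \<open>a\<close> and \<open>b\<close> are not better off than prescribed, and deferred acceptance finds it in
  quadratic time. A first stable partition results from the man-optimal stable marriage by the
  elimination of rotations. It yields the odd cycles, and the \<open>n\<^sub>1\<^sup>2\<close> pairs \<open>(a, b)\<close> of agents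
  outside the odd cycles yield the even ones.\<close>

text \<open>The obstacle is that no stable partition through a given arc is at hand; only stable
  marriages can be computed fast. They treat the two roles of an agent separately, so a bound on
  where a man starts in his list does no harm: a greatest solution still exists. The one partition
  found at the outset turns a test of the candidate marriage into a proof, because off the cycle
  that partition can be fitted between the candidate and its inverse. Cycles of length two need a
  search of their own: their successors and predecessors coincide, so no agent can be pushed
  strictly below its successor. On longer cycles two strict bounds at the neighbours
  \<open>a\<close> and \<open>b\<close> suffice, one for each half of the cycle, but the second
  bound requires the unknown successor of \<open>b\<close>, hence two runs. An even cycle is
  reported only for its least agent and the arc leaving it, so duplicates never have to be detected.
  Every pair thus costs \<open>O(n^2)\<close>, and all other work costs \<open>O(n^2)\<close> in
  total, which is absorbed as soon as there is an agent outside the odd cycles.\<close>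

lemma permutes_eq_inv_iff: "p permutes S \<Longrightarrow> inv p y = x \<longleftrightarrow> p x = y"
  by (metis permutes_inverses)

lemma permutes_funpow_in: "p permutes S \<Longrightarrow> x \<in> S \<Longrightarrow> (p ^^ k) x \<in> S"
  by (induction k) (auto simp: permutes_in_image)

section \<open>The lattice of stable marriages of the symmetric instance\<close>

locale roommates =
  fixes A :: "'a set" and rk :: "'a \<Rightarrow> 'a \<Rightarrow> nat"
  assumes finite_A: "finite A"
    and rk_inj: "\<lbrakk>a \<in> A; x \<in> A; y \<in> A; rk a x = rk a y\<rbrakk> \<Longrightarrow> x = y"
    and rk_self: "\<lbrakk>a \<in> A; x \<in> A\<rbrakk> \<Longrightarrow> rk a x \<le> rk a a"
begin

text \<open>Man \<open>a\<close> is married to woman \<open>\<mu> a\<close>, and woman \<open>b\<close> to man \<open>inv \<mu> b\<close>.\<close>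

definition marriage :: "('a \<Rightarrow> 'a) \<Rightarrow> bool" where
  "marriage \<mu> \<longleftrightarrow> \<mu> permutes A \<and>
     (\<forall>a\<in>A. \<forall>b\<in>A. \<not> (rk a b < rk a (\<mu> a) \<and> rk b a < rk b (inv \<mu> b)))"

text \<open>(T1) becomes \<open>\<le>\<close> because equal ranks mean equal agents. The case
  \<open>a = b\<close> may be included in (T2) because \<open>rk a a\<close> is the largest rank of
  \<open>a\<close>, so no agent blocks with itself.\<close>

definition partition :: "('a \<Rightarrow> 'a) \<Rightarrow> bool" where
  "partition \<pi> \<longleftrightarrow> \<pi> permutes A \<and> (\<forall>a\<in>A. rk a (\<pi> a) \<le> rk a (inv \<pi> a)) \<and>
     (\<forall>a\<in>A. \<forall>b\<in>A. \<not> (rk a b < rk a (inv \<pi> a) \<and> rk b a < rk b (inv \<pi> b)))"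

text \<open>The lattice operations of Conway. That the better partners of all men, chosen
  independently, form a matching at all is the content of \<open>join_permutes\<close>.\<close>

definition join :: "('a \<Rightarrow> 'a) \<Rightarrow> ('a \<Rightarrow> 'a) \<Rightarrow> 'a \<Rightarrow> 'a" where
  "join \<mu> \<nu> a = (if rk a (\<mu> a) \<le> rk a (\<nu> a) then \<mu> a else \<nu> a)"

definition meet :: "('a \<Rightarrow> 'a) \<Rightarrow> ('a \<Rightarrow> 'a) \<Rightarrow> 'a \<Rightarrow> 'a" where
  "meet \<mu> \<nu> a = (if rk a (\<mu> a) \<le> rk a (\<nu> a) then \<nu> a else \<mu> a)"

lemma marriage_permutes: "marriage \<mu> \<Longrightarrow> \<mu> permutes A"
  and partition_permutes: "partition \<pi> \<Longrightarrow> \<pi> permutes A"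
  by (auto simp: marriage_def partition_def)

lemma permutes_permutation: "p permutes A \<Longrightarrow> permutation p"
  using finite_A permutation_permutes by blast

text \<open>Inversion exchanges men and women; blocking pairs correspond because both sides rank by
  the same \<open>rk\<close>.\<close>

lemma marriage_inv: "marriage \<mu> \<Longrightarrow> marriage (inv \<mu>)"
  unfolding marriage_def by (metis permutes_inv permutes_inv_inv)

lemma rk_join: "rk a (join \<mu> \<nu> a) = min (rk a (\<mu> a)) (rk a (\<nu> a))"
  and rk_meet: "rk a (meet \<mu> \<nu> a) = max (rk a (\<mu> a)) (rk a (\<nu> a))"
  by (auto simp: join_def meet_def)

text \<open>Two men who obtain the same woman would have her in different marriages, and each
  strictly prefers her to his partner in the other one. She prefers one of the two, who then blocks
  with her the marriage in which she has the other.\<close>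

lemma join_inj_aux:
  assumes \<mu>: "marriage \<mu>" and \<nu>: "marriage \<nu>" and a: "a \<in> A" "a' \<in> A"
    and eq: "join \<mu> \<nu> a = join \<mu> \<nu> a'" and le: "rk a (\<mu> a) \<le> rk a (\<nu> a)"
  shows "a = a'"
proof (rule ccontr)
  assume ne: "a \<noteq> a'"
  note p = marriage_permutes[OF \<mu>] marriage_permutes[OF \<nu>]
  have y: "join \<mu> \<nu> a = \<mu> a" using le by (simp add: join_def)
  have nl: "\<not> rk a' (\<mu> a') \<le> rk a' (\<nu> a')"
  proof
    assume "rk a' (\<mu> a') \<le> rk a' (\<nu> a')"
    then have "\<mu> a = \<mu> a'" using eq y by (simp add: join_def)
    then show False using ne p by (metis permutes_inverses(2))
  qed
  then have y': "\<nu> a' = \<mu> a" using eq y by (simp add: join_def)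
  have "\<mu> a \<in> A" using p a permutes_in_image by metis
  have "\<nu> a \<noteq> \<mu> a" using y' ne p permutes_inj[of \<nu>] by (metis injD)
  then have 1: "rk a (\<mu> a) < rk a (\<nu> a)"
    using le rk_inj[of a "\<mu> a" "\<nu> a"] a p by (metis le_neq_implies_less permutes_in_image)
  have 2: "rk a' (\<mu> a) < rk a' (\<mu> a')" using nl y' by simp
  have i1: "inv \<nu> (\<mu> a) = a'" using y' p by (metis permutes_inverses(2))
  have i2: "inv \<mu> (\<mu> a) = a" using p by (metis permutes_inverses(2))
  have "rk (\<mu> a) a \<noteq> rk (\<mu> a) a'" using rk_inj \<open>\<mu> a \<in> A\<close> a ne by metis
  then consider "rk (\<mu> a) a < rk (\<mu> a) a'" | "rk (\<mu> a) a' < rk (\<mu> a) a" by linarith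
  then show False
  proof cases
    case c: 1 then show ?thesis using \<nu> 1 i1 a \<open>\<mu> a \<in> A\<close> unfolding marriage_def by metis
  next
    case b: 2 then show ?thesis using \<mu> 2 i2 a \<open>\<mu> a \<in> A\<close> unfolding marriage_def by metis
  qed
qed

lemma join_commute_on:
  assumes "\<mu> permutes A" "\<nu> permutes A"
  shows "join \<mu> \<nu> = join \<nu> \<mu>"
proof
  fix a show "join \<mu> \<nu> a = join \<nu> \<mu> a"
  proof (cases "a \<in> A")
    case True
    then have "\<mu> a \<in> A" "\<nu> a \<in> A" using assms by (auto simp: permutes_in_image)
    then show ?thesis using rk_inj[OF True, of "\<mu> a" "\<nu> a"] by (auto simp: join_def)
  next
    case False
    then show ?thesis using assms by (auto simp: join_def permutes_not_in)
  qed
qed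

lemma join_permutes:
  assumes \<mu>: "marriage \<mu>" and \<nu>: "marriage \<nu>"
  shows "join \<mu> \<nu> permutes A"
proof -
  note p = marriage_permutes[OF \<mu>] marriage_permutes[OF \<nu>]
  have "inj_on (join \<mu> \<nu>) A"
  proof (rule inj_onI)
    fix a a' assume a: "a \<in> A" "a' \<in> A" and eq: "join \<mu> \<nu> a = join \<mu> \<nu> a'"
    show "a = a'"
    proof (cases "rk a (\<mu> a) \<le> rk a (\<nu> a)")
      case True then show ?thesis using join_inj_aux[OF \<mu> \<nu> a eq] by simp
    next
      case False
      then show ?thesis
        using join_inj_aux[OF \<nu> \<mu> a] eq join_commute_on[OF p] by simp
    qed
  qed
  moreover have "join \<mu> \<nu> ` A \<subseteq> A" using p by (auto simp: join_def permutes_in_image)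
  ultimately have "bij_betw (join \<mu> \<nu>) A A"
    by (simp add: bij_betw_def endo_inj_surj finite_A)
  moreover have "\<forall>x. x \<notin> A \<longrightarrow> join \<mu> \<nu> x = x" using p by (auto simp: join_def permutes_not_in)
  ultimately show ?thesis by (auto intro: bij_imp_permutes)
qed

text \<open>Opposition of interests: let \<open>y\<close> be matched to \<open>a\<close> in the
  join, say through the first marriage, and to another man in the second. Then \<open>a\<close>
  prefers \<open>y\<close> to his second partner, so stability of the second marriage means that
  \<open>y\<close> does not prefer \<open>a\<close> to the man she has there.\<close>

lemma inv_join:
  assumes \<mu>: "marriage \<mu>" and \<nu>: "marriage \<nu>"
  shows "inv (join \<mu> \<nu>) = meet (inv \<mu>) (inv \<nu>)"
proof
  fix y
  note p = marriage_permutes[OF \<mu>] marriage_permutes[OF \<nu>]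
  note J = join_permutes[OF \<mu> \<nu>]
  have aux: "inv (join \<mu>' \<nu>') y = meet (inv \<mu>') (inv \<nu>') y"
    if m: "marriage \<mu>'" "marriage \<nu>'" and y: "y \<in> A"
      and e: "join \<mu>' \<nu>' (inv (join \<mu>' \<nu>') y) = \<mu>' (inv (join \<mu>' \<nu>') y)" for \<mu>' \<nu>'
  proof -
    note p = marriage_permutes[OF m(1)] marriage_permutes[OF m(2)]
    note J = join_permutes[OF m]
    define a where "a = inv (join \<mu>' \<nu>') y"
    have a: "a \<in> A" unfolding a_def using J y by (metis permutes_in_image permutes_inv)
    have Ja: "join \<mu>' \<nu>' a = y" unfolding a_def using J by (metis permutes_inverses(1))
    then have mua: "\<mu>' a = y" using e a_def by simp
    then have i: "inv \<mu>' y = a" using p by (metis permutes_inverses(2))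
    define a' where "a' = inv \<nu>' y"
    have a': "a' \<in> A" unfolding a'_def using p y by (metis permutes_in_image permutes_inv)
    have nua': "\<nu>' a' = y" unfolding a'_def using p by (metis permutes_inverses(1))
    have "rk y a' \<le> rk y a"
    proof (cases "a' = a")
      case False
      have "rk a y \<le> rk a (\<nu>' a)" using Ja rk_join[of a \<mu>' \<nu>'] by simp
      moreover have "\<nu>' a \<noteq> y" using False nua' p by (metis permutes_inverses(2))
      ultimately have "rk a y < rk a (\<nu>' a)"
        using rk_inj[OF a y, of "\<nu>' a"] p a by (metis le_neq_implies_less permutes_in_image)
      then show ?thesis using m(2) a y unfolding marriage_def a'_def by (metis not_le_imp_less)
    qed simp
    then show ?thesis unfolding meet_def i a'_def[symmetric]
      using rk_inj[OF y a a'] a_def i by auto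
  qed
  show "inv (join \<mu> \<nu>) y = meet (inv \<mu>) (inv \<nu>) y"
  proof (cases "y \<in> A")
    case True
    let ?a = "inv (join \<mu> \<nu>) y"
    show ?thesis
    proof (cases "join \<mu> \<nu> ?a = \<mu> ?a")
      case T: True show ?thesis using aux[OF \<mu> \<nu> True T] .
    next
      case False
      then have F: "join \<mu> \<nu> ?a = \<nu> ?a" by (auto simp: join_def)
      have c: "join \<nu> \<mu> = join \<mu> \<nu>" using join_commute_on p by metis
      have "?a = meet (inv \<nu>) (inv \<mu>) y" using aux[OF \<nu> \<mu> True] F c by simp
      also have "\<dots> = meet (inv \<mu>) (inv \<nu>) y"
        using rk_inj[OF True, of "inv \<nu> y" "inv \<mu> y"] True p
        by (auto simp: meet_def permutes_in_image permutes_inv)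
      finally show ?thesis .
    qed
  next
    case False
    then show ?thesis unfolding meet_def using p J by (metis permutes_not_in permutes_inv)
  qed
qed

text \<open>A man who prefers \<open>b\<close> to his partner in the join prefers her to both of his
  partners. She has the worse of her two men, so she prefers him to one of them, and the pair blocks
  that marriage.\<close>

lemma marriage_join:
  assumes \<mu>: "marriage \<mu>" and \<nu>: "marriage \<nu>"
  shows "marriage (join \<mu> \<nu>)"
  unfolding marriage_def
proof (intro conjI ballI notI)
  show "join \<mu> \<nu> permutes A" by (rule join_permutes[OF \<mu> \<nu>])
  fix a b assume ab: "a \<in> A" "b \<in> A"
    and H: "rk a b < rk a (join \<mu> \<nu> a) \<and> rk b a < rk b (inv (join \<mu> \<nu>) b)"
  then have "rk a b < rk a (\<mu> a)" "rk a b < rk a (\<nu> a)"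
    "rk b a < rk b (inv \<mu> b) \<or> rk b a < rk b (inv \<nu> b)"
    by (auto simp: rk_join inv_join[OF \<mu> \<nu>] rk_meet)
  then show False using \<mu> \<nu> ab unfolding marriage_def by blast
qed

lemma meet_eq:
  assumes \<mu>: "marriage \<mu>" and \<nu>: "marriage \<nu>"
  shows "meet \<mu> \<nu> = inv (join (inv \<mu>) (inv \<nu>))"
  using inv_join[OF marriage_inv[OF \<mu>] marriage_inv[OF \<nu>]] permutes_inv_inv marriage_permutes \<mu> \<nu>
  by metis

lemma marriage_meet: "marriage \<mu> \<Longrightarrow> marriage \<nu> \<Longrightarrow> marriage (meet \<mu> \<nu>)"
  by (simp add: meet_eq marriage_inv marriage_join)

lemma inv_meet:
  assumes \<mu>: "marriage \<mu>" and \<nu>: "marriage \<nu>"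
  shows "inv (meet \<mu> \<nu>) = join (inv \<mu>) (inv \<nu>)"
  using meet_eq[OF assms] join_permutes[OF marriage_inv[OF \<mu>] marriage_inv[OF \<nu>]]
  by (metis permutes_inv_inv)

text \<open>Small ranks are good, so the second argument is the marriage that is better for the
  men.\<close>

definition le :: "('a \<Rightarrow> 'a) \<Rightarrow> ('a \<Rightarrow> 'a) \<Rightarrow> bool" where
  "le \<nu> \<mu> \<longleftrightarrow> (\<forall>a\<in>A. rk a (\<mu> a) \<le> rk a (\<nu> a))"

text \<open>Under \<open>le\<close> the join is the better marriage itself, and
  \<open>inv_join\<close> hands the women the worse partners.\<close>

lemma le_opposite:
  assumes \<mu>: "marriage \<mu>" and \<nu>: "marriage \<nu>" and "le \<nu> \<mu>" and b: "b \<in> A"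
  shows "rk b (inv \<nu> b) \<le> rk b (inv \<mu> b)"
proof -
  have "join \<mu> \<nu> = \<mu>" using \<open>le \<nu> \<mu>\<close> \<mu> \<nu> unfolding join_def le_def fun_eq_iff
    by (metis marriage_permutes permutes_not_in)
  then have "meet (inv \<mu>) (inv \<nu>) b = inv \<mu> b" using inv_join[OF \<mu> \<nu>] by metis
  then show ?thesis using rk_meet[of b "inv \<mu>" "inv \<nu>"] by simp
qed

section \<open>Clamping a marriage between another one and its inverse; invariance of the odd
  cycles\<close>

definition clamp :: "('a \<Rightarrow> 'a) \<Rightarrow> ('a \<Rightarrow> 'a) \<Rightarrow> 'a \<Rightarrow> 'a" where
  "clamp \<nu> \<tau> = join (meet \<tau> \<nu>) (inv \<nu>)"

lemma rk_clamp: "rk a (clamp \<nu> \<tau> a) = min (max (rk a (\<tau> a)) (rk a (\<nu> a))) (rk a (inv \<nu> a))"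
  by (simp add: clamp_def rk_join rk_meet)

lemma marriage_clamp: "marriage \<nu> \<Longrightarrow> marriage \<tau> \<Longrightarrow> marriage (clamp \<nu> \<tau>)"
  by (simp add: clamp_def marriage_join marriage_meet marriage_inv)

text \<open>Inversion exchanges \<open>join\<close> and \<open>meet\<close> and maps the interval
  between \<open>inv \<nu>\<close> and \<open>\<nu>\<close> to itself. The two operations come out
  in the opposite order, which makes no difference because the interval is nonempty at every
  agent.\<close>

lemma inv_clamp:
  assumes \<nu>: "marriage \<nu>" and \<tau>: "marriage \<tau>" and "le (inv \<nu>) \<nu>"
  shows "inv (clamp \<nu> \<tau>) = clamp \<nu> (inv \<tau>)"
proof
  fix a
  have eq: "inv (clamp \<nu> \<tau>) = meet (join (inv \<tau>) (inv \<nu>)) \<nu>"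
    using \<nu> \<tau> permutes_inv_inv[OF marriage_permutes[OF \<nu>]] unfolding clamp_def
    by (simp add: inv_join marriage_meet marriage_inv inv_meet)
  note m = marriage_clamp[OF \<nu> \<tau>] marriage_clamp[OF \<nu> marriage_inv[OF \<tau>]]
  show "inv (clamp \<nu> \<tau>) a = clamp \<nu> (inv \<tau>) a"
  proof (cases "a \<in> A")
    case True
    have "rk a (\<nu> a) \<le> rk a (inv \<nu> a)" using True assms(3) by (auto simp: le_def)
    then have "rk a (inv (clamp \<nu> \<tau>) a) = rk a (clamp \<nu> (inv \<tau>) a)"
      by (simp add: eq rk_clamp rk_meet rk_join)
    then show ?thesis using m True
      by (meson marriage_permutes marriage_inv permutes_in_image rk_inj)
  next
    case False
    then show ?thesis using m by (metis marriage_permutes permutes_inv permutes_not_in)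
  qed
qed

lemma partition_le: "partition \<pi> \<Longrightarrow> le (inv \<pi>) \<pi>"
  by (auto simp: partition_def le_def)

lemma partition_marriage:
  assumes "partition \<pi>" shows "marriage \<pi>"
  unfolding marriage_def
proof (intro conjI ballI notI)
  show "\<pi> permutes A" using assms by (rule partition_permutes)
  fix a b assume "a \<in> A" "b \<in> A" "rk a b < rk a (\<pi> a) \<and> rk b a < rk b (inv \<pi> b)"
  then show False using assms unfolding partition_def by (meson order_less_le_trans)
qed

text \<open>An agent \<open>a\<close> strictly between its two neighbours would prefer its new
  partner \<open>b\<close> to \<open>inv \<pi> a\<close>. As a woman, \<open>b\<close> has
  \<open>a\<close> under the inverse of the clamp, which is again a clamp, so \<open>b\<close>
  prefers \<open>a\<close> to \<open>inv \<pi> b\<close>. This violates (T2).\<close>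

lemma clamp_partition_cases:
  assumes \<pi>: "partition \<pi>" and \<tau>: "marriage \<tau>" and a: "a \<in> A"
  shows "clamp \<pi> \<tau> a = \<pi> a \<or> clamp \<pi> \<tau> a = inv \<pi> a"
proof (rule ccontr)
  assume H: "\<not> ?thesis"
  let ?l = "clamp \<pi> \<tau>"
  note p = partition_permutes[OF \<pi>] note m = partition_marriage[OF \<pi>]
  note ml = marriage_clamp[OF m \<tau>] note pl = marriage_permutes[OF ml]
  define b where "b = ?l a"
  have b: "b \<in> A" "\<pi> a \<in> A" "inv \<pi> a \<in> A"
    unfolding b_def using a p pl by (metis permutes_in_image permutes_inv)+
  have r: "rk a (\<pi> a) \<le> rk a (inv \<pi> a)" using \<pi> a by (auto simp: partition_def)
  have r1: "rk a b \<le> rk a (inv \<pi> a)" unfolding b_def by (simp add: rk_clamp)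
  then have r1: "rk a b < rk a (inv \<pi> a)"
    using H rk_inj[OF a b(1) b(3)] unfolding b_def by fastforce
  have i: "inv ?l b = a" unfolding b_def using pl by (metis permutes_inverses(2))
  have "rk b a \<le> rk b (inv \<pi> b)"
    using i inv_clamp[OF m \<tau> partition_le[OF \<pi>]] rk_clamp[of b \<pi> "inv \<tau>"] by simp
  moreover have "a \<noteq> inv \<pi> b" using H b_def p by (metis permutes_inverses(1))
  moreover have "inv \<pi> b \<in> A" using b p by (metis permutes_in_image permutes_inv)
  ultimately have "rk b a < rk b (inv \<pi> b)" using rk_inj[OF b(1) a] by fastforce
  then show False using r1 \<pi> a b unfolding partition_def by blast
qed

text \<open>Since two men cannot share a partner, moving a single man down to his predecessor drags down
  the whole half of the cycle that is reached in steps of two.\<close>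

lemma clamp_down_step:
  assumes \<pi>: "partition \<pi>" and \<tau>: "marriage \<tau>" and a: "a \<in> A" and "\<pi> a \<noteq> inv \<pi> a"
    and d: "clamp \<pi> \<tau> a = inv \<pi> a"
  shows "clamp \<pi> \<tau> (inv \<pi> (inv \<pi> a)) = inv \<pi> (inv \<pi> (inv \<pi> a))"
proof -
  let ?l = "clamp \<pi> \<tau>" let ?c = "inv \<pi> (inv \<pi> a)"
  note p = partition_permutes[OF \<pi>]
  have pl: "?l permutes A" using marriage_clamp[OF partition_marriage[OF \<pi>] \<tau>] marriage_permutes by blast
  have c: "?c \<in> A" using a p by (metis permutes_in_image permutes_inv)
  have "?c \<noteq> a" using assms(4) p by (metis permutes_inverses(1))
  then have "?l ?c \<noteq> ?l a" using pl by (metis permutes_inverses(2))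
  moreover have "\<pi> ?c = ?l a" using d p by (metis permutes_inverses(1))
  ultimately show ?thesis using clamp_partition_cases[OF \<pi> \<tau> c] by auto
qed

text \<open>On a cycle of odd length \<open>L\<close>, an element at odd distance \<open>m\<close>
  from \<open>a\<close> is also at the even distance \<open>m + L\<close>, so steps of two reach
  everything.\<close>

lemma odd_orbit_induct:
  assumes f: "permutation f" and odd: "odd (card (orbit f a))" and "P a"
    and step: "\<And>x. x \<in> orbit f a \<Longrightarrow> P x \<Longrightarrow> P (f (f x))" and x: "x \<in> orbit f a"
  shows "P x"
proof -
  define L where "L = least_power f a"
  have orb: "orbit f a = set (support f a)"
    unfolding support_set[OF f] orbit_altdef_permutation[OF f] by blast
  have "card (orbit f a) = L"
    unfolding orb L_def using distinct_card[OF cycle_of_permutation[OF f]] by simp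
  then have L: "odd L" "(f ^^ L) a = a"
    using odd least_power_of_permutation(1)[OF f] L_def by auto
  have ev: "P ((f ^^ (2 * k)) a)" for k
  proof (induction k)
    case (Suc k)
    have "(f ^^ (2 * k)) a \<in> orbit f a"
      using orbit_altdef_permutation[OF f] by blast
    from step[OF this Suc] show ?case by simp
  qed (use \<open>P a\<close> in simp)
  obtain m where m: "x = (f ^^ m) a" using x orbit_altdef_permutation[OF f] by auto
  show ?thesis
  proof (cases "even m")
    case True then show ?thesis using ev m by (auto elim!: evenE)
  next
    case False
    then obtain k where "m + L = 2 * k" using L(1) by (metis evenE odd_add)
    then have "x = (f ^^ (2 * k)) a" using m L(2) by (metis comp_apply funpow_add)
    then show ?thesis using ev by simp
  qed
qed

text \<open>As a woman, \<open>a\<close> has herself in \<open>\<pi>\<close>, the worst possible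
  partner, and therefore also in the join with \<open>\<tau>\<close>. Hence man \<open>a\<close> has
  himself in the join, where he gets the better of \<open>\<tau> a\<close> and \<open>a\<close>; as
  he ranks himself last, \<open>\<tau> a = a\<close>.\<close>

lemma partition_fixed_point:
  assumes \<pi>: "partition \<pi>" and \<tau>: "marriage \<tau>" and a: "a \<in> A" and "\<pi> a = a"
  shows "\<tau> a = a"
proof -
  note m = partition_marriage[OF \<pi>] and p = partition_permutes[OF \<pi>]
  have "inv \<pi> a = a" using \<open>\<pi> a = a\<close> p by (metis permutes_inverses(2))
  have in_A: "\<tau> a \<in> A" "inv \<tau> a \<in> A"
    using a marriage_permutes[OF \<tau>] by (simp_all add: permutes_in_image permutes_inv)
  have "inv (join \<tau> \<pi>) a = a"
    unfolding inv_join[OF \<tau> m] meet_def \<open>inv \<pi> a = a\<close>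
    using rk_self[OF a in_A(2)] by simp
  then have "join \<tau> \<pi> a = a"
    using join_permutes[OF \<tau> m] by (metis permutes_inverses(1))
  then show ?thesis
    using rk_self[OF a in_A(1)] \<open>\<pi> a = a\<close> by (simp add: join_def split: if_splits)
qed

text \<open>What has to be excluded is the constant choice of the predecessor: then
  \<open>\<tau> z\<close> would be no better than \<open>inv \<pi> z\<close> and
  \<open>inv \<tau> z\<close> no worse than \<open>\<pi> z\<close>, against (T1) for
  \<open>\<tau>\<close>. If the successor is chosen everywhere, \<open>\<tau> x\<close> is no worse
  than \<open>\<pi> x\<close>, and exchanging the two partitions gives equality.\<close>

theorem partition_odd_orbit:
  assumes \<pi>: "partition \<pi>" and \<tau>: "partition \<tau>" and a: "a \<in> A"
    and odd: "odd (card (orbit \<pi> a))" and x: "x \<in> orbit \<pi> a"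
  shows "\<tau> x = \<pi> x"
proof -
  note p = partition_permutes[OF \<pi>] and m = partition_marriage[OF \<pi>]
  note pt = partition_permutes[OF \<tau>] and mt = partition_marriage[OF \<tau>]
  note per = permutes_permutation[OF p]
  note self = permutation_self_in_orbit[OF per]
  have sub: "orbit \<pi> a \<subseteq> A" using permutes_orbit_subset[OF p a] .
  have cyc: "orbit \<pi> z = orbit \<pi> a" if "z \<in> orbit \<pi> a" for z
    using that cyclic_on_orbit[OF p finite_A] orbit_cyclic_eq3 by fastforce
  have inA: "\<pi> z \<in> A" "inv \<pi> z \<in> A" "\<tau> z \<in> A" "inv \<tau> z \<in> A" if "z \<in> A" for z
    using that p pt by (metis permutes_in_image permutes_inv)+
  have in_orb: "\<pi> z \<in> orbit \<pi> a" "inv \<pi> z \<in> orbit \<pi> a" if "z \<in> orbit \<pi> a" for z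
  proof -
    show "\<pi> z \<in> orbit \<pi> a" using that by (rule orbit.step)
    have "inv \<pi> z \<in> orbit (inv \<pi>) a" using that orbit_inv_eq[OF per] orbit.step by metis
    then show "inv \<pi> z \<in> orbit \<pi> a" using orbit_inv_eq[OF per] by metis
  qed
  let ?l = "clamp \<pi> \<tau>"
  have inv_l: "inv ?l = clamp \<pi> (inv \<tau>)" using inv_clamp[OF m mt partition_le[OF \<pi>]] .
  have lp: "?l permutes A" using marriage_clamp[OF m mt] marriage_permutes by blast
  show ?thesis
  proof (cases "\<pi> x = x")
    case True
    then show ?thesis using partition_fixed_point[OF \<pi> mt] x sub by auto
  next
    case nfix: False
    \<comment> \<open>Coinciding neighbours would leave a cycle of length two, which is not odd, or
      a fixed point, which has been treated above.\<close>
    have ne: "\<pi> z \<noteq> inv \<pi> z" if z: "z \<in> orbit \<pi> a" for z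
    proof
      assume "\<pi> z = inv \<pi> z"
      then have "(\<pi> ^^ 2) z = z" using p by (simp add: numeral_2_eq_2) (metis permutes_inverses(1))
      then have "orbit \<pi> z = {(\<pi> ^^ k) z | k. k < 2}" by (rule orbit_altdef_bounded) simp
      also have "\<dots> = {z, \<pi> z}" by (auto simp: less_2_cases_iff intro: exI[of _ 0] exI[of _ 1])
      finally have o: "orbit \<pi> a = {z, \<pi> z}" using cyc[OF z] by simp
      then have "z = \<pi> z" using odd by (auto simp: card_insert_if split: if_splits)
      then show False using o x nfix by auto
    qed
    have lt: "rk z (\<pi> z) < rk z (inv \<pi> z)" if z: "z \<in> orbit \<pi> a" for z
    proof -
      have "z \<in> A" using z sub by blast
      then have "rk z (\<pi> z) \<noteq> rk z (inv \<pi> z)" using rk_inj[of z] inA ne[OF z] by metis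
      moreover have "rk z (\<pi> z) \<le> rk z (inv \<pi> z)" using \<pi> \<open>z \<in> A\<close> by (auto simp: partition_def)
      ultimately show ?thesis by simp
    qed
    have \<tau>1: "rk z (\<tau> z) \<le> rk z (inv \<tau> z)" if "z \<in> A" for z using \<tau> that by (auto simp: partition_def)
    have up: "?l z = \<pi> z" if z: "z \<in> orbit \<pi> a" for z
    proof (rule ccontr)
      assume "?l z \<noteq> \<pi> z"
      then have d: "?l z = inv \<pi> z" using clamp_partition_cases[OF \<pi> mt] z sub by auto
      have down: "?l y = inv \<pi> y" if "y \<in> orbit \<pi> a" for y
      proof (rule odd_orbit_induct[of "inv \<pi>" z "\<lambda>y. ?l y = inv \<pi> y"])
        show "permutation (inv \<pi>)" using per by (rule permutation_inverse)
        show "odd (card (orbit (inv \<pi>) z))" using odd cyc z orbit_inv_eq[OF per] by simp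
        show "y \<in> orbit (inv \<pi>) z" using that cyc z orbit_inv_eq[OF per] by simp
        show "?l (inv \<pi> (inv \<pi> v)) = inv \<pi> (inv \<pi> (inv \<pi> v))"
          if "v \<in> orbit (inv \<pi>) z" "?l v = inv \<pi> v" for v
          using clamp_down_step[OF \<pi> mt _ ne] that sub cyc z orbit_inv_eq[OF per] by blast
      qed (rule d)
      have zA: "z \<in> A" using z sub by blast
      have "?l (\<pi> z) = z" using down[OF in_orb(1)[OF z]] p by (metis permutes_inverses(2))
      then have "inv ?l z = \<pi> z" using lp by (metis permutes_inverses(2))
      then have "rk z (inv \<tau> z) \<le> rk z (\<pi> z)"
        using inv_l rk_clamp[of z \<pi> "inv \<tau>"] lt[OF z] by (simp add: min_def max_def split: if_splits)
      moreover have "rk z (inv \<pi> z) \<le> rk z (\<tau> z)"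
        using d rk_clamp[of z \<pi> \<tau>] lt[OF z] by (simp add: min_def max_def split: if_splits)
      ultimately show False using lt[OF z] \<tau>1[OF zA] by linarith
    qed
    have xA: "x \<in> A" using x sub by blast
    have r1: "rk x (\<tau> x) \<le> rk x (\<pi> x)"
      using up[OF x] rk_clamp[of x \<pi> \<tau>] lt[OF x] by (simp add: min_def max_def split: if_splits)
    have "?l (inv \<pi> x) = x" using up[OF in_orb(2)[OF x]] p by (metis permutes_inverses(1))
    then have "inv ?l x = inv \<pi> x" using lp by (metis permutes_inverses(2))
    then have r2: "rk x (inv \<pi> x) \<le> rk x (inv \<tau> x)"
      using inv_l rk_clamp[of x \<pi> "inv \<tau>"] lt[OF x] by (simp add: min_def max_def split: if_splits)
    \<comment> \<open>Now the roles are exchanged: by the two bounds \<open>\<pi> x\<close> already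
      lies in the interval that \<open>\<tau>\<close> spans at \<open>x\<close>, so it is one of the
      two neighbours of \<open>x\<close> in \<open>\<tau>\<close>.\<close>
    have "rk x (clamp \<tau> \<pi> x) = rk x (\<pi> x)"
      using r1 r2 lt[OF x] by (simp add: rk_clamp)
    moreover have "clamp \<tau> \<pi> x = \<tau> x \<or> clamp \<tau> \<pi> x = inv \<tau> x"
      using clamp_partition_cases[OF \<tau> m xA] .
    ultimately have "rk x (\<tau> x) = rk x (\<pi> x)" using r1 r2 lt[OF x] by auto
    then show ?thesis using rk_inj[OF xA] inA xA by blast
  qed
qed

section \<open>A partition obtained from a marriage that reverses the wanted cycle\<close>

definition glue :: "'a set \<Rightarrow> ('a \<Rightarrow> 'a) \<Rightarrow> ('a \<Rightarrow> 'a) \<Rightarrow> 'a \<Rightarrow> 'a" where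
  "glue C p q x = (if x \<in> C then p x else q x)"

lemma glue_permutes_inv:
  assumes p: "p permutes A" and q: "q permutes A" and C: "C \<subseteq> A"
    and pC: "\<And>x. x \<in> C \<Longrightarrow> p x \<in> C" and qC: "\<And>x. x \<in> C \<Longrightarrow> q x \<in> C"
  shows "glue C p q permutes A" "inv (glue C p q) = glue C (inv p) (inv q)"
proof -
  have fin: "finite C" using C finite_A finite_subset by blast
  have inv_in: "inv f x \<in> C \<longleftrightarrow> x \<in> C"
    if f: "f permutes A" and fC: "\<And>x. x \<in> C \<Longrightarrow> f x \<in> C" for f x
  proof -
    have "inj_on f C" using f by (metis inj_on_subset permutes_inj subset_UNIV)
    then have "f ` C = C" using fC fin by (simp add: endo_inj_surj image_subsetI)
    then show ?thesis using f by (metis imageE image_eqI permutes_inverses(1) permutes_inverses(2))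
  qed
  note ip = inv_in[OF p pC] and iq = inv_in[OF q qC]
  have 1: "glue C p q \<circ> glue C (inv p) (inv q) = id"
    using p q ip iq by (auto simp: fun_eq_iff glue_def permutes_inverses)
  have "q x \<notin> C" if "x \<notin> C" for x using that iq[of "q x"] q by (simp add: permutes_inverses)
  then have 2: "glue C (inv p) (inv q) \<circ> glue C p q = id"
    using p q pC by (auto simp: fun_eq_iff glue_def permutes_inverses)
  show "inv (glue C p q) = glue C (inv p) (inv q)" using inv_unique_comp[OF 1 2] .
  have "bij (glue C p q)" using o_bij[OF 2 1] .
  moreover have "\<forall>x. x \<notin> A \<longrightarrow> glue C p q x = x"
    using C q by (auto simp: glue_def permutes_not_in)
  ultimately show "glue C p q permutes A" by (simp add: permutes_def bij_iff)
qed

text \<open>On \<open>C\<close> the marriage gives every agent its predecessor; off \<open>C\<close> the known partition \<open>\<pi>\<^sub>0\<close> is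
  clamped between the marriage and its inverse.\<close>

theorem partition_from_marriage:
  assumes \<pi>0: "partition \<pi>\<^sub>0" and \<zeta>: "marriage \<zeta>" and C: "C \<subseteq> A"
    and CC: "\<And>x. x \<in> C \<Longrightarrow> \<zeta> x \<in> C" "\<And>x. x \<in> C \<Longrightarrow> inv \<zeta> x \<in> C"
    and on: "\<And>x. x \<in> C \<Longrightarrow> rk x (inv \<zeta> x) \<le> rk x (\<zeta> x)"
    and block: "\<And>x y. x \<in> C \<Longrightarrow> y \<in> C \<Longrightarrow> \<not> (rk x y < rk x (\<zeta> x) \<and> rk y x < rk y (\<zeta> y))"
    and off: "\<And>x. x \<in> A - C \<Longrightarrow> rk x (\<zeta> x) \<le> rk x (inv \<zeta> x)"
  obtains \<pi> where "partition \<pi>" "\<And>x. x \<in> C \<Longrightarrow> \<pi> x = inv \<zeta> x"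
proof -
  note pz = marriage_permutes[OF \<zeta>]
  \<comment> \<open>Turning \<open>\<zeta>\<close> round on \<open>C\<close> yields a marriage above
    its inverse, as \<open>inv_clamp\<close> demands.\<close>
  define \<nu> where "\<nu> = glue C (inv \<zeta>) \<zeta>"
  have p\<nu>: "\<nu> permutes A" and "inv \<nu> = glue C (inv (inv \<zeta>)) (inv \<zeta>)"
    unfolding \<nu>_def using glue_permutes_inv[OF permutes_inv[OF pz] pz C CC(2) CC(1)] by auto
  then have inv\<nu>: "inv \<nu> = glue C \<zeta> (inv \<zeta>)" using permutes_inv_inv[OF pz] by simp
  have zst: "\<not> (rk a b < rk a (\<zeta> a) \<and> rk b a < rk b (inv \<zeta> b))" if "a \<in> A" "b \<in> A" for a b
    using \<zeta> that unfolding marriage_def by blast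
  have m\<nu>: "marriage \<nu>"
    unfolding marriage_def
  proof (intro conjI p\<nu> ballI notI)
    fix a b assume ab: "a \<in> A" "b \<in> A" and H: "rk a b < rk a (\<nu> a) \<and> rk b a < rk b (inv \<nu> b)"
    show False
    proof (cases "b \<in> C")
      case b: True
      have H2: "rk b a < rk b (\<zeta> b)" using H b by (simp add: inv\<nu> glue_def)
      show False
      proof (cases "a \<in> C")
        case True
        then show ?thesis using H H2 block[OF True b] on[OF True] by (simp add: \<nu>_def glue_def)
      next
        case False
        then have "rk a b < rk a (\<zeta> a)" using H by (simp add: \<nu>_def glue_def)
        moreover have "rk a (\<zeta> a) \<le> rk a (inv \<zeta> a)" using off ab False by blast
        ultimately show ?thesis using zst[OF ab(2,1)] H2 by linarith
      qed
    next
      case b: False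
      have "rk a (\<nu> a) \<le> rk a (\<zeta> a)" using on by (simp add: \<nu>_def glue_def)
      then show ?thesis using H zst[OF ab] b by (auto simp: inv\<nu> glue_def)
    qed
  qed
  have le\<nu>: "le (inv \<nu>) \<nu>"
    unfolding le_def inv\<nu> unfolding \<nu>_def glue_def using on off by simp
  define l where "l = clamp \<nu> \<pi>\<^sub>0"
  note m0 = partition_marriage[OF \<pi>0]
  have ml: "marriage l" unfolding l_def using marriage_clamp[OF m\<nu> m0] .
  note pl = marriage_permutes[OF ml]
  have invl: "inv l = clamp \<nu> (inv \<pi>\<^sub>0)" unfolding l_def using inv_clamp[OF m\<nu> m0 le\<nu>] .
  have inv_le: "rk x (inv l x) \<le> rk x (inv \<nu> x)" for x by (simp add: invl rk_clamp)
  \<comment> \<open>If \<open>l\<close> married \<open>c\<close> to some \<open>x\<close> outside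
    \<open>C\<close>, then \<open>c\<close> would prefer \<open>x\<close> to
    \<open>\<zeta> c\<close>, so by stability of \<open>\<zeta>\<close> woman \<open>x\<close> likes
    \<open>inv \<zeta> x\<close> at least as much as \<open>c\<close>. Clamping leaves her no worse
    off than with \<open>inv \<zeta> x\<close>, hence that man is \<open>c\<close>, and
    \<open>x = \<zeta> c\<close> lies in \<open>C\<close>.\<close>
  have lC: "l c \<in> C" if c: "c \<in> C" for c
  proof (rule ccontr)
    assume H: "l c \<notin> C"
    have cA: "c \<in> A" using c C by blast
    define x where "x = l c"
    have x: "x \<in> A" "x \<notin> C" using cA pl H x_def by (auto simp: permutes_in_image)
    have zc: "\<zeta> c \<in> A" using CC c C by blast
    have "rk c x \<le> rk c (inv \<nu> c)" unfolding x_def l_def by (simp add: rk_clamp)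
    moreover have "x \<noteq> \<zeta> c" using x CC c by metis
    ultimately have "rk c x < rk c (\<zeta> c)"
      using rk_inj[OF cA x(1) zc] c by (fastforce simp: inv\<nu> glue_def)
    then have "rk x (inv \<zeta> x) \<le> rk x c" using zst[OF cA x(1)] by linarith
    moreover have "inv l x = c" unfolding x_def using pl by (simp add: permutes_inverses)
    ultimately have "rk x (inv \<zeta> x) = rk x c" using inv_le[of x] x by (simp add: inv\<nu> glue_def)
    then have "inv \<zeta> x = c" using rk_inj[OF x(1)] cA x pz by (metis permutes_in_image permutes_inv)
    then show False using \<open>x \<noteq> \<zeta> c\<close> pz by (metis permutes_inverses(1))
  qed
  have \<nu>C: "\<nu> x \<in> C" if "x \<in> C" for x using that CC by (simp add: \<nu>_def glue_def)
  define \<pi> where "\<pi> = glue C \<nu> l"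
  have p\<pi>: "\<pi> permutes A" and inv\<pi>: "inv \<pi> = glue C (inv \<nu>) (inv l)"
    unfolding \<pi>_def using glue_permutes_inv[OF p\<nu> pl C \<nu>C lC] by auto
  have rl: "rk x (l x) = min (max (rk x (\<pi>\<^sub>0 x)) (rk x (\<nu> x))) (rk x (inv \<nu> x))"
    and ri: "rk x (inv l x) = min (max (rk x (inv \<pi>\<^sub>0 x)) (rk x (\<nu> x))) (rk x (inv \<nu> x))" for x
    unfolding invl by (simp_all add: l_def rk_clamp)
  have l_le: "rk x (l x) \<le> rk x (inv l x)" if "x \<in> A" for x
  proof -
    have "rk x (\<pi>\<^sub>0 x) \<le> rk x (inv \<pi>\<^sub>0 x)" using \<pi>0 that by (auto simp: partition_def)
    then show ?thesis unfolding rl ri by simp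
  qed
  \<comment> \<open>Assumption \<open>b\<close> says that \<open>x\<close> does not prefer
    \<open>y\<close> to its predecessor in \<open>\<pi>\<^sub>0\<close>. Then \<open>inv l x\<close>
    can be worse than \<open>y\<close> only because both \<open>\<nu> x\<close> and
    \<open>inv \<nu> x\<close> are; but then \<open>l x\<close> is worse than \<open>y\<close> too,
    and the pair blocks \<open>l\<close>.\<close>
  have off_block: False if x: "x \<in> A" and y: "y \<in> A"
    and H: "rk x y < rk x (inv l x)" "rk y x < rk y (inv l y)"
    and b: "rk x (inv \<pi>\<^sub>0 x) \<le> rk x y" for x y
  proof -
    have "\<not> rk y x < rk y (l y)"
      using marriage_inv[OF ml] permutes_inv_inv[OF pl] H(1) x y unfolding marriage_def by metis
    then have "\<not> rk x y < rk x (l x)"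
      using ml H(2) x y unfolding marriage_def by blast
    then show False using b H(1) unfolding rl ri by linarith
  qed
  have "partition \<pi>"
    unfolding partition_def
  proof (intro conjI p\<pi> ballI notI)
    fix a assume "a \<in> A"
    then show "rk a (\<pi> a) \<le> rk a (inv \<pi> a)"
      using l_le le\<nu> unfolding inv\<pi> unfolding \<pi>_def by (simp add: glue_def le_def)
  next
    \<comment> \<open>A mixed pair already blocks \<open>\<zeta>\<close>: on \<open>C\<close> the
      predecessor is \<open>\<zeta> x\<close>, and off \<open>C\<close> the predecessor under
      \<open>l\<close> is no worse than the one under \<open>\<zeta>\<close>.\<close>
    have cross: False if "x \<in> A" "y \<in> A" "x \<in> C" "y \<notin> C"
      "rk x y < rk x (inv \<pi> x)" "rk y x < rk y (inv \<pi> y)" for x y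
    proof -
      have "rk x y < rk x (\<zeta> x)" using that by (simp add: inv\<pi> inv\<nu> glue_def)
      moreover have "rk y x < rk y (inv \<zeta> y)"
        using that inv_le[of y] by (simp add: inv\<pi> inv\<nu> glue_def)
      ultimately show False using zst that by blast
    qed
    fix a b assume ab: "a \<in> A" "b \<in> A" and H: "rk a b < rk a (inv \<pi> a) \<and> rk b a < rk b (inv \<pi> b)"
    consider "a \<in> C" "b \<in> C" | "a \<in> C" "b \<notin> C" | "a \<notin> C" "b \<in> C" | "a \<notin> C" "b \<notin> C" by blast
    then show False
    proof cases
      case 1 then show ?thesis using H block[OF 1] by (simp add: inv\<pi> inv\<nu> glue_def)
    next
      case 2 then show ?thesis using cross[OF ab] H by blast
    next
      case 3 then show ?thesis using cross[OF ab(2,1)] H by blast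
    next
      case 4
      then have H': "rk a b < rk a (inv l a)" "rk b a < rk b (inv l b)"
        using H by (auto simp: inv\<pi> glue_def)
      have "rk a (inv \<pi>\<^sub>0 a) \<le> rk a b \<or> rk b (inv \<pi>\<^sub>0 b) \<le> rk b a"
        using \<pi>0 ab unfolding partition_def by (meson not_le_imp_less)
      then show ?thesis using off_block[OF ab H'] off_block[OF ab(2,1) H'(2,1)] by blast
    qed
  qed
  moreover have "\<pi> x = inv \<zeta> x" if "x \<in> C" for x using that by (simp add: \<pi>_def \<nu>_def glue_def)
  ultimately show thesis using that by blast
qed

section \<open>Marriages that reverse a cycle, and how they determine it\<close>

lemma marriage_above_partition:
  assumes \<pi>: "partition \<pi>" and \<zeta>: "marriage \<zeta>" and "le \<pi> \<zeta>" and x: "x \<in> A"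
  shows "rk x (\<zeta> x) \<le> rk x (inv \<zeta> x)"
proof -
  have "rk x (inv \<pi> x) \<le> rk x (inv \<zeta> x)"
    using le_opposite[OF \<zeta> partition_marriage[OF \<pi>] \<open>le \<pi> \<zeta>\<close> x] .
  then show ?thesis using \<pi> \<open>le \<pi> \<zeta>\<close> x unfolding partition_def le_def by fastforce
qed

text \<open>The witness that the bounds imposed at \<open>a\<close> and at its successor can be met,
  and hence a lower estimate for the greatest marriage that meets them.\<close>

definition flipped :: "('a \<Rightarrow> 'a) \<Rightarrow> 'a \<Rightarrow> 'a \<Rightarrow> 'a" where
  "flipped \<pi> a = glue (orbit \<pi> a) (inv \<pi>) \<pi>"

lemma orbit_closed:
  assumes p: "\<pi> permutes A" and "x \<in> orbit \<pi> a"
  shows "\<pi> x \<in> orbit \<pi> a" "inv \<pi> x \<in> orbit \<pi> a"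
proof -
  show "\<pi> x \<in> orbit \<pi> a" using assms(2) by (rule orbit.step)
  have "inv \<pi> x \<in> orbit (inv \<pi>) a"
    using assms(2) orbit_inv_eq[OF permutes_permutation[OF p]] orbit.step by metis
  then show "inv \<pi> x \<in> orbit \<pi> a" using orbit_inv_eq[OF permutes_permutation[OF p]] by metis
qed

lemma inv_flipped:
  assumes p: "\<pi> permutes A" and a: "a \<in> A"
  shows "flipped \<pi> a permutes A" "inv (flipped \<pi> a) = glue (orbit \<pi> a) \<pi> (inv \<pi>)"
  unfolding flipped_def
  using glue_permutes_inv[OF permutes_inv[OF p] p permutes_orbit_subset[OF p a]]
    orbit_closed[OF p, of _ a] by (auto simp: permutes_inv_inv[OF p])

text \<open>After the reversal every agent, as man and as woman, still has a partner no worse than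
  its predecessor in \<open>\<pi>\<close>, so a blocking pair would violate (T2).\<close>

lemma marriage_flipped:
  assumes \<pi>: "partition \<pi>" and a: "a \<in> A"
  shows "marriage (flipped \<pi> a)"
  unfolding marriage_def
proof (intro conjI ballI notI)
  note p = partition_permutes[OF \<pi>]
  show "flipped \<pi> a permutes A" using inv_flipped[OF p a] by simp
  fix x y assume xy: "x \<in> A" "y \<in> A"
    and H: "rk x y < rk x (flipped \<pi> a x) \<and> rk y x < rk y (inv (flipped \<pi> a) y)"
  have r: "rk z (\<pi> z) \<le> rk z (inv \<pi> z)" if "z \<in> A" for z using that \<pi> by (auto simp: partition_def)
  have "rk x (flipped \<pi> a x) \<le> rk x (inv \<pi> x)"
    using r[OF xy(1)] by (simp add: flipped_def glue_def)
  moreover have "rk y (inv (flipped \<pi> a) y) \<le> rk y (inv \<pi> y)"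
    using r[OF xy(2)] unfolding inv_flipped(2)[OF p a] by (simp add: glue_def)
  ultimately have "rk x y < rk x (inv \<pi> x)" "rk y x < rk y (inv \<pi> y)"
    using H by linarith+
  then show False using \<pi> xy unfolding partition_def by blast
qed

text \<open>Whether successor and predecessor coincide is constant along a cycle; where they differ,
  (T1) is strict.\<close>

lemma long_cycle_lt:
  assumes \<pi>: "partition \<pi>" and a: "a \<in> A" and ne: "\<pi> a \<noteq> inv \<pi> a" and x: "x \<in> orbit \<pi> a"
  shows "\<pi> x \<noteq> inv \<pi> x" "rk x (\<pi> x) < rk x (inv \<pi> x)"
proof -
  note p = partition_permutes[OF \<pi>]
  have "\<pi> (\<pi> x) \<noteq> x" using x
  proof induction
    case base
    have "\<pi> (\<pi> a) \<noteq> a" using ne p by (metis permutes_inverses(2))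
    then show ?case using p by (metis permutes_inverses(2))
  next
    case (step y) then show ?case using p by (metis permutes_inverses(2))
  qed
  then show ne: "\<pi> x \<noteq> inv \<pi> x" using p by (metis permutes_inverses(1))
  have xA: "x \<in> A" using x permutes_orbit_subset[OF p a] by blast
  then have "\<pi> x \<in> A" "inv \<pi> x \<in> A" using p by (metis permutes_in_image permutes_inv)+
  then have "rk x (\<pi> x) \<noteq> rk x (inv \<pi> x)" using rk_inj[OF xA] ne by blast
  moreover have "rk x (\<pi> x) \<le> rk x (inv \<pi> x)" using \<pi> xA by (auto simp: partition_def)
  ultimately show "rk x (\<pi> x) < rk x (inv \<pi> x)" by simp
qed

lemma clamp_down:
  assumes "clamp \<pi> \<tau> x = inv \<pi> x" "rk x (\<pi> x) < rk x (inv \<pi> x)"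
  shows "rk x (inv \<pi> x) \<le> rk x (\<tau> x)"
  using assms rk_clamp[of x \<pi> \<tau>] by (simp add: min_def max_def split: if_splits)

lemma clamp_downI:
  assumes \<pi>: "partition \<pi>" and \<tau>: "marriage \<tau>" and x: "x \<in> A"
    and "rk x (\<pi> x) < rk x (\<tau> x)" "rk x (\<pi> x) < rk x (inv \<pi> x)"
  shows "clamp \<pi> \<tau> x = inv \<pi> x"
  using clamp_partition_cases[OF \<pi> \<tau> x] rk_clamp[of x \<pi> \<tau>] assms(4,5) by auto

text \<open>The agent after \<open>\<pi> a\<close> is not known to the algorithm. Pushing
  \<open>a\<close> below its successor moves the clamp down on all agents reached from
  \<open>a\<close> in steps of two, among them \<open>\<pi> (\<pi> a)\<close>, whose predecessor is
  \<open>\<pi> a\<close>. Since \<open>\<eta>\<close> lies above the reversed marriage, it puts this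
  agent no lower, so woman \<open>\<pi> a\<close> holds exactly this man.\<close>

lemma successor_from_marriage:
  assumes \<pi>: "partition \<pi>" and a: "a \<in> A" and ne: "\<pi> a \<noteq> inv \<pi> a"
    and \<eta>: "marriage \<eta>" and le: "le (flipped \<pi> a) \<eta>" and lt: "rk a (\<pi> a) < rk a (\<eta> a)"
  shows "inv \<eta> (\<pi> a) = \<pi> (\<pi> a)"
proof -
  note p = partition_permutes[OF \<pi>]
  let ?c = "\<pi> (\<pi> a)"
  note per = permutes_permutation[OF p]
  have orb: "a \<in> orbit \<pi> a" "?c \<in> orbit \<pi> a" "orbit \<pi> a \<subseteq> A"
    using permutation_self_in_orbit[OF per] permutes_orbit_subset[OF p a] by (auto intro: orbit.intros)
  have d: "clamp \<pi> \<eta> a = inv \<pi> a"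
    using clamp_downI[OF \<pi> \<eta> a lt] long_cycle_lt(2)[OF \<pi> a ne orb(1)] by simp
  have "clamp \<pi> \<eta> x = inv \<pi> x" if "x \<in> orbit (inv \<pi> \<circ> inv \<pi>) a" for x
    using that
  proof induction
    case base show ?case using clamp_down_step[OF \<pi> \<eta> a ne d] by simp
  next
    case (step y)
    have "y \<in> orbit \<pi> a" using step(1)
      by induction (auto intro: orbit_closed[OF p] orb)
    then show ?case using clamp_down_step[OF \<pi> \<eta> _ _ step(2)] long_cycle_lt(1)[OF \<pi> a ne] orb by auto
  qed
  \<comment> \<open>Backward steps of two eventually return to \<open>a\<close>, so they also reach
    what lies two steps ahead.\<close>
  moreover have "?c \<in> orbit (inv \<pi> \<circ> inv \<pi>) a"
  proof -
    have q: "permutation (\<pi> \<circ> \<pi>)" using per by (rule permutation_compose) (rule per)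
    have "inv (\<pi> \<circ> \<pi>) = inv \<pi> \<circ> inv \<pi>" using p by (meson o_inv_distrib permutes_bij)
    then show ?thesis using orbit_inv_eq[OF q] orbit.base[of "\<pi> \<circ> \<pi>" a] by simp
  qed
  ultimately have "clamp \<pi> \<eta> ?c = inv \<pi> ?c" by blast
  then have "rk ?c (inv \<pi> ?c) \<le> rk ?c (\<eta> ?c)"
    using clamp_down long_cycle_lt(2)[OF \<pi> a ne orb(2)] by blast
  moreover have "flipped \<pi> a ?c = inv \<pi> ?c" using orb by (simp add: flipped_def glue_def)
  then have "rk ?c (\<eta> ?c) \<le> rk ?c (inv \<pi> ?c)"
    using le orb unfolding le_def by (metis subsetD)
  moreover have "?c \<in> A" using orb by blast
  ultimately have "\<eta> ?c = inv \<pi> ?c"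
    using rk_inj[of ?c] p marriage_permutes[OF \<eta>] by (metis le_antisym permutes_in_image permutes_inv)
  then have "\<eta> ?c = \<pi> a" using p by (simp add: permutes_inverses)
  then show ?thesis using marriage_permutes[OF \<eta>] by (metis permutes_inverses(2))
qed

text \<open>Steps of two from \<open>a\<close> may reach only half of the cycle; the bound at
  \<open>\<pi> a\<close> drags down the other half. On the cycle, the clamp and the reversed
  marriage then enclose \<open>\<zeta>\<close>. Off the cycle, men do at least as well as in
  \<open>\<pi>\<close> and, by opposition of interests, women at most as well.\<close>

theorem marriage_on_long_cycle:
  assumes \<pi>: "partition \<pi>" and a: "a \<in> A" and ne: "\<pi> a \<noteq> inv \<pi> a"
    and \<zeta>: "marriage \<zeta>" and le: "le (flipped \<pi> a) \<zeta>"
    and lta: "rk a (\<pi> a) < rk a (\<zeta> a)" and ltb: "rk (\<pi> a) (\<pi> (\<pi> a)) < rk (\<pi> a) (\<zeta> (\<pi> a))"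
  shows "\<And>x. x \<in> orbit \<pi> a \<Longrightarrow> \<zeta> x = inv \<pi> x"
    and "\<And>x. x \<in> A - orbit \<pi> a \<Longrightarrow> rk x (\<zeta> x) \<le> rk x (inv \<zeta> x)"
proof -
  note p = partition_permutes[OF \<pi>]
  note per = permutes_permutation[OF p]
  let ?C = "orbit \<pi> a"
  have orb: "a \<in> ?C" "\<pi> a \<in> ?C" "?C \<subseteq> A"
    using permutation_self_in_orbit[OF per] permutes_orbit_subset[OF p a] by (auto intro: orbit.intros)
  have "clamp \<pi> \<zeta> x = inv \<pi> x \<and> clamp \<pi> \<zeta> (\<pi> x) = inv \<pi> (\<pi> x)" if "x \<in> orbit (inv \<pi>) a" for x
    using that
  proof induction
    case base
    have "clamp \<pi> \<zeta> a = inv \<pi> a" "clamp \<pi> \<zeta> (\<pi> a) = inv \<pi> (\<pi> a)"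
      using clamp_downI[OF \<pi> \<zeta>] long_cycle_lt(2)[OF \<pi> a ne] orb a lta ltb by auto
    then show ?case
      using clamp_down_step[OF \<pi> \<zeta> _ long_cycle_lt(1)[OF \<pi> a ne], of "\<pi> a"] orb p
      by (auto simp: permutes_inverses)
  next
    case (step y)
    have y: "y \<in> ?C" using step(1) orbit_inv_eq[OF per] by metis
    then have py: "\<pi> y \<in> ?C" by (rule orbit.step)
    have "clamp \<pi> \<zeta> (inv \<pi> (inv \<pi> (\<pi> y))) = inv \<pi> (inv \<pi> (inv \<pi> (\<pi> y)))"
      using clamp_down_step[OF \<pi> \<zeta> _ long_cycle_lt(1)[OF \<pi> a ne py]] step.IH py orb by blast
    then show ?case using step.IH p by (simp add: permutes_inverses)
  qed
  then have down: "clamp \<pi> \<zeta> x = inv \<pi> x" if "x \<in> ?C" for x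
    using that orbit_inv_eq[OF per] by metis
  show on: "\<zeta> x = inv \<pi> x" if x: "x \<in> ?C" for x
  proof -
    have xA: "x \<in> A" using x orb by blast
    have "rk x (inv \<pi> x) \<le> rk x (\<zeta> x)"
      using clamp_down[OF down[OF x]] long_cycle_lt(2)[OF \<pi> a ne x] by blast
    moreover have "rk x (\<zeta> x) \<le> rk x (inv \<pi> x)"
      using le xA x unfolding le_def flipped_def glue_def by auto
    ultimately show ?thesis
      using rk_inj[OF xA] xA p marriage_permutes[OF \<zeta>] by (metis le_antisym permutes_in_image permutes_inv)
  qed
  fix x assume x: "x \<in> A - ?C"
  have "rk x (inv (flipped \<pi> a) x) \<le> rk x (inv \<zeta> x)"
    using le_opposite[OF \<zeta> marriage_flipped[OF \<pi> a] le] x by blast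
  then have "rk x (inv \<pi> x) \<le> rk x (inv \<zeta> x)"
    using x by (simp add: inv_flipped(2)[OF p a] glue_def)
  moreover have "rk x (\<zeta> x) \<le> rk x (\<pi> x)"
    using le x unfolding le_def flipped_def glue_def by auto
  moreover have "rk x (\<pi> x) \<le> rk x (inv \<pi> x)" using \<pi> x by (auto simp: partition_def)
  ultimately show "rk x (\<zeta> x) \<le> rk x (inv \<zeta> x)" by linarith
qed

subsection \<open>Eliminating rotations\<close>

definition acceptable :: "('a \<Rightarrow> 'a) \<Rightarrow> 'a \<Rightarrow> 'a \<Rightarrow> bool" where
  "acceptable \<mu> a y \<longleftrightarrow> rk y a < rk y (inv \<mu> y)"

definition next_choice :: "('a \<Rightarrow> 'a) \<Rightarrow> 'a \<Rightarrow> 'a \<Rightarrow> bool" where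
  "next_choice \<mu> a y \<longleftrightarrow> y \<in> A \<and> acceptable \<mu> a y \<and> rk a (\<mu> a) < rk a y \<and>
     (\<forall>x\<in>A. rk a (\<mu> a) < rk a x \<and> rk a x < rk a y \<longrightarrow> \<not> acceptable \<mu> a x)"

text \<open>A rotation exposed in \<open>\<mu>\<close>, in the sense of the stable marriage lattice:
  \<open>inv \<mu> (s z)\<close> is the man whom \<open>z\<close> displaces. Agents whose partner is
  already their predecessor are kept out.\<close>

definition rotation :: "('a \<Rightarrow> 'a) \<Rightarrow> ('a \<Rightarrow> 'a) \<Rightarrow> 'a set \<Rightarrow> bool" where
  "rotation \<mu> s R \<longleftrightarrow> R \<subseteq> A \<and> cyclic_on (\<lambda>z. inv \<mu> (s z)) R \<and>
     (\<forall>z\<in>R. next_choice \<mu> z (s z) \<and> \<mu> z \<noteq> inv \<mu> z)"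

definition eliminate :: "('a \<Rightarrow> 'a) \<Rightarrow> ('a \<Rightarrow> 'a) \<Rightarrow> 'a set \<Rightarrow> 'a \<Rightarrow> 'a" where
  "eliminate \<mu> s R z = (if z \<in> R then s z else \<mu> z)"

lemma marriage_stable:
  "marriage \<mu> \<Longrightarrow> a \<in> A \<Longrightarrow> b \<in> A \<Longrightarrow> rk a b < rk a (\<mu> a) \<Longrightarrow> rk b (inv \<mu> b) \<le> rk b a"
  unfolding marriage_def by (meson not_le_imp_less)

lemma marriage_in:
  assumes "marriage \<mu>" "a \<in> A" shows "\<mu> a \<in> A" "inv \<mu> a \<in> A"
  using assms by (simp_all add: marriage_permutes permutes_in_image permutes_inv)

text \<open>As a woman, the predecessor of \<open>a\<close> likes her partner no more than
  \<open>a\<close>. Thus an agent whose two neighbours differ always has a next choice, at its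
  predecessor or before.\<close>

lemma predecessor_acceptable:
  assumes \<mu>: "marriage \<mu>" and le: "le (inv \<mu>) \<mu>" and a: "a \<in> A" and ne: "\<mu> a \<noteq> inv \<mu> a"
  shows "acceptable \<mu> a (inv \<mu> a)" "rk a (\<mu> a) < rk a (inv \<mu> a)"
proof -
  note p = marriage_permutes[OF \<mu>]
  note in_A = marriage_in[OF \<mu>]
  let ?z = "inv \<mu> a"
  have z: "\<mu> ?z = a" using p by (simp add: permutes_inverses)
  have "rk ?z a \<le> rk ?z (inv \<mu> ?z)" using le in_A(2)[OF a] z unfolding le_def by metis
  moreover have "a \<noteq> inv \<mu> ?z" using ne p by (metis permutes_inverses(1))
  then have "rk ?z a \<noteq> rk ?z (inv \<mu> ?z)" using rk_inj in_A a by metis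
  ultimately show "acceptable \<mu> a ?z" unfolding acceptable_def by simp
  have "rk a (\<mu> a) \<le> rk a (inv \<mu> a)" using le a unfolding le_def by blast
  moreover have "rk a (\<mu> a) \<noteq> rk a (inv \<mu> a)" using rk_inj in_A a ne by metis
  ultimately show "rk a (\<mu> a) < rk a (inv \<mu> a)" by simp
qed

lemma next_choice_bound:
  assumes \<mu>: "marriage \<mu>" and le: "le (inv \<mu>) \<mu>" and a: "a \<in> A" and ne: "\<mu> a \<noteq> inv \<mu> a"
    and s: "next_choice \<mu> a y"
  shows "rk a y \<le> rk a (inv \<mu> a)"
  using predecessor_acceptable[OF \<mu> le a ne] s marriage_in(2)[OF \<mu> a]
  unfolding next_choice_def by (meson not_le_imp_less)

text \<open>A woman who would accept \<open>a\<close> and whom he prefers to his partner would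
  block.\<close>

lemma acceptable_after:
  assumes \<mu>: "marriage \<mu>" and "a \<in> A" "y \<in> A" and acc: "acceptable \<mu> a y"
  shows "rk a (\<mu> a) < rk a y"
proof -
  have "\<not> rk a y < rk a (\<mu> a)"
    using acc \<mu> assms(2,3) unfolding acceptable_def marriage_def by blast
  moreover have "\<mu> a \<noteq> y"
    using acc marriage_permutes[OF \<mu>] unfolding acceptable_def by (metis order_less_irrefl permutes_inverses(2))
  then have "rk a y \<noteq> rk a (\<mu> a)" using rk_inj assms(2,3) marriage_in[OF \<mu>] by metis
  ultimately show ?thesis by simp
qed

context
  fixes \<mu> s R
  assumes \<mu>: "marriage \<mu>" and le: "le (inv \<mu>) \<mu>" and R: "rotation \<mu> s R"
begin

lemma rotationD:
  assumes "z \<in> R"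
  shows "z \<in> A" "s z \<in> A" "acceptable \<mu> z (s z)" "rk z (\<mu> z) < rk z (s z)"
    "\<And>x. x \<in> A \<Longrightarrow> acceptable \<mu> z x \<Longrightarrow> rk z (s z) \<le> rk z x" "\<mu> z \<noteq> inv \<mu> z"
    "rk z (s z) \<le> rk z (inv \<mu> z)"
proof -
  have *: "z \<in> A" "next_choice \<mu> z (s z)" "\<mu> z \<noteq> inv \<mu> z" using R assms by (auto simp: rotation_def)
  then show "z \<in> A" "s z \<in> A" "acceptable \<mu> z (s z)" "rk z (\<mu> z) < rk z (s z)" "\<mu> z \<noteq> inv \<mu> z"
    by (auto simp: next_choice_def)
  show "rk z (s z) \<le> rk z (inv \<mu> z)" using next_choice_bound[OF \<mu> le] * by blast
  show "rk z (s z) \<le> rk z x" if "x \<in> A" "acceptable \<mu> z x" for x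
    using acceptable_after[OF \<mu> *(1) that] *(2) that unfolding next_choice_def by (meson not_le_imp_less)
qed

lemma rotation_succ_bij: "bij_betw (\<lambda>z. inv \<mu> (s z)) R R"
proof -
  let ?f = "\<lambda>z. inv \<mu> (s z)"
  have c: "cyclic_on ?f R" using R by (simp add: rotation_def)
  have "?f ` R = R"
  proof
    show "?f ` R \<subseteq> R" using cyclic_on_inI[OF c] by blast
    show "R \<subseteq> ?f ` R"
    proof
      fix x assume "x \<in> R"
      then have "x \<in> orbit ?f x" using c unfolding cyclic_on_alldef by blast
      then show "x \<in> ?f ` R"
      proof cases
        case base then show ?thesis using \<open>x \<in> R\<close> by blast
      next
        case (step y)
        then have "y \<in> R" using c \<open>x \<in> R\<close> unfolding cyclic_on_alldef by blast
        then show ?thesis using step by blast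
      qed
    qed
  qed
  moreover have "finite R" using R finite_A finite_subset unfolding rotation_def by blast
  ultimately show ?thesis by (simp add: bij_betw_def finite_surj_inj)
qed

lemma rotation_partner_image: "s ` R = \<mu> ` R"
proof -
  have "\<mu> ` ((\<lambda>z. inv \<mu> (s z)) ` R) = s ` R"
    unfolding image_image using permutes_inverses(1)[OF marriage_permutes[OF \<mu>]] by simp
  then show ?thesis using rotation_succ_bij by (simp add: bij_betw_def)
qed

text \<open>Elimination composes \<open>\<mu>\<close> with the permutation of \<open>R\<close> that
  sends every man to the one he displaces.\<close>

lemma eliminate_permutes: "eliminate \<mu> s R permutes A"
proof -
  note p = marriage_permutes[OF \<mu>]
  define g where "g z = (if z \<in> R then inv \<mu> (s z) else z)" for z
  have "bij_betw g R R" using rotation_succ_bij by (simp add: g_def cong: bij_betw_cong)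
  then have "g permutes R" by (rule bij_imp_permutes) (simp add: g_def)
  then have "g permutes A" using R permutes_subset unfolding rotation_def by blast
  then have "\<mu> \<circ> g permutes A" using p by (rule permutes_compose)
  moreover have "\<mu> \<circ> g = eliminate \<mu> s R"
    using p by (auto simp: fun_eq_iff g_def eliminate_def permutes_inverses)
  ultimately show ?thesis by simp
qed

lemma inv_eliminate:
  shows "z \<in> R \<Longrightarrow> inv (eliminate \<mu> s R) (s z) = z"
    and "y \<notin> s ` R \<Longrightarrow> inv (eliminate \<mu> s R) y = inv \<mu> y"
proof -
  note p = marriage_permutes[OF \<mu>]
  show "inv (eliminate \<mu> s R) (s z) = z" if "z \<in> R"
    using that permutes_eq_inv_iff[OF eliminate_permutes] by (simp add: eliminate_def)
  show "inv (eliminate \<mu> s R) y = inv \<mu> y" if "y \<notin> s ` R"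
  proof -
    have "inv \<mu> y \<notin> R" using that p unfolding rotation_partner_image by (metis image_eqI permutes_inverses(1))
    then show ?thesis
      using permutes_eq_inv_iff[OF eliminate_permutes] p by (simp add: eliminate_def permutes_inverses)
  qed
qed

lemma eliminate_women_improve:
  assumes "y \<in> A" shows "rk y (inv (eliminate \<mu> s R) y) \<le> rk y (inv \<mu> y)"
proof (cases "y \<in> s ` R")
  case True
  then obtain z where z: "z \<in> R" "y = s z" by blast
  then show ?thesis using inv_eliminate(1) rotationD(3)[OF z(1)] by (simp add: acceptable_def)
qed (simp add: inv_eliminate)

lemma acceptable_eliminate:
  "y \<in> A \<Longrightarrow> acceptable (eliminate \<mu> s R) a y \<Longrightarrow> acceptable \<mu> a y"
  using eliminate_women_improve[of y] unfolding acceptable_def by linarith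

text \<open>Women only improve, so a pair blocking the new marriage is acceptable in
  \<open>\<mu>\<close> already. No acceptable woman precedes \<open>s a\<close> for a man of the
  rotation, and none precedes \<open>\<mu> a\<close> for any other man.\<close>

lemma eliminate_marriage: "marriage (eliminate \<mu> s R)"
  unfolding marriage_def
proof (intro conjI eliminate_permutes ballI notI)
  let ?l = "eliminate \<mu> s R"
  fix a b assume ab: "a \<in> A" "b \<in> A" and H: "rk a b < rk a (?l a) \<and> rk b a < rk b (inv ?l b)"
  then have acc: "acceptable \<mu> a b" using eliminate_women_improve[OF ab(2)] by (simp add: acceptable_def)
  then have "rk a (\<mu> a) < rk a b" using acceptable_after[OF \<mu> ab] by blast
  then show False using H acc rotationD(5)[of a b] ab by (auto simp: eliminate_def split: if_splits)
qed

text \<open>A rotation is self-dual at \<open>z\<close> if it moves \<open>z\<close> to its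
  predecessor and contains that predecessor. As a woman, \<open>z\<close> is then the next choice of
  some \<open>v\<close>. If \<open>v\<close> were not \<open>\<mu> z\<close>, then \<open>v\<close>
  would accept \<open>z\<close> and precede \<open>inv \<mu> z\<close> in the list of
  \<open>z\<close>, so the next choice of \<open>z\<close> would come earlier.\<close>

lemma dual_step:
  assumes z: "z \<in> R" "s z = inv \<mu> z" "inv \<mu> z \<in> R"
  shows "\<mu> z \<in> R" "s (\<mu> z) = z"
proof -
  note p = marriage_permutes[OF \<mu>]
  have "z \<in> \<mu> ` R" using z(3) p by (metis image_eqI permutes_inverses(1))
  then have "z \<in> s ` R" by (simp only: rotation_partner_image)
  then obtain v where v: "v \<in> R" "s v = z" by auto
  have "v = \<mu> z"
  proof (rule ccontr)
    assume ne: "v \<noteq> \<mu> z"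
    then have "z \<noteq> inv \<mu> v" using p by (metis permutes_inverses(1))
    moreover have "rk v z \<le> rk v (inv \<mu> v)" using rotationD(7)[OF v(1)] v by simp
    ultimately have "rk v z < rk v (inv \<mu> v)"
      using rk_inj[of v z "inv \<mu> v"] rotationD(1) z v marriage_in[OF \<mu>] by fastforce
    then have "rk z (s z) \<le> rk z v"
      using rotationD(5)[OF z(1), of v] rotationD(1)[OF v(1)] by (simp add: acceptable_def)
    moreover have "rk z v < rk z (inv \<mu> z)" using rotationD(3)[OF v(1)] v by (simp add: acceptable_def)
    ultimately show False using z by simp
  qed
  then show "\<mu> z \<in> R" "s (\<mu> z) = z" using v by auto
qed

text \<open>Self-duality passes along \<open>\<mu>\<close> in both directions, and the rotation step
  from a self-dual \<open>z\<close> leads to \<open>inv \<mu> (inv \<mu> z)\<close>. So a test at a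
  single agent decides for the whole rotation.\<close>

lemma dual_all:
  assumes z: "z \<in> R" "s z = inv \<mu> z" "inv \<mu> z \<in> R" and x: "x \<in> R"
  shows "s x = inv \<mu> x" "inv \<mu> x \<in> R" "\<mu> x \<in> R"
proof -
  note p = marriage_permutes[OF \<mu>] note per = permutes_permutation[OF p]
  define Q where "Q x \<longleftrightarrow> x \<in> R \<and> s x = inv \<mu> x \<and> inv \<mu> x \<in> R" for x
  have Q_step: "Q (\<mu> y)" if "Q y" for y
    using that dual_step[of y] p by (simp add: Q_def permutes_inverses)
  have Q_orbit: "Q y" if "y \<in> orbit \<mu> w" "Q w" for y w
    using that by induction (auto intro: Q_step)
  have Q_inv: "Q (inv \<mu> y)" if "Q y" for y
  proof -
    have "inv \<mu> y \<in> orbit \<mu> y" using orbit_inv_eq[OF per] orbit.base[of "inv \<mu>" y] by simp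
    then show ?thesis using Q_orbit that by blast
  qed
  have "x \<in> orbit (\<lambda>z. inv \<mu> (s z)) z" using R x z(1) unfolding rotation_def cyclic_on_alldef by blast
  then have "Q x"
  proof induction
    case base
    have "Q z" using z by (simp add: Q_def)
    then show ?case using Q_inv[OF Q_inv] z by metis
  next
    case (step y)
    then have "s y = inv \<mu> y" by (simp add: Q_def)
    then show ?case using Q_inv[OF Q_inv[OF step(2)]] by simp
  qed
  then show "s x = inv \<mu> x" "inv \<mu> x \<in> R" "\<mu> x \<in> R" using Q_step[of x] by (auto simp: Q_def)
qed

text \<open>An agent \<open>x\<close> that came to prefer its predecessor to its successor would
  have moved both as a man and as a woman. Its new man \<open>v\<close> would either accept
  \<open>x\<close> as a woman and precede \<open>s x\<close>, against the choice of
  \<open>s x\<close>, or equal \<open>\<mu> x\<close>, which makes the rotation self-dual.\<close>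

lemma eliminate_le:
  assumes z: "z \<in> R" "\<not> (s z = inv \<mu> z \<and> inv \<mu> z \<in> R)"
  shows "le (inv (eliminate \<mu> s R)) (eliminate \<mu> s R)"
  unfolding le_def
proof (rule ballI, rule ccontr)
  let ?l = "eliminate \<mu> s R"
  note p = marriage_permutes[OF \<mu>]
  fix x assume x: "x \<in> A" and "\<not> rk x (?l x) \<le> rk x (inv ?l x)"
  then have lt: "rk x (inv ?l x) < rk x (?l x)" by simp
  have lb: "rk y (?l y) \<le> rk y (inv \<mu> y)" if "y \<in> A" for y
    using that le rotationD(7) by (auto simp: eliminate_def le_def)
  have "rk x (inv (inv \<mu>) x) \<le> rk x (inv ?l x)"
    using le_opposite[OF eliminate_marriage marriage_inv[OF \<mu>]] lb x unfolding le_def by blast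
  then have up: "rk x (\<mu> x) \<le> rk x (inv ?l x)" using permutes_inv_inv[OF p] by simp
  have xR: "x \<in> R" using lt up by (auto simp: eliminate_def split: if_splits)
  have "x \<in> s ` R"
  proof (rule ccontr)
    assume "x \<notin> s ` R"
    then show False using inv_eliminate(2) lb[OF x] lt by fastforce
  qed
  then obtain v where v: "v \<in> R" "x = s v" by blast
  then have iv: "inv ?l x = v" using inv_eliminate(1) by simp
  have sx: "?l x = s x" using xR by (simp add: eliminate_def)
  have "v = \<mu> x"
  proof (rule ccontr)
    assume "v \<noteq> \<mu> x"
    then have "x \<noteq> inv \<mu> v" using p by (metis permutes_inverses(1))
    moreover have "rk v x \<le> rk v (inv \<mu> v)" using rotationD(7)[OF v(1)] v by simp
    ultimately have "acceptable \<mu> x v"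
      using rk_inj[of v x "inv \<mu> v"] rotationD(1)[OF v(1)] x marriage_in[OF \<mu>]
      unfolding acceptable_def by fastforce
    then show False using rotationD(5)[OF xR, of v] rotationD(1)[OF v(1)] lt iv sx by simp
  qed
  then have "s v = inv \<mu> v" "inv \<mu> v \<in> R" using v xR p by (metis permutes_inverses(2))+
  then show False using dual_all[OF v(1)] z by blast
qed

end

section \<open>Agents that need no further treatment\<close>

definition settled :: "('a \<Rightarrow> 'a) \<Rightarrow> 'a set" where
  "settled \<mu> = {a \<in> A. \<mu> a = inv \<mu> a}"

text \<open>What (T2) demands of the agents in \<open>F\<close>: a blocking partner would be
  acceptable, hence behind the present partner, and before the predecessor. Closure under
  \<open>\<mu>\<close> keeps later rotations away from \<open>F\<close>.\<close>

definition frozen :: "('a \<Rightarrow> 'a) \<Rightarrow> 'a set \<Rightarrow> bool" where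
  "frozen \<mu> F \<longleftrightarrow> F \<subseteq> A \<and> (\<forall>z\<in>F. \<mu> z \<in> F \<and>
     (\<forall>y\<in>A. rk z (\<mu> z) < rk z y \<and> rk z y < rk z (inv \<mu> z) \<longrightarrow> \<not> acceptable \<mu> z y))"

lemma frozen_inv:
  assumes p: "\<mu> permutes A" and F: "frozen \<mu> F" and z: "z \<in> F"
  shows "inv \<mu> z \<in> F"
proof -
  have "finite F" using F finite_A finite_subset unfolding frozen_def by blast
  moreover have "\<mu> ` F \<subseteq> F" using F unfolding frozen_def by blast
  moreover have "inj_on \<mu> F" using p by (metis inj_on_subset permutes_inj subset_UNIV)
  ultimately have "\<mu> ` F = F" by (simp add: endo_inj_surj)
  then show ?thesis using z p by (metis imageE permutes_inverses(2))
qed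

text \<open>If the displaced man lay in \<open>F\<close>, so would \<open>y\<close>. As
  \<open>a\<close> moves no further than its predecessor, man \<open>y\<close> finds in
  \<open>a\<close> a woman who accepts him, strictly between his partner and his predecessor, which
  a frozen set forbids.\<close>

lemma next_not_frozen:
  assumes \<mu>: "marriage \<mu>" and le: "le (inv \<mu>) \<mu>" and F: "frozen \<mu> F" and S: "settled \<mu> \<subseteq> F"
    and a: "a \<in> A - F" and s: "next_choice \<mu> a y"
  shows "inv \<mu> y \<notin> F"
proof
  note p = marriage_permutes[OF \<mu>]
  assume "inv \<mu> y \<in> F"
  then have yF: "y \<in> F" using F p unfolding frozen_def by (metis permutes_inverses(1))
  have y: "y \<in> A" using s by (simp add: next_choice_def)
  have aA: "a \<in> A" using a by blast
  have ne: "\<mu> a \<noteq> inv \<mu> a" using a S by (auto simp: settled_def)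
  have "rk a y \<le> rk a (inv \<mu> a)" using next_choice_bound[OF \<mu> le aA ne s] .
  moreover have "y \<noteq> inv \<mu> a" using yF F a p unfolding frozen_def by (metis DiffD2 permutes_inverses(1))
  ultimately have acc: "acceptable \<mu> y a"
    using rk_inj[OF aA y, of "inv \<mu> a"] marriage_in[OF \<mu> aA] unfolding acceptable_def by fastforce
  have "rk y (\<mu> y) < rk y a" using acceptable_after[OF \<mu> y aA acc] .
  moreover have "rk y a < rk y (inv \<mu> y)" using s by (simp add: next_choice_def acceptable_def)
  ultimately show False using F yF aA acc unfolding frozen_def by blast
qed

lemma frozen_eliminate:
  assumes \<mu>: "marriage \<mu>" and le: "le (inv \<mu>) \<mu>" and R: "rotation \<mu> s R"
    and F: "frozen \<mu> (Z \<union> settled \<mu>)" and disj: "R \<inter> (Z \<union> settled \<mu>) = {}"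
  shows "frozen (eliminate \<mu> s R) (Z \<union> settled (eliminate \<mu> s R))"
proof -
  note p = marriage_permutes[OF \<mu>]
  let ?l = "eliminate \<mu> s R"
  have pl: "?l permutes A" using eliminate_permutes[OF \<mu> le R] .
  have same: "?l z = \<mu> z" "inv ?l z = inv \<mu> z" if z: "z \<in> Z \<union> settled \<mu>" for z
  proof -
    show "?l z = \<mu> z" using z disj by (auto simp: eliminate_def)
    have "z \<notin> \<mu> ` R"
    proof
      assume "z \<in> \<mu> ` R"
      then obtain r where "r \<in> R" "inv \<mu> z = r" using p by (metis imageE permutes_inverses(2))
      then show False using frozen_inv[OF p F z] disj by blast
    qed
    then show "inv ?l z = inv \<mu> z"
      using inv_eliminate(2)[OF \<mu> le R] rotation_partner_image[OF \<mu> le R] by simp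
  qed
  have sub: "settled \<mu> \<subseteq> settled ?l" using same by (auto simp: settled_def)
  show ?thesis unfolding frozen_def
  proof (intro conjI ballI impI)
    show "Z \<union> settled ?l \<subseteq> A" using F by (auto simp: frozen_def settled_def)
    fix z assume z: "z \<in> Z \<union> settled ?l"
    show "?l z \<in> Z \<union> settled ?l"
    proof (cases "z \<in> Z")
      case True
      then have "\<mu> z \<in> Z \<union> settled \<mu>" using F unfolding frozen_def by blast
      then show ?thesis using same[of z] True sub by auto
    next
      case False
      then have s: "z \<in> A" "?l z = inv ?l z" using z by (auto simp: settled_def)
      then have "?l (?l z) = inv ?l (?l z)" using pl by (metis permutes_inverses)
      then show ?thesis using s pl by (simp add: settled_def permutes_in_image permutes_inv)
    qed
    fix y assume y: "y \<in> A" and H: "rk z (?l z) < rk z y \<and> rk z y < rk z (inv ?l z)"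
    then have "z \<in> Z" using z by (auto simp: settled_def)
    then have "\<not> acceptable \<mu> z y" using F H y same[of z] unfolding frozen_def by auto
    then show "\<not> acceptable ?l z y" using acceptable_eliminate[OF \<mu> le R y] by blast
  qed
qed

text \<open>A self-dual rotation is not eliminated. Its agents see no acceptable woman before the
  next choice, which is the predecessor, so they can be frozen as they are.\<close>

lemma frozen_dual:
  assumes \<mu>: "marriage \<mu>" and le: "le (inv \<mu>) \<mu>" and R: "rotation \<mu> s R"
    and F: "frozen \<mu> (Z \<union> settled \<mu>)"
    and z: "z \<in> R" "s z = inv \<mu> z" "inv \<mu> z \<in> R"
  shows "frozen \<mu> ((Z \<union> R) \<union> settled \<mu>)"
  unfolding frozen_def
proof (intro conjI ballI impI)
  show "(Z \<union> R) \<union> settled \<mu> \<subseteq> A" using F R by (auto simp: frozen_def rotation_def)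
  fix x assume x: "x \<in> (Z \<union> R) \<union> settled \<mu>"
  show "\<mu> x \<in> (Z \<union> R) \<union> settled \<mu>"
    using x F dual_all(3)[OF \<mu> le R z] unfolding frozen_def by blast
  fix y assume y: "y \<in> A" "rk x (\<mu> x) < rk x y \<and> rk x y < rk x (inv \<mu> x)"
  show "\<not> acceptable \<mu> x y"
  proof (cases "x \<in> R")
    case True
    then show ?thesis using rotationD(5)[OF \<mu> le R True y(1)] dual_all(1)[OF \<mu> le R z True] y by force
  next
    case False
    then show ?thesis using x y F unfolding frozen_def by blast
  qed
qed

theorem frozen_partition:
  assumes \<mu>: "marriage \<mu>" and le: "le (inv \<mu>) \<mu>" and F: "frozen \<mu> F" and all: "A \<subseteq> F"
  shows "partition \<mu>"
  unfolding partition_def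
proof (intro conjI ballI notI)
  show "\<mu> permutes A" using marriage_permutes[OF \<mu>] .
  show "rk a (\<mu> a) \<le> rk a (inv \<mu> a)" if "a \<in> A" for a using le that by (auto simp: le_def)
  fix a b assume ab: "a \<in> A" "b \<in> A" and H: "rk a b < rk a (inv \<mu> a) \<and> rk b a < rk b (inv \<mu> b)"
  then have acc: "acceptable \<mu> a b" by (simp add: acceptable_def)
  then show False using acceptable_after[OF \<mu> ab acc] F all ab H unfolding frozen_def by blast
qed

end

section \<open>Deferred acceptance\<close>

text \<open>Every list is completed by the agent itself at position \<open>n - 1\<close>, so that
  positions and agents correspond one to one.\<close>

locale preference_table =
  fixes n :: nat and lst rk :: "nat \<Rightarrow> nat \<Rightarrow> nat"
  assumes lst_lt: "\<lbrakk>a < n; j < n\<rbrakk> \<Longrightarrow> lst a j < n"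
    and rk_lt: "\<lbrakk>a < n; x < n\<rbrakk> \<Longrightarrow> rk a x < n"
    and lst_rk: "\<lbrakk>a < n; x < n\<rbrakk> \<Longrightarrow> lst a (rk a x) = x"
    and rk_lst: "\<lbrakk>a < n; j < n\<rbrakk> \<Longrightarrow> rk a (lst a j) = j"
    and rk_last: "a < n \<Longrightarrow> rk a a = n - 1"
begin

sublocale roommates "{..<n}" rk
proof
  show "x = y" if "a \<in> {..<n}" "x \<in> {..<n}" "y \<in> {..<n}" "rk a x = rk a y" for a x y
    using that lst_rk by (metis lessThan_iff)
  show "rk a x \<le> rk a a" if "a \<in> {..<n}" "x \<in> {..<n}" for a x
    using that rk_lt[of a x] rk_last[of a] by simp
qed simp

lemma rk_eq_iff: "a < n \<Longrightarrow> x < n \<Longrightarrow> y < n \<Longrightarrow> rk a x = rk a y \<longleftrightarrow> x = y"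
  using lst_rk by metis

definition represents :: "(nat \<Rightarrow> nat) \<Rightarrow> (nat \<Rightarrow> nat) \<Rightarrow> (nat \<Rightarrow> nat) \<Rightarrow> bool" where
  "represents p h \<mu> \<longleftrightarrow> marriage \<mu> \<and> (\<forall>a<n. p a < n \<and> \<mu> a = lst a (p a) \<and> h a = inv \<mu> a)"

text \<open>A lower bound on positions limits how well the men may fare: \<open>z\<close> must not
  have any of his first \<open>t z\<close> women.\<close>

definition at_least :: "(nat \<Rightarrow> nat) \<Rightarrow> (nat \<Rightarrow> nat) \<Rightarrow> bool" where
  "at_least t \<theta> \<longleftrightarrow> marriage \<theta> \<and> (\<forall>z<n. t z \<le> rk z (\<theta> z))"

definition engaged :: "nat \<Rightarrow> nat \<Rightarrow> nat set" where
  "engaged x cur = {z. z < n \<and> z \<le> x \<and> z \<noteq> cur}"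

text \<open>Every man \<open>z\<close> starts at position \<open>t z\<close> of his list. The women before that position have
  already received a proposal from him that counts as a lower bound \<open>w\<close> for what they accept, but
  does not make him their partner.\<close>

definition da_inv where
  "da_inv t x cur p h w \<longleftrightarrow> x \<le> n \<and> cur \<le> x \<and>
     (\<forall>y<n. h y = n \<or> (h y \<in> engaged x cur \<and> p (h y) < n \<and> lst (h y) (p (h y)) = y \<and> w y = rk y (h y))) \<and>
     (\<forall>z\<in>engaged x cur. p z < n \<and> h (lst z (p z)) = z) \<and>
     (\<forall>z<n. t z \<le> p z \<and> p z \<le> n) \<and>
     (\<forall>z<n. \<forall>k<p z. w (lst z k) \<le> rk (lst z k) z) \<and>
     (\<forall>y<n. w y < n \<longrightarrow> (\<exists>z<n. w y = rk y z \<and> rk z y \<le> p z \<and> (h y = z \<or> rk z y < p z))) \<and>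
     (\<forall>\<theta>. at_least t \<theta> \<longrightarrow> (\<forall>z<n. p z \<le> rk z (\<theta> z))) \<and>
     ((\<forall>z<n. t z = 0) \<longrightarrow> (\<forall>y<n. w y < n \<longrightarrow> h y < n))"

lemma da_invD:
  assumes "da_inv t x cur p h w"
  shows "x \<le> n" "cur \<le> x"
    "\<And>v. v < n \<Longrightarrow> h v = n \<or> (h v \<in> engaged x cur \<and> p (h v) < n \<and> lst (h v) (p (h v)) = v \<and> w v = rk v (h v))"
    "\<And>z. z \<in> engaged x cur \<Longrightarrow> p z < n \<and> h (lst z (p z)) = z"
    "\<And>z. z < n \<Longrightarrow> t z \<le> p z \<and> p z \<le> n"
    "\<And>z k. z < n \<Longrightarrow> k < p z \<Longrightarrow> w (lst z k) \<le> rk (lst z k) z"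
    "\<And>v. v < n \<Longrightarrow> w v < n \<Longrightarrow> \<exists>z<n. w v = rk v z \<and> rk z v \<le> p z \<and> (h v = z \<or> rk z v < p z)"
    "\<And>\<theta> z. at_least t \<theta> \<Longrightarrow> z < n \<Longrightarrow> p z \<le> rk z (\<theta> z)"
    "\<And>v. \<forall>z<n. t z = 0 \<Longrightarrow> v < n \<Longrightarrow> w v < n \<Longrightarrow> h v < n"
  using assms by (simp_all add: da_inv_def)

text \<open>If \<open>\<theta>\<close> gave \<open>y\<close> to \<open>z\<close>, then
  \<open>y\<close> and \<open>g\<close> would block it, since \<open>g\<close> fares no better than
  \<open>y\<close> in \<open>\<theta>\<close>. This is the optimality argument of deferred
  acceptance; \<open>g\<close> may be a man who never held \<open>y\<close> but skipped her because
  of his starting bound.\<close>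

lemma rejected_not_partner:
  assumes \<theta>: "marriage \<theta>" and le: "rk g y \<le> rk g (\<theta> g)" and y: "y < n" and g: "g < n"
    and z: "z < n" and "rk y g < rk y z"
  shows "\<theta> z \<noteq> y"
proof
  assume eq: "\<theta> z = y"
  have per: "\<theta> permutes {..<n}" using marriage_permutes[OF \<theta>] .
  have "g \<noteq> z" using assms by auto
  then have "\<theta> g \<noteq> y" using eq per by (metis permutes_inverses(2))
  moreover have "\<theta> g < n" using per g by (metis lessThan_iff permutes_in_image)
  ultimately have "rk g y < rk g (\<theta> g)"
    using assms rk_eq_iff[of g y "\<theta> g"] by fastforce
  moreover have "inv \<theta> y = z" using eq per by (metis permutes_inverses(2))
  ultimately show False using marriage_stable[OF \<theta>, of g y] assms by simp
qed

lemma da_init: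
  assumes h: "\<And>y. y < n \<Longrightarrow> h y = n" and p: "\<And>z. z < n \<Longrightarrow> p z = t z \<and> t z \<le> n"
    and w: "\<And>z k. z < n \<Longrightarrow> k < t z \<Longrightarrow> w (lst z k) \<le> rk (lst z k) z"
    and w2: "\<And>y. y < n \<Longrightarrow> w y < n \<Longrightarrow> \<exists>z<n. w y = rk y z \<and> rk z y < t z"
  shows "da_inv t 0 0 p h w"
  unfolding da_inv_def engaged_def
proof (intro conjI allI impI ballI)
  fix \<theta> z assume "at_least t \<theta>" "z < n" then show "p z \<le> rk z (\<theta> z)"
    using p by (simp add: at_least_def)
next
  fix y assume "\<forall>z<n. t z = 0" "y < n" "w y < n"
  then show "h y < n" using w2 by fastforce
next
  fix y assume y: "y < n" "w y < n"
  show "\<exists>z<n. w y = rk y z \<and> rk z y \<le> p z \<and> (h y = z \<or> rk z y < p z)"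
    using w2[OF y] p by (metis order_less_imp_le)
qed (use assms in auto)

lemma da_reject:
  assumes I: "da_inv t x cur p h w" and x: "x < n" and pc: "p cur < n"
    and y: "y = lst cur (p cur)" and rej: "\<not> rk y cur < w y"
  shows "da_inv t x cur (p(cur := Suc (p cur))) h w"
proof -
  have cur: "cur < n" using I x by (simp add: da_inv_def)
  have yn: "y < n" using y lst_lt cur pc by blast
  have rky: "rk cur y = p cur" using y rk_lst cur pc by blast
  have "w y < n" using rej rk_lt[OF yn cur] by simp
  \<comment> \<open>The man whose rank is the current bound \<open>w y\<close>; he need not be the
    partner of \<open>y\<close>.\<close>
  then obtain g where g: "g < n" "w y = rk y g" "rk g y \<le> p g" "h y = g \<or> rk g y < p g"
    using da_invD(7)[OF I yn] by blast
  have ncur: "h y \<noteq> cur" using da_invD(3)[OF I yn] cur by (auto simp: engaged_def)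
  then have "g \<noteq> cur" using g rky by auto
  then have lt: "rk y g < rk y cur" using rej g rk_eq_iff[OF yn g(1) cur] by simp
  show ?thesis
    unfolding da_inv_def
  proof (intro conjI allI impI ballI)
    fix \<theta> z assume \<theta>: "at_least t \<theta>" and z: "z < n"
    then have all: "\<forall>z<n. p z \<le> rk z (\<theta> z)" using da_invD(8)[OF I] by blast
    have "\<theta> cur \<noteq> y" using rejected_not_partner[of \<theta> g y cur] \<theta> all g lt yn cur
      unfolding at_least_def by (metis order_trans)
    moreover have "\<theta> cur < n" using \<theta> cur unfolding at_least_def
      by (metis lessThan_iff marriage_permutes permutes_in_image)
    ultimately have "rk cur (\<theta> cur) \<noteq> p cur" using rk_eq_iff[OF cur, of "\<theta> cur" y] yn rky by metis
    then show "(p(cur := Suc (p cur))) z \<le> rk z (\<theta> z)" using all z cur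
      by (metis Suc_leI fun_upd_apply le_neq_implies_less)
  next
    fix z k assume z: "z < n" "k < (p(cur := Suc (p cur))) z"
    show "w (lst z k) \<le> rk (lst z k) z"
    proof (cases "z = cur \<and> k = p cur")
      case True then show ?thesis using rej y by simp
    next
      case False
      then have "k < p z" using z by (auto split: if_splits)
      then show ?thesis using da_invD(6)[OF I z(1)] by blast
    qed
  next
    fix v assume v: "v < n" "w v < n"
    then obtain z where z: "z < n" "w v = rk v z" "rk z v \<le> p z" "h v = z \<or> rk z v < p z"
      using da_invD(7)[OF I v] by blast
    then show "\<exists>z<n. w v = rk v z \<and> rk z v \<le> (p(cur := Suc (p cur))) z \<and> (h v = z \<or> rk z v < (p(cur := Suc (p cur))) z)"
      by (intro exI[of _ z]) auto
  qed (use I cur pc in \<open>auto simp: da_inv_def engaged_def\<close>)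
qed

text \<open>Acceptance by a woman without partner is the case \<open>h y = n\<close>.\<close>

lemma da_accept:
  assumes I: "da_inv t x cur p h w" and x: "x < n" and pc: "p cur < n"
    and y: "y = lst cur (p cur)" and acc: "rk y cur < w y"
  shows "h y < n \<Longrightarrow> da_inv t x (h y) (p(h y := Suc (p (h y)))) (h(y := cur)) (w(y := rk y cur))"
    and "\<not> h y < n \<Longrightarrow> da_inv t (Suc x) (Suc x) p (h(y := cur)) (w(y := rk y cur))"
proof -
  have cur: "cur < n" using I x by (simp add: da_inv_def)
  have yn: "y < n" using y lst_lt cur pc by blast
  have rky: "rk cur y = p cur" using y rk_lst cur pc by blast
  note I1 = da_invD(3)[OF I] and I2 = da_invD(4)[OF I] and I3 = da_invD(5)[OF I]
    and I4 = da_invD(6)[OF I] and I5 = da_invD(7)[OF I] and I6 = da_invD(8)[OF I]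
    and I7 = da_invD(9)[OF I]
  have w': "(w(y := rk y cur)) v \<le> w v" for v using acc by simp
  have I4': "(w(y := rk y cur)) (lst z k) \<le> rk (lst z k) z" if "z < n" "k < p z" for z k
    using order_trans[OF w' I4[OF that]] .
  show "da_inv t (Suc x) (Suc x) p (h(y := cur)) (w(y := rk y cur))" if hy: "\<not> h y < n"
    unfolding da_inv_def
  proof (intro conjI allI impI ballI)
    fix v assume v: "v < n"
    show "(h(y := cur)) v = n \<or> (h(y := cur)) v \<in> engaged (Suc x) (Suc x) \<and>
         p ((h(y := cur)) v) < n \<and> lst ((h(y := cur)) v) (p ((h(y := cur)) v)) = v \<and>
         (w(y := rk y cur)) v = rk v ((h(y := cur)) v)"
      using I1[OF v] pc y cur I by (auto simp: engaged_def da_inv_def)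
  next
    fix z assume z: "z \<in> engaged (Suc x) (Suc x)"
    show "p z < n" using z I2[of z] pc by (auto simp: engaged_def)
    show "(h(y := cur)) (lst z (p z)) = z"
    proof (cases "z = cur")
      case True then show ?thesis using y by simp
    next
      case False
      then have "z \<in> engaged x cur" using z by (auto simp: engaged_def)
      then show ?thesis using I2[of z] hy by (auto simp: engaged_def)
    qed
  next
    fix v assume v: "v < n" "(w(y := rk y cur)) v < n"
    show "\<exists>z<n. (w(y := rk y cur)) v = rk v z \<and> rk z v \<le> p z \<and> ((h(y := cur)) v = z \<or> rk z v < p z)"
    proof (cases "v = y")
      case True then show ?thesis using cur rky by (intro exI[of _ cur]) simp
    next
      case False then show ?thesis using I5[OF v(1)] v by simp
    qed
  qed (use I3 I4' I6 I7 x cur in auto)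
  show "da_inv t x (h y) (p(h y := Suc (p (h y)))) (h(y := cur)) (w(y := rk y cur))" if hy: "h y < n"
  proof -
    define o' where "o' = h y"
    have oo: "o' \<in> engaged x cur" "p o' < n" "lst o' (p o') = y" "w y = rk y o'" "o' < n" "o' \<noteq> cur"
      using I1[OF yn] hy by (auto simp: o'_def engaged_def)
    have rko: "rk o' y = p o'" using oo rk_lst by metis
    have uniq: "h v \<noteq> o'" if "v < n" "v \<noteq> y" for v
      using I1[OF that(1)] oo that by auto
    show ?thesis unfolding o'_def[symmetric] da_inv_def
    proof (intro conjI allI impI ballI)
      fix v assume v: "v < n"
      let ?h = "h(y := cur)" let ?p = "p(o' := Suc (p o'))"
      show "?h v = n \<or> ?h v \<in> engaged x o' \<and> ?p (?h v) < n \<and> lst (?h v) (?p (?h v)) = v \<and>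
           (w(y := rk y cur)) v = rk v (?h v)"
        using I1[OF v] pc y cur I uniq[OF v] oo by (auto simp: engaged_def da_inv_def)
    next
      fix z assume z: "z \<in> engaged x o'"
      show "(p(o' := Suc (p o'))) z < n" using z I2[of z] pc by (auto simp: engaged_def)
      show "(h(y := cur)) (lst z ((p(o' := Suc (p o'))) z)) = z"
      proof (cases "z = cur")
        case True then show ?thesis using y oo by simp
      next
        case False
        then have "z \<in> engaged x cur" "z \<noteq> o'" using z by (auto simp: engaged_def)
        then show ?thesis using I2[of z] oo by (auto simp: o'_def)
      qed
    next
      fix z assume "z < n"
      then show "t z \<le> (p(o' := Suc (p o'))) z" "(p(o' := Suc (p o'))) z \<le> n"
        using I3[of z] oo by auto
    next
      fix z k assume z: "z < n" "k < (p(o' := Suc (p o'))) z"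
      show "(w(y := rk y cur)) (lst z k) \<le> rk (lst z k) z"
      proof (cases "z = o' \<and> k = p o'")
        case True then show ?thesis using oo acc by simp
      next
        case False
        then have "k < p z" using z by (auto split: if_splits)
        then show ?thesis using I4' z by blast
      qed
    next
      fix v assume v: "v < n" "(w(y := rk y cur)) v < n"
      show "\<exists>z<n. (w(y := rk y cur)) v = rk v z \<and> rk z v \<le> (p(o' := Suc (p o'))) z \<and>
         ((h(y := cur)) v = z \<or> rk z v < (p(o' := Suc (p o'))) z)"
      proof (cases "v = y")
        case True then show ?thesis using cur rky oo by (intro exI[of _ cur]) simp
      next
        case False
        then obtain z where "z < n" "w v = rk v z" "rk z v \<le> p z" "h v = z \<or> rk z v < p z"
          using I5[OF v(1)] v by auto
        then show ?thesis using False by (intro exI[of _ z]) auto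
      qed
    next
      fix \<theta> z assume \<theta>: "at_least t \<theta>" and z: "z < n"
      \<comment> \<open>The displaced man loses \<open>y\<close> to \<open>cur\<close>, who has no
        better woman than \<open>y\<close> in any admissible marriage.\<close>
      have "\<theta> o' \<noteq> y"
        using rejected_not_partner[of \<theta> cur y o'] I6[OF \<theta> cur] yn cur rky acc oo \<theta>
        unfolding at_least_def by simp
      moreover have "\<theta> o' < n" using \<theta> oo unfolding at_least_def
        by (metis lessThan_iff marriage_permutes permutes_in_image)
      ultimately have "rk o' (\<theta> o') \<noteq> p o'" using rk_eq_iff[of o' "\<theta> o'" y] yn rko oo by metis
      then show "(p(o' := Suc (p o'))) z \<le> rk z (\<theta> z)" using I6[OF \<theta> z]
        by (metis Suc_leI fun_upd_apply le_neq_implies_less)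
    next
      fix v assume "\<forall>z<n. t z = 0" "v < n" "(w(y := rk y cur)) v < n"
      then show "(h(y := cur)) v < n" using I7[of v] cur by (auto split: if_splits)
    qed (use I x oo in \<open>auto simp: da_inv_def engaged_def\<close>)
  qed
qed

text \<open>The second conjunct on failure records that the run without bounds, which must produce
  the man-optimal marriage, cannot fail.\<close>

definition da_result where
  "da_result t fail p h \<longleftrightarrow>
     (if fail then \<not> (\<exists>\<theta>. at_least t \<theta>) \<and> \<not> (\<forall>z<n. t z = 0)
      else \<exists>\<mu>. represents p h \<mu> \<and> (\<forall>z<n. t z \<le> p z) \<and> (\<forall>\<theta>. at_least t \<theta> \<longrightarrow> le \<theta> \<mu>))"

lemma da_fail:
  assumes I: "da_inv t x cur p h w" and x: "x < n" and pc: "\<not> p cur < n"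
  shows "da_result t True p h"
proof -
  have cur: "cur < n" "cur \<le> x" using I x by (simp_all add: da_inv_def)
  have pn: "p cur = n" using pc da_invD(5)[OF I cur(1)] by simp
  have 1: False if \<theta>: "at_least t \<theta>" for \<theta>
  proof -
    have "n \<le> rk cur (\<theta> cur)" using da_invD(8)[OF I \<theta> cur(1)] pn by simp
    moreover have "\<theta> cur < n" using \<theta> cur unfolding at_least_def
      by (metis lessThan_iff marriage_permutes permutes_in_image)
    ultimately show False using rk_lt[of cur "\<theta> cur"] cur by simp
  qed
  \<comment> \<open>Pigeonhole: \<open>cur\<close> has run through his whole list, so all
    \<open>n\<close> women hold men, who are distinct and different from \<open>cur\<close>.\<close>
  have 2: False if t: "\<forall>z<n. t z = 0"
  proof -
    have "h y \<in> engaged x cur \<and> lst (h y) (p (h y)) = y" if y: "y < n" for y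
    proof -
      have "w (lst cur (rk cur y)) \<le> rk (lst cur (rk cur y)) cur"
        using da_invD(6)[OF I cur(1)] pn rk_lt[OF cur(1) y] by simp
      then have "w y < n" using lst_rk[OF cur(1) y] rk_lt[OF y cur(1)] by simp
      then have "h y < n" using da_invD(9)[OF I t y] by simp
      then show ?thesis using da_invD(3)[OF I y] by simp
    qed
    then have "h ` {..<n} \<subseteq> engaged x cur" "inj_on h {..<n}"
      by (auto, metis inj_onI lessThan_iff)
    then have "n \<le> card (engaged x cur)"
      using card_inj_on_le[of h "{..<n}" "engaged x cur"] by (simp add: engaged_def)
    moreover have "engaged x cur \<subset> {..<n}" using cur by (auto simp: engaged_def)
    then have "card (engaged x cur) < n" using psubset_card_mono[of "{..<n}"] by auto
    ultimately show False by simp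
  qed
  show ?thesis unfolding da_result_def using 1 2 by meson
qed

lemma da_success:
  assumes I: "da_inv t x cur p h w" and x: "\<not> x < n" and c: "cur = x"
  shows "da_result t False p h"
proof -
  have eng: "engaged x cur = {..<n}" using I x c by (auto simp: engaged_def da_inv_def)
  define \<mu> where "\<mu> a = (if a < n then lst a (p a) else a)" for a
  have p: "p z < n" "h (lst z (p z)) = z" if "z < n" for z
    using da_invD(4)[OF I, of z] that unfolding eng by auto
  have maps: "\<mu> ` {..<n} \<subseteq> {..<n}" using p lst_lt by (auto simp: \<mu>_def)
  have "inj_on \<mu> {..<n}" by (rule inj_onI) (metis \<mu>_def lessThan_iff p(2))
  then have "bij_betw \<mu> {..<n} {..<n}" using maps by (simp add: bij_betw_def endo_inj_surj)
  then have per: "\<mu> permutes {..<n}" by (rule bij_imp_permutes) (simp add: \<mu>_def)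
  have inv: "inv \<mu> y = h y" if "y < n" for y
  proof -
    have "inv \<mu> y < n" using that per by (metis lessThan_iff permutes_in_image permutes_inv)
    then show ?thesis using p(2)[of "inv \<mu> y"] per by (metis \<mu>_def permutes_inverses(1))
  qed
  have hn: "h y < n" if "y < n" for y using inv that per by (metis lessThan_iff permutes_in_image permutes_inv)
  have wh: "w y = rk y (h y)" if "y < n" for y
    using da_invD(3)[OF I that] hn[OF that] by simp
  have rkp: "rk a (\<mu> a) = p a" if "a < n" for a using that p rk_lst by (simp add: \<mu>_def)
  have "marriage \<mu>" unfolding marriage_def
  proof (intro conjI per ballI notI)
    fix a b assume "a \<in> {..<n}" "b \<in> {..<n}" and H: "rk a b < rk a (\<mu> a) \<and> rk b a < rk b (inv \<mu> b)"
    then have ab: "a < n" "b < n" by auto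
    have "w (lst a (rk a b)) \<le> rk (lst a (rk a b)) a"
      using da_invD(6)[OF I ab(1)] H rkp[OF ab(1)] by simp
    then show False using wh[OF ab(2)] inv[OF ab(2)] lst_rk[OF ab] H by simp
  qed
  then have "represents p h \<mu>" using p inv by (simp add: represents_def \<mu>_def)
  moreover have "\<forall>z<n. t z \<le> p z" using da_invD(5)[OF I] by blast
  moreover have "\<forall>\<theta>. at_least t \<theta> \<longrightarrow> le \<theta> \<mu>"
    using da_invD(8)[OF I] rkp by (simp add: le_def)
  ultimately show ?thesis unfolding da_result_def by auto
qed

definition thresholds :: "nat \<Rightarrow> nat \<Rightarrow> nat \<Rightarrow> nat \<Rightarrow> nat \<Rightarrow> nat" where
  "thresholds a i b j z = (if z = b then j else if z = a then i else 0)"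

end

section \<open>Finding a stable partition\<close>

context preference_table
begin

definition chained :: "(nat \<Rightarrow> nat) \<Rightarrow> (nat \<Rightarrow> nat) \<Rightarrow> nat \<Rightarrow> nat \<Rightarrow> bool" where
  "chained \<mu> q a b \<longleftrightarrow> q a < n \<and> acceptable \<mu> a (lst a (q a)) \<and> inv \<mu> (lst a (q a)) = b"

definition frozen_set :: "(nat \<Rightarrow> nat) \<Rightarrow> (nat \<Rightarrow> nat) \<Rightarrow> nat set" where
  "frozen_set fz \<mu> = {z. z < n \<and> fz z \<noteq> 0} \<union> settled \<mu>"

text \<open>\<open>p\<close> and \<open>q\<close> are the positions of the partner of a man and of the first woman behind her that
  may still accept him. The stack \<open>stk\<close> of height \<open>sp\<close> holds the walk along the rotation digraph;
  \<open>on x\<close> is one more than the place of \<open>x\<close> on the stack, and \<open>0\<close> if \<open>x\<close> is not on it. The agents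
  before \<open>i\<close> need no further treatment.\<close>

definition search_inv where
  "search_inv \<mu> p q h fz on stk sp i \<longleftrightarrow> represents p h \<mu> \<and> le (inv \<mu>) \<mu> \<and>
     (\<forall>a<n. p a < q a \<and> q a \<le> n \<and> (\<forall>k. p a < k \<and> k < q a \<longrightarrow> \<not> acceptable \<mu> a (lst a k))) \<and>
     frozen \<mu> (frozen_set fz \<mu>) \<and>
     (\<forall>l<sp. stk l < n \<and> fz (stk l) = 0 \<and> on (stk l) = Suc l) \<and>
     (\<forall>x<n. on x \<noteq> 0 \<longrightarrow> on x \<le> sp \<and> stk (on x - 1) = x) \<and>
     (\<forall>l. Suc l < sp \<longrightarrow> chained \<mu> q (stk l) (stk (Suc l))) \<and>
     i \<le> n \<and> (\<forall>x<i. x \<in> frozen_set fz \<mu>)"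

text \<open>Popping \<open>d\<close> agents raises the last term by \<open>d\<close> but lowers one
  of the first two by \<open>3 * d\<close>. Of the net gain \<open>2 * d\<close>, one
  \<open>d\<close> pays for the popping loop and the other makes the decrease strict. A push gains
  one from the last term.\<close>

definition search_pot where
  "search_pot q fz sp i = 3 * (\<Sum>a<n. n - q a) + 3 * card {a. a < n \<and> fz a = 0} + (n - i) + (n - (sp::nat))"

lemma search_invD:
  assumes "search_inv \<mu> p q h fz on stk sp i"
  shows "represents p h \<mu>" "le (inv \<mu>) \<mu>"
    "\<And>a. a < n \<Longrightarrow> p a < q a \<and> q a \<le> n"
    "\<And>a k. a < n \<Longrightarrow> p a < k \<Longrightarrow> k < q a \<Longrightarrow> \<not> acceptable \<mu> a (lst a k)"
    "frozen \<mu> (frozen_set fz \<mu>)"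
    "\<And>l. l < sp \<Longrightarrow> stk l < n \<and> fz (stk l) = 0 \<and> on (stk l) = Suc l"
    "\<And>x. x < n \<Longrightarrow> on x \<noteq> 0 \<Longrightarrow> on x \<le> sp \<and> stk (on x - 1) = x"
    "\<And>l. Suc l < sp \<Longrightarrow> chained \<mu> q (stk l) (stk (Suc l))"
    "i \<le> n" "\<And>x. x < i \<Longrightarrow> x \<in> frozen_set fz \<mu>"
  using assms by (simp_all add: search_inv_def)

lemma representsD:
  assumes "represents p h \<mu>"
  shows "marriage \<mu>" "\<mu> permutes {..<n}"
    "a < n \<Longrightarrow> p a < n" "a < n \<Longrightarrow> \<mu> a = lst a (p a)" "a < n \<Longrightarrow> h a = inv \<mu> a"
    "a < n \<Longrightarrow> \<mu> a < n" "a < n \<Longrightarrow> h a < n" "a < n \<Longrightarrow> rk a (\<mu> a) = p a"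
proof -
  show m: "marriage \<mu>" using assms by (simp add: represents_def)
  show "\<mu> permutes {..<n}" using marriage_permutes[OF m] .
  show a: "p a < n" "\<mu> a = lst a (p a)" "h a = inv \<mu> a" if "a < n"
    using assms that by (simp_all add: represents_def)
  show "\<mu> a < n" "h a < n" "rk a (\<mu> a) = p a" if "a < n"
    using marriage_in[OF m, of a] a that rk_lst by simp_all
qed

lemma represents_le_iff: "a < n \<Longrightarrow> represents p h \<mu> \<Longrightarrow> a \<in> settled \<mu> \<longleftrightarrow> lst a (p a) = h a"
  by (simp add: settled_def representsD)

lemma stack_inj:
  assumes I: "search_inv \<mu> p q h fz on stk sp i"
  shows "inj_on stk {..<sp}" "sp \<le> n"
proof -
  show inj: "inj_on stk {..<sp}"
    by (rule inj_onI) (metis search_invD(6)[OF I] lessThan_iff nat.inject)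
  have "stk ` {..<sp} \<subseteq> {..<n}" using search_invD(6)[OF I] by auto
  then show "sp \<le> n" using card_inj_on_le[OF inj, of "{..<n}"] by simp
qed

text \<open>The man-optimal marriage lies above its own inverse because the inverse is a stable
  marriage, too.\<close>

lemma search_init:
  assumes "da_result (\<lambda>_. 0) False p h" and q: "\<And>a. a < n \<Longrightarrow> q a = Suc (p a)"
    and on: "\<And>a. a < n \<Longrightarrow> on a = 0" and fz: "\<And>a. a < n \<Longrightarrow> fz a = 0"
  obtains \<mu> where "search_inv \<mu> p q h fz on stk 0 0"
proof -
  obtain \<mu> where r: "represents p h \<mu>" and g: "\<forall>\<theta>. at_least (\<lambda>_. 0) \<theta> \<longrightarrow> le \<theta> \<mu>"
    using assms(1) by (auto simp: da_result_def)
  note p = representsD(2)[OF r]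
  have "le (inv \<mu>) \<mu>" using g marriage_inv[OF representsD(1)[OF r]] by (simp add: at_least_def)
  moreover have "frozen \<mu> (settled \<mu>)"
    unfolding frozen_def
  proof (intro conjI ballI impI)
    show "settled \<mu> \<subseteq> {..<n}" by (auto simp: settled_def)
    fix z assume z: "z \<in> settled \<mu>"
    have "\<mu> z = inv \<mu> z" using z by (simp add: settled_def)
    then have "\<mu> (\<mu> z) = inv \<mu> (\<mu> z)" using p by (metis permutes_inverses)
    moreover have "\<mu> z \<in> {..<n}" using z representsD(6)[OF r] unfolding settled_def by blast
    ultimately show "\<mu> z \<in> settled \<mu>" unfolding settled_def by blast
    show "\<not> acceptable \<mu> z y" if "rk z (\<mu> z) < rk z y \<and> rk z y < rk z (inv \<mu> z)" for y
      using that z unfolding settled_def by auto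
  qed
  moreover have "frozen_set fz \<mu> = settled \<mu>" using fz by (auto simp: frozen_set_def)
  ultimately have "search_inv \<mu> p q h fz on stk 0 0"
    using r representsD(3)[OF r] q on by (auto simp: search_inv_def Suc_leI)
  then show thesis using that by blast
qed

lemma search_final:
  assumes I: "search_inv \<mu> p q h fz on stk sp i" and "\<not> i < n"
  shows "partition \<mu>"
proof -
  have "{..<n} \<subseteq> frozen_set fz \<mu>" using search_invD(9,10)[OF I] assms(2) by auto
  then show ?thesis
    using frozen_partition representsD(1) search_invD[OF I] by blast
qed

lemma search_start:
  assumes I: "search_inv \<mu> p q h fz on stk 0 i" and i: "i < n" "fz i = 0"
  shows "search_inv \<mu> p q h fz (on(i := 1)) (stk(0 := i)) 1 i"
    "search_pot q fz 1 i < search_pot q fz 0 i"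
  using I i by (auto simp: search_inv_def search_pot_def)

lemma search_skip:
  assumes I: "search_inv \<mu> p q h fz on stk 0 i" and i: "i < n" "fz i \<noteq> 0 \<or> lst i (p i) = h i"
  shows "search_inv \<mu> p q h fz on stk 0 (Suc i)"
    "search_pot q fz 0 (Suc i) < search_pot q fz 0 i"
proof -
  have "i \<in> frozen_set fz \<mu>"
    using represents_le_iff[OF i(1) search_invD(1)[OF I]] i by (auto simp: frozen_set_def)
  then show "search_inv \<mu> p q h fz on stk 0 (Suc i)"
    using I i by (auto simp: search_inv_def less_Suc_eq)
  show "search_pot q fz 0 (Suc i) < search_pot q fz 0 i" using i by (simp add: search_pot_def)
qed

lemma card_unfrozen:
  assumes "R \<subseteq> {a. a < n \<and> fz a = (0::nat)}"
  shows "card {a. a < n \<and> (if a \<in> R then 1 else fz a) = (0::nat)} + card R = card {a. a < n \<and> fz a = 0}"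
proof -
  have "{a. a < n \<and> (if a \<in> R then 1 else fz a) = (0::nat)} = {a. a < n \<and> fz a = 0} - R" by auto
  then show ?thesis using assms card_Diff_subset[OF _ assms] card_mono[OF _ assms] finite_subset[OF assms]
    by simp
qed

text \<open>An agent on the stack can become settled when a rotation above it is eliminated: as a
  man it keeps its partner, as a woman it may receive a new one. It then belongs to
  \<open>frozen_set\<close> already, so marking it in \<open>fz\<close> only lowers the
  potential.\<close>

lemma search_pop_settled:
  assumes I: "search_inv \<mu> p q h fz on stk sp i" and sp: "0 < sp" and a: "a = stk (sp - 1)"
    and s: "lst a (p a) = h a"
  shows "search_inv \<mu> p q h (fz(a := 1)) (on(a := 0)) stk (sp - 1) i"
    "search_pot q (fz(a := 1)) (sp - 1) i < search_pot q fz sp i"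
proof -
  have an: "a < n" "fz a = 0" "on a = sp" using search_invD(6)[OF I, of "sp - 1"] sp a by auto
  have "a \<in> settled \<mu>" using represents_le_iff[OF an(1) search_invD(1)[OF I]] s by simp
  then have F: "frozen_set (fz(a := 1)) \<mu> = frozen_set fz \<mu>"
    using an by (auto simp: frozen_set_def)
  have ne: "stk l \<noteq> a" if "l < sp - 1" for l
  proof
    assume "stk l = a"
    then have "on a = Suc l" using search_invD(6)[OF I, of l] that by simp
    then show False using an(3) that by simp
  qed
  have "on x \<le> sp - 1 \<and> stk (on x - 1) = x" if "x < n" "x \<noteq> a" "on x \<noteq> 0" for x
  proof -
    have *: "on x \<le> sp" "stk (on x - 1) = x" using search_invD(7)[OF I that(1,3)] by auto
    then have "on x \<noteq> sp" using a that by auto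
    then show ?thesis using * by simp
  qed
  then show "search_inv \<mu> p q h (fz(a := 1)) (on(a := 0)) stk (sp - 1) i"
    unfolding search_inv_def F using I ne by (auto simp: search_inv_def)
  have "card {x. x < n \<and> (fz(a := 1)) x = 0} + 1 = card {a. a < n \<and> fz a = 0}"
  proof -
    have "{x. x < n \<and> (fz(a := 1)) x = 0} = {x. x < n \<and> (if x \<in> {a} then 1 else fz x) = 0}" by auto
    then show ?thesis using card_unfrozen[of "{a}" fz] an by simp
  qed
  then show "search_pot q (fz(a := 1)) (sp - 1) i < search_pot q fz sp i"
    using stack_inj(2)[OF I] sp by (simp add: search_pot_def)
qed

context
  fixes \<mu> p q h fz on stk sp i
  assumes I: "search_inv \<mu> p q h fz on stk sp i"
begin

lemma marriage_search: "marriage \<mu>" and le_search: "le (inv \<mu>) \<mu>"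
  using search_invD[OF I] representsD by auto

lemma settled_frozen_set: "settled \<mu> \<subseteq> frozen_set fz \<mu>"
  by (auto simp: frozen_set_def)

text \<open>The scan pointer \<open>q a\<close> stays inside the list because it cannot pass the
  predecessor, which is acceptable and lies behind the partner.\<close>

lemma unfrozen_next:
  assumes a: "a < n" "a \<notin> frozen_set fz \<mu>"
  shows "q a < n"
    and "acceptable \<mu> a (lst a (q a)) \<Longrightarrow> next_choice \<mu> a (lst a (q a))"
    and "acceptable \<mu> a (lst a (q a)) \<Longrightarrow> inv \<mu> (lst a (q a)) < n \<and> inv \<mu> (lst a (q a)) \<notin> frozen_set fz \<mu>"
    and "\<mu> a \<noteq> inv \<mu> a"
proof -
  note r = search_invD(1)[OF I]
  show ne: "\<mu> a \<noteq> inv \<mu> a" using a by (auto simp: frozen_set_def settled_def)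
  note pa = predecessor_acceptable[OF marriage_search le_search _ ne]
  have ia: "inv \<mu> a < n" using representsD(5,7)[OF r a(1)] by simp
  let ?k = "rk a (inv \<mu> a)"
  have "\<not> ?k < q a"
    using search_invD(4)[OF I a(1), of ?k] pa a representsD(8)[OF r a(1)] lst_rk[OF a(1) ia] by auto
  then show qn: "q a < n" using rk_lt[OF a(1) ia] by simp
  show nc: "next_choice \<mu> a (lst a (q a))" if acc: "acceptable \<mu> a (lst a (q a))"
    unfolding next_choice_def
  proof (intro conjI acc ballI impI)
    show "lst a (q a) \<in> {..<n}" using lst_lt a qn by simp
    show "rk a (\<mu> a) < rk a (lst a (q a))"
      using representsD(8)[OF r a(1)] rk_lst[OF a(1) qn] search_invD(3)[OF I a(1)] by simp
    fix x assume "x \<in> {..<n}" and H: "rk a (\<mu> a) < rk a x \<and> rk a x < rk a (lst a (q a))"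
    then have x: "x < n" by simp
    have "\<not> acceptable \<mu> a (lst a (rk a x))"
      using search_invD(4)[OF I a(1), of "rk a x"] H representsD(8)[OF r a(1)] rk_lst[OF a(1) qn] by simp
    then show "\<not> acceptable \<mu> a x" using lst_rk[OF a(1) x] by simp
  qed
  show "inv \<mu> (lst a (q a)) < n \<and> inv \<mu> (lst a (q a)) \<notin> frozen_set fz \<mu>"
    if acc: "acceptable \<mu> a (lst a (q a))"
  proof
    show "inv \<mu> (lst a (q a)) < n"
      using representsD(5,7)[OF r, of "lst a (q a)"] lst_lt[OF a(1) qn] by simp
    show "inv \<mu> (lst a (q a)) \<notin> frozen_set fz \<mu>"
      using next_not_frozen[OF marriage_search le_search search_invD(5)[OF I] settled_frozen_set _ nc[OF acc]] a
      by simp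
  qed
qed

context
  fixes a
  assumes sp: "0 < sp" and a: "a = stk (sp - 1)" and unsettled: "lst a (p a) \<noteq> h a"
begin

lemma top_unfrozen: "a < n" "fz a = 0" "on a = sp" "a \<notin> frozen_set fz \<mu>"
proof -
  show an: "a < n" "fz a = 0" "on a = sp" using search_invD(6)[OF I, of "sp - 1"] sp a by auto
  then show "a \<notin> frozen_set fz \<mu>"
    using unsettled represents_le_iff[OF an(1) search_invD(1)[OF I]] by (simp add: frozen_set_def)
qed

lemma top_next: "q a < n" "lst a (q a) < n" "h (lst a (q a)) < n"
  "acceptable \<mu> a (lst a (q a)) \<longleftrightarrow> rk (lst a (q a)) a < rk (lst a (q a)) (h (lst a (q a)))"
proof -
  note r = search_invD(1)[OF I]
  show q: "q a < n" using unfrozen_next(1)[OF top_unfrozen(1,4)] .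
  show l: "lst a (q a) < n" using lst_lt top_unfrozen q by blast
  show "h (lst a (q a)) < n" using representsD(7)[OF r l] .
  show "acceptable \<mu> a (lst a (q a)) \<longleftrightarrow> rk (lst a (q a)) a < rk (lst a (q a)) (h (lst a (q a)))"
    using representsD(5)[OF r l] by (simp add: acceptable_def)
qed

lemma search_advance:
  assumes rej: "\<not> rk (lst a (q a)) a < rk (lst a (q a)) (h (lst a (q a)))"
  shows "search_inv \<mu> p (q(a := Suc (q a))) h fz on stk sp i"
    "search_pot (q(a := Suc (q a))) fz sp i < search_pot q fz sp i"
proof -
  note an = top_unfrozen note na = top_next
  let ?q = "q(a := Suc (q a))"
  have nacc: "\<not> acceptable \<mu> a (lst a (q a))" using rej na by simp
  have ch: "chained \<mu> ?q (stk l) (stk (Suc l))" if "Suc l < sp" for l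
  proof -
    have "stk l \<noteq> a" using search_invD(6)[OF I, of l] that an by auto
    then show ?thesis using search_invD(8)[OF I that] by (simp add: chained_def)
  qed
  have "p z < ?q z \<and> ?q z \<le> n \<and> (\<forall>k. p z < k \<and> k < ?q z \<longrightarrow> \<not> acceptable \<mu> z (lst z k))" if "z < n" for z
    using search_invD(3,4)[OF I that] nacc na by (auto simp: less_Suc_eq)
  then show "search_inv \<mu> p ?q h fz on stk sp i"
    using I ch by (simp add: search_inv_def)
  have "(\<Sum>z<n. n - ?q z) < (\<Sum>z<n. n - q z)"
    using an na by (intro sum_strict_mono_ex1) auto
  then show "search_pot ?q fz sp i < search_pot q fz sp i" by (simp add: search_pot_def)
qed

lemma search_push:
  assumes acc: "rk (lst a (q a)) a < rk (lst a (q a)) (h (lst a (q a)))" and b: "b = h (lst a (q a))"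
    and off: "on b = 0"
  shows "search_inv \<mu> p q h fz (on(b := Suc sp)) (stk(sp := b)) (Suc sp) i"
    "search_pot q fz (Suc sp) i < search_pot q fz sp i"
proof -
  note an = top_unfrozen note na = top_next
  have acc': "acceptable \<mu> a (lst a (q a))" using acc na by simp
  have ib: "inv \<mu> (lst a (q a)) = b" using b representsD(5)[OF search_invD(1)[OF I] na(2)] by simp
  have bn: "b < n" "b \<notin> frozen_set fz \<mu>"
    using unfrozen_next(3)[OF an(1,4) acc'] ib by auto
  then have fb: "fz b = 0" by (simp add: frozen_set_def)
  have ne: "stk l \<noteq> b" if "l < sp" for l using search_invD(6)[OF I that] off by auto
  have ch: "chained \<mu> q ((stk(sp := b)) l) ((stk(sp := b)) (Suc l))" if "Suc l < Suc sp" for l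
  proof (cases "Suc l = sp")
    case True
    then have "stk l = a" using a by auto
    then show ?thesis using True acc' ib na by (auto simp: chained_def)
  next
    case False
    then show ?thesis using search_invD(8)[OF I, of l] that by simp
  qed
  have st: "\<forall>l<Suc sp. (stk(sp := b)) l < n \<and> fz ((stk(sp := b)) l) = 0 \<and> (on(b := Suc sp)) ((stk(sp := b)) l) = Suc l"
    using search_invD(6)[OF I] ne bn fb by (auto simp: less_Suc_eq)
  have onn: "\<forall>x<n. (on(b := Suc sp)) x \<noteq> 0 \<longrightarrow> (on(b := Suc sp)) x \<le> Suc sp \<and> (stk(sp := b)) ((on(b := Suc sp)) x - 1) = x"
    using search_invD(7)[OF I] by (auto simp: le_SucI) (metis Suc_leD Suc_pred less_irrefl_nat not_less_eq_eq neq0_conv)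
  show J: "search_inv \<mu> p q h fz (on(b := Suc sp)) (stk(sp := b)) (Suc sp) i"
    using I ch st onn by (simp add: search_inv_def)
  \<comment> \<open>The stack entries, including the new one, are distinct agents; without this
    bound the truncated term \<open>n - sp\<close> need not drop.\<close>
  have "sp < n"
  proof (rule ccontr)
    assume "\<not> sp < n"
    have "inj_on (stk(sp := b)) {..<Suc sp}"
      by (rule inj_onI) (metis st lessThan_iff nat.inject)
    moreover have "(stk(sp := b)) ` {..<Suc sp} \<subseteq> {..<n}" using st by auto
    ultimately have "Suc sp \<le> n" using card_inj_on_le[of "stk(sp := b)" "{..<Suc sp}" "{..<n}"] by simp
    then show False using \<open>\<not> sp < n\<close> by simp
  qed
  then show "search_pot q fz (Suc sp) i < search_pot q fz sp i" by (simp add: search_pot_def)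
qed

context
  fixes e R
  assumes acc: "rk (lst a (q a)) a < rk (lst a (q a)) (h (lst a (q a)))"
    and e: "on (h (lst a (q a))) = Suc e" and R: "R = stk ` {e..<sp}"
begin

lemma cycle_bottom: "e < sp" "stk e = inv \<mu> (lst a (q a))"
proof -
  have "on (h (lst a (q a))) \<noteq> 0" using e by simp
  from search_invD(7)[OF I top_next(3) this] e
  show "e < sp" "stk e = inv \<mu> (lst a (q a))"
    using representsD(5)[OF search_invD(1)[OF I] top_next(2)] by simp_all
qed

text \<open>The induction starts at place \<open>e\<close>, occupied by the man whom the unfrozen
  top displaces, and follows the stack upwards.\<close>

lemma cycle_unfrozen: "l < sp \<Longrightarrow> e \<le> l \<Longrightarrow> stk l \<notin> frozen_set fz \<mu>"
proof (induction l)
  case 0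
  then show ?case using unfrozen_next(3)[OF top_unfrozen(1,4)] acc top_next cycle_bottom by simp
next
  case (Suc l)
  show ?case
  proof (cases "Suc l = e")
    case True
    then show ?thesis using unfrozen_next(3)[OF top_unfrozen(1,4)] acc top_next cycle_bottom by simp
  next
    case False
    then have l: "stk l \<notin> frozen_set fz \<mu>" "stk l < n"
      using Suc search_invD(6)[OF I, of l] by auto
    show ?thesis using search_invD(8)[OF I Suc.prems(1)] unfrozen_next(3)[OF l(2,1)]
      by (auto simp: chained_def)
  qed
qed

lemma cycle_succ:
  assumes "e \<le> l" "l < sp"
  shows "acceptable \<mu> (stk l) (lst (stk l) (q (stk l)))"
    "inv \<mu> (lst (stk l) (q (stk l))) = stk (if Suc l = sp then e else Suc l)"
proof -
  have "acceptable \<mu> (stk l) (lst (stk l) (q (stk l))) \<and>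
    inv \<mu> (lst (stk l) (q (stk l))) = stk (if Suc l = sp then e else Suc l)"
  proof (cases "Suc l = sp")
    case True
    then have "stk l = a" using a by auto
    then show ?thesis using acc top_next cycle_bottom True by auto
  next
    case False
    then have "Suc l < sp" using assms(2) by simp
    then show ?thesis using search_invD(8)[OF I] False by (auto simp: chained_def)
  qed
  then show "acceptable \<mu> (stk l) (lst (stk l) (q (stk l)))"
    "inv \<mu> (lst (stk l) (q (stk l))) = stk (if Suc l = sp then e else Suc l)" by auto
qed

text \<open>The walk has met the agent at place \<open>e\<close> again, so the stack from there to
  the top is a cycle of the rotation digraph.\<close>

lemma cycle_rotation: "rotation \<mu> (\<lambda>z. lst z (q z)) R"
  unfolding rotation_def
proof (intro conjI ballI)
  let ?f = "\<lambda>z. inv \<mu> (lst z (q z))"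
  show "R \<subseteq> {..<n}" using search_invD(6)[OF I] R by auto
  fix z assume "z \<in> R"
  then obtain l where l: "z = stk l" "e \<le> l" "l < sp" using R by auto
  have z: "z < n" "z \<notin> frozen_set fz \<mu>"
    using cycle_unfrozen[OF l(3,2)] search_invD(6)[OF I l(3)] l by auto
  show "next_choice \<mu> z (lst z (q z))" "\<mu> z \<noteq> inv \<mu> z"
    using unfrozen_next(2,4)[OF z] cycle_succ(1)[OF l(2,3)] l by auto
next
  let ?f = "\<lambda>z. inv \<mu> (lst z (q z))"
  have f: "?f (stk l) = stk (if Suc l = sp then e else Suc l)" if "e \<le> l" "l < sp" for l
    using cycle_succ(2)[OF that] .
  have up: "e + k < sp \<Longrightarrow> (?f ^^ k) (stk e) = stk (e + k)" for k
    by (induction k) (use f in auto)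
  have return: "(?f ^^ (sp - e)) (stk e) = stk e"
  proof -
    have "sp - e = Suc (sp - 1 - e)" using cycle_bottom(1) by simp
    then have "(?f ^^ (sp - e)) (stk e) = ?f ((?f ^^ (sp - 1 - e)) (stk e))" by simp
    also have "\<dots> = ?f (stk (sp - 1))" using up[of "sp - 1 - e"] cycle_bottom(1) by simp
    also have "\<dots> = stk e" using f[of "sp - 1"] cycle_bottom(1) by simp
    finally show ?thesis .
  qed
  have "stk l \<in> orbit ?f (stk e)" if "e \<le> l" "l < sp" for l
  proof (cases "l = e")
    case True
    then show ?thesis unfolding orbit_altdef using return cycle_bottom(1)
      by (auto intro!: exI[of _ "sp - e"])
  next
    case False
    then show ?thesis unfolding orbit_altdef using up[of "l - e"] that
      by (auto intro!: exI[of _ "l - e"])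
  qed
  then have 1: "R \<subseteq> orbit ?f (stk e)" using R by auto
  have 2: "orbit ?f (stk e) \<subseteq> R"
  proof
    have in_R: "?f (stk l) \<in> R" if "e \<le> l" "l < sp" for l
      using f[OF that] that cycle_bottom(1) by (auto simp: R)
    fix x assume "x \<in> orbit ?f (stk e)"
    then show "x \<in> R"
    proof induction
      case base show ?case using in_R[of e] cycle_bottom(1) by simp
    next
      case (step y) then show ?case using in_R by (auto simp: R)
    qed
  qed
  have "stk e \<in> R" using cycle_bottom(1) by (auto simp: R)
  then show "cyclic_on ?f R" using 1 2 unfolding cyclic_on_def by blast
qed

lemma cycle_facts: "R \<inter> frozen_set fz \<mu> = {}" "R \<subseteq> {z. z < n \<and> fz z = 0}" "card R = sp - e" "a \<in> R"
  "x \<in> R \<Longrightarrow> e < on x" "l < e \<Longrightarrow> stk l \<notin> R"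
proof -
  show "R \<inter> frozen_set fz \<mu> = {}" using cycle_unfrozen by (auto simp: R)
  show "R \<subseteq> {z. z < n \<and> fz z = 0}" using search_invD(6)[OF I] by (auto simp: R)
  have "inj_on stk {e..<sp}" using stack_inj(1)[OF I] by (rule inj_on_subset) auto
  then show "card R = sp - e" by (simp add: R card_image)
  show "a \<in> R" using cycle_bottom(1) a sp by (auto simp: R)
  show "e < on x" if "x \<in> R" for x using that search_invD(6)[OF I] by (auto simp: R)
  show "stk l \<notin> R" if "l < e"
  proof
    assume "stk l \<in> R"
    then have "e < on (stk l)" using search_invD(6)[OF I] by (auto simp: R)
    then show False using search_invD(6)[OF I, of l] that cycle_bottom(1) by simp
  qed
qed

lemma mem_cycle_iff: "x < n \<Longrightarrow> x \<in> R \<longleftrightarrow> Suc e \<le> on x"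
proof
  show "x \<in> R \<Longrightarrow> Suc e \<le> on x" using cycle_facts(5) by (simp add: Suc_leI)
  assume "x < n" "Suc e \<le> on x"
  then have "on x \<le> sp" "stk (on x - 1) = x" using search_invD(7)[OF I, of x] by auto
  then show "x \<in> R" using \<open>Suc e \<le> on x\<close> unfolding R by (intro image_eqI[of _ _ "on x - 1"]) auto
qed

lemma search_popped:
  "\<forall>l<e. stk l < n \<and> fz (stk l) = 0 \<and> (if stk l \<in> R then 0 else on (stk l)) = Suc l"
  "\<forall>x<n. (if x \<in> R then 0 else on x) \<noteq> 0 \<longrightarrow> (if x \<in> R then 0 else on x) \<le> e \<and> stk ((if x \<in> R then 0 else on x) - 1) = x"
proof -
  show "\<forall>l<e. stk l < n \<and> fz (stk l) = 0 \<and> (if stk l \<in> R then 0 else on (stk l)) = Suc l"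
    using search_invD(6)[OF I] cycle_facts(6) cycle_bottom(1) by auto
  show "\<forall>x<n. (if x \<in> R then 0 else on x) \<noteq> 0 \<longrightarrow> (if x \<in> R then 0 else on x) \<le> e \<and> stk ((if x \<in> R then 0 else on x) - 1) = x"
    using search_invD(7)[OF I] mem_cycle_iff by (auto simp: not_less_eq_eq)
qed

text \<open>By \<open>dual_all\<close> it suffices to test self-duality at the top of the stack;
  \<open>Suc e \<le> on x\<close> decides whether \<open>x\<close> lies on the cycle.\<close>

lemma search_freeze:
  assumes dual: "lst a (q a) = h a" "Suc e \<le> on (lst a (q a))"
  shows "search_inv \<mu> p q h (\<lambda>x. if x \<in> R then 1 else fz x) (\<lambda>x. if x \<in> R then 0 else on x) stk e i"
    "search_pot q (\<lambda>x. if x \<in> R then 1 else fz x) e i + (sp - e) < search_pot q fz sp i"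
proof -
  note cf = cycle_facts
  have ia: "inv \<mu> a = lst a (q a)" using dual representsD(5)[OF search_invD(1)[OF I] top_unfrozen(1)] by simp
  have "inv \<mu> a \<in> R" using ia dual mem_cycle_iff top_next(2) by simp
  let ?fz = "\<lambda>x. if x \<in> R then 1 else fz x"
  have "frozen_set ?fz \<mu> = ({z. z < n \<and> fz z \<noteq> 0} \<union> R) \<union> settled \<mu>"
    using cf(2) by (auto simp: frozen_set_def)
  then have F: "frozen \<mu> (frozen_set ?fz \<mu>)"
    using frozen_dual[OF marriage_search le_search cycle_rotation _ cf(4) ia[symmetric] \<open>inv \<mu> a \<in> R\<close>]
      search_invD(5)[OF I] by (simp add: frozen_set_def)
  have Fsub: "frozen_set fz \<mu> \<subseteq> frozen_set ?fz \<mu>" by (auto simp: frozen_set_def)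
  have st: "\<forall>l<e. stk l < n \<and> ?fz (stk l) = 0 \<and> (if stk l \<in> R then 0 else on (stk l)) = Suc l"
    using search_popped(1) cf(6) by auto
  have ch: "\<forall>l. Suc l < e \<longrightarrow> chained \<mu> q (stk l) (stk (Suc l))"
    using search_invD(8)[OF I] cycle_bottom(1) by auto
  show "search_inv \<mu> p q h ?fz (\<lambda>x. if x \<in> R then 0 else on x) stk e i"
    unfolding search_inv_def
    using search_invD(1,2)[OF I] search_invD(3,4,9)[OF I] F st search_popped(2) ch search_invD(10)[OF I] Fsub by blast
  have "card {a. a < n \<and> ?fz a = 0} + (sp - e) = card {a. a < n \<and> fz a = 0}"
    using card_unfrozen[OF cf(2)] cf(3) by simp
  then show "search_pot q ?fz e i + (sp - e) < search_pot q fz sp i"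
    using cycle_bottom(1) stack_inj(2)[OF I] by (simp add: search_pot_def)
qed

text \<open>The walk below place \<open>e\<close> remains valid after the elimination, so it need
  not be repeated; this keeps the whole search quadratic.\<close>

lemma search_eliminate:
  assumes ndual: "\<not> (lst a (q a) = h a \<and> Suc e \<le> on (lst a (q a)))"
    and h': "\<And>z. z \<in> R \<Longrightarrow> h' (lst z (q z)) = z" "\<And>y. y \<notin> (\<lambda>z. lst z (q z)) ` R \<Longrightarrow> h' y = h y"
  shows "\<exists>\<mu>'. search_inv \<mu>' (\<lambda>x. if x \<in> R then q x else p x) (\<lambda>x. if x \<in> R then Suc (q x) else q x) h'
      fz (\<lambda>x. if x \<in> R then 0 else on x) stk e i"
    "search_pot (\<lambda>x. if x \<in> R then Suc (q x) else q x) fz e i + (sp - e) < search_pot q fz sp i"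
proof -
  note cf = cycle_facts
  note rot = cycle_rotation
  note r = search_invD(1)[OF I]
  let ?s = "\<lambda>z. lst z (q z)"
  let ?m = "eliminate \<mu> ?s R"
  let ?p = "\<lambda>x. if x \<in> R then q x else p x" and ?q = "\<lambda>x. if x \<in> R then Suc (q x) else q x"
  have RqN: "q z < n" "z < n" if "z \<in> R" for z proof -
    show "z < n" using that cf(2) by blast
    then show "q z < n" using unfrozen_next(1) that cf(1) by blast
  qed
  have "inv \<mu> a = h a" using representsD(5)[OF r top_unfrozen(1)] by simp
  then have "\<not> (?s a = inv \<mu> a \<and> inv \<mu> a \<in> R)" using ndual mem_cycle_iff[OF top_next(2)] by metis
  then have le: "le (inv ?m) ?m" using eliminate_le[OF marriage_search le_search rot cf(4)] by simp
  have inv_eq: "h' y = inv ?m y" if "y < n" for y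
  proof (cases "y \<in> ?s ` R")
    case True
    then show ?thesis using h'(1) inv_eliminate(1)[OF marriage_search le_search rot] by auto
  next
    case False
    then show ?thesis using h'(2) inv_eliminate(2)[OF marriage_search le_search rot] representsD(5)[OF r that] by auto
  qed
  have rep: "represents ?p h' ?m"
    unfolding represents_def
    using eliminate_marriage[OF marriage_search le_search rot] inv_eq RqN representsD(3,4)[OF r]
    by (auto simp: eliminate_def)
  have acc_mono: "acceptable \<mu> x y" if "y < n" "acceptable ?m x y" for x y
    using acceptable_eliminate[OF marriage_search le_search rot] that by auto
  have scan: "?p x < ?q x \<and> ?q x \<le> n \<and> (\<forall>k. ?p x < k \<and> k < ?q x \<longrightarrow> \<not> acceptable ?m x (lst x k))" if "x < n" for x
  proof -
    note pq = search_invD(3)[OF I that]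
    have "\<not> acceptable ?m x (lst x k)" if k: "p x < k" "k < q x" for k
      using search_invD(4)[OF I \<open>x < n\<close> k] acc_mono[OF lst_lt[OF \<open>x < n\<close>]] k pq by auto
    then show ?thesis using pq RqN by (auto intro: Suc_leI)
  qed
  have F: "frozen ?m (frozen_set fz ?m)"
    using frozen_eliminate[OF marriage_search le_search rot, of "{z. z < n \<and> fz z \<noteq> 0}"]
      search_invD(5)[OF I] cf(1) by (simp add: frozen_set_def)
  have ch: "chained ?m ?q (stk l) (stk (Suc l))" if l: "Suc l < e" for l
  proof -
    have nR: "stk l \<notin> R" "stk (Suc l) \<notin> R" using cf(6) l by auto
    have c: "chained \<mu> q (stk l) (stk (Suc l))" using search_invD(8)[OF I] l cycle_bottom(1) by auto
    \<comment> \<open>If the next woman of \<open>stk l\<close> took part in the rotation, the man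
      displaced there would lie in \<open>R\<close>. But he is the entry after place
      \<open>l\<close>, still below the cycle.\<close>
    have "?s (stk l) \<notin> ?s ` R"
    proof
      assume "?s (stk l) \<in> ?s ` R"
      then obtain z where z: "z \<in> R" "?s z = ?s (stk l)" by auto
      then have "inv \<mu> (?s z) = stk (Suc l)" using c by (simp add: chained_def)
      moreover have "inv \<mu> (?s z) \<in> R"
        using rotation_succ_bij[OF marriage_search le_search rot] z(1) by (auto simp: bij_betw_def)
      ultimately show False using nR by simp
    qed
    then have "inv ?m (?s (stk l)) = inv \<mu> (?s (stk l))"
      using inv_eliminate(2)[OF marriage_search le_search rot] by simp
    then show ?thesis using c nR unfolding chained_def acceptable_def by auto
  qed
  have i: "i \<le> n" "x \<in> frozen_set fz ?m" if "x < i" for x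
  proof -
    show "i \<le> n" using search_invD(9)[OF I] .
    have x: "x \<in> frozen_set fz \<mu>" using search_invD(10)[OF I that] .
    show "x \<in> frozen_set fz ?m"
    proof (cases "fz x \<noteq> 0 \<and> x < n")
      case True then show ?thesis by (simp add: frozen_set_def)
    next
      case False
      then have s: "x < n" "\<mu> x = inv \<mu> x" using x by (auto simp: frozen_set_def settled_def)
      have "x \<notin> R" using x cf(1) by auto
      moreover have "x \<notin> ?s ` R"
      proof
        assume "x \<in> ?s ` R"
        then have "x \<in> \<mu> ` R" using rotation_partner_image[OF marriage_search le_search rot] by simp
        then have "inv \<mu> x \<in> R" using representsD(2)[OF r] by (metis imageE permutes_inverses(2))
        moreover have "inv \<mu> x \<in> frozen_set fz \<mu>"
          using frozen_inv[OF representsD(2)[OF r] search_invD(5)[OF I] x] .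
        ultimately show False using cf(1) by auto
      qed
      ultimately have "?m x = inv ?m x"
        using inv_eliminate(2)[OF marriage_search le_search rot] s by (simp add: eliminate_def)
      then show ?thesis using s by (simp add: frozen_set_def settled_def)
    qed
  qed
  have "search_inv ?m ?p ?q h' fz (\<lambda>x. if x \<in> R then 0 else on x) stk e i"
    unfolding search_inv_def
    using rep le scan F search_popped ch search_invD(9)[OF I] i(2) by blast
  then show "\<exists>\<mu>'. search_inv \<mu>' ?p ?q h' fz (\<lambda>x. if x \<in> R then 0 else on x) stk e i" by blast
  have "(\<Sum>x<n. n - q x) = (\<Sum>x<n. (n - ?q x) + (if x \<in> R then 1 else 0))"
  proof (rule sum.cong[OF refl])
    fix x show "n - q x = (n - ?q x) + (if x \<in> R then 1 else 0)" using RqN(1)[of x] by auto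
  qed
  also have "\<dots> = (\<Sum>x<n. n - ?q x) + card R"
  proof -
    have "{x \<in> {..<n}. x \<in> R} = R" using RqN(2) by auto
    then show ?thesis by (simp add: sum.distrib sum.If_cases Int_def)
  qed
  finally show "search_pot ?q fz e i + (sp - e) < search_pot q fz sp i"
    using cf(3) cycle_bottom(1) stack_inj(2)[OF I] by (simp add: search_pot_def)
qed

end
end
end
end

section \<open>Stable cycles\<close>

context preference_table
begin

definition stable_cycle_set :: "(nat \<times> nat) set set" where
  "stable_cycle_set = {cycle_at \<pi> a | \<pi> a. partition \<pi> \<and> a < n}"

definition cycle_list :: "(nat \<Rightarrow> nat) \<Rightarrow> nat \<Rightarrow> nat list" where
  "cycle_list f a = map (\<lambda>i. (f ^^ i) a) [0..<least_power f a]"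

text \<open>Besides the required enumeration it bounds the lengths, from which the size of the
  output is estimated.\<close>

definition listing :: "nat list list \<Rightarrow> (nat \<times> nat) set set \<Rightarrow> bool" where
  "listing L S \<longleftrightarrow> (\<forall>c\<in>set L. c \<noteq> [] \<and> distinct c \<and> length c \<le> n) \<and> distinct (map arcs_of L) \<and> set (map arcs_of L) = S"

lemma listing_append:
  "listing L S \<Longrightarrow> listing L' S' \<Longrightarrow> S \<inter> S' = {} \<Longrightarrow> listing (L @ L') (S \<union> S')"
  by (auto simp: listing_def)

lemma listing_Nil: "listing [] {}"
  by (simp add: listing_def)

lemma cycle_list_facts:
  assumes f: "f permutes {..<n}" and a: "a < n"
  shows "set (cycle_list f a) = orbit f a" "distinct (cycle_list f a)" "cycle_list f a \<noteq> []"
    "length (cycle_list f a) = card (orbit f a)" "card (orbit f a) = least_power f a" "card (orbit f a) \<le> n"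
    "arcs_of (cycle_list f a) = cycle_at f a"
proof -
  have per: "permutation f" using permutes_permutation[OF f] .
  let ?L = "least_power f a"
  have L: "(f ^^ ?L) a = a" "?L > 0" using least_power_of_permutation[OF per] by auto
  show 1: "set (cycle_list f a) = orbit f a"
    unfolding cycle_list_def support_set[OF per] orbit_altdef_permutation[OF per] by blast
  show 2: "distinct (cycle_list f a)" unfolding cycle_list_def using cycle_of_permutation[OF per] .
  show "cycle_list f a \<noteq> []" using L by (simp add: cycle_list_def)
  show 3: "length (cycle_list f a) = card (orbit f a)" using distinct_card[OF 2] 1 by simp
  then show "card (orbit f a) = least_power f a" by (simp add: cycle_list_def)
  have "orbit f a \<subseteq> {..<n}" using permutes_orbit_subset[OF f] a by auto
  then show "card (orbit f a) \<le> n" using card_mono[of "{..<n}"] by auto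
  have next_eq: "cycle_list f a ! (Suc i mod length (cycle_list f a)) = f (cycle_list f a ! i)"
    if "i < length (cycle_list f a)" for i
  proof (cases "Suc i = ?L")
    case True
    then show ?thesis using L that by (simp add: cycle_list_def) (metis comp_apply funpow.simps(2))
  next
    case False
    then show ?thesis using that by (simp add: cycle_list_def)
  qed
  have "arcs_of (cycle_list f a) = (\<lambda>x. (x, f x)) ` set (cycle_list f a)"
  proof -
    have "arcs_of (cycle_list f a) = {(cycle_list f a ! i, f (cycle_list f a ! i)) | i. i < length (cycle_list f a)}"
      unfolding arcs_of_def using next_eq by force
    then show ?thesis by (auto simp: set_conv_nth)
  qed
  then show "arcs_of (cycle_list f a) = cycle_at f a" unfolding 1 cycle_at_def by auto
qed

lemma cycle_at_cong:
  assumes "f permutes {..<n}" and "\<And>x. x \<in> orbit f a \<Longrightarrow> g x = f x"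
  shows "cycle_at g a = cycle_at f a"
proof -
  have "orbit g a = orbit f a"
    by (rule orbit_cong[OF permutation_self_in_orbit[OF permutes_permutation[OF assms(1)]] assms(2)])
  then show ?thesis unfolding cycle_at_def using assms(2) by auto
qed

lemma cycle_at_arc:
  assumes f: "f permutes {..<n}" and "(x, y) \<in> cycle_at f a"
  shows "y = f x" "x \<in> orbit f a" "cycle_at f x = cycle_at f a" "orbit f x = orbit f a"
proof -
  show 1: "y = f x" "x \<in> orbit f a" using assms(2) by (auto simp: cycle_at_def)
  show "orbit f x = orbit f a"
    using orbit_cyclic_eq3[OF cyclic_on_orbit[OF f] 1(2)] by simp
  then show "cycle_at f x = cycle_at f a" by (simp add: cycle_at_def)
qed

lemma card_cycle_at: "card (cycle_at f a) = card (orbit f a)"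
proof -
  have "cycle_at f a = (\<lambda>x. (x, f x)) ` orbit f a" by (auto simp: cycle_at_def)
  then show ?thesis by (simp add: card_image inj_on_def)
qed

lemma Field_cycle_at:
  "f permutes {..<n} \<Longrightarrow> Field (cycle_at f a) = orbit f a"
  unfolding Field_def cycle_at_def Domain_unfold Range.simps by (auto intro: orbit.step)

definition least_on :: "(nat \<Rightarrow> nat) \<Rightarrow> nat \<Rightarrow> bool" where
  "least_on f a \<longleftrightarrow> (\<forall>x\<in>orbit f a. a \<le> x)"

text \<open>The least agent and the arc leaving it form a canonical name of an even cycle, so
  different pairs never report the same one. A pair may still name two cycles, one of length two and
  one longer.\<close>

definition cycles_at :: "nat \<Rightarrow> nat \<Rightarrow> (nat \<times> nat) set set" where
  "cycles_at a b = {C \<in> stable_cycle_set. even (card C) \<and> (a, b) \<in> C \<and> (\<forall>x\<in>Field C. a \<le> x)}"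

definition odd_members :: "(nat \<Rightarrow> nat) \<Rightarrow> nat set" where
  "odd_members \<pi> = {a. a < n \<and> odd (card (orbit \<pi> a))}"

text \<open>The test conditions of \<open>partition_from_marriage\<close>, with the cycle of
  \<open>a\<close> in \<open>inv \<zeta>\<close> for \<open>C\<close>.\<close>

definition check_ok :: "(nat \<Rightarrow> nat) \<Rightarrow> nat \<Rightarrow> bool" where
  "check_ok \<zeta> a \<longleftrightarrow> (\<forall>x<n. (x \<in> orbit (inv \<zeta>) a \<longrightarrow> rk x (inv \<zeta> x) \<le> rk x (\<zeta> x) \<and>
      (\<forall>y<n. y \<in> orbit (inv \<zeta>) a \<longrightarrow> \<not> (rk x y < rk x (\<zeta> x) \<and> rk y x < rk y (\<zeta> y)))) \<and>
    (x \<notin> orbit (inv \<zeta>) a \<longrightarrow> rk x (\<zeta> x) \<le> rk x (inv \<zeta> x)))"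

context
  fixes \<pi>\<^sub>0
  assumes \<pi>0: "partition \<pi>\<^sub>0"
begin

lemma odd_members_invariant:
  assumes \<pi>: "partition \<pi>" and a: "a < n"
  shows "odd (card (orbit \<pi> a)) \<longleftrightarrow> a \<in> odd_members \<pi>\<^sub>0" "a \<in> odd_members \<pi>\<^sub>0 \<Longrightarrow> cycle_at \<pi> a = cycle_at \<pi>\<^sub>0 a"
proof -
  note p = partition_permutes[OF \<pi>] and p0 = partition_permutes[OF \<pi>0]
  have eq: "orbit \<sigma> a = orbit \<tau> a" "cycle_at \<sigma> a = cycle_at \<tau> a"
    if "partition \<sigma>" "partition \<tau>" "odd (card (orbit \<tau> a))" for \<sigma> \<tau>
  proof -
    have e: "\<And>x. x \<in> orbit \<tau> a \<Longrightarrow> \<sigma> x = \<tau> x" using partition_odd_orbit[OF that(2,1) _ that(3)] a by simp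
    show "cycle_at \<sigma> a = cycle_at \<tau> a" using cycle_at_cong[OF partition_permutes[OF that(2)] e] .
    then show "orbit \<sigma> a = orbit \<tau> a" using Field_cycle_at partition_permutes that by metis
  qed
  show "odd (card (orbit \<pi> a)) \<longleftrightarrow> a \<in> odd_members \<pi>\<^sub>0"
  proof
    assume o: "odd (card (orbit \<pi> a))"
    then have "orbit \<pi>\<^sub>0 a = orbit \<pi> a" by (rule eq(1)[OF \<pi>0 \<pi>])
    then show "a \<in> odd_members \<pi>\<^sub>0" using o a by (simp add: odd_members_def)
  next
    assume "a \<in> odd_members \<pi>\<^sub>0"
    then have o: "odd (card (orbit \<pi>\<^sub>0 a))" by (simp add: odd_members_def)
    then have "orbit \<pi> a = orbit \<pi>\<^sub>0 a" by (rule eq(1)[OF \<pi> \<pi>0])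
    then show "odd (card (orbit \<pi> a))" using o by simp
  qed
  show "cycle_at \<pi> a = cycle_at \<pi>\<^sub>0 a" if "a \<in> odd_members \<pi>\<^sub>0"
    by (rule eq(2)[OF \<pi> \<pi>0]) (use that in \<open>simp add: odd_members_def\<close>)
qed

lemma stable_cycleE:
  assumes "C \<in> stable_cycle_set"
  obtains \<pi> a where "partition \<pi>" "a < n" "C = cycle_at \<pi> a" "\<pi> permutes {..<n}"
  using assms partition_permutes by (auto simp: stable_cycle_set_def)

lemma even_cycle_arc:
  assumes "C \<in> cycles_at a b"
  obtains \<pi> where "partition \<pi>" "\<pi> permutes {..<n}" "C = cycle_at \<pi> a" "\<pi> a = b" "a < n" "b < n"
    "a \<notin> odd_members \<pi>\<^sub>0" "b \<notin> odd_members \<pi>\<^sub>0" "a \<noteq> b" "least_on \<pi> a"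
proof -
  obtain \<pi> c where 1: "partition \<pi>" "c < n" "C = cycle_at \<pi> c" "\<pi> permutes {..<n}"
    using assms stable_cycleE by (metis (no_types, lifting) cycles_at_def mem_Collect_eq)
  have C: "even (card C)" "(a, b) \<in> C" "\<forall>x\<in>Field C. a \<le> x" using assms by (auto simp: cycles_at_def)
  note arc = cycle_at_arc[OF 1(4) C(2)[unfolded 1(3)]]
  have "orbit \<pi> c \<subseteq> {..<n}" using permutes_orbit_subset[OF 1(4)] 1(2) by auto
  then have ab: "a < n" "b < n" using arc orbit.step[of a \<pi> c] by auto
  have ca: "C = cycle_at \<pi> a" using arc 1(3) by simp
  have ev: "even (card (orbit \<pi> a))" using C(1) ca by (simp add: card_cycle_at)
  have "orbit \<pi> b = orbit \<pi> a" using arc permutation_orbit_step[OF permutes_permutation[OF 1(4)], of a] by simp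
  then have "a \<notin> odd_members \<pi>\<^sub>0" "b \<notin> odd_members \<pi>\<^sub>0" using odd_members_invariant(1)[OF 1(1)] ab ev by metis+
  moreover have "a \<noteq> b" using ev arc(1) orbit_eq_singleton_iff[of \<pi> a] by fastforce
  moreover have "least_on \<pi> a" using C(3) Field_cycle_at[OF 1(4)] ca by (simp add: least_on_def)
  ultimately show thesis using that 1 ca arc ab by blast
qed

text \<open>The cycle has even length because it occurs in some stable partition and
  \<open>a\<close> lies on no odd cycle, which does not depend on the partition.\<close>

lemma check_sound:
  assumes \<zeta>: "marriage \<zeta>" and a: "a < n" "a \<notin> odd_members \<pi>\<^sub>0" and ok: "check_ok \<zeta> a" and min: "least_on (inv \<zeta>) a"
  shows "cycle_at (inv \<zeta>) a \<in> cycles_at a (inv \<zeta> a)"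
proof -
  note p = marriage_permutes[OF \<zeta>]
  note pi = permutes_inv[OF p]
  let ?C = "orbit (inv \<zeta>) a"
  have C: "?C \<subseteq> {..<n}" using permutes_orbit_subset[OF pi] a by auto
  have self: "a \<in> ?C" using permutation_self_in_orbit[OF permutes_permutation[OF pi]] .
  obtain \<pi> where \<pi>: "partition \<pi>" "\<And>x. x \<in> ?C \<Longrightarrow> \<pi> x = inv \<zeta> x"
  proof (rule partition_from_marriage[OF \<pi>0 \<zeta> C])
    show "\<zeta> x \<in> ?C" if "x \<in> ?C" for x using orbit_closed(2)[OF pi that] permutes_inv_inv[OF p] by simp
    show "inv \<zeta> x \<in> ?C" if "x \<in> ?C" for x using orbit_closed(1)[OF pi that] .
    show "rk x (inv \<zeta> x) \<le> rk x (\<zeta> x)" if "x \<in> ?C" for x using that C ok by (auto simp: check_ok_def)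
    show "\<not> (rk x y < rk x (\<zeta> x) \<and> rk y x < rk y (\<zeta> y))" if "x \<in> ?C" "y \<in> ?C" for x y
      using that C ok unfolding check_ok_def by (meson lessThan_iff subsetD)
    show "rk x (\<zeta> x) \<le> rk x (inv \<zeta> x)" if "x \<in> {..<n} - ?C" for x using that ok by (auto simp: check_ok_def)
  qed blast
  have eq: "cycle_at \<pi> a = cycle_at (inv \<zeta>) a" using cycle_at_cong[OF pi \<pi>(2)] .
  note pp = partition_permutes[OF \<pi>(1)]
  have "orbit \<pi> a = ?C" using Field_cycle_at[OF pp] Field_cycle_at[OF pi] eq by metis
  then have "even (card (cycle_at (inv \<zeta>) a))"
    using odd_members_invariant(1)[OF \<pi>(1) a(1)] a(2) by (simp add: card_cycle_at)
  moreover have "cycle_at (inv \<zeta>) a \<in> stable_cycle_set" using \<pi>(1) a eq[symmetric] by (auto simp: stable_cycle_set_def)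
  moreover have "(a, inv \<zeta> a) \<in> cycle_at (inv \<zeta>) a" using self by (auto simp: cycle_at_def)
  ultimately show ?thesis using min by (simp add: cycles_at_def Field_cycle_at[OF pi] least_on_def)
qed

lemma listing_single:
  assumes "f permutes {..<n}" "a < n"
  shows "listing [cycle_list f a] {cycle_at f a}"
  using cycle_list_facts[OF assms] by (simp add: listing_def)

text \<open>If \<open>a\<close> and \<open>b\<close> form a cycle of a partition, that partition
  itself meets the bounds, so the run succeeds with a marriage above it. The bounds from one side
  and \<open>le\<close> from the other leave \<open>a\<close> and \<open>b\<close> with exactly each
  other.\<close>

lemma short_cycle_listing:
  assumes ab: "a < n" "b < n" "a \<notin> odd_members \<pi>\<^sub>0" "a \<noteq> b"
    and da: "da_result (thresholds a (rk a b) b (rk b a)) fail p h"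
    and L: "L = (if \<not> fail \<and> h a = b \<and> h b = a \<and> check_ok (\<lambda>x. if x < n then lst x (p x) else x) a \<and>
        least_on (inv (\<lambda>x. if x < n then lst x (p x) else x)) a
      then [cycle_list (inv (\<lambda>x. if x < n then lst x (p x) else x)) a] else [])"
  shows "listing L {C \<in> cycles_at a b. card C = 2}"
proof -
  define \<zeta> where "\<zeta> = (\<lambda>x. if x < n then lst x (p x) else x)"
  let ?t = "thresholds a (rk a b) b (rk b a)"
  have two: "cycle_at f a = {(a, b), (b, a)} \<and> orbit f a = {a, b}" if f: "f permutes {..<n}" "f a = b" "f b = a" for f
  proof -
    have "(f ^^ 2) a = a" using f by (simp add: numeral_2_eq_2)
    then have "orbit f a = {(f ^^ m) a | m. m < 2}" by (rule orbit_altdef_bounded) simp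
    also have "\<dots> = {a, b}" using f by (auto simp: less_2_cases_iff intro: exI[of _ 0] exI[of _ 1])
    finally show ?thesis using f by (auto simp: cycle_at_def)
  qed
  have complete: "\<not> fail \<and> represents p h \<zeta> \<and> h a = b \<and> h b = a \<and> check_ok \<zeta> a \<and> least_on (inv \<zeta>) a \<and>
      C = cycle_at (inv \<zeta>) a" if C: "C \<in> cycles_at a b" "card C = 2" for C
  proof -
    obtain \<pi> where \<pi>: "partition \<pi>" "\<pi> permutes {..<n}" "C = cycle_at \<pi> a" "\<pi> a = b" "least_on \<pi> a"
      using even_cycle_arc[OF C(1)] by metis
    have self: "a \<in> orbit \<pi> a" "b \<in> orbit \<pi> a"
      using permutation_self_in_orbit[OF permutes_permutation[OF \<pi>(2)]] orbit.base[of \<pi> a] \<pi>(4) by auto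
    have "card (orbit \<pi> a) = 2" using C(2) \<pi>(3) by (simp add: card_cycle_at)
    then have orb: "orbit \<pi> a = {a, b}" using self ab(4)
      by (metis card_2_iff doubleton_eq_iff insertE singletonD)
    then have "\<pi> b \<in> {a, b}" using orbit.step[OF self(2)] by simp
    then have ba: "\<pi> b = a" using \<pi>(2,4) ab(4) by (metis insertE permutes_inverses(2) singletonD)
    have ge: "at_least ?t \<pi>" using partition_marriage[OF \<pi>(1)] \<pi>(4) ba by (simp add: at_least_def thresholds_def)
    then obtain \<mu> where f: "\<not> fail" "represents p h \<mu>" "\<forall>z<n. ?t z \<le> p z" "le \<pi> \<mu>"
      using da by (auto simp: da_result_def split: if_splits)
    have \<mu>\<zeta>: "\<mu> = \<zeta>"
      using representsD[OF f(2)] by (auto simp: \<zeta>_def fun_eq_iff permutes_not_in)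
    note r = f(2)[unfolded \<mu>\<zeta>]
    note le = f(4)[unfolded \<mu>\<zeta>]
    have m: "marriage \<zeta>" using representsD(1)[OF r] .
    note pz = marriage_permutes[OF m]
    have "rk a b \<le> rk a (\<zeta> a)" "rk b a \<le> rk b (\<zeta> b)"
      using f(3)[rule_format, of a] f(3)[rule_format, of b] ab representsD(8)[OF r] by (simp_all add: thresholds_def)
    moreover have "rk a (\<zeta> a) \<le> rk a b" "rk b (\<zeta> b) \<le> rk b a"
      using le \<pi>(4) ba ab unfolding le_def by force+
    ultimately have "rk a (\<zeta> a) = rk a b" "rk b (\<zeta> b) = rk b a" by simp_all
    then have z: "\<zeta> a = b" "\<zeta> b = a" using rk_eq_iff ab representsD(6)[OF r] by blast+
    then have iz: "inv \<zeta> b = a" "inv \<zeta> a = b" using pz by (metis permutes_inverses(2))+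
    note tz = two[OF permutes_inv[OF pz] iz(2,1)]
    have "check_ok \<zeta> a" unfolding check_ok_def
    proof (intro allI impI conjI)
      fix x assume x: "x < n"
      show "rk x (inv \<zeta> x) \<le> rk x (\<zeta> x)" if "x \<in> orbit (inv \<zeta>) a" using that tz z iz by auto
      \<comment> \<open>Candidates are the pair \<open>a\<close>, \<open>b\<close> itself, where
        nothing is strict, and an agent with itself, which it ranks last.\<close>
      show "\<not> (rk x y < rk x (\<zeta> x) \<and> rk y x < rk y (\<zeta> y))"
        if "x \<in> orbit (inv \<zeta>) a" "y < n" "y \<in> orbit (inv \<zeta>) a" for y
        using that tz z rk_self[of a b] rk_self[of b a] ab by auto
      show "rk x (\<zeta> x) \<le> rk x (inv \<zeta> x)" using marriage_above_partition[OF \<pi>(1) m le] x by simp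
    qed
    moreover have "least_on (inv \<zeta>) a" using \<pi>(5) orb tz by (simp add: least_on_def)
    moreover have "C = cycle_at (inv \<zeta>) a" using two[OF \<pi>(2,4) ba] tz \<pi>(3) by simp
    ultimately show ?thesis using f(1) r representsD(5)[OF r] ab iz by auto
  qed
  show ?thesis
  proof (cases "\<not> fail \<and> h a = b \<and> h b = a \<and> check_ok \<zeta> a \<and> least_on (inv \<zeta>) a")
    case True
    then obtain \<mu> where r': "represents p h \<mu>" using da by (auto simp: da_result_def)
    have "\<mu> = \<zeta>" using representsD[OF r'] by (auto simp: \<zeta>_def fun_eq_iff permutes_not_in)
    then have r: "represents p h \<zeta>" using r' by simp
    note m = representsD(1)[OF r]
    note pz = marriage_permutes[OF m]
    have iz: "inv \<zeta> a = b" "inv \<zeta> b = a" using True representsD(5)[OF r] ab by auto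
    have "cycle_at (inv \<zeta>) a \<in> cycles_at a b" using check_sound[OF m ab(1,3)] True iz by auto
    moreover have "card (cycle_at (inv \<zeta>) a) = 2" using two[OF permutes_inv[OF pz] iz] ab(4) by simp
    ultimately have "{C \<in> cycles_at a b. card C = 2} = {cycle_at (inv \<zeta>) a}" using complete by blast
    then show ?thesis using L True listing_single[OF permutes_inv[OF pz] ab(1)] by (simp flip: \<zeta>_def)
  next
    case False
    have "{C \<in> cycles_at a b. card C = 2} = {}" using complete False by blast
    moreover have "L = []" unfolding L \<zeta>_def[symmetric] if_not_P[OF False] ..
    ultimately show ?thesis using listing_Nil by metis
  qed
qed

text \<open>The successor of \<open>b\<close> on the cycle is not known beforehand: it is the man held by \<open>b\<close> in the
  greatest stable marriage that puts \<open>a\<close> below \<open>b\<close>.\<close>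

lemma long_cycle_listing:
  assumes ab: "a < n" "b < n" "a \<notin> odd_members \<pi>\<^sub>0" "a \<noteq> b"
    and da1: "da_result (thresholds a (Suc (rk a b)) b 0) fail1 p1 h1"
    and da2: "\<not> fail1 \<Longrightarrow> da_result (thresholds a (Suc (rk a b)) b (Suc (rk b (h1 b)))) fail p h"
    and L: "L = (if \<not> fail1 \<and> \<not> fail \<and> h a = b \<and> check_ok (\<lambda>x. if x < n then lst x (p x) else x) a \<and>
        least_on (inv (\<lambda>x. if x < n then lst x (p x) else x)) a
      then [cycle_list (inv (\<lambda>x. if x < n then lst x (p x) else x)) a] else [])"
  shows "listing L {C \<in> cycles_at a b. card C \<noteq> 2}"
proof -
  define \<zeta> where "\<zeta> = (\<lambda>x. if x < n then lst x (p x) else x)"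
  have \<mu>\<zeta>: "\<mu> = \<zeta>" if "represents p h \<mu>" for \<mu>
    using representsD[OF that] by (auto simp: \<zeta>_def fun_eq_iff permutes_not_in)
  have two: "card (orbit f a) = 2" if f: "f permutes {..<n}" "f a = b" "f b = a" for f
  proof -
    have "(f ^^ 2) a = a" using f by (simp add: numeral_2_eq_2)
    then have "orbit f a = {(f ^^ m) a | m. m < 2}" by (rule orbit_altdef_bounded) simp
    also have "\<dots> = {a, b}" using f by (auto simp: less_2_cases_iff intro: exI[of _ 0] exI[of _ 1])
    finally show ?thesis using ab(4) by simp
  qed
  have complete: "\<not> fail1 \<and> \<not> fail \<and> h a = b \<and> check_ok \<zeta> a \<and> least_on (inv \<zeta>) a \<and> C = cycle_at (inv \<zeta>) a"
    if C: "C \<in> cycles_at a b" "card C \<noteq> 2" for C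
  proof -
    obtain \<pi> where \<pi>: "partition \<pi>" "\<pi> permutes {..<n}" "C = cycle_at \<pi> a" "\<pi> a = b" "least_on \<pi> a"
      using even_cycle_arc[OF C(1)] by metis
    note per = permutes_permutation[OF \<pi>(2)]
    have aA: "a \<in> {..<n}" using ab by simp
    have ne: "\<pi> a \<noteq> inv \<pi> a"
    proof
      assume "\<pi> a = inv \<pi> a"
      then have "\<pi> b = a" using \<pi>(2,4) by (metis permutes_inverses(1))
      then show False using two[OF \<pi>(2,4)] C(2) \<pi>(3) by (simp add: card_cycle_at)
    qed
    let ?O = "orbit \<pi> a"
    have self: "a \<in> ?O" "b \<in> ?O" using permutation_self_in_orbit[OF per] orbit.base[of \<pi> a] \<pi>(4) by auto
    note long = long_cycle_lt(2)[OF \<pi>(1) aA ne]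
    \<comment> \<open>The reversal puts \<open>a\<close> and \<open>b\<close> strictly below their
      successors, so it meets the strict bounds of both runs.\<close>
    define \<theta> where "\<theta> = flipped \<pi> a"
    have m\<theta>: "marriage \<theta>" unfolding \<theta>_def using marriage_flipped[OF \<pi>(1) aA] .
    have \<theta>a: "rk a b < rk a (\<theta> a)" using long[OF self(1)] self \<pi>(4) by (simp add: \<theta>_def flipped_def glue_def)
    have \<theta>b: "rk b (\<pi> b) < rk b (\<theta> b)" using long[OF self(2)] self by (simp add: \<theta>_def flipped_def glue_def)
    have "at_least (thresholds a (Suc (rk a b)) b 0) \<theta>" using m\<theta> \<theta>a by (simp add: at_least_def thresholds_def)
    then obtain \<mu> where 1: "\<not> fail1" "represents p1 h1 \<mu>" "\<forall>z<n. thresholds a (Suc (rk a b)) b 0 z \<le> p1 z" "le \<theta> \<mu>"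
      using da1 by (auto simp: da_result_def split: if_splits)
    have "rk a (\<pi> a) < rk a (\<mu> a)" using 1(3)[rule_format, OF ab(1)] representsD(8)[OF 1(2) ab(1)] ab \<pi>(4)
      by (simp add: thresholds_def)
    then have "inv \<mu> (\<pi> a) = \<pi> (\<pi> a)"
      using successor_from_marriage[OF \<pi>(1) aA ne representsD(1)[OF 1(2)]] 1(4) by (simp add: \<theta>_def)
    then have h1: "h1 b = \<pi> b" using representsD(5)[OF 1(2) ab(2)] \<pi>(4) by simp
    let ?t = "thresholds a (Suc (rk a b)) b (Suc (rk b (\<pi> b)))"
    have d2: "da_result ?t fail p h" using da2[OF 1(1)] h1 by simp
    have "at_least ?t \<theta>" using m\<theta> \<theta>a \<theta>b by (simp add: at_least_def thresholds_def)
    then obtain \<mu>2 where 2: "\<not> fail" "represents p h \<mu>2" "\<forall>z<n. ?t z \<le> p z" "le \<theta> \<mu>2"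
      using d2 by (auto simp: da_result_def split: if_splits)
    note r = 2(2)[unfolded \<mu>\<zeta>[OF 2(2)]] and le = 2(4)[unfolded \<mu>\<zeta>[OF 2(2)]]
    note m = representsD(1)[OF r]
    note pz = marriage_permutes[OF m]
    have lt: "rk a (\<pi> a) < rk a (\<zeta> a)" "rk (\<pi> a) (\<pi> (\<pi> a)) < rk (\<pi> a) (\<zeta> (\<pi> a))"
      using 2(3)[rule_format, OF ab(1)] 2(3)[rule_format, OF ab(2)] representsD(8)[OF r] ab \<pi>(4)
      by (simp_all add: thresholds_def)
    note on = marriage_on_long_cycle(1)[OF \<pi>(1) aA ne m le[unfolded \<theta>_def] lt]
      and off = marriage_on_long_cycle(2)[OF \<pi>(1) aA ne m le[unfolded \<theta>_def] lt]
    have iz: "inv \<zeta> x = \<pi> x" if "x \<in> ?O" for x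
    proof -
      have "\<zeta> (\<pi> x) = x" using on[OF orbit.step[OF that]] \<pi>(2) by (simp add: permutes_inverses)
      then show ?thesis using pz by (metis permutes_inverses(2))
    qed
    have cyc: "cycle_at (inv \<zeta>) a = cycle_at \<pi> a" by (rule cycle_at_cong[OF \<pi>(2) iz])
    then have orb: "orbit (inv \<zeta>) a = ?O" using Field_cycle_at[OF \<pi>(2)] Field_cycle_at[OF permutes_inv[OF pz]] by metis
    have "check_ok \<zeta> a" unfolding check_ok_def orb
    proof (intro allI impI conjI)
      fix x assume x: "x < n"
      show "rk x (inv \<zeta> x) \<le> rk x (\<zeta> x)" if "x \<in> ?O" using long[OF that] on[OF that] iz[OF that] by simp
      show "\<not> (rk x y < rk x (\<zeta> x) \<and> rk y x < rk y (\<zeta> y))" if "x \<in> ?O" "y < n" "y \<in> ?O" for y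
        using \<pi>(1) x that on unfolding partition_def by simp
      show "rk x (\<zeta> x) \<le> rk x (inv \<zeta> x)" if "x \<notin> ?O" using off[of x] x that by simp
    qed
    moreover have "least_on (inv \<zeta>) a" using \<pi>(5) orb by (simp add: least_on_def)
    moreover have "h a = b" using representsD(5)[OF r ab(1)] iz[OF self(1)] \<pi>(4) by simp
    ultimately show ?thesis using 1(1) 2(1) cyc \<pi>(3) by simp
  qed
  show ?thesis
  proof (cases "\<not> fail1 \<and> \<not> fail \<and> h a = b \<and> check_ok \<zeta> a \<and> least_on (inv \<zeta>) a")
    case True
    then obtain \<mu> where r': "represents p h \<mu>" "\<forall>z<n. thresholds a (Suc (rk a b)) b (Suc (rk b (h1 b))) z \<le> p z"
      using da2 by (auto simp: da_result_def)
    note r = r'(1)[unfolded \<mu>\<zeta>[OF r'(1)]]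
    note m = representsD(1)[OF r]
    note pz = marriage_permutes[OF m] and pi = permutes_inv[OF marriage_permutes[OF m]]
    have iz: "inv \<zeta> a = b" using True representsD(5)[OF r] ab by auto
    have C: "cycle_at (inv \<zeta>) a \<in> cycles_at a b" using check_sound[OF m ab(1,3)] True iz by auto
    \<comment> \<open>On a cycle of length two \<open>\<zeta> a\<close> would be \<open>b\<close>,
      which the strict bound at \<open>a\<close> forbids.\<close>
    have "card (orbit (inv \<zeta>) a) \<noteq> 2"
    proof
      assume c2: "card (orbit (inv \<zeta>) a) = 2"
      have self: "a \<in> orbit (inv \<zeta>) a" "b \<in> orbit (inv \<zeta>) a"
        using permutation_self_in_orbit[OF permutes_permutation[OF pi]] orbit.base[of "inv \<zeta>" a] iz by auto
      then have orb: "orbit (inv \<zeta>) a = {a, b}" using c2 ab(4)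
        by (metis card_2_iff doubleton_eq_iff insertE singletonD)
      then have "inv \<zeta> b \<in> {a, b}" using orbit.step[OF self(2)] by simp
      then have "inv \<zeta> b = a" using pi iz ab(4) by (metis insertE permutes_inverses(2) singletonD)
      then have "\<zeta> a = b" using pz by (metis permutes_inverses(1))
      moreover have "Suc (rk a b) \<le> p a" using r'(2)[rule_format, OF ab(1)] ab(4) by (simp add: thresholds_def)
      ultimately show False using representsD(8)[OF r ab(1)] by simp
    qed
    then have "cycle_at (inv \<zeta>) a \<in> {C \<in> cycles_at a b. card C \<noteq> 2}" using C by (simp add: card_cycle_at)
    then have "{C \<in> cycles_at a b. card C \<noteq> 2} = {cycle_at (inv \<zeta>) a}" using complete by blast
    then show ?thesis using L True listing_single[OF pi ab(1)] by (simp flip: \<zeta>_def)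
  next
    case False
    have "{C \<in> cycles_at a b. card C \<noteq> 2} = {}" using complete False by blast
    moreover have "L = []" unfolding L \<zeta>_def[symmetric] if_not_P[OF False] ..
    ultimately show ?thesis using listing_Nil by metis
  qed
qed

definition odd_cycles_at :: "nat \<Rightarrow> (nat \<times> nat) set set" where
  "odd_cycles_at a = {C \<in> stable_cycle_set. odd (card C) \<and> a \<in> Field C \<and> (\<forall>x\<in>Field C. a \<le> x)}"

lemma odd_cycle_listing:
  assumes a: "a < n"
  shows "listing (if a \<in> odd_members \<pi>\<^sub>0 \<and> least_on \<pi>\<^sub>0 a then [cycle_list \<pi>\<^sub>0 a] else []) (odd_cycles_at a)"
proof -
  note p0 = partition_permutes[OF \<pi>0]
  note self = permutation_self_in_orbit[OF permutes_permutation[OF p0]]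
  have 1: "a \<in> odd_members \<pi>\<^sub>0 \<and> least_on \<pi>\<^sub>0 a \<and> C = cycle_at \<pi>\<^sub>0 a" if C: "C \<in> odd_cycles_at a" for C
  proof -
    obtain \<pi> c where \<pi>: "partition \<pi>" "c < n" "C = cycle_at \<pi> c" "\<pi> permutes {..<n}"
      using C stable_cycleE by (metis (no_types, lifting) odd_cycles_at_def mem_Collect_eq)
    have F: "odd (card C)" "a \<in> orbit \<pi> c" "\<forall>x\<in>orbit \<pi> c. a \<le> x"
      using C Field_cycle_at[OF \<pi>(4)] \<pi>(3) by (auto simp: odd_cycles_at_def)
    have "(a, \<pi> a) \<in> cycle_at \<pi> c" using F by (auto simp: cycle_at_def)
    note arc = cycle_at_arc[OF \<pi>(4) this]
    have "odd (card (orbit \<pi> a))" using F(1) arc(4) \<pi>(3) by (simp add: card_cycle_at)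
    then have o: "a \<in> odd_members \<pi>\<^sub>0" using odd_members_invariant(1)[OF \<pi>(1) a] by simp
    then have eq: "C = cycle_at \<pi>\<^sub>0 a" using odd_members_invariant(2)[OF \<pi>(1) a] arc(3) \<pi>(3) by simp
    have "orbit \<pi>\<^sub>0 a = orbit \<pi> c" using eq \<pi>(3) Field_cycle_at p0 \<pi>(4) by metis
    then show ?thesis using o eq F(3) by (simp add: least_on_def)
  qed
  show ?thesis
  proof (cases "a \<in> odd_members \<pi>\<^sub>0 \<and> least_on \<pi>\<^sub>0 a")
    case True
    then have "cycle_at \<pi>\<^sub>0 a \<in> odd_cycles_at a"
      using \<pi>0 a self Field_cycle_at[OF p0] by (auto simp: odd_cycles_at_def stable_cycle_set_def least_on_def odd_members_def card_cycle_at)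
    then have "odd_cycles_at a = {cycle_at \<pi>\<^sub>0 a}" using 1 by blast
    then show ?thesis using True listing_single[OF p0 a] by simp
  next
    case False
    then have "odd_cycles_at a = {}" using 1 by blast
    then show ?thesis unfolding if_not_P[OF False] using listing_Nil by metis
  qed
qed

lemma odd_cycles_disjoint: "a \<noteq> a' \<Longrightarrow> odd_cycles_at a \<inter> odd_cycles_at a' = {}"
  unfolding odd_cycles_at_def by (auto dest: le_antisym)

lemma odd_even_disjoint: "odd_cycles_at a \<inter> cycles_at a' b = {}"
  by (auto simp: odd_cycles_at_def cycles_at_def)

lemma cycles_at_disjoint:
  assumes "(a, b) \<noteq> (a', b')" shows "cycles_at a b \<inter> cycles_at a' b' = {}"
proof (rule ccontr)
  assume "cycles_at a b \<inter> cycles_at a' b' \<noteq> {}"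
  then obtain C where C: "C \<in> cycles_at a b" "C \<in> cycles_at a' b'" by blast
  then have "a \<in> Field C" "a' \<in> Field C" by (auto simp: cycles_at_def Field_def)
  then have "a = a'" using C by (auto simp: cycles_at_def intro: le_antisym)
  moreover have "b = b'" if "a = a'"
  proof -
    obtain \<pi> where "\<pi> permutes {..<n}" "C = cycle_at \<pi> a" "\<pi> a = b" using even_cycle_arc[OF C(1)] by metis
    moreover have "(a, b') \<in> C" using C(2) that by (simp add: cycles_at_def)
    ultimately show ?thesis using cycle_at_arc(1) by metis
  qed
  ultimately show False using assms by simp
qed

lemma stable_cycle_set_decompose:
  "stable_cycle_set = (\<Union>a<n. odd_cycles_at a) \<union> (\<Union>a<n. \<Union>b<n. cycles_at a b)"
proof (intro equalityI subsetI)
  fix C assume C: "C \<in> stable_cycle_set"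
  then obtain \<pi> c where \<pi>: "partition \<pi>" "c < n" "C = cycle_at \<pi> c" "\<pi> permutes {..<n}"
    using stable_cycleE by metis
  have F: "Field C = orbit \<pi> c" using Field_cycle_at[OF \<pi>(4)] \<pi>(3) by simp
  have sub: "orbit \<pi> c \<subseteq> {..<n}" using permutes_orbit_subset[OF \<pi>(4)] \<pi>(2) by auto
  have "finite (Field C)" "Field C \<noteq> {}" using F finite_subset[OF sub] orbit_nonempty[of \<pi> c] by auto
  then have a: "Min (Field C) \<in> Field C" "\<forall>x\<in>Field C. Min (Field C) \<le> x" by auto
  let ?a = "Min (Field C)"
  have an: "?a < n" "\<pi> ?a < n" using a(1) F sub orbit.step[of ?a \<pi> c] by auto
  have "(?a, \<pi> ?a) \<in> C" using a(1) F \<pi>(3) by (auto simp: cycle_at_def)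
  then show "C \<in> (\<Union>a<n. odd_cycles_at a) \<union> (\<Union>a<n. \<Union>b<n. cycles_at a b)"
    using C a an by (cases "even (card C)") (auto simp: odd_cycles_at_def cycles_at_def)
next
  fix C assume "C \<in> (\<Union>a<n. odd_cycles_at a) \<union> (\<Union>a<n. \<Union>b<n. cycles_at a b)"
  then show "C \<in> stable_cycle_set" by (auto simp: odd_cycles_at_def cycles_at_def)
qed

text \<open>Connects the set computed from one partition with the invariant set of agents on odd
  cycles.\<close>

lemma odd_members_Field: "odd_members \<pi>\<^sub>0 = \<Union> (Field ` {C \<in> stable_cycle_set. odd (card C)})"
proof (intro equalityI subsetI)
  note p0 = partition_permutes[OF \<pi>0]
  fix a assume "a \<in> odd_members \<pi>\<^sub>0"
  then have "cycle_at \<pi>\<^sub>0 a \<in> {C \<in> stable_cycle_set. odd (card C)}" "a \<in> Field (cycle_at \<pi>\<^sub>0 a)"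
    using \<pi>0 permutation_self_in_orbit[OF permutes_permutation[OF p0]]
    by (auto simp: odd_members_def stable_cycle_set_def card_cycle_at Field_cycle_at[OF p0])
  then show "a \<in> \<Union> (Field ` {C \<in> stable_cycle_set. odd (card C)})" by blast
next
  fix a assume "a \<in> \<Union> (Field ` {C \<in> stable_cycle_set. odd (card C)})"
  then obtain C where C: "C \<in> stable_cycle_set" "odd (card C)" "a \<in> Field C" by blast
  obtain \<pi> c where \<pi>: "partition \<pi>" "c < n" "C = cycle_at \<pi> c" "\<pi> permutes {..<n}" using stable_cycleE[OF C(1)] .
  have o: "a \<in> orbit \<pi> c" using C(3) Field_cycle_at[OF \<pi>(4)] \<pi>(3) by simp
  then have an: "a < n" using permutes_orbit_subset[OF \<pi>(4)] \<pi>(2) by auto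
  have "orbit \<pi> a = orbit \<pi> c" using orbit_cyclic_eq3[OF cyclic_on_orbit[OF \<pi>(4)] o] by simp
  then show "a \<in> odd_members \<pi>\<^sub>0" using odd_members_invariant(1)[OF \<pi>(1) an] C(2) \<pi>(3) by (simp add: card_cycle_at)
qed

end
end

section \<open>A language with arrays\<close>

text \<open>Besides registers there are two-dimensional arrays of unbounded size, and the initial segment
  of the memory, in which input and output live. The only arithmetic operations are successor and
  truncated subtraction, so that a run of \<open>t\<close> steps cannot create numbers that exceed the initial
  ones by more than \<open>t\<close>. This makes the word bound automatic.\<close>

datatype exp =
    Lit nat
  | Var nat
  | Arr nat exp exp
  | Incr exp
  | Minus exp exp
  | Lt exp exp
  | Eql exp exp
  | Conj exp exp

datatype cmd =
    Nop
  | Assign nat exp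
  | Put nat exp exp exp
  | ReadRaw nat exp
  | WriteRaw exp exp
  | Then cmd cmd (infixr ";;" 60)
  | Cond exp cmd cmd
  | Loop exp cmd

type_synonym regs = "nat \<Rightarrow> nat"
type_synonym arrays = "nat \<Rightarrow> nat \<Rightarrow> nat \<Rightarrow> nat"
type_synonym hstate = "regs \<times> arrays \<times> (nat \<Rightarrow> nat)"

fun val :: "exp \<Rightarrow> regs \<Rightarrow> arrays \<Rightarrow> nat" where
  "val (Lit k) r A = k"
| "val (Var x) r A = r x"
| "val (Arr k e f) r A = A k (val e r A) (val f r A)"
| "val (Incr e) r A = Suc (val e r A)"
| "val (Minus e f) r A = val e r A - val f r A"
| "val (Lt e f) r A = (if val e r A < val f r A then 1 else 0)"
| "val (Eql e f) r A = (if val e r A = val f r A then 1 else 0)"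
| "val (Conj e f) r A = (if val e r A \<noteq> 0 \<and> val f r A \<noteq> 0 then 1 else 0)"

fun cost :: "exp \<Rightarrow> nat" where
  "cost (Lit k) = 1"
| "cost (Var x) = 1"
| "cost (Arr k e f) = Suc (cost e + cost f)"
| "cost (Incr e) = Suc (cost e)"
| "cost (Minus e f) = Suc (cost e + cost f)"
| "cost (Lt e f) = Suc (cost e + cost f)"
| "cost (Eql e f) = Suc (cost e + cost f)"
| "cost (Conj e f) = Suc (cost e + cost f)"

definition update :: "('k \<Rightarrow> 'i \<Rightarrow> 'j \<Rightarrow> 'v) \<Rightarrow> 'k \<Rightarrow> 'i \<Rightarrow> 'j \<Rightarrow> 'v \<Rightarrow> 'k \<Rightarrow> 'i \<Rightarrow> 'j \<Rightarrow> 'v" where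
  "update A k i j v = A(k := (A k)(i := (A k i)(j := v)))"

inductive hexec :: "nat \<Rightarrow> cmd \<Rightarrow> hstate \<Rightarrow> nat \<Rightarrow> hstate \<Rightarrow> bool" for lo :: nat where
  Nop: "hexec lo Nop s 1 s"
| Assign: "hexec lo (Assign x e) (r, A, M) (Suc (cost e)) (r(x := val e r A), A, M)"
| Put: "hexec lo (Put k e f g) (r, A, M) (Suc (cost e + cost f + cost g))
    (r, update A k (val e r A) (val f r A) (val g r A), M)"
| ReadRaw: "val e r A < lo \<Longrightarrow>
    hexec lo (ReadRaw x e) (r, A, M) (Suc (cost e)) (r(x := M (val e r A)), A, M)"
| WriteRaw: "val e r A < lo \<Longrightarrow>
    hexec lo (WriteRaw e f) (r, A, M) (Suc (cost e + cost f)) (r, A, M(val e r A := val f r A))"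
| Then: "hexec lo c s t s' \<Longrightarrow> hexec lo d s' u s'' \<Longrightarrow> hexec lo (c ;; d) s (t + u) s''"
| CondTrue: "val b r A \<noteq> 0 \<Longrightarrow> hexec lo c (r, A, M) t s' \<Longrightarrow>
    hexec lo (Cond b c d) (r, A, M) (t + Suc (cost b)) s'"
| CondFalse: "val b r A = 0 \<Longrightarrow> hexec lo d (r, A, M) t s' \<Longrightarrow>
    hexec lo (Cond b c d) (r, A, M) (t + Suc (cost b)) s'"
| LoopFalse: "val b r A = 0 \<Longrightarrow> hexec lo (Loop b c) (r, A, M) (Suc (cost b)) (r, A, M)"
| LoopTrue: "val b r A \<noteq> 0 \<Longrightarrow> hexec lo c (r, A, M) t s' \<Longrightarrow> hexec lo (Loop b c) s' u s'' \<Longrightarrow>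
    hexec lo (Loop b c) (r, A, M) (t + u + Suc (cost b)) s''"

inductive_simps hexec_simps:
  "hexec lo Nop s t s'" "hexec lo (Assign x e) s t s'" "hexec lo (Put k e f g) s t s'"
  "hexec lo (ReadRaw x e) s t s'" "hexec lo (WriteRaw e f) s t s'" "hexec lo (c ;; d) s t s'"
  "hexec lo (Cond b c d) s t s'"

text \<open>A weakest precondition whose postcondition also sees the running time. Existence of a
  run is enough here, because the final claim is made for \<open>exec\<close>, which is
  deterministic.\<close>

definition runs :: "nat \<Rightarrow> cmd \<Rightarrow> hstate \<Rightarrow> (nat \<Rightarrow> hstate \<Rightarrow> bool) \<Rightarrow> bool" where
  "runs lo c s Q \<longleftrightarrow> (\<exists>t s'. hexec lo c s t s' \<and> Q t s')"

lemma runs_simps: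
  "runs lo Nop s Q \<longleftrightarrow> Q 1 s"
  "runs lo (Assign x e) (r, A, M) Q \<longleftrightarrow> Q (Suc (cost e)) (r(x := val e r A), A, M)"
  "runs lo (Put k e f g) (r, A, M) Q \<longleftrightarrow> Q (Suc (cost e + cost f + cost g))
     (r, update A k (val e r A) (val f r A) (val g r A), M)"
  "runs lo (ReadRaw x e) (r, A, M) Q \<longleftrightarrow>
     val e r A < lo \<and> Q (Suc (cost e)) (r(x := M (val e r A)), A, M)"
  "runs lo (WriteRaw e f) (r, A, M) Q \<longleftrightarrow>
     val e r A < lo \<and> Q (Suc (cost e + cost f)) (r, A, M(val e r A := val f r A))"
  "runs lo (c ;; d) s Q \<longleftrightarrow> runs lo c s (\<lambda>t s'. runs lo d s' (\<lambda>u. Q (t + u)))"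
  "runs lo (Cond b c d) (r, A, M) Q \<longleftrightarrow>
     (if val b r A \<noteq> 0 then runs lo c (r, A, M) (\<lambda>t. Q (t + Suc (cost b)))
      else runs lo d (r, A, M) (\<lambda>t. Q (t + Suc (cost b))))"
  unfolding runs_def
  by (simp_all add: hexec_simps) blast+

lemma runs_mono:
  assumes "runs lo c s Q" "\<And>t r A M. Q t (r, A, M) \<Longrightarrow> Q' t (r, A, M)"
  shows "runs lo c s Q'"
  using assms unfolding runs_def by (metis prod_cases3)

text \<open>Amortized analysis: every round, with its test, is paid for by a drop of
  \<open>\<Phi>\<close>. As the test alone costs a step, the drop is strict, so the same potential
  also proves termination.\<close>

lemma runs_loop:
  assumes init: "I r A M"
    and body: "\<And>r A M. I r A M \<Longrightarrow> val b r A \<noteq> 0 \<Longrightarrow>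
      runs lo c (r, A, M) (\<lambda>t (r', A', M'). I r' A' M' \<and> t + Suc (cost b) + \<Phi> r' A' \<le> \<Phi> r A)"
    and exit: "\<And>t r' A' M'. I r' A' M' \<Longrightarrow> val b r' A' = 0 \<Longrightarrow> t + \<Phi> r' A' \<le> \<Phi> r A + Suc (cost b) \<Longrightarrow> Q t (r', A', M')"
  shows "runs lo (Loop b c) (r, A, M) Q"
proof -
  have "\<exists>t r' A' M'. hexec lo (Loop b c) (r, A, M) t (r', A', M') \<and> I r' A' M' \<and> val b r' A' = 0 \<and>
      t + \<Phi> r' A' \<le> \<Phi> r A + Suc (cost b)"
    using init
  proof (induction "\<Phi> r A" arbitrary: r A M rule: less_induct)
    case less
    show ?case
    proof (cases "val b r A = 0")
      case True
      have "hexec lo (Loop b c) (r, A, M) (Suc (cost b)) (r, A, M)" by (rule hexec.LoopFalse[OF True])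
      then show ?thesis using less.prems True by (intro exI conjI) (assumption, auto)
    next
      case False
      from body[OF less.prems False] obtain t r1 A1 M1
        where 1: "hexec lo c (r, A, M) t (r1, A1, M1)" "I r1 A1 M1" "t + Suc (cost b) + \<Phi> r1 A1 \<le> \<Phi> r A"
        unfolding runs_def by auto
      then have "\<Phi> r1 A1 < \<Phi> r A" by simp
      from less.hyps[OF this 1(2)] obtain u r' A' M'
        where 2: "hexec lo (Loop b c) (r1, A1, M1) u (r', A', M')" "I r' A' M'" "val b r' A' = 0"
          "u + \<Phi> r' A' \<le> \<Phi> r1 A1 + Suc (cost b)" by blast
      have "hexec lo (Loop b c) (r, A, M) (t + u + Suc (cost b)) (r', A', M')"
        using hexec.LoopTrue[OF False 1(1) 2(1)] .
      moreover have "t + u + Suc (cost b) + \<Phi> r' A' \<le> \<Phi> r A + Suc (cost b)" using 1(3) 2(4) by simp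
      ultimately show ?thesis using 2 by blast
    qed
  qed
  then show ?thesis unfolding runs_def using exit by blast
qed

fun reg_writes :: "cmd \<Rightarrow> nat set" where
  "reg_writes (Assign x e) = {x}"
| "reg_writes (ReadRaw x e) = {x}"
| "reg_writes (c ;; d) = reg_writes c \<union> reg_writes d"
| "reg_writes (Cond b c d) = reg_writes c \<union> reg_writes d"
| "reg_writes (Loop b c) = reg_writes c"
| "reg_writes _ = {}"

fun arr_writes :: "cmd \<Rightarrow> nat set" where
  "arr_writes (Put k e f g) = {k}"
| "arr_writes (c ;; d) = arr_writes c \<union> arr_writes d"
| "arr_writes (Cond b c d) = arr_writes c \<union> arr_writes d"
| "arr_writes (Loop b c) = arr_writes c"
| "arr_writes _ = {}"

fun raw_writes :: "cmd \<Rightarrow> bool" where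
  "raw_writes (WriteRaw e f) = True"
| "raw_writes (c ;; d) \<longleftrightarrow> raw_writes c \<or> raw_writes d"
| "raw_writes (Cond b c d) \<longleftrightarrow> raw_writes c \<or> raw_writes d"
| "raw_writes (Loop b c) = raw_writes c"
| "raw_writes _ = False"

lemma hexec_frame:
  assumes "hexec lo c s t s'"
  shows "(\<forall>x. x \<notin> reg_writes c \<longrightarrow> fst s' x = fst s x) \<and>
    (\<forall>k. k \<notin> arr_writes c \<longrightarrow> fst (snd s') k = fst (snd s) k) \<and>
    (\<not> raw_writes c \<longrightarrow> snd (snd s') = snd (snd s))"
  using assms by induction (auto simp: update_def)

text \<open>Lets invariants and postconditions omit everything that a piece of code does not
  write.\<close>

lemma runs_frame:
  assumes "runs lo c (r, A, M) Q"
  shows "runs lo c (r, A, M) (\<lambda>t (r', A', M'). Q t (r', A', M') \<and>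
    (\<forall>x. x \<notin> reg_writes c \<longrightarrow> r' x = r x) \<and> (\<forall>k. k \<notin> arr_writes c \<longrightarrow> A' k = A k) \<and>
    (\<not> raw_writes c \<longrightarrow> M' = M))"
  using assms unfolding runs_def by (fastforce dest: hexec_frame)

subsection \<open>Compilation to the word RAM\<close>

abbreviation "limit_reg \<equiv> 64 :: nat"
abbreviation "temp_reg \<equiv> 65 :: nat"
abbreviation "num_arrays \<equiv> 16 :: nat"

text \<open>The pairing \<open>(i, j) \<mapsto> (i + j)\<^sup>2 + i\<close> is injective; the arrays are interleaved above the
  initial segment.\<close>

definition address :: "nat \<Rightarrow> nat \<Rightarrow> nat \<Rightarrow> nat \<Rightarrow> nat" where
  "address lo k i j = lo + (((i + j) * (i + j) + i) * num_arrays + k)"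

definition addr_code :: "nat \<Rightarrow> nat \<Rightarrow> com" where
  "addr_code k t = Seq (Add (t + 1) t (t + 1)) (Seq (Mult (t + 1) (t + 1) (t + 1)) (Seq (Add t (t + 1) t)
     (Seq (Const (t + 1) num_arrays) (Seq (Mult t t (t + 1)) (Seq (Const (t + 1) k)
     (Seq (Add t t (t + 1)) (Add t limit_reg t)))))))"

text \<open>Expressions are evaluated on a stack of registers growing upwards from \<open>t\<close>;
  registers below \<open>t\<close> are untouched. Register \<open>0\<close> always holds zero and
  serves as that constant in tests.\<close>

fun exp_code :: "exp \<Rightarrow> nat \<Rightarrow> com" where
  "exp_code (Lit k) t = Const t k"
| "exp_code (Var x) t = Copy t x"
| "exp_code (Arr k e f) t = Seq (exp_code e t) (Seq (exp_code f (t + 1)) (Seq (addr_code k t) (Load t t)))"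
| "exp_code (Incr e) t = Seq (exp_code e t) (Seq (Const (t + 1) 1) (Add t t (t + 1)))"
| "exp_code (Minus e f) t = Seq (exp_code e t) (Seq (exp_code f (t + 1)) (Sub t t (t + 1)))"
| "exp_code (Lt e f) t = Seq (exp_code e t) (Seq (exp_code f (t + 1))
     (If (Less t (t + 1)) (Const t 1) (Const t 0)))"
| "exp_code (Eql e f) t = Seq (exp_code e t) (Seq (exp_code f (t + 1))
     (If (Equal t (t + 1)) (Const t 1) (Const t 0)))"
| "exp_code (Conj e f) t = Seq (exp_code e t) (Seq (exp_code f (t + 1))
     (If (Equal t 0) (Const t 0) (If (Equal (t + 1) 0) (Const t 0) (Const t 1))))"

text \<open>The loop test is compiled twice, before the loop and at the end of its body, because
  \<open>While\<close> can only compare registers.\<close>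

fun code :: "cmd \<Rightarrow> com" where
  "code Nop = Skip"
| "code (Assign x e) = Seq (exp_code e temp_reg) (Copy x temp_reg)"
| "code (Put k e f g) = Seq (exp_code g temp_reg) (Seq (exp_code e (temp_reg + 1)) (Seq (exp_code f (temp_reg + 1 + 1))
     (Seq (addr_code k (temp_reg + 1)) (Store (temp_reg + 1) temp_reg))))"
| "code (ReadRaw x e) = Seq (exp_code e temp_reg) (Load x temp_reg)"
| "code (WriteRaw e f) = Seq (exp_code e temp_reg) (Seq (exp_code f (temp_reg + 1)) (Store temp_reg (temp_reg + 1)))"
| "code (c ;; d) = Seq (code c) (code d)"
| "code (Cond b c d) = Seq (exp_code b temp_reg) (If (Less 0 temp_reg) (code c) (code d))"
| "code (Loop b c) = Seq (exp_code b temp_reg)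
     (While (Less 0 temp_reg) (Seq (code c) (exp_code b temp_reg)))"

fun exp_ok :: "exp \<Rightarrow> bool" where
  "exp_ok (Lit k) \<longleftrightarrow> k < 64"
| "exp_ok (Var x) \<longleftrightarrow> x < 64"
| "exp_ok (Arr k e f) \<longleftrightarrow> k < num_arrays \<and> exp_ok e \<and> exp_ok f"
| "exp_ok (Incr e) \<longleftrightarrow> exp_ok e"
| "exp_ok (Minus e f) \<longleftrightarrow> exp_ok e \<and> exp_ok f"
| "exp_ok (Lt e f) \<longleftrightarrow> exp_ok e \<and> exp_ok f"
| "exp_ok (Eql e f) \<longleftrightarrow> exp_ok e \<and> exp_ok f"
| "exp_ok (Conj e f) \<longleftrightarrow> exp_ok e \<and> exp_ok f"

text \<open>Register \<open>0\<close> is no admissible target: compiled tests compare with it, and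
  at the end it is the output address, so that the output starts at cell zero.\<close>

fun cmd_ok :: "cmd \<Rightarrow> bool" where
  "cmd_ok Nop \<longleftrightarrow> True"
| "cmd_ok (Assign x e) \<longleftrightarrow> 0 < x \<and> x < 64 \<and> exp_ok e"
| "cmd_ok (Put k e f g) \<longleftrightarrow> k < num_arrays \<and> exp_ok e \<and> exp_ok f \<and> exp_ok g"
| "cmd_ok (ReadRaw x e) \<longleftrightarrow> 0 < x \<and> x < 64 \<and> exp_ok e"
| "cmd_ok (WriteRaw e f) \<longleftrightarrow> exp_ok e \<and> exp_ok f"
| "cmd_ok (c ;; d) \<longleftrightarrow> cmd_ok c \<and> cmd_ok d"
| "cmd_ok (Cond b c d) \<longleftrightarrow> exp_ok b \<and> cmd_ok c \<and> cmd_ok d"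
| "cmd_ok (Loop b c) \<longleftrightarrow> exp_ok b \<and> cmd_ok c"

definition refines :: "nat \<Rightarrow> hstate \<Rightarrow> state \<Rightarrow> bool" where
  "refines lo s \<sigma> \<longleftrightarrow> (\<forall>x<64. fst \<sigma> x = fst s x) \<and> fst s 0 = 0 \<and> fst \<sigma> limit_reg = lo \<and>
     (\<forall>i<lo. snd \<sigma> i = snd (snd s) i) \<and>
     (\<forall>k<num_arrays. \<forall>i j. snd \<sigma> (address lo k i j) = fst (snd s) k i j)"

definition bounded_by :: "nat \<Rightarrow> hstate \<Rightarrow> bool" where
  "bounded_by v s \<longleftrightarrow> (\<forall>x. fst s x \<le> v) \<and> (\<forall>k i j. fst (snd s) k i j \<le> v) \<and> (\<forall>i. snd (snd s) i \<le> v)"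

text \<open>Only \<open>Incr\<close> raises a value, by one for one unit of cost; literals and truth
  values stay below \<open>64\<close>.\<close>

lemma val_bound:
  assumes "bounded_by v (r, A, M)" "exp_ok e" "64 \<le> v"
  shows "val e r A \<le> v + cost e"
  using assms(2)
proof (induction e)
  case (Arr k e f)
  have "A k (val e r A) (val f r A) \<le> v" using assms(1) by (simp add: bounded_by_def)
  then show ?case by simp
next
  case (Var x)
  have "r x \<le> v" using assms(1) by (simp add: bounded_by_def)
  then show ?case by simp
qed (use assms(3) in auto)

text \<open>For \<open>s = i + j\<close> the paired value lies between \<open>s * s\<close> and the
  next square, because \<open>i \<le> s\<close>. This determines \<open>s\<close>, then
  \<open>i\<close>, then \<open>j\<close>.\<close>

lemma pairing_inj:
  assumes "(i + j) * (i + j) + i = (i' + j') * (i' + j') + (i' :: nat)"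
  shows "i = i' \<and> j = j'"
proof -
  have lt: "s * s + i < s' * s' + i'" if "s < s'" "i \<le> s" for s s' i i' :: nat
  proof -
    have "s * s + i < Suc s * Suc s" using that by simp
    also have "\<dots> \<le> s' * s'" using that by (intro mult_le_mono) auto
    finally show ?thesis by simp
  qed
  have "i + j = i' + j'"
    using lt[of "i + j" "i' + j'" i i'] lt[of "i' + j'" "i + j" i' i] assms by (metis le_add1 linorder_neqE_nat less_irrefl_nat)
  then show ?thesis using assms by auto
qed

lemma address_inj:
  assumes "k < num_arrays" "k' < num_arrays" "address lo k i j = address lo k' i' j'"
  shows "k = k' \<and> i = i' \<and> j = j'"
proof -
  let ?p = "(i + j) * (i + j) + i" and ?q = "(i' + j') * (i' + j') + i'"
  have e: "?p * num_arrays + k = ?q * num_arrays + k'"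
    using assms(3) unfolding address_def by linarith
  have "(?p * num_arrays + k) div num_arrays = ?p" "(?q * num_arrays + k') div num_arrays = ?q"
    using assms by simp_all
  then have "?p = ?q" using e by metis
  then show ?thesis using pairing_inj[of i j i' j'] e by simp
qed

lemma exec_Seq_Ex:
  assumes "\<exists>u \<sigma>'. exec W c \<sigma> u \<sigma>' \<and> u \<le> n \<and> P \<sigma>'"
    and "\<And>\<sigma>'. P \<sigma>' \<Longrightarrow> \<exists>u \<sigma>''. exec W d \<sigma>' u \<sigma>'' \<and> u \<le> k \<and> R \<sigma>''"
  shows "\<exists>u \<sigma>'. exec W (Seq c d) \<sigma> u \<sigma>' \<and> u \<le> n + k \<and> R \<sigma>'"
proof -
  obtain u \<sigma>' where 1: "exec W c \<sigma> u \<sigma>'" "u \<le> n" "P \<sigma>'" using assms(1) by blast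
  obtain v \<sigma>'' where 2: "exec W d \<sigma>' v \<sigma>''" "v \<le> k" "R \<sigma>''" using assms(2)[OF 1(3)] by blast
  show ?thesis using exec.Seq[OF 1(1) 2(1)] 1 2 by (meson add_mono)
qed

text \<open>The bound on \<open>W\<close> dominates every intermediate value: \<open>i + j\<close>
  is at most \<open>2 * z\<close>, so the pairing is at most \<open>4 * z * z + z\<close>.\<close>

lemma exec_addr_code:
  assumes "r t = i" "r (t + 1) = j" "r limit_reg = lo" "limit_reg < t" "k < num_arrays"
    and i: "i \<le> z" and j: "j \<le> z" and W: "lo + (4 * z * z + z + 1) * num_arrays < W"
  shows "\<exists>u \<sigma>'. exec W (addr_code k t) (r, m) u \<sigma>' \<and> u \<le> 8 \<and>
    (fst \<sigma>' t = address lo k i j \<and> snd \<sigma>' = m \<and> (\<forall>x<t. fst \<sigma>' x = r x))"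
proof -
  define a where "a = (i + j) * (i + j)"
  have "i + j \<le> 2 * z" using i j by simp
  then have "a \<le> (2 * z) * (2 * z)" unfolding a_def by (rule mult_le_mono) fact
  then have a: "a + i \<le> 4 * z * z + z" using i by simp
  define y where "y = 4 * z * z + z"
  have zz: "i + j \<le> y"
  proof (cases "z = 0")
    case False
    then have "z \<le> 4 * z * z" by simp
    then show ?thesis using i j unfolding y_def by linarith
  qed (use i j in simp)
  have y: "a + i \<le> y" "lo + (y + 1) * num_arrays < W" using a W by (simp_all add: y_def)
  have s1: "i + j < W" "num_arrays < W" "k < W" using zz y assms(5) by simp_all
  have s2: "a < W" "a + i < W" using y by simp_all
  have "(a + i) * num_arrays \<le> y * num_arrays" using y(1) by simp
  then have s3: "(a + i) * num_arrays < W" "(a + i) * num_arrays + k < W" "lo + ((a + i) * num_arrays + k) < W"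
    using y(2) assms(5) by simp_all
  let ?r1 = "r(t + 1 := i + j)" let ?r2 = "?r1(t + 1 := a)" let ?r3 = "?r2(t := a + i)"
  let ?r4 = "?r3(t + 1 := num_arrays)" let ?r5 = "?r4(t := (a + i) * num_arrays)"
  let ?r6 = "?r5(t + 1 := k)" let ?r7 = "?r6(t := (a + i) * num_arrays + k)"
  let ?r8 = "?r7(t := lo + ((a + i) * num_arrays + k))"
  have e1: "exec W (Add (t + 1) t (t + 1)) (r, m) 1 (?r1, m)"
    using exec.Add[of r t "t + 1" W "t + 1" m] assms(1,2) s1 by simp
  have e2: "exec W (Mult (t + 1) (t + 1) (t + 1)) (?r1, m) 1 (?r2, m)"
    using exec.Mult[of ?r1 "t + 1" "t + 1" W "t + 1" m] s2 by (simp add: a_def)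
  have e3: "exec W (Add t (t + 1) t) (?r2, m) 1 (?r3, m)"
    using exec.Add[of ?r2 "t + 1" t W t m] assms(1) s2 by simp
  have e4: "exec W (Const (t + 1) num_arrays) (?r3, m) 1 (?r4, m)"
    using exec.Const[of num_arrays W "t + 1" ?r3 m] s1 by simp
  have e5: "exec W (Mult t t (t + 1)) (?r4, m) 1 (?r5, m)"
    using exec.Mult[of ?r4 t "t + 1" W t m] s3 by simp
  have e6: "exec W (Const (t + 1) k) (?r5, m) 1 (?r6, m)"
    using exec.Const[of k W "t + 1" ?r5 m] s1 by simp
  have e7: "exec W (Add t t (t + 1)) (?r6, m) 1 (?r7, m)"
    using exec.Add[of ?r6 t "t + 1" W t m] s3 by simp
  have e8: "exec W (Add t limit_reg t) (?r7, m) 1 (?r8, m)"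
    using exec.Add[of ?r7 limit_reg t W t m] s3 assms(3,4) by simp
  have "exec W (addr_code k t) (r, m) (1 + (1 + (1 + (1 + (1 + (1 + (1 + 1))))))) (?r8, m)"
    unfolding addr_code_def by (intro exec.Seq) (rule e1 e2 e3 e4 e5 e6 e7 e8)+
  moreover have "?r8 t = address lo k i j" by (simp add: address_def a_def)
  ultimately show ?thesis by (intro exI[of _ "1 + (1 + (1 + (1 + (1 + (1 + (1 + 1))))))"] exI[of _ "(?r8, m)"]) simp
qed

text \<open>The factor \<open>11\<close> leaves room for the most expensive node: an array access
  adds eight instructions for the address and one \<open>Load\<close>.\<close>

lemma exec_exp_code:
  assumes "refines lo (r, A, M) (\<rho>, m)" and v: "bounded_by v (r, A, M)" "64 \<le> v"
    and "exp_ok e" and "v + cost e \<le> z" and W: "lo + (4 * z * z + z + 1) * num_arrays < W"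
    and "limit_reg < t"
  shows "\<exists>u \<sigma>'. exec W (exp_code e t) (\<rho>, m) u \<sigma>' \<and> u \<le> 11 * cost e \<and>
    (fst \<sigma>' t = val e r A \<and> snd \<sigma>' = m \<and> (\<forall>x<t. fst \<sigma>' x = \<rho> x))"
proof -
  define y where "y = 4 * z * z"
  have "lo + (y + z + 1) * num_arrays < W" "64 \<le> z" using W assms(3,5) by (simp_all add: y_def)
  then have W2: "64 < W" "Suc z < W" by simp_all
  show ?thesis
  using assms(1,4,5,7)
proof (induction e arbitrary: t \<rho>)
  case (Lit k)
  then have "exec W (Const t k) (\<rho>, m) 1 (\<rho>(t := k), m)" using W2 by (intro exec.Const) simp
  then show ?case by (intro exI[of _ 1] exI conjI) auto
next
  case (Var x)
  have "exec W (Copy t x) (\<rho>, m) 1 (\<rho>(t := \<rho> x), m)" by (rule exec.Copy)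
  then show ?case using Var by (intro exI[of _ 1] exI conjI) (auto simp: refines_def)
next
  case (Incr e)
  have b: "val e r A \<le> v + cost e" using val_bound[OF v(1) _ v(2)] Incr.prems by simp
  have "\<exists>u \<sigma>'. exec W (exp_code (Incr e) t) (\<rho>, m) u \<sigma>' \<and> u \<le> 11 * cost e + 2 \<and>
      (fst \<sigma>' t = Suc (val e r A) \<and> snd \<sigma>' = m \<and> (\<forall>x<t. fst \<sigma>' x = \<rho> x))"
    unfolding exp_code.simps
  proof (rule exec_Seq_Ex)
    show "\<exists>u \<sigma>'. exec W (exp_code e t) (\<rho>, m) u \<sigma>' \<and> u \<le> 11 * cost e \<and>
      (fst \<sigma>' t = val e r A \<and> snd \<sigma>' = m \<and> (\<forall>x<t. fst \<sigma>' x = \<rho> x))"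
      using Incr by simp
  next
    fix \<sigma>' assume H: "fst \<sigma>' t = val e r A \<and> snd \<sigma>' = m \<and> (\<forall>x<t. fst \<sigma>' x = \<rho> x)"
    obtain r1 where s: "\<sigma>' = (r1, m)" using H by (metis prod.collapse)
    have w: "1 < W" "val e r A + 1 < W" using W2 b Incr.prems by auto
    have "exec W (Const (t + 1) 1) (r1, m) 1 (r1(t + 1 := 1), m)" by (rule exec.Const[OF w(1)])
    moreover have "exec W (Add t t (t + 1)) (r1(t + 1 := 1), m) 1
        ((r1(t + 1 := 1))(t := (r1(t + 1 := 1)) t + (r1(t + 1 := 1)) (t + 1)), m)"
      by (rule exec.Add) (use w H s in simp)
    ultimately have "exec W (Seq (Const (t + 1) 1) (Add t t (t + 1))) (r1, m) (1 + 1)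
        ((r1(t + 1 := 1))(t := (r1(t + 1 := 1)) t + (r1(t + 1 := 1)) (t + 1)), m)"
      by (rule exec.Seq)
    then show "\<exists>u \<sigma>''. exec W (Seq (Const (t + 1) 1) (Add t t (t + 1))) \<sigma>' u \<sigma>'' \<and> u \<le> 2 \<and>
      (fst \<sigma>'' t = Suc (val e r A) \<and> snd \<sigma>'' = m \<and> (\<forall>x<t. fst \<sigma>'' x = \<rho> x))"
      unfolding s using H s by (intro exI[of _ "1 + 1"] exI conjI) auto
  qed
  then obtain u \<sigma>' where "exec W (exp_code (Incr e) t) (\<rho>, m) u \<sigma>'" "u \<le> 11 * cost e + 2"
      "fst \<sigma>' t = Suc (val e r A) \<and> snd \<sigma>' = m \<and> (\<forall>x<t. fst \<sigma>' x = \<rho> x)" by blast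
  then show ?case by (intro exI conjI) (assumption, auto)
next
  case (Arr k e f)
  have "\<exists>u \<sigma>'. exec W (exp_code (Arr k e f) t) (\<rho>, m) u \<sigma>' \<and> u \<le> 11 * cost e + (11 * cost f + (8 + 1)) \<and>
      (fst \<sigma>' t = A k (val e r A) (val f r A) \<and> snd \<sigma>' = m \<and> (\<forall>x<t. fst \<sigma>' x = \<rho> x))"
    unfolding exp_code.simps
  proof (rule exec_Seq_Ex)
    show "\<exists>u \<sigma>'. exec W (exp_code e t) (\<rho>, m) u \<sigma>' \<and> u \<le> 11 * cost e \<and>
      (fst \<sigma>' t = val e r A \<and> snd \<sigma>' = m \<and> (\<forall>x<t. fst \<sigma>' x = \<rho> x))"
      using Arr by simp
  next
    fix \<sigma>' assume H: "fst \<sigma>' t = val e r A \<and> snd \<sigma>' = m \<and> (\<forall>x<t. fst \<sigma>' x = \<rho> x)"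
    obtain r1 where s: "\<sigma>' = (r1, m)" using H by (metis prod.collapse)
    have ref: "refines lo (r, A, M) (r1, m)" using Arr.prems H s by (auto simp: refines_def)
    show "\<exists>u \<sigma>''. exec W (Seq (exp_code f (t + 1)) (Seq (addr_code k t) (Load t t))) \<sigma>' u \<sigma>'' \<and>
        u \<le> 11 * cost f + (8 + 1) \<and>
        (fst \<sigma>'' t = A k (val e r A) (val f r A) \<and> snd \<sigma>'' = m \<and> (\<forall>x<t. fst \<sigma>'' x = \<rho> x))"
    proof (rule exec_Seq_Ex)
      show "\<exists>u \<sigma>''. exec W (exp_code f (t + 1)) \<sigma>' u \<sigma>'' \<and> u \<le> 11 * cost f \<and>
        (fst \<sigma>'' (t + 1) = val f r A \<and> snd \<sigma>'' = m \<and> (\<forall>x<t + 1. fst \<sigma>'' x = r1 x))"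
        using Arr.IH(2)[OF ref] Arr.prems s by auto
    next
      fix \<sigma>'' assume H2: "fst \<sigma>'' (t + 1) = val f r A \<and> snd \<sigma>'' = m \<and> (\<forall>x<t + 1. fst \<sigma>'' x = r1 x)"
      obtain r2 where s2: "\<sigma>'' = (r2, m)" using H2 by (metis prod.collapse)
      have b: "val e r A \<le> z" "val f r A \<le> z"
        using val_bound[OF v(1) _ v(2), of e] val_bound[OF v(1) _ v(2), of f] Arr.prems by auto
      show "\<exists>u \<sigma>'. exec W (Seq (addr_code k t) (Load t t)) \<sigma>'' u \<sigma>' \<and> u \<le> 8 + 1 \<and>
        (fst \<sigma>' t = A k (val e r A) (val f r A) \<and> snd \<sigma>' = m \<and> (\<forall>x<t. fst \<sigma>' x = \<rho> x))"
      proof (rule exec_Seq_Ex)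
        show "\<exists>u \<sigma>'. exec W (addr_code k t) \<sigma>'' u \<sigma>' \<and> u \<le> 8 \<and>
          (fst \<sigma>' t = address lo k (val e r A) (val f r A) \<and> snd \<sigma>' = m \<and> (\<forall>x<t. fst \<sigma>' x = r2 x))"
          unfolding s2
        proof (rule exec_addr_code[OF _ _ _ _ _ b W])
          show "r2 t = val e r A" "r2 (t + 1) = val f r A" using H H2 s s2 by auto
          show "r2 limit_reg = lo" using H2 s2 ref Arr.prems by (auto simp: refines_def)
        qed (use Arr.prems in auto)
      next
        fix \<sigma>3 assume H3: "fst \<sigma>3 t = address lo k (val e r A) (val f r A) \<and> snd \<sigma>3 = m \<and> (\<forall>x<t. fst \<sigma>3 x = r2 x)"
        obtain r3 where s3: "\<sigma>3 = (r3, m)" using H3 by (metis prod.collapse)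
        have "exec W (Load t t) (r3, m) 1 (r3(t := m (r3 t)), m)" by (rule exec.Load)
        then show "\<exists>u \<sigma>'. exec W (Load t t) \<sigma>3 u \<sigma>' \<and> u \<le> 1 \<and>
          (fst \<sigma>' t = A k (val e r A) (val f r A) \<and> snd \<sigma>' = m \<and> (\<forall>x<t. fst \<sigma>' x = \<rho> x))"
          unfolding s3 using H H2 H3 s s2 s3 Arr.prems by (intro exI[of _ 1] exI conjI) (auto simp: refines_def)
      qed
    qed
  qed
  then obtain u \<sigma>' where "exec W (exp_code (Arr k e f) t) (\<rho>, m) u \<sigma>'" "u \<le> 11 * cost e + (11 * cost f + (8 + 1))"
      "fst \<sigma>' t = A k (val e r A) (val f r A) \<and> snd \<sigma>' = m \<and> (\<forall>x<t. fst \<sigma>' x = \<rho> x)" by blast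
  then show ?case by (intro exI conjI) (assumption, auto)
next
  \<comment> \<open>The binary operators differ only in how the two evaluated arguments are
    combined, within at most four steps and using that register \<open>0\<close> is zero.\<close>
  have bin: "\<exists>u \<sigma>'. exec W (Seq (exp_code e t) (Seq (exp_code f (t + 1)) c)) (\<rho>, m) u \<sigma>' \<and> u \<le> 11 * Suc (cost e + cost f) \<and>
      (fst \<sigma>' t = x \<and> snd \<sigma>' = m \<and> (\<forall>x<t. fst \<sigma>' x = \<rho> x))"
    if IH1: "\<exists>u \<sigma>'. exec W (exp_code e t) (\<rho>, m) u \<sigma>' \<and> u \<le> 11 * cost e \<and>
      (fst \<sigma>' t = val e r A \<and> snd \<sigma>' = m \<and> (\<forall>x<t. fst \<sigma>' x = \<rho> x))"
    and IH2: "\<And>\<rho>. refines lo (r, A, M) (\<rho>, m) \<Longrightarrow> \<exists>u \<sigma>'. exec W (exp_code f (t + 1)) (\<rho>, m) u \<sigma>' \<and> u \<le> 11 * cost f \<and>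
      (fst \<sigma>' (t + 1) = val f r A \<and> snd \<sigma>' = m \<and> (\<forall>x<t + 1. fst \<sigma>' x = \<rho> x))"
    and c: "\<And>r2. r2 t = val e r A \<Longrightarrow> r2 (t + 1) = val f r A \<Longrightarrow> r2 0 = 0 \<Longrightarrow> \<exists>u. exec W c (r2, m) u (r2(t := x), m) \<and> u \<le> 4"
    and ref: "refines lo (r, A, M) (\<rho>, m)" and t: "limit_reg < t"
    for e f t \<rho> c x
  proof -
    obtain u r1 where 1: "exec W (exp_code e t) (\<rho>, m) u (r1, m)" "u \<le> 11 * cost e"
      "r1 t = val e r A" "\<forall>x<t. r1 x = \<rho> x" using IH1 by (metis prod.collapse)
    have "refines lo (r, A, M) (r1, m)" using ref 1 t by (auto simp: refines_def)
    then obtain w r2 where 2: "exec W (exp_code f (t + 1)) (r1, m) w (r2, m)" "w \<le> 11 * cost f"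
      "r2 (t + 1) = val f r A" "\<forall>x<t + 1. r2 x = r1 x" using IH2 by (metis prod.collapse)
    have "r2 0 = 0" "r2 t = val e r A" using 1 2 t ref by (auto simp: refines_def)
    then obtain y where 3: "exec W c (r2, m) y (r2(t := x), m)" "y \<le> 4" using c 2 by blast
    show ?thesis
      using exec.Seq[OF 1(1) exec.Seq[OF 2(1) 3(1)]] 1 2 3
      by (intro exI conjI) (assumption, auto)
  qed
  have W1: "0 < W" "1 < W" using W2 by auto
  {
    case (Minus e f)
    have *: "\<exists>u. exec W (Sub t t (t + 1)) (r2, m) u (r2(t := val (Minus e f) r A), m) \<and> u \<le> 4"
      if "r2 t = val e r A" "r2 (t + 1) = val f r A" "r2 0 = 0" for r2
      using exec.Sub[of W t t "t + 1" r2 m] that by (intro exI[of _ 1]) simp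
    show ?case unfolding exp_code.simps cost.simps
      by (rule bin) (use Minus * in auto)
  next
    case (Lt e f)
    have *: "\<exists>u. exec W (If (Less t (t + 1)) (Const t 1) (Const t 0)) (r2, m) u (r2(t := val (Lt e f) r A), m) \<and> u \<le> 4"
      if "r2 t = val e r A" "r2 (t + 1) = val f r A" "r2 0 = 0" for r2
    proof (cases "val e r A < val f r A")
      case True
      then have "exec W (If (Less t (t + 1)) (Const t 1) (Const t 0)) (r2, m) (Suc 1) (r2(t := 1), m)"
        by (intro exec.IfTrue exec.Const) (use that W1 in auto)
      then show ?thesis using True by (intro exI[of _ "Suc 1"]) auto
    next
      case False
      then have "exec W (If (Less t (t + 1)) (Const t 1) (Const t 0)) (r2, m) (Suc 1) (r2(t := 0), m)"
        by (intro exec.IfFalse exec.Const) (use that W1 in auto)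
      then show ?thesis using False by (intro exI[of _ "Suc 1"]) auto
    qed
    show ?case unfolding exp_code.simps cost.simps
      by (rule bin) (use Lt * in auto)
  next
    case (Eql e f)
    have *: "\<exists>u. exec W (If (Equal t (t + 1)) (Const t 1) (Const t 0)) (r2, m) u (r2(t := val (Eql e f) r A), m) \<and> u \<le> 4"
      if "r2 t = val e r A" "r2 (t + 1) = val f r A" "r2 0 = 0" for r2
    proof (cases "val e r A = val f r A")
      case True
      then have "exec W (If (Equal t (t + 1)) (Const t 1) (Const t 0)) (r2, m) (Suc 1) (r2(t := 1), m)"
        by (intro exec.IfTrue exec.Const) (use that W1 in auto)
      then show ?thesis using True by (intro exI[of _ "Suc 1"]) auto
    next
      case False
      then have "exec W (If (Equal t (t + 1)) (Const t 1) (Const t 0)) (r2, m) (Suc 1) (r2(t := 0), m)"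
        by (intro exec.IfFalse exec.Const) (use that W1 in auto)
      then show ?thesis using False by (intro exI[of _ "Suc 1"]) auto
    qed
    show ?case unfolding exp_code.simps cost.simps
      by (rule bin) (use Eql * in auto)
  next
    case (Conj e f)
    have *: "\<exists>u. exec W (If (Equal t 0) (Const t 0) (If (Equal (t + 1) 0) (Const t 0) (Const t 1))) (r2, m) u
        (r2(t := val (Conj e f) r A), m) \<and> u \<le> 4"
      if "r2 t = val e r A" "r2 (t + 1) = val f r A" "r2 0 = 0" for r2
    proof (cases "val e r A = 0")
      case True
      then have "exec W (If (Equal t 0) (Const t 0) (If (Equal (t + 1) 0) (Const t 0) (Const t 1))) (r2, m) (Suc 1) (r2(t := 0), m)"
        by (intro exec.IfTrue exec.Const) (use that W1 in auto)
      then show ?thesis using True by (intro exI[of _ "Suc 1"]) auto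
    next
      case ne: False
      show ?thesis
      proof (cases "val f r A = 0")
        case True
        have "exec W (If (Equal t 0) (Const t 0) (If (Equal (t + 1) 0) (Const t 0) (Const t 1))) (r2, m) (Suc (Suc 1)) (r2(t := 0), m)"
          by (rule exec.IfFalse, use that ne in simp, rule exec.IfTrue, use that True in simp, rule exec.Const, rule W1)
        then show ?thesis using True by (intro exI[of _ "Suc (Suc 1)"]) auto
      next
        case False
        have "exec W (If (Equal t 0) (Const t 0) (If (Equal (t + 1) 0) (Const t 0) (Const t 1))) (r2, m) (Suc (Suc 1)) (r2(t := 1), m)"
          by (rule exec.IfFalse, use that ne in simp, rule exec.IfFalse, use that False in simp, rule exec.Const, rule W1)
        then show ?thesis using False ne by (intro exI[of _ "Suc (Suc 1)"]) auto
      qed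
    qed
    show ?case unfolding exp_code.simps cost.simps
      by (rule bin) (use Conj * in auto)
  }
qed
qed

lemma exec_exp_codeE:
  assumes "refines lo (r, A, M) (\<rho>, m)" and v: "bounded_by v (r, A, M)" "64 \<le> v"
    and "exp_ok e" and "v + cost e \<le> z" and W: "lo + (4 * z * z + z + 1) * num_arrays < W"
    and t: "limit_reg < t"
  obtains u \<rho>' where "exec W (exp_code e t) (\<rho>, m) u (\<rho>', m)" "u \<le> 11 * cost e"
    "\<rho>' t = val e r A" "\<And>x. x < t \<Longrightarrow> \<rho>' x = \<rho> x" "refines lo (r, A, M) (\<rho>', m)"
proof -
  obtain u \<rho>' where 1: "exec W (exp_code e t) (\<rho>, m) u (\<rho>', m)" "u \<le> 11 * cost e"
    "\<rho>' t = val e r A" "\<forall>x<t. \<rho>' x = \<rho> x"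
    using exec_exp_code[OF assms] by (metis prod.collapse)
  moreover have "refines lo (r, A, M) (\<rho>', m)" using assms(1) 1(4) t by (auto simp: refines_def)
  ultimately show thesis using that by blast
qed

lemma exec_assign_from_temp:
  assumes "refines lo (r, A, M) (\<rho>, m)" "0 < x" "x < 64" "w = v"
  shows "refines lo (r(x := v), A, M) (\<rho>(x := w), m)"
  using assms by (auto simp: refines_def)

lemma bounded_by_mono: "bounded_by v s \<Longrightarrow> v \<le> v' \<Longrightarrow> bounded_by v' s"
  unfolding bounded_by_def by (meson order_trans)

text \<open>Size and time are proved together: after \<open>t\<close> steps no value exceeds
  \<open>v + t\<close>, which bounds all addresses and so keeps the compiled program below
  \<open>W\<close>.\<close>

theorem exec_code:
  assumes "hexec lo c s t s'" "cmd_ok c" "refines lo s \<sigma>" "bounded_by v s" "64 \<le> v" "v + t \<le> z"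
    and W: "lo + (4 * z * z + z + 1) * num_arrays < W"
  shows "bounded_by (v + t) s' \<and> (\<exists>u \<sigma>'. exec W (code c) \<sigma> u \<sigma>' \<and> u \<le> 20 * t \<and> refines lo s' \<sigma>')"
  using assms(1-6)
proof (induction arbitrary: \<sigma> v)
  case (Nop s)
  have "exec W Skip \<sigma> 1 \<sigma>" by (rule exec.Skip)
  moreover have "bounded_by (v + 1) s" using Nop bounded_by_mono[of v s "v + 1"] by simp
  moreover have "(1::nat) \<le> 20 * 1" by simp
  ultimately show ?case using Nop.prems unfolding code.simps by blast
next
  case (Assign x e r A M)
  obtain \<rho> m where s: "\<sigma> = (\<rho>, m)" by (cases \<sigma>)
  have ok: "exp_ok e" "0 < x" "x < 64" using Assign.prems by auto
  obtain u \<rho>' where 1: "exec W (exp_code e temp_reg) (\<rho>, m) u (\<rho>', m)" "u \<le> 11 * cost e"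
    "\<rho>' temp_reg = val e r A" "refines lo (r, A, M) (\<rho>', m)"
    by (rule exec_exp_codeE[of lo r A M \<rho> m v e z W temp_reg]) (use Assign.prems s W ok in auto)
  have "exec W (code (Assign x e)) \<sigma> (u + 1) (\<rho>'(x := \<rho>' temp_reg), m)"
    unfolding code.simps s by (rule exec.Seq[OF 1(1) exec.Copy])
  moreover have "refines lo (r(x := val e r A), A, M) (\<rho>'(x := \<rho>' temp_reg), m)"
    using exec_assign_from_temp[OF 1(4) ok(2,3) 1(3)] .
  moreover have "bounded_by (v + Suc (cost e)) (r(x := val e r A), A, M)"
    using bounded_by_mono[OF Assign.prems(3), of "v + Suc (cost e)"] val_bound[OF Assign.prems(3) ok(1) Assign.prems(4)]
    by (auto simp: bounded_by_def intro: le_SucI)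
  moreover have "u + 1 \<le> 20 * Suc (cost e)" using 1(2) by simp
  ultimately show ?case by blast
next
  case (Put k e f g r A M)
  obtain \<rho> m where s: "\<sigma> = (\<rho>, m)" by (cases \<sigma>)
  have ok: "exp_ok e" "exp_ok f" "exp_ok g" "k < num_arrays" using Put.prems by auto
  have b: "val e r A \<le> v + cost e" "val f r A \<le> v + cost f" "val g r A \<le> v + cost g"
    using val_bound[OF Put.prems(3) _ Put.prems(4)] ok by auto
  obtain u1 \<rho>1 where 1: "exec W (exp_code g temp_reg) (\<rho>, m) u1 (\<rho>1, m)" "u1 \<le> 11 * cost g"
    "\<rho>1 temp_reg = val g r A" "refines lo (r, A, M) (\<rho>1, m)"
    by (rule exec_exp_codeE[of lo r A M \<rho> m v g z W temp_reg]) (use Put.prems s W ok in auto)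
  obtain u2 \<rho>2 where 2: "exec W (exp_code e (temp_reg + 1)) (\<rho>1, m) u2 (\<rho>2, m)" "u2 \<le> 11 * cost e"
    "\<rho>2 (temp_reg + 1) = val e r A" "\<And>x. x < temp_reg + 1 \<Longrightarrow> \<rho>2 x = \<rho>1 x" "refines lo (r, A, M) (\<rho>2, m)"
    by (rule exec_exp_codeE[of lo r A M \<rho>1 m v e z W "temp_reg + 1"]) (use Put.prems 1 W ok in auto)
  obtain u3 \<rho>3 where 3: "exec W (exp_code f (temp_reg + 1 + 1)) (\<rho>2, m) u3 (\<rho>3, m)" "u3 \<le> 11 * cost f"
    "\<rho>3 (temp_reg + 1 + 1) = val f r A" "\<And>x. x < temp_reg + 1 + 1 \<Longrightarrow> \<rho>3 x = \<rho>2 x" "refines lo (r, A, M) (\<rho>3, m)"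
    by (rule exec_exp_codeE[of lo r A M \<rho>2 m v f z W "temp_reg + 1 + 1"]) (use Put.prems 2 W ok in auto)
  have "\<exists>u \<sigma>'. exec W (addr_code k (temp_reg + 1)) (\<rho>3, m) u \<sigma>' \<and> u \<le> 8 \<and>
    (fst \<sigma>' (temp_reg + 1) = address lo k (val e r A) (val f r A) \<and> snd \<sigma>' = m \<and> (\<forall>x<temp_reg + 1. fst \<sigma>' x = \<rho>3 x))"
  proof (rule exec_addr_code[OF _ _ _ _ ok(4) _ _ W])
    show "\<rho>3 (temp_reg + 1) = val e r A" using 2(3) 3(4)[of "temp_reg + 1"] by simp
    show "\<rho>3 (temp_reg + 1 + 1) = val f r A" using 3(3) .
    show "\<rho>3 limit_reg = lo" using 3(5) by (simp add: refines_def)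
    show "val e r A \<le> z" "val f r A \<le> z" using b Put.prems by auto
  qed simp
  then obtain u4 \<rho>4 where 4: "exec W (addr_code k (temp_reg + 1)) (\<rho>3, m) u4 (\<rho>4, m)" "u4 \<le> 8"
    "\<rho>4 (temp_reg + 1) = address lo k (val e r A) (val f r A)" "\<forall>x<temp_reg + 1. \<rho>4 x = \<rho>3 x"
    by (metis prod.collapse)
  let ?a = "address lo k (val e r A) (val f r A)"
  let ?m = "m(\<rho>4 (temp_reg + 1) := \<rho>4 temp_reg)"
  have g: "\<rho>4 temp_reg = val g r A" using 1(3) 2(4)[of temp_reg] 3(4)[of temp_reg] 4(4) by simp
  have ex: "exec W (code (Put k e f g)) \<sigma> (u1 + (u2 + (u3 + (u4 + 1)))) (\<rho>4, ?m)"
    unfolding code.simps s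
    by (rule exec.Seq[OF 1(1) exec.Seq[OF 2(1) exec.Seq[OF 3(1) exec.Seq[OF 4(1) exec.Store]]]])
  have mem: "?m (address lo k' i j) = update A k (val e r A) (val f r A) (val g r A) k' i j" if "k' < num_arrays" for k' i j
    using address_inj[OF that ok(4), of lo i j "val e r A" "val f r A"] g 4(3) 3(5) that
    by (auto simp: update_def refines_def)
  have low: "?m i = M i" if "i < lo" for i
  proof -
    have "i \<noteq> ?a" using that by (simp add: address_def)
    then show ?thesis using that 3(5) 4(3) by (simp add: refines_def)
  qed
  have ref: "refines lo (r, update A k (val e r A) (val f r A) (val g r A), M) (\<rho>4, ?m)"
    using 3(5) 4(4) mem low unfolding refines_def by simp
  have "v + cost g \<le> v + Suc (cost e + cost f + cost g)" by simp
  then have bd: "bounded_by (v + Suc (cost e + cost f + cost g)) (r, update A k (val e r A) (val f r A) (val g r A), M)"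
    using bounded_by_mono[OF Put.prems(3), of "v + Suc (cost e + cost f + cost g)"] b(3)
    unfolding bounded_by_def update_def by auto
  have "u1 + (u2 + (u3 + (u4 + 1))) \<le> 20 * Suc (cost e + cost f + cost g)" using 1 2 3 4 by simp
  then show ?case using bd ex ref by blast
next
  case (ReadRaw e r A x M)
  obtain \<rho> m where s: "\<sigma> = (\<rho>, m)" by (cases \<sigma>)
  have ok: "exp_ok e" "0 < x" "x < 64" using ReadRaw.prems by auto
  obtain u \<rho>' where 1: "exec W (exp_code e temp_reg) (\<rho>, m) u (\<rho>', m)" "u \<le> 11 * cost e"
    "\<rho>' temp_reg = val e r A" "refines lo (r, A, M) (\<rho>', m)"
    by (rule exec_exp_codeE[of lo r A M \<rho> m v e z W temp_reg]) (use ReadRaw.prems s W ok in auto)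
  have "exec W (code (ReadRaw x e)) \<sigma> (u + 1) (\<rho>'(x := m (\<rho>' temp_reg)), m)"
    unfolding code.simps s by (rule exec.Seq[OF 1(1) exec.Load])
  moreover have "m (\<rho>' temp_reg) = M (val e r A)" using 1 ReadRaw.hyps by (simp add: refines_def)
  then have "refines lo (r(x := M (val e r A)), A, M) (\<rho>'(x := m (\<rho>' temp_reg)), m)"
    using exec_assign_from_temp[OF 1(4) ok(2,3)] by blast
  moreover have "bounded_by (v + Suc (cost e)) (r(x := M (val e r A)), A, M)"
    using bounded_by_mono[OF ReadRaw.prems(3), of "v + Suc (cost e)"]
    by (auto simp: bounded_by_def)
  moreover have "u + 1 \<le> 20 * Suc (cost e)" using 1(2) by simp
  ultimately show ?case by blast
next
  case (WriteRaw e r A f M)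
  obtain \<rho> m where s: "\<sigma> = (\<rho>, m)" by (cases \<sigma>)
  have ok: "exp_ok e" "exp_ok f" using WriteRaw.prems by auto
  have b: "val f r A \<le> v + cost f" using val_bound[OF WriteRaw.prems(3) ok(2) WriteRaw.prems(4)] .
  obtain u1 \<rho>1 where 1: "exec W (exp_code e temp_reg) (\<rho>, m) u1 (\<rho>1, m)" "u1 \<le> 11 * cost e"
    "\<rho>1 temp_reg = val e r A" "refines lo (r, A, M) (\<rho>1, m)"
    by (rule exec_exp_codeE[of lo r A M \<rho> m v e z W temp_reg]) (use WriteRaw.prems s W ok in auto)
  obtain u2 \<rho>2 where 2: "exec W (exp_code f (temp_reg + 1)) (\<rho>1, m) u2 (\<rho>2, m)" "u2 \<le> 11 * cost f"
    "\<rho>2 (temp_reg + 1) = val f r A" "\<And>x. x < temp_reg + 1 \<Longrightarrow> \<rho>2 x = \<rho>1 x" "refines lo (r, A, M) (\<rho>2, m)"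
    by (rule exec_exp_codeE[of lo r A M \<rho>1 m v f z W "temp_reg + 1"]) (use WriteRaw.prems 1 W ok in auto)
  have e: "\<rho>2 temp_reg = val e r A" using 1(3) 2(4)[of temp_reg] by simp
  let ?m = "m(\<rho>2 temp_reg := \<rho>2 (temp_reg + 1))"
  have ex: "exec W (code (WriteRaw e f)) \<sigma> (u1 + (u2 + 1)) (\<rho>2, ?m)"
    unfolding code.simps s by (rule exec.Seq[OF 1(1) exec.Seq[OF 2(1) exec.Store]])
  have "address lo k i j \<noteq> val e r A" for k i j using WriteRaw.hyps by (simp add: address_def)
  then have ref: "refines lo (r, A, M(val e r A := val f r A)) (\<rho>2, ?m)"
    using 2(3,5) e unfolding refines_def by simp
  have bd: "bounded_by (v + Suc (cost e + cost f)) (r, A, M(val e r A := val f r A))"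
    using bounded_by_mono[OF WriteRaw.prems(3), of "v + Suc (cost e + cost f)"] b
    unfolding bounded_by_def by auto
  have "u1 + (u2 + 1) \<le> 20 * Suc (cost e + cost f)" using 1 2 by simp
  then show ?case using bd ex ref by blast
next
  case (Then c s t s' d u s'')
  obtain u1 \<sigma>1 where 1: "bounded_by (v + t) s'" "exec W (code c) \<sigma> u1 \<sigma>1" "u1 \<le> 20 * t" "refines lo s' \<sigma>1"
    using Then.IH(1)[of \<sigma> v] Then.prems by auto
  obtain u2 \<sigma>2 where 2: "bounded_by (v + t + u) s''" "exec W (code d) \<sigma>1 u2 \<sigma>2" "u2 \<le> 20 * u" "refines lo s'' \<sigma>2"
    using Then.IH(2)[of \<sigma>1 "v + t"] Then.prems 1 by auto
  have "exec W (code (c ;; d)) \<sigma> (u1 + u2) \<sigma>2" using exec.Seq[OF 1(2) 2(2)] by simp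
  moreover have "u1 + u2 \<le> 20 * (t + u)" using 1 2 by simp
  ultimately show ?case using 2 by (metis add.assoc)
next
  case (CondTrue b r A c M t s' d)
  obtain \<rho> m where s: "\<sigma> = (\<rho>, m)" by (cases \<sigma>)
  obtain u1 \<rho>1 where 1: "exec W (exp_code b temp_reg) (\<rho>, m) u1 (\<rho>1, m)" "u1 \<le> 11 * cost b"
    "\<rho>1 temp_reg = val b r A" "refines lo (r, A, M) (\<rho>1, m)"
    by (rule exec_exp_codeE[of lo r A M \<rho> m v b z W temp_reg]) (use CondTrue.prems s W in auto)
  obtain u2 \<sigma>2 where 2: "bounded_by (v + t) s'" "exec W (code c) (\<rho>1, m) u2 \<sigma>2" "u2 \<le> 20 * t" "refines lo s' \<sigma>2"
    using CondTrue.IH[of "(\<rho>1, m)" v] CondTrue.prems 1 by auto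
  have "\<rho>1 0 = 0" using 1(4) by (simp add: refines_def)
  then have "exec W (If (Less 0 temp_reg) (code c) (code d)) (\<rho>1, m) (Suc u2) \<sigma>2"
    using CondTrue.hyps 1(3) by (intro exec.IfTrue 2(2)) simp
  then have "exec W (code (Cond b c d)) \<sigma> (u1 + Suc u2) \<sigma>2" unfolding code.simps s by (rule exec.Seq[OF 1(1)])
  moreover have "u1 + Suc u2 \<le> 20 * (t + Suc (cost b))" using 1 2 by simp
  moreover have "bounded_by (v + (t + Suc (cost b))) s'"
    using bounded_by_mono[OF 2(1), of "v + (t + Suc (cost b))"] by simp
  ultimately show ?case using 2(4) by blast
next
  case (CondFalse b r A d M t s' c)
  obtain \<rho> m where s: "\<sigma> = (\<rho>, m)" by (cases \<sigma>)
  obtain u1 \<rho>1 where 1: "exec W (exp_code b temp_reg) (\<rho>, m) u1 (\<rho>1, m)" "u1 \<le> 11 * cost b"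
    "\<rho>1 temp_reg = val b r A" "refines lo (r, A, M) (\<rho>1, m)"
    by (rule exec_exp_codeE[of lo r A M \<rho> m v b z W temp_reg]) (use CondFalse.prems s W in auto)
  obtain u2 \<sigma>2 where 2: "bounded_by (v + t) s'" "exec W (code d) (\<rho>1, m) u2 \<sigma>2" "u2 \<le> 20 * t" "refines lo s' \<sigma>2"
    using CondFalse.IH[of "(\<rho>1, m)" v] CondFalse.prems 1 by auto
  have "\<rho>1 0 = 0" using 1(4) by (simp add: refines_def)
  then have "exec W (If (Less 0 temp_reg) (code c) (code d)) (\<rho>1, m) (Suc u2) \<sigma>2"
    using CondFalse.hyps 1(3) by (intro exec.IfFalse 2(2)) simp
  then have "exec W (code (Cond b c d)) \<sigma> (u1 + Suc u2) \<sigma>2" unfolding code.simps s by (rule exec.Seq[OF 1(1)])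
  moreover have "u1 + Suc u2 \<le> 20 * (t + Suc (cost b))" using 1 2 by simp
  moreover have "bounded_by (v + (t + Suc (cost b))) s'"
    using bounded_by_mono[OF 2(1), of "v + (t + Suc (cost b))"] by simp
  ultimately show ?case using 2(4) by blast
next
  case (LoopFalse b r A c M)
  obtain \<rho> m where s: "\<sigma> = (\<rho>, m)" by (cases \<sigma>)
  obtain u1 \<rho>1 where 1: "exec W (exp_code b temp_reg) (\<rho>, m) u1 (\<rho>1, m)" "u1 \<le> 11 * cost b"
    "\<rho>1 temp_reg = val b r A" "refines lo (r, A, M) (\<rho>1, m)"
    by (rule exec_exp_codeE[of lo r A M \<rho> m v b z W temp_reg]) (use LoopFalse.prems s W in auto)
  have "\<rho>1 0 = 0" using 1(4) by (simp add: refines_def)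
  then have "exec W (While (Less 0 temp_reg) (Seq (code c) (exp_code b temp_reg))) (\<rho>1, m) 1 (\<rho>1, m)"
    using LoopFalse.hyps 1(3) by (intro exec.WhileFalse) simp
  then have "exec W (code (Loop b c)) \<sigma> (u1 + 1) (\<rho>1, m)" unfolding code.simps s by (rule exec.Seq[OF 1(1)])
  moreover have "u1 + 1 \<le> 20 * Suc (cost b)" using 1 by simp
  ultimately show ?case using 1(4) bounded_by_mono[OF LoopFalse.prems(3) le_add1] by blast
next
  case (LoopTrue b r A c M t s' u s'')
  let ?w = "While (Less 0 temp_reg) (Seq (code c) (exp_code b temp_reg))"
  obtain \<rho> m where s: "\<sigma> = (\<rho>, m)" by (cases \<sigma>)
  obtain u1 \<rho>1 where 1: "exec W (exp_code b temp_reg) (\<rho>, m) u1 (\<rho>1, m)" "u1 \<le> 11 * cost b"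
    "\<rho>1 temp_reg = val b r A" "refines lo (r, A, M) (\<rho>1, m)"
    by (rule exec_exp_codeE[of lo r A M \<rho> m v b z W temp_reg]) (use LoopTrue.prems s W in auto)
  obtain u2 \<sigma>2 where 2: "bounded_by (v + t) s'" "exec W (code c) (\<rho>1, m) u2 \<sigma>2" "u2 \<le> 20 * t" "refines lo s' \<sigma>2"
    using LoopTrue.IH(1)[of "(\<rho>1, m)" v] LoopTrue.prems 1 by auto
  obtain u3 \<sigma>3 where 3: "bounded_by (v + t + u) s''" "exec W (code (Loop b c)) \<sigma>2 u3 \<sigma>3" "u3 \<le> 20 * u" "refines lo s'' \<sigma>3"
    using LoopTrue.IH(2)[of \<sigma>2 "v + t"] LoopTrue.prems 2 by auto
  \<comment> \<open>The remaining iterations start with an evaluation of the test. In the compiled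
    loop it is the one at the end of the current body, so it is split off and attached
    there.\<close>
  obtain x y \<sigma>4 where 4: "exec W (exp_code b temp_reg) \<sigma>2 x \<sigma>4" "exec W ?w \<sigma>4 y \<sigma>3" "u3 = x + y"
    using 3(2) by (auto elim: exec_elims)
  have "\<rho>1 0 = 0" using 1(4) by (simp add: refines_def)
  then have "exec W ?w (\<rho>1, m) (Suc ((u2 + x) + y)) \<sigma>3"
    using LoopTrue.hyps(1) 1(3) by (intro exec.WhileTrue[OF _ exec.Seq[OF 2(2) 4(1)] 4(2)]) simp
  then have "exec W (code (Loop b c)) \<sigma> (u1 + Suc ((u2 + x) + y)) \<sigma>3" unfolding code.simps s by (rule exec.Seq[OF 1(1)])
  moreover have "u1 + Suc ((u2 + x) + y) \<le> 20 * (t + u + Suc (cost b))" using 1 2 3 4 by simp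
  moreover have "bounded_by (v + (t + u + Suc (cost b))) s''"
    using bounded_by_mono[OF 3(1), of "v + (t + u + Suc (cost b))"] by simp
  ultimately show ?case using 3(4) by blast
qed

section \<open>The program\<close>

text \<open>Deferred acceptance starts agent \<open>r_ga\<close> at position \<open>r_gi\<close> of its list, agent \<open>r_gb\<close> at
  position \<open>r_gj\<close>, and all others at position \<open>0\<close>; it sets \<open>r_f\<close> if no stable marriage obeys
  these bounds. The number of cycles found so far is in \<open>r_cnt\<close>, and \<open>r_out\<close> is the next free
  output cell.\<close>

abbreviation (input) "r_n \<equiv> 2 :: nat"
abbreviation (input) "r_a \<equiv> 3 :: nat"
abbreviation (input) "r_b \<equiv> 4 :: nat"
abbreviation (input) "r_ga \<equiv> 5 :: nat"
abbreviation (input) "r_gi \<equiv> 6 :: nat"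
abbreviation (input) "r_gb \<equiv> 7 :: nat"
abbreviation (input) "r_gj \<equiv> 8 :: nat"
abbreviation (input) "r_x \<equiv> 9 :: nat"
abbreviation (input) "r_c \<equiv> 10 :: nat"
abbreviation (input) "r_y \<equiv> 11 :: nat"
abbreviation (input) "r_o \<equiv> 12 :: nat"
abbreviation (input) "r_f \<equiv> 13 :: nat"
abbreviation (input) "r_k \<equiv> 14 :: nat"
abbreviation (input) "r_i \<equiv> 15 :: nat"
abbreviation (input) "r_s \<equiv> 16 :: nat"
abbreviation (input) "r_t \<equiv> 17 :: nat"
abbreviation (input) "r_e \<equiv> 18 :: nat"
abbreviation (input) "r_u \<equiv> 19 :: nat"
abbreviation (input) "r_z \<equiv> 20 :: nat"
abbreviation (input) "r_w \<equiv> 21 :: nat"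
abbreviation (input) "r_len \<equiv> 22 :: nat"
abbreviation (input) "r_par \<equiv> 23 :: nat"
abbreviation (input) "r_min \<equiv> 24 :: nat"
abbreviation (input) "r_ok \<equiv> 25 :: nat"
abbreviation (input) "r_cnt \<equiv> 26 :: nat"
abbreviation (input) "r_out \<equiv> 27 :: nat"
abbreviation (input) "r_j \<equiv> 28 :: nat"
abbreviation (input) "r_pos \<equiv> 29 :: nat"

text \<open>A man proposes at position \<open>a_p\<close> of his list; \<open>a_h\<close> is the man held by a woman (\<open>n\<close> if there
  is none), and she rejects the men whose rank is not below \<open>a_w\<close>. Of the permutation stored in
  \<open>a_nxt\<close>, \<open>a_inc\<close> marks the cycle that was walked last.\<close>

abbreviation (input) "a_lst \<equiv> 2 :: nat"
abbreviation (input) "a_rk \<equiv> 3 :: nat"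
abbreviation (input) "a_p \<equiv> 4 :: nat"
abbreviation (input) "a_q \<equiv> 5 :: nat"
abbreviation (input) "a_h \<equiv> 6 :: nat"
abbreviation (input) "a_w \<equiv> 7 :: nat"
abbreviation (input) "a_stk \<equiv> 8 :: nat"
abbreviation (input) "a_on \<equiv> 9 :: nat"
abbreviation (input) "a_fz \<equiv> 10 :: nat"
abbreviation (input) "a_nxt \<equiv> 11 :: nat"
abbreviation (input) "a_inc \<equiv> 12 :: nat"
abbreviation (input) "a_odd \<equiv> 13 :: nat"

abbreviation "Arr1 k e \<equiv> Arr k (Lit 0) e"
abbreviation "Put1 k e f \<equiv> Put k (Lit 0) e f"
abbreviation "inc x \<equiv> Assign x (Incr (Var x))"
abbreviation "Neg e \<equiv> Eql e (Lit 0)"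

definition for_code :: "nat \<Rightarrow> nat \<Rightarrow> cmd \<Rightarrow> cmd" where
  "for_code x m c = Assign x (Lit 0) ;; Loop (Lt (Var x) (Var m)) (c ;; inc x)"

text \<open>A man kept below his first women would block with any of them whose partner she likes
  less than him. Hence these women may accept only men whom they prefer to him.\<close>

definition bound_code :: "nat \<Rightarrow> nat \<Rightarrow> cmd" where
  "bound_code a i = for_code r_k i (
      Assign r_y (Arr a_lst (Var a) (Var r_k)) ;;
      Cond (Lt (Arr a_rk (Var r_y) (Var a)) (Arr1 a_w (Var r_y)))
        (Put1 a_w (Var r_y) (Arr a_rk (Var r_y) (Var a))) Nop) ;;
    Put1 a_p (Var a) (Var i)"

text \<open>A displaced man proposes next; if there is none, the next man enters. After a failure,
  \<open>r_x\<close> is set to \<open>n\<close> in order to leave the loop.\<close>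

definition da_step :: cmd where
  "da_step = Cond (Lt (Arr1 a_p (Var r_c)) (Var r_n))
    (Assign r_y (Arr a_lst (Var r_c) (Arr1 a_p (Var r_c))) ;;
     Cond (Lt (Arr a_rk (Var r_y) (Var r_c)) (Arr1 a_w (Var r_y)))
      (Put1 a_w (Var r_y) (Arr a_rk (Var r_y) (Var r_c)) ;;
       Assign r_o (Arr1 a_h (Var r_y)) ;;
       Put1 a_h (Var r_y) (Var r_c) ;;
       Cond (Lt (Var r_o) (Var r_n))
        (Assign r_c (Var r_o) ;; Put1 a_p (Var r_c) (Incr (Arr1 a_p (Var r_c))))
        (inc r_x ;; Assign r_c (Var r_x)))
      (Put1 a_p (Var r_c) (Incr (Arr1 a_p (Var r_c)))))
    (Assign r_f (Lit 1) ;; Assign r_x (Var r_n))"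

definition da_code :: cmd where
  "da_code =
    for_code r_x r_n (Put1 a_p (Var r_x) (Lit 0) ;; Put1 a_h (Var r_x) (Var r_n) ;; Put1 a_w (Var r_x) (Var r_n)) ;;
    bound_code r_ga r_gi ;; bound_code r_gb r_gj ;;
    Assign r_f (Lit 0) ;; Assign r_x (Lit 0) ;; Assign r_c (Lit 0) ;;
    Loop (Lt (Var r_x) (Var r_n)) da_step"

lemma update_same [simp]: "update A k i j v k = (A k)(i := (A k i)(j := v))"
  and update_other [simp]: "k' \<noteq> k \<Longrightarrow> update A k i j v k' = A k'"
  by (simp_all add: update_def)

text \<open>The \<open>7\<close> consists of the loop test and the increment, the \<open>6\<close>
  of the initial assignment and the last test.\<close>

lemma runs_for:
  assumes init: "I 0 r A M" and m: "r m = N" and mx: "x \<notin> reg_writes c" "m \<notin> reg_writes c" "m \<noteq> x"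
    and body: "\<And>i r A M. I i r A M \<Longrightarrow> i < N \<Longrightarrow> r x = i \<Longrightarrow> r m = N \<Longrightarrow>
      runs lo c (r, A, M) (\<lambda>t (r', A', M'). I (Suc i) (r'(x := Suc i)) A' M' \<and> t \<le> b i)"
    and cong: "I 0 r A M \<Longrightarrow> I 0 (r(x := 0)) A M"
    and exit: "\<And>t r' A' M'. I N r' A' M' \<Longrightarrow> t \<le> 6 + (\<Sum>i<N. b i + 7) \<Longrightarrow> Q t (r', A', M')"
  shows "runs lo (for_code x m c) (r, A, M) Q"
  unfolding for_code_def runs_simps
proof (rule runs_loop[where I = "\<lambda>r A M. r x \<le> N \<and> r m = N \<and> I (r x) r A M" and \<Phi> = "\<lambda>r A. \<Sum>i\<in>{r x..<N}. b i + 7"])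
  show "(r(x := val (Lit 0) r A)) x \<le> N \<and> (r(x := val (Lit 0) r A)) m = N \<and>
      I ((r(x := val (Lit 0) r A)) x) (r(x := val (Lit 0) r A)) A M"
    using cong[OF init] m mx by simp
next
  fix r A M assume I: "r x \<le> N \<and> r m = N \<and> I (r x) r A M" and "val (Lt (Var x) (Var m)) r A \<noteq> 0"
  then have lt: "r x < N" by (simp split: if_splits)
  have split: "(\<Sum>i\<in>{r x..<N}. b i + 7) = b (r x) + 7 + (\<Sum>i\<in>{Suc (r x)..<N}. b i + 7)"
    by (rule sum.atLeast_Suc_lessThan[OF lt])
  have "runs lo c (r, A, M) (\<lambda>t (r', A', M'). I (Suc (r x)) (r'(x := Suc (r x))) A' M' \<and> t \<le> b (r x))"
    using body[of "r x" r A M] I lt by blast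
  then have *: "runs lo c (r, A, M) (\<lambda>t (r', A', M'). (I (Suc (r x)) (r'(x := Suc (r x))) A' M' \<and> t \<le> b (r x)) \<and>
    (\<forall>y. y \<notin> reg_writes c \<longrightarrow> r' y = r y))"
    by (rule runs_mono[OF runs_frame]) auto
  show "runs lo (c ;; inc x) (r, A, M) (\<lambda>t (r', A', M'). (r' x \<le> N \<and> r' m = N \<and> I (r' x) r' A' M') \<and>
      t + Suc (cost (Lt (Var x) (Var m))) + (\<Sum>i\<in>{r' x..<N}. b i + 7) \<le> (\<Sum>i\<in>{r x..<N}. b i + 7))"
    unfolding runs_simps
    by (rule runs_mono[OF *]) (use I lt mx split in \<open>auto simp: runs_simps\<close>)
next
  fix t r' A' M'
  assume I: "r' x \<le> N \<and> r' m = N \<and> I (r' x) r' A' M'" and ex: "val (Lt (Var x) (Var m)) r' A' = 0"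
    and t: "t + (\<Sum>i\<in>{r' x..<N}. b i + 7) \<le> (\<Sum>i\<in>{(r(x := val (Lit 0) r A)) x..<N}. b i + 7) + Suc (cost (Lt (Var x) (Var m)))"
  have "r' x = N" using I ex by (simp split: if_splits)
  then show "Q (Suc (cost (Lit 0)) + t) (r', A', M')"
    using I t by (intro exit) (auto simp: lessThan_atLeast0)
qed

lemma reg_writes_bound [simp]: "reg_writes (bound_code a i) = {r_k, r_y}"
  and arr_writes_bound [simp]: "arr_writes (bound_code a i) = {a_w, a_p}"
  and raw_writes_bound [simp]: "\<not> raw_writes (bound_code a i)"
  by (auto simp: bound_code_def for_code_def)

lemma runs_then:
  assumes "runs lo c s P"
    and "\<And>t r A M. P t (r, A, M) \<Longrightarrow> runs lo d (r, A, M) (\<lambda>u. Q (t + u))"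
  shows "runs lo (c ;; d) s Q"
  unfolding runs_simps by (rule runs_mono[OF assms(1)]) (rule assms(2))

section \<open>Correctness and running time of deferred acceptance\<close>

context preference_table
begin

definition tables :: "arrays \<Rightarrow> bool" where
  "tables A \<longleftrightarrow> (\<forall>a<n. \<forall>j<n. A a_lst a j = lst a j \<and> A a_rk a j = rk a j)"

lemma tablesD: "tables A \<Longrightarrow> a < n \<Longrightarrow> j < n \<Longrightarrow> A a_lst a j = lst a j"
  "tables A \<Longrightarrow> a < n \<Longrightarrow> j < n \<Longrightarrow> A a_rk a j = rk a j"
  by (simp_all add: tables_def)

lemma tables_cong: "tables A \<Longrightarrow> A' a_lst = A a_lst \<Longrightarrow> A' a_rk = A a_rk \<Longrightarrow> tables A'"
  by (simp add: tables_def)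

lemma tables_update [simp]: "k \<noteq> a_lst \<Longrightarrow> k \<noteq> a_rk \<Longrightarrow> tables (update A k i j v) = tables A"
  by (simp add: tables_def)

lemma da_clear_runs:
  assumes "r r_n = n"
  shows "runs lo (for_code r_x r_n (Put1 a_p (Var r_x) (Lit 0) ;; Put1 a_h (Var r_x) (Var r_n) ;; Put1 a_w (Var r_x) (Var r_n)))
    (r, A, M) (\<lambda>t (r', A', M'). t \<le> 6 + n * 21 \<and> (\<forall>x<n. A' a_p 0 x = 0 \<and> A' a_h 0 x = n \<and> A' a_w 0 x = n))"
  by (rule runs_for[where N = n and b = "\<lambda>_. 14" and
        I = "\<lambda>i r A M. \<forall>x<i. A a_p 0 x = 0 \<and> A a_h 0 x = n \<and> A a_w 0 x = n"])
    (use assms in \<open>auto simp: runs_simps less_Suc_eq\<close>)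

lemma bound_code_runs:
  assumes tab: "tables A" and a: "r a < n \<or> r i = 0" and i: "r i \<le> n"
    and reg: "a \<noteq> r_k" "a \<noteq> r_y" "i \<noteq> r_k" "i \<noteq> r_y"
  shows "runs lo (bound_code a i) (r, A, M) (\<lambda>t (r', A', M'). t \<le> 20 + n * 40 \<and>
      A' a_p 0 = (A a_p 0)(r a := r i) \<and>
      (\<forall>y<n. A' a_w 0 y \<le> A a_w 0 y \<and> (A' a_w 0 y = A a_w 0 y \<or> A' a_w 0 y = rk y (r a) \<and> rk (r a) y < r i)) \<and>
      (\<forall>k<r i. A' a_w 0 (lst (r a) k) \<le> rk (lst (r a) k) (r a)))"
proof -
  define W where "W = A a_w 0" define ra where "ra = r a" define ri where "ri = r i"
  define J where "J = (\<lambda>k w. (\<forall>y<n. w y \<le> W y \<and> (w y = W y \<or> w y = rk y ra \<and> rk ra y < ri)) \<and>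
      (\<forall>l<k. w (lst ra l) \<le> rk (lst ra l) ra))"
  define I where "I = (\<lambda>k (r :: regs) A (M :: nat \<Rightarrow> nat). tables A \<and> r a = ra \<and> r i = ri \<and> J k (A a_w 0))"
  let ?Q = "\<lambda>t r' A' M'. t \<le> 6 + n * 35 \<and> I ri r' A' M'"
  have ri: "ri \<le> n" using i by (simp add: ri_def)
  have "runs lo (for_code r_k i (
      Assign r_y (Arr a_lst (Var a) (Var r_k)) ;;
      Cond (Lt (Arr a_rk (Var r_y) (Var a)) (Arr1 a_w (Var r_y)))
        (Put1 a_w (Var r_y) (Arr a_rk (Var r_y) (Var a))) Nop)) (r, A, M) (\<lambda>t (r', A', M'). ?Q t r' A' M')"
  proof (rule runs_for[where N = ri and b = "\<lambda>_. 28" and I = I])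
    show "I 0 r A M" using tab by (simp add: I_def J_def W_def ra_def ri_def)
    show "I 0 (r(r_k := 0)) A M" if "I 0 r A M" using that reg by (simp add: I_def)
    fix t :: nat and r' A' M' assume 1: "I ri r' A' M'" "t \<le> 6 + (\<Sum>i<ri. 28 + 7)"
    have "ri * 35 \<le> n * 35" using ri by simp
    then have "t \<le> 6 + n * 35" using 1(2) by simp
    then show "case (r', A', M') of (r', A', M') \<Rightarrow> ?Q t r' A' M'" using 1(1) by simp
  next
    fix k r A M assume I: "I k r A M" and k: "k < ri" "r r_k = k" "r i = ri"
    let ?y = "lst ra k"
    have A: "ra < n" "k < n" using a i k by (auto simp: ra_def ri_def)
    have y: "?y < n" "rk ra ?y = k" using lst_lt rk_lst A by auto
    have e: "A a_lst ra k = ?y" "A a_rk ?y ra = rk ?y ra" using tablesD I A y by (auto simp: I_def)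
    have J1: "J (Suc k) (A a_w 0)" if "\<not> rk ?y ra < A a_w 0 ?y"
      using I that by (auto simp: I_def J_def less_Suc_eq)
    have J2: "J (Suc k) ((A a_w 0)(?y := rk ?y ra))" if lt: "rk ?y ra < A a_w 0 ?y"
    proof -
      have le: "((A a_w 0)(?y := rk ?y ra)) z \<le> A a_w 0 z" for z using lt by simp
      have Jk: "J k (A a_w 0)" using I by (simp add: I_def)
      show ?thesis unfolding J_def
      proof (intro conjI allI impI)
        fix z assume z: "z < n"
        have W: "A a_w 0 z \<le> W z \<and> (A a_w 0 z = W z \<or> A a_w 0 z = rk z ra \<and> rk ra z < ri)"
          using Jk z by (simp add: J_def)
        then show "((A a_w 0)(?y := rk ?y ra)) z \<le> W z" using order_trans[OF le] by blast
        show "((A a_w 0)(?y := rk ?y ra)) z = W z \<or> ((A a_w 0)(?y := rk ?y ra)) z = rk z ra \<and> rk ra z < ri"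
          using W y(2) k(1) by simp
      next
        fix l assume "l < Suc k"
        then consider "l < k" | "l = k" by linarith
        then show "((A a_w 0)(?y := rk ?y ra)) (lst ra l) \<le> rk (lst ra l) ra"
        proof cases
          case 1
          then have "A a_w 0 (lst ra l) \<le> rk (lst ra l) ra" using Jk by (simp add: J_def)
          then show ?thesis using order_trans[OF le] by blast
        qed simp
      qed
    qed
    show "runs lo (Assign r_y (Arr a_lst (Var a) (Var r_k)) ;;
      Cond (Lt (Arr a_rk (Var r_y) (Var a)) (Arr1 a_w (Var r_y)))
        (Put1 a_w (Var r_y) (Arr a_rk (Var r_y) (Var a))) Nop) (r, A, M)
        (\<lambda>t (r', A', M'). I (Suc k) (r'(r_k := Suc k)) A' M' \<and> t \<le> 28)"
    proof (cases "rk ?y ra < A a_w 0 ?y")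
      case True
      show ?thesis using I k reg e True J2 by (simp add: runs_simps I_def)
    next
      case False
      then show ?thesis using I k reg e J1 by (simp add: runs_simps I_def)
    qed
  qed (use reg in \<open>auto simp: ri_def\<close>)
  then have "runs lo (for_code r_k i (
      Assign r_y (Arr a_lst (Var a) (Var r_k)) ;;
      Cond (Lt (Arr a_rk (Var r_y) (Var a)) (Arr1 a_w (Var r_y)))
        (Put1 a_w (Var r_y) (Arr a_rk (Var r_y) (Var a))) Nop)) (r, A, M) (\<lambda>t (r', A', M'). ?Q t r' A' M' \<and> A' a_p = A a_p)"
    by (rule runs_mono[OF runs_frame]) (auto simp: for_code_def)
  then show ?thesis unfolding bound_code_def runs_simps(6)
    by (rule runs_mono) (auto simp: runs_simps I_def J_def ra_def ri_def W_def)
qed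

text \<open>Each step advances a list position, admits the next man, or ends the loop, which gives
  at most \<open>n * n + n\<close> steps.\<close>

lemma da_step_runs:
  assumes tab: "tables A" and n: "r r_n = n" and x: "r r_x < n" and c: "r r_c \<le> r r_x"
    and f: "r r_f = 0" and I: "da_inv t (r r_x) (r r_c) (A a_p 0) (A a_h 0) (A a_w 0)"
  shows "runs lo da_step (r, A, M) (\<lambda>s (r', A', M'). s \<le> 60 \<and> tables A' \<and> r' r_n = n \<and>
      (r' r_f = 0 \<and> da_inv t (r' r_x) (r' r_c) (A' a_p 0) (A' a_h 0) (A' a_w 0) \<and> (r' r_x < n \<or> r' r_c = r' r_x) \<or>
       r' r_f = 1 \<and> r' r_x = n \<and> da_result t True (A' a_p 0) (A' a_h 0)) \<and>
      (\<Sum>z<n. n - A' a_p 0 z) + (n - r' r_x) < (\<Sum>z<n. n - A a_p 0 z) + (n - r r_x))"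
proof (cases "A a_p 0 (r r_c) < n")
  case False
  then show ?thesis using da_fail[OF I x] assms by (simp add: da_step_def runs_simps)
next
  case pc: True
  have cn: "r r_c < n" using c x by simp
  define y where "y = lst (r r_c) (A a_p 0 (r r_c))"
  have y: "y < n" using lst_lt cn pc by (simp add: y_def)
  have e: "A a_lst (r r_c) (A a_p 0 (r r_c)) = y" "A a_rk y (r r_c) = rk y (r r_c)"
    using tablesD[OF tab] cn pc y by (auto simp: y_def)
  have dec: "(\<Sum>z<n. n - ((A a_p 0)(v := Suc (A a_p 0 v))) z) < (\<Sum>z<n. n - A a_p 0 z)"
    if "v < n" "A a_p 0 v < n" for v
    using that by (intro sum_strict_mono_ex1) auto
  show ?thesis
  proof (cases "rk y (r r_c) < A a_w 0 y")
    case False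
    then show ?thesis using da_reject[OF I x pc y_def] assms pc e dec[OF cn pc]
      by (simp add: da_step_def runs_simps)
  next
    case acc: True
    show ?thesis
    proof (cases "A a_h 0 y < n")
      case True
      have "A a_p 0 (A a_h 0 y) < n" using da_invD(3)[OF I y] True by auto
      then show ?thesis using da_accept(1)[OF I x pc y_def acc True] assms pc e acc True dec[OF True]
        by (simp add: da_step_def runs_simps)
    next
      case False
      then show ?thesis using da_accept(2)[OF I x pc y_def acc False] assms pc e acc
        by (simp add: da_step_def runs_simps)
    qed
  qed
qed
text \<open>Unless both bounds are zero they must concern different agents, since the second would
  overwrite the first. The exception covers the first run, in which all four registers are
  zero.\<close>

lemma da_code_runs:
  assumes tab: "tables A" and n: "r r_n = n" and ga: "r r_ga < n \<or> r r_gi = 0" and gb: "r r_gb < n \<or> r r_gj = 0"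
    and ij: "r r_gi \<le> n" "r r_gj \<le> n" and ne: "r r_ga \<noteq> r r_gb \<or> r r_gi = 0 \<and> r r_gj = 0"
  shows "runs lo da_code (r, A, M) (\<lambda>s (r', A', M'). s \<le> 300 * ((n + 1) * (n + 1)) \<and>
      da_result (thresholds (r r_ga) (r r_gi) (r r_gb) (r r_gj)) (r' r_f \<noteq> 0) (A' a_p 0) (A' a_h 0))"
  unfolding da_code_def
proof (rule runs_then, rule runs_frame, rule da_clear_runs, rule n, goal_cases)
  case (1 t1 r1 A1 M1)
  define a b i j where abij: "a = r r_ga" "b = r r_gb" "i = r r_gi" "j = r r_gj"
  define T where "T = thresholds a i b j"
  have c0: "\<And>x. x < n \<Longrightarrow> A1 a_p 0 x = 0 \<and> A1 a_h 0 x = n \<and> A1 a_w 0 x = n" "t1 \<le> 6 + n * 21"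
    and r1: "r1 r_n = n" "r1 r_ga = a" "r1 r_gb = b" "r1 r_gi = i" "r1 r_gj = j"
    using 1 n by (auto simp: for_code_def abij)
  have tab1: "tables A1" by (rule tables_cong[OF tab]) (use 1 in \<open>simp_all add: for_code_def\<close>)
  show ?case
  proof (rule runs_then, rule runs_frame, rule bound_code_runs[OF tab1], goal_cases)
    case (7 t2 r2 A2 M2)
    note b1 = 7[simplified r1]
    have p2: "A2 a_p 0 = (A1 a_p 0)(a := i)" and h2: "A2 a_h = A1 a_h" and t2: "t2 \<le> 20 + n * 40"
      and w2: "\<And>y. y < n \<Longrightarrow> A2 a_w 0 y \<le> A1 a_w 0 y \<and> (A2 a_w 0 y = A1 a_w 0 y \<or> A2 a_w 0 y = rk y a \<and> rk a y < i)"
        "\<And>k. k < i \<Longrightarrow> A2 a_w 0 (lst a k) \<le> rk (lst a k) a"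
      and r2: "r2 r_n = n" "r2 r_ga = a" "r2 r_gb = b" "r2 r_gi = i" "r2 r_gj = j"
      using b1 r1 by auto
    have tab2: "tables A2" by (rule tables_cong[OF tab1]) (use b1 in simp_all)
    show ?case
    proof (rule runs_then, rule runs_frame, rule bound_code_runs[OF tab2], goal_cases)
      case (7 t3 r3 A3 M3)
      note b2 = 7[simplified r2]
      have p3: "A3 a_p 0 = (A2 a_p 0)(b := j)" and h3: "A3 a_h = A1 a_h" and t3: "t3 \<le> 20 + n * 40"
        and w3: "\<And>y. y < n \<Longrightarrow> A3 a_w 0 y \<le> A2 a_w 0 y \<and> (A3 a_w 0 y = A2 a_w 0 y \<or> A3 a_w 0 y = rk y b \<and> rk b y < j)"
          "\<And>k. k < j \<Longrightarrow> A3 a_w 0 (lst b k) \<le> rk (lst b k) b"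
        and r3: "r3 r_n = n"
        using b2 r2 h2 by auto
      have tab3: "tables A3" by (rule tables_cong[OF tab2]) (use b2 in simp_all)
      have init: "da_inv T 0 0 (A3 a_p 0) (A3 a_h 0) (A3 a_w 0)"
      proof (rule da_init)
        show "A3 a_h 0 y = n" if "y < n" for y using c0 h3 that by simp
        show "A3 a_p 0 z = T z \<and> T z \<le> n" if "z < n" for z
          using p3 p2 c0 that ij by (simp add: T_def thresholds_def abij)
        show "A3 a_w 0 (lst z k) \<le> rk (lst z k) z" if z: "z < n" and k: "k < T z" for z k
        proof (cases "z = b")
          case True then show ?thesis using w3(2) k by (simp add: T_def thresholds_def)
        next
          case False
          then have za: "z = a" "k < i" using k by (auto simp: T_def thresholds_def split: if_splits)
          then have "lst z k < n" using lst_lt[OF z, of k] ij(1) by (simp add: abij)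
          then show ?thesis using w3(1) w2(2)[OF za(2)] za(1) order_trans by blast
        qed
        show "\<exists>z<n. A3 a_w 0 y = rk y z \<and> rk z y < T z" if y: "y < n" and w: "A3 a_w 0 y < n" for y
        proof (cases "A3 a_w 0 y = A2 a_w 0 y")
          case False
          then have "A3 a_w 0 y = rk y b" "rk b y < j" using w3(1)[OF y] by auto
          then show ?thesis using gb by (intro exI[of _ b]) (auto simp: T_def thresholds_def abij)
        next
          case True
          then have "A2 a_w 0 y \<noteq> A1 a_w 0 y" using c0(1)[OF y] w by simp
          then have "A2 a_w 0 y = rk y a" "rk a y < i" using w2(1)[OF y] by auto
          then show ?thesis using True ga ne by (intro exI[of _ a]) (auto simp: T_def thresholds_def abij)
        qed
      qed
      let ?\<Phi> = "\<lambda>(r :: regs) (A :: arrays). 100 * ((\<Sum>z<n. n - A a_p 0 z) + (n - r r_x))"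
      let ?I = "\<lambda>(r :: regs) A (M :: nat \<Rightarrow> nat). tables A \<and> r r_n = n \<and>
        (r r_f = 0 \<and> da_inv T (r r_x) (r r_c) (A a_p 0) (A a_h 0) (A a_w 0) \<and> (r r_x < n \<or> r r_c = r r_x) \<or>
         r r_f = 1 \<and> r r_x = n \<and> da_result T True (A a_p 0) (A a_h 0))"
      have sum_le: "(\<Sum>z<n. n - A a_p 0 z) \<le> n * n" for A :: arrays
        using sum_bounded_above[of "{..<n}" "\<lambda>z. n - A a_p 0 z" n] by simp
      have "runs lo (Loop (Lt (Var r_x) (Var r_n)) da_step) (r3(r_f := 0, r_x := 0, r_c := 0), A3, M3)
          (\<lambda>t (r', A', M'). t \<le> 100 * (n * n + n) + 4 \<and> da_result T (r' r_f \<noteq> 0) (A' a_p 0) (A' a_h 0))"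
      proof (rule runs_loop[where I = ?I and \<Phi> = ?\<Phi>])
        show "?I (r3(r_f := 0, r_x := 0, r_c := 0)) A3 M3" using init tab3 r3 by simp
      next
        fix r A M assume I: "?I r A M" and "val (Lt (Var r_x) (Var r_n)) r A \<noteq> 0"
        then have x: "r r_x < n" by (simp split: if_splits)
        then have *: "r r_n = n" "tables A" "r r_f = 0" "da_inv T (r r_x) (r r_c) (A a_p 0) (A a_h 0) (A a_w 0)"
          using I by auto
        show "runs lo da_step (r, A, M) (\<lambda>t (r', A', M'). ?I r' A' M' \<and>
            t + Suc (cost (Lt (Var r_x) (Var r_n))) + ?\<Phi> r' A' \<le> ?\<Phi> r A)"
        proof (rule runs_mono[OF da_step_runs[OF *(2,1) x da_invD(2)[OF *(4)] *(3,4)]], goal_cases)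
          case (1 t r' A' M')
          define S S' where "S = (\<Sum>z<n. n - A a_p 0 z) + (n - r r_x)"
            and "S' = (\<Sum>z<n. n - A' a_p 0 z) + (n - r' r_x)"
          have "S' < S" "t \<le> 60" using 1 by (simp_all add: S_def S'_def)
          then have "t + Suc (cost (Lt (Var r_x) (Var r_n))) + 100 * S' \<le> 100 * S" by simp
          then show ?case using 1 unfolding S_def S'_def by simp
        qed
      next
        fix t :: nat and r' A' M'
        assume I: "?I r' A' M'" and ex: "val (Lt (Var r_x) (Var r_n)) r' A' = 0"
          and t: "t + ?\<Phi> r' A' \<le> ?\<Phi> (r3(r_f := 0, r_x := 0, r_c := 0)) A3 + Suc (cost (Lt (Var r_x) (Var r_n)))"
        have nx: "\<not> r' r_x < n" using I ex by (simp split: if_splits)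
        have "t \<le> 100 * (n * n + n) + 4" using t sum_le[of A3] by simp
        moreover have "da_result T (r' r_f \<noteq> 0) (A' a_p 0) (A' a_h 0)"
          using I nx da_success[of T "r' r_x" "r' r_c"] by auto
        ultimately show "case (r', A', M') of (r', A', M') \<Rightarrow>
          t \<le> 100 * (n * n + n) + 4 \<and> da_result T (r' r_f \<noteq> 0) (A' a_p 0) (A' a_h 0)" by simp
      qed
      then show ?case unfolding runs_simps
        by (auto elim!: runs_mono simp: T_def abij, use c0(2) t2 t3 in \<open>simp add: algebra_simps\<close>)
    qed (use r2 gb ij in \<open>auto simp: abij\<close>)
  qed (use r1 ga ij in \<open>auto simp: abij\<close>)
qed

lemma reg_writes_da: "reg_writes da_code = {r_x, r_k, r_y, r_f, r_c, r_o}"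
  and arr_writes_da: "arr_writes da_code = {a_p, a_h, a_w}" and raw_writes_da: "\<not> raw_writes da_code"
  by (auto simp: da_code_def da_step_def for_code_def)

end

text \<open>One loop serves both outcomes of a closed walk: \<open>r_u\<close> tells whether the
  popped agents are frozen or move to their next choices.\<close>

definition pop_code :: cmd where
  "pop_code = Loop (Lt (Var r_e) (Var r_s)) (
     Assign r_s (Minus (Var r_s) (Lit 1)) ;;
     Assign r_z (Arr1 a_stk (Var r_s)) ;;
     Put1 a_on (Var r_z) (Lit 0) ;;
     Cond (Var r_u) (Put1 a_fz (Var r_z) (Lit 1))
       (Put1 a_h (Arr a_lst (Var r_z) (Arr1 a_q (Var r_z))) (Var r_z) ;;
        Put1 a_p (Var r_z) (Arr1 a_q (Var r_z)) ;;
        Put1 a_q (Var r_z) (Incr (Arr1 a_q (Var r_z)))))"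

definition search_step :: cmd where
  "search_step =
    Cond (Eql (Var r_s) (Lit 0))
     (Cond (Conj (Neg (Arr1 a_fz (Var r_i))) (Neg (Eql (Arr a_lst (Var r_i) (Arr1 a_p (Var r_i))) (Arr1 a_h (Var r_i)))))
       (Put1 a_stk (Lit 0) (Var r_i) ;; Put1 a_on (Var r_i) (Lit 1) ;; Assign r_s (Lit 1))
       (inc r_i))
     (Assign r_t (Arr1 a_stk (Minus (Var r_s) (Lit 1))) ;;
      Cond (Eql (Arr a_lst (Var r_t) (Arr1 a_p (Var r_t))) (Arr1 a_h (Var r_t)))
       (Assign r_s (Minus (Var r_s) (Lit 1)) ;; Put1 a_on (Var r_t) (Lit 0) ;; Put1 a_fz (Var r_t) (Lit 1))
       (Assign r_y (Arr a_lst (Var r_t) (Arr1 a_q (Var r_t))) ;;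
        Assign r_o (Arr1 a_h (Var r_y)) ;;
        Cond (Lt (Arr a_rk (Var r_y) (Var r_t)) (Arr a_rk (Var r_y) (Var r_o)))
         (Cond (Neg (Arr1 a_on (Var r_o)))
           (Put1 a_stk (Var r_s) (Var r_o) ;; inc r_s ;; Put1 a_on (Var r_o) (Var r_s))
           (Assign r_e (Minus (Arr1 a_on (Var r_o)) (Lit 1)) ;;
            Assign r_u (Conj (Eql (Var r_y) (Arr1 a_h (Var r_t))) (Lt (Var r_e) (Arr1 a_on (Var r_y)))) ;;
            pop_code))
         (Put1 a_q (Var r_t) (Incr (Arr1 a_q (Var r_t))))))"

definition search_code :: cmd where
  "search_code =
    for_code r_x r_n (Put1 a_q (Var r_x) (Incr (Arr1 a_p (Var r_x))) ;; Put1 a_on (Var r_x) (Lit 0) ;; Put1 a_fz (Var r_x) (Lit 0)) ;;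
    Assign r_i (Lit 0) ;; Assign r_s (Lit 0) ;;
    Loop (Lt (Var r_i) (Var r_n)) search_step"

section \<open>Correctness and running time of the search for a first partition\<close>

context preference_table
begin

lemma pop_freeze_runs:
  assumes u: "r r_u \<noteq> 0" and e: "r r_e \<le> r r_s" and R: "R = A a_stk 0 ` {r r_e..<r r_s}"
  shows "runs lo pop_code (r, A, M) (\<lambda>t (r', A', M'). t \<le> 30 * (r r_s - r r_e) + 10 \<and> r' r_s = r r_e \<and>
    A' a_fz 0 = (\<lambda>x. if x \<in> R then 1 else A a_fz 0 x) \<and> A' a_on 0 = (\<lambda>x. if x \<in> R then 0 else A a_on 0 x) \<and>
    A' a_p = A a_p \<and> A' a_q = A a_q \<and> A' a_h = A a_h)"
proof -
  define stk e0 s0 where "stk = A a_stk 0" and "e0 = r r_e" and "s0 = r r_s"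
  define S where "S k = stk ` {k..<s0}" for k
  define I where "I = (\<lambda>(r :: regs) A' (M :: nat \<Rightarrow> nat). r r_u \<noteq> 0 \<and> r r_e = e0 \<and> e0 \<le> r r_s \<and> r r_s \<le> s0 \<and> A' a_stk 0 = stk \<and>
      A' a_fz 0 = (\<lambda>x. if x \<in> S (r r_s) then 1 else A a_fz 0 x) \<and> A' a_on 0 = (\<lambda>x. if x \<in> S (r r_s) then 0 else A a_on 0 x) \<and>
      A' a_p = A a_p \<and> A' a_q = A a_q \<and> A' a_h = A a_h)"
  show ?thesis unfolding pop_code_def
  proof (rule runs_loop[where I = I and \<Phi> = "\<lambda>r A. 30 * (r r_s - e0)"])
    show "I r A M" using assms by (simp add: I_def e0_def s0_def S_def stk_def)
  next
    fix r A' M assume I: "I r A' M" and "val (Lt (Var r_e) (Var r_s)) r A' \<noteq> 0"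
    then have lt: "e0 < r r_s" by (simp add: I_def split: if_splits)
    define k where "k = r r_s - 1"
    have k: "r r_s = Suc k" "e0 \<le> k" "k < s0" using lt I by (auto simp: k_def I_def)
    have "{k..<s0} = insert k {Suc k..<s0}" using k by auto
    then have S: "S k = insert (stk k) (S (Suc k))" by (simp add: S_def)
    have fz: "(A' a_fz 0)(stk k := 1) = (\<lambda>x. if x \<in> S k then 1 else A a_fz 0 x)"
      and on: "(A' a_on 0)(stk k := 0) = (\<lambda>x. if x \<in> S k then 0 else A a_on 0 x)"
      using I k(1) unfolding I_def S by auto
    show "runs lo (Assign r_s (Minus (Var r_s) (Lit 1)) ;;
     Assign r_z (Arr1 a_stk (Var r_s)) ;;
     Put1 a_on (Var r_z) (Lit 0) ;;
     Cond (Var r_u) (Put1 a_fz (Var r_z) (Lit 1))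
       (Put1 a_h (Arr a_lst (Var r_z) (Arr1 a_q (Var r_z))) (Var r_z) ;;
        Put1 a_p (Var r_z) (Arr1 a_q (Var r_z)) ;;
        Put1 a_q (Var r_z) (Incr (Arr1 a_q (Var r_z))))) (r, A', M)
      (\<lambda>t (r', A', M'). I r' A' M' \<and> t + Suc (cost (Lt (Var r_e) (Var r_s))) + 30 * (r' r_s - e0) \<le> 30 * (r r_s - e0))"
      using I k fz on unfolding I_def by (simp add: runs_simps)
  next
    fix t :: nat and r' A' M'
    assume I: "I r' A' M'" and "val (Lt (Var r_e) (Var r_s)) r' A' = 0"
      and t: "t + 30 * (r' r_s - e0) \<le> 30 * (r r_s - e0) + Suc (cost (Lt (Var r_e) (Var r_s)))"
    then have "r' r_s = e0" by (simp add: I_def split: if_splits)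
    moreover have "S e0 = R" by (simp add: S_def R stk_def e0_def s0_def)
    ultimately show "case (r', A', M') of (r', A', M') \<Rightarrow> t \<le> 30 * (r r_s - r r_e) + 10 \<and> r' r_s = r r_e \<and>
    A' a_fz 0 = (\<lambda>x. if x \<in> R then 1 else A a_fz 0 x) \<and> A' a_on 0 = (\<lambda>x. if x \<in> R then 0 else A a_on 0 x) \<and>
    A' a_p = A a_p \<and> A' a_q = A a_q \<and> A' a_h = A a_h"
      using I t by (simp add: I_def e0_def)
  qed
qed

text \<open>The agents are updated one after the other. As the stack entries are distinct and so are
  their next women, no update disturbs what an earlier one wrote or a later one reads.\<close>

lemma pop_eliminate_runs:
  assumes tab: "tables A" and u: "r r_u = 0" and e: "r r_e \<le> r r_s" and R: "R = A a_stk 0 ` {r r_e..<r r_s}"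
    and inj: "inj_on (A a_stk 0) {r r_e..<r r_s}" "inj_on (\<lambda>z. lst z (A a_q 0 z)) R"
    and small: "\<And>z. z \<in> R \<Longrightarrow> z < n \<and> A a_q 0 z < n"
  shows "runs lo pop_code (r, A, M) (\<lambda>t (r', A', M'). t \<le> 50 * (r r_s - r r_e) + 10 \<and> r' r_s = r r_e \<and>
    A' a_p 0 = (\<lambda>x. if x \<in> R then A a_q 0 x else A a_p 0 x) \<and>
    A' a_q 0 = (\<lambda>x. if x \<in> R then Suc (A a_q 0 x) else A a_q 0 x) \<and>
    A' a_on 0 = (\<lambda>x. if x \<in> R then 0 else A a_on 0 x) \<and>
    (\<forall>z\<in>R. A' a_h 0 (lst z (A a_q 0 z)) = z) \<and>
    (\<forall>y. y \<notin> (\<lambda>z. lst z (A a_q 0 z)) ` R \<longrightarrow> A' a_h 0 y = A a_h 0 y) \<and>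
    A' a_fz = A a_fz)"
proof -
  define stk e0 s0 q where "stk = A a_stk 0" and "e0 = r r_e" and "s0 = r r_s" and "q = A a_q 0"
  define S where "S k = stk ` {k..<s0}" for k
  have SR: "S e0 = R" by (simp add: S_def R stk_def e0_def s0_def)
  define I where "I = (\<lambda>(r :: regs) A' (M :: nat \<Rightarrow> nat). r r_u = 0 \<and> r r_e = e0 \<and> e0 \<le> r r_s \<and> r r_s \<le> s0 \<and> A' a_stk 0 = stk \<and>
      tables A' \<and> A' a_p 0 = (\<lambda>x. if x \<in> S (r r_s) then q x else A a_p 0 x) \<and>
      A' a_q 0 = (\<lambda>x. if x \<in> S (r r_s) then Suc (q x) else q x) \<and>
      A' a_on 0 = (\<lambda>x. if x \<in> S (r r_s) then 0 else A a_on 0 x) \<and>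
      (\<forall>z\<in>S (r r_s). A' a_h 0 (lst z (q z)) = z) \<and>
      (\<forall>y. y \<notin> (\<lambda>z. lst z (q z)) ` S (r r_s) \<longrightarrow> A' a_h 0 y = A a_h 0 y) \<and>
      A' a_fz = A a_fz)"
  show ?thesis unfolding pop_code_def
  proof (rule runs_loop[where I = I and \<Phi> = "\<lambda>r A. 50 * (r r_s - e0)"])
    show "I r A M" using assms by (simp add: I_def e0_def s0_def S_def stk_def q_def)
  next
    fix r A' M assume I: "I r A' M" and "val (Lt (Var r_e) (Var r_s)) r A' \<noteq> 0"
    then have lt: "e0 < r r_s" by (simp add: I_def split: if_splits)
    define k where "k = r r_s - 1"
    have k: "r r_s = Suc k" "e0 \<le> k" "k < s0" using lt I by (auto simp: k_def I_def)
    have "{k..<s0} = insert k {Suc k..<s0}" using k by auto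
    then have S: "S k = insert (stk k) (S (Suc k))" by (simp add: S_def)
    have SkR: "S k \<subseteq> R" using k(2) unfolding SR[symmetric] S_def by (intro image_mono) auto
    have zR: "stk k \<in> R" using S SkR by auto
    have nin: "stk k \<notin> S (Suc k)"
    proof
      assume "stk k \<in> S (Suc k)"
      then obtain l where "Suc k \<le> l" "l < s0" "stk l = stk k" by (auto simp: S_def)
      then show False using inj_onD[OF inj(1), of l k] k by (auto simp: stk_def e0_def s0_def)
    qed
    let ?y = "lst (stk k) (q (stk k))"
    have sm: "stk k < n" "q (stk k) < n" using small[OF zR] by (auto simp: q_def)
    have A': "A' a_stk 0 k = stk k" "A' a_q 0 (stk k) = q (stk k)" "A' a_lst (stk k) (q (stk k)) = ?y"
      using I nin k(1) tablesD(1)[of A' "stk k" "q (stk k)"] sm by (auto simp: I_def)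
    have ynin: "?y \<noteq> lst z (q z)" if "z \<in> S (Suc k)" for z
    proof
      assume eq: "?y = lst z (q z)"
      have "z \<in> R" using that S SkR by blast
      then have "stk k = z" using inj_onD[OF inj(2), of "stk k" z] eq zR by (simp add: q_def)
      then show False using nin that by simp
    qed
    have p: "(A' a_p 0)(stk k := q (stk k)) = (\<lambda>x. if x \<in> S k then q x else A a_p 0 x)"
      and qq: "(A' a_q 0)(stk k := Suc (q (stk k))) = (\<lambda>x. if x \<in> S k then Suc (q x) else q x)"
      and on: "(A' a_on 0)(stk k := 0) = (\<lambda>x. if x \<in> S k then 0 else A a_on 0 x)"
      using I k(1) unfolding I_def S by auto
    have h: "\<forall>z\<in>S k. ((A' a_h 0)(?y := stk k)) (lst z (q z)) = z"
      "\<forall>y. y \<notin> (\<lambda>z. lst z (q z)) ` S k \<longrightarrow> ((A' a_h 0)(?y := stk k)) y = A a_h 0 y"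
    proof -
      have Ih: "\<forall>z\<in>S (Suc k). A' a_h 0 (lst z (q z)) = z"
        "\<forall>y. y \<notin> (\<lambda>z. lst z (q z)) ` S (Suc k) \<longrightarrow> A' a_h 0 y = A a_h 0 y"
        using I k(1) by (simp_all add: I_def)
      show "\<forall>z\<in>S k. ((A' a_h 0)(?y := stk k)) (lst z (q z)) = z" using Ih(1) ynin[symmetric] unfolding S by simp
      show "\<forall>y. y \<notin> (\<lambda>z. lst z (q z)) ` S k \<longrightarrow> ((A' a_h 0)(?y := stk k)) y = A a_h 0 y"
        using Ih(2) unfolding S by simp
    qed
    have I': "r r_u = 0" "r r_e = e0" "A' a_stk 0 = stk" "tables A'" "A' a_fz = A a_fz" using I by (simp_all add: I_def)
    show "runs lo (Assign r_s (Minus (Var r_s) (Lit 1)) ;;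
     Assign r_z (Arr1 a_stk (Var r_s)) ;;
     Put1 a_on (Var r_z) (Lit 0) ;;
     Cond (Var r_u) (Put1 a_fz (Var r_z) (Lit 1))
       (Put1 a_h (Arr a_lst (Var r_z) (Arr1 a_q (Var r_z))) (Var r_z) ;;
        Put1 a_p (Var r_z) (Arr1 a_q (Var r_z)) ;;
        Put1 a_q (Var r_z) (Incr (Arr1 a_q (Var r_z))))) (r, A', M)
      (\<lambda>t (r', A', M'). I r' A' M' \<and> t + Suc (cost (Lt (Var r_e) (Var r_s))) + 50 * (r' r_s - e0) \<le> 50 * (r r_s - e0))"
      unfolding I_def using I' k A' p qq on h by (simp add: runs_simps)
  next
    fix t :: nat and r' A' M'
    assume I: "I r' A' M'" and "val (Lt (Var r_e) (Var r_s)) r' A' = 0"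
      and t: "t + 50 * (r' r_s - e0) \<le> 50 * (r r_s - e0) + Suc (cost (Lt (Var r_e) (Var r_s)))"
    then have "r' r_s = e0" by (simp add: I_def split: if_splits)
    then show "case (r', A', M') of (r', A', M') \<Rightarrow> t \<le> 50 * (r r_s - r r_e) + 10 \<and> r' r_s = r r_e \<and>
    A' a_p 0 = (\<lambda>x. if x \<in> R then A a_q 0 x else A a_p 0 x) \<and>
    A' a_q 0 = (\<lambda>x. if x \<in> R then Suc (A a_q 0 x) else A a_q 0 x) \<and>
    A' a_on 0 = (\<lambda>x. if x \<in> R then 0 else A a_on 0 x) \<and>
    (\<forall>z\<in>R. A' a_h 0 (lst z (A a_q 0 z)) = z) \<and>
    (\<forall>y. y \<notin> (\<lambda>z. lst z (A a_q 0 z)) ` R \<longrightarrow> A' a_h 0 y = A a_h 0 y) \<and>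
    A' a_fz = A a_fz"
      using I t SR by (simp add: I_def e0_def q_def cong: if_cong)
  qed
qed

definition search_state :: "regs \<Rightarrow> arrays \<Rightarrow> bool" where
  "search_state r A \<longleftrightarrow> tables A \<and> r r_n = n \<and>
    (\<exists>\<mu>. search_inv \<mu> (A a_p 0) (A a_q 0) (A a_h 0) (A a_fz 0) (A a_on 0) (A a_stk 0) (r r_s) (r r_i))"

text \<open>If a step pops a cycle of \<open>d\<close> agents, \<open>search_pot\<close> drops by
  more than \<open>d\<close>. The popping takes at most \<open>50 * d\<close> instructions and the
  rest of a step, with the loop test, fewer than \<open>150\<close>; hence the factor.\<close>

definition search_potential :: "regs \<Rightarrow> arrays \<Rightarrow> nat" where
  "search_potential r A = 150 * search_pot (A a_q 0) (A a_fz 0) (r r_s) (r r_i)"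

lemma search_step_runs:
  assumes st: "search_state r A" and i: "r r_i < n"
  shows "runs lo search_step (r, A, M) (\<lambda>t (r', A', M'). search_state r' A' \<and> t + 4 + search_potential r' A' \<le> search_potential r A)"
proof -
  define p q h fz on stk s i where pq: "p = A a_p 0" "q = A a_q 0" "h = A a_h 0" "fz = A a_fz 0" "on = A a_on 0"
    "stk = A a_stk 0" "s = r r_s" "i = r r_i"
  obtain \<mu> where I: "search_inv \<mu> p q h fz on stk s i" and tab: "tables A" and n: "r r_n = n"
    using st by (auto simp: search_state_def pq)
  note rep = search_invD(1)[OF I]
  have pot: "t + 4 + 150 * P' \<le> 150 * P" if "P' + d < P" "t \<le> 60 + 100 * d" for t P P' d :: nat
    using that by linarith
  show ?thesis
  proof (cases "s = 0")
    case s: True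
    have e: "A a_lst i (p i) = lst i (p i)" using tablesD(1)[OF tab] assms(2) representsD(3)[OF rep] by (simp add: pq)
    note I0 = I[unfolded s] note i' = assms(2)[folded pq(8)]
    show ?thesis
    proof (cases "fz i = 0 \<and> lst i (p i) \<noteq> h i")
      case True
      then have "search_inv \<mu> p q h fz (on(i := 1)) (stk(0 := i)) 1 i" "search_pot q fz 1 i < search_pot q fz 0 i"
        using search_start[OF I0 i'] by auto
      then show ?thesis using True e s tab n
        by (auto simp: search_step_def runs_simps search_state_def search_potential_def pq simp flip: One_nat_def)
    next
      case False
      then have "search_inv \<mu> p q h fz on stk 0 (Suc i)" "search_pot q fz 0 (Suc i) < search_pot q fz 0 i"
        using search_skip[OF I0 i'] by auto
      then show ?thesis using False e s tab n
        by (auto simp: search_step_def runs_simps search_state_def search_potential_def pq)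
    qed
  next
    case s: False
    then have s0: "0 < s" by simp
    define a where "a = stk (s - 1)"
    have an: "a < n" "p a < n" using search_invD(6)[OF I, of "s - 1"] s representsD(3)[OF rep, of a] by (auto simp: a_def)
    have e: "A a_lst a (p a) = lst a (p a)" "A a_stk 0 (s - 1) = a" using tablesD(1)[OF tab] an by (simp_all add: pq a_def)
    show ?thesis
    proof (cases "lst a (p a) = h a")
      case True
      have "search_inv \<mu> p q h (fz(a := 1)) (on(a := 0)) stk (s - 1) i"
        "search_pot q (fz(a := 1)) (s - 1) i < search_pot q fz s i"
        using search_pop_settled[OF I s0 a_def True] by auto
      then show ?thesis using True e s tab n
        by (auto simp: search_step_def runs_simps search_state_def search_potential_def pq)
    next
      case uns: False
      define y b where "y = lst a (q a)" and "b = h y"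
      note tn = top_next[OF I s0 a_def uns, folded y_def, folded b_def]
      have e2: "A a_lst a (q a) = y" "A a_rk y a = rk y a" "A a_rk y b = rk y b" "A a_h 0 y = b"
        using tablesD[OF tab] an tn by (simp_all add: y_def b_def pq(3))
      show ?thesis
      proof (cases "rk y a < rk y b")
        case False
        then have "search_inv \<mu> p (q(a := Suc (q a))) h fz on stk s i"
          "search_pot (q(a := Suc (q a))) fz s i < search_pot q fz s i"
          using search_advance[OF I s0 a_def uns] by (auto simp: y_def b_def)
        then show ?thesis using False uns e e2 s tab n
          by (auto simp: search_step_def runs_simps search_state_def search_potential_def pq)
      next
        case acc: True
        note acc' = acc[unfolded b_def y_def]
        show ?thesis
        proof (cases "on b = 0")
          case True
          have "search_inv \<mu> p q h fz (on(b := Suc s)) (stk(s := b)) (Suc s) i"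
            "search_pot q fz (Suc s) i < search_pot q fz s i"
            using search_push[OF I s0 a_def uns acc' _ True] by (auto simp: y_def b_def)
          then show ?thesis using True acc uns e e2 s tab n
            by (auto simp: search_step_def runs_simps search_state_def search_potential_def pq)
        next
          case False
          then obtain e where eb: "on b = Suc e" using not0_implies_Suc by blast
          then have eb': "on (h (lst a (q a))) = Suc e" by (simp add: b_def y_def)
          define R where "R = stk ` {e..<s}"
          note cyc = I s0 a_def uns acc' eb' R_def
          have es: "e < s" using cycle_bottom(1)[OF cyc] .
          \<comment> \<open>The value that the code computes in \<open>r_u\<close>: the test of
            self-duality at the top of the stack.\<close>
          define u where "u = (if y = h a \<and> e < on y then 1 else (0::nat))"
          define r1 where "r1 = r(r_t := a, r_y := y, r_o := b, r_e := e, r_u := u)"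
          have r1: "r1 r_e = e" "r1 r_s = s" "r1 r_u = u" "r1 r_n = n" "r1 r_i = i" by (simp_all add: r1_def pq n)
          have "runs lo pop_code (r1, A, M) (\<lambda>t (r', A', M'). t \<le> 50 * (s - e) + 10 \<and>
             search_state r' A' \<and> search_pot (A' a_q 0) (A' a_fz 0) (r' r_s) (r' r_i) + (s - e) < search_pot q fz s i)"
          proof (cases "u = 0")
            case True
            then have nd: "\<not> (lst a (q a) = h a \<and> Suc e \<le> on (lst a (q a)))" by (auto simp: u_def y_def split: if_splits)
            have sub: "R \<subseteq> {z. z < n \<and> fz z = 0}" using cycle_facts(2)[OF cyc] .
            have small: "z < n \<and> q z < n" if "z \<in> R" for z
            proof -
              have "z < n" "z \<notin> frozen_set fz \<mu>" using sub that cycle_facts(1)[OF cyc] by auto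
              then show ?thesis using unfrozen_next(1)[OF I] by simp
            qed
            have inj1: "inj_on stk {e..<s}" using stack_inj(1)[OF I] by (rule inj_on_subset) auto
            have "inj_on (\<lambda>z. inv \<mu> (lst z (q z))) R"
              using rotation_succ_bij[OF marriage_search[OF I] le_search[OF I] cycle_rotation[OF cyc]]
              by (rule bij_betw_imp_inj_on)
            then have inj2: "inj_on (\<lambda>z. lst z (q z)) R"
              using inj_on_imageI2[of "inv \<mu>" "\<lambda>z. lst z (q z)" R] by (simp add: comp_def)
            note el = search_eliminate[OF cyc nd]
            have pr: "runs lo pop_code (r1, A, M) (\<lambda>t (r', A', M'). (t \<le> 50 * (r1 r_s - r1 r_e) + 10 \<and> r' r_s = r1 r_e \<and>
              A' a_p 0 = (\<lambda>x. if x \<in> R then A a_q 0 x else A a_p 0 x) \<and>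
              A' a_q 0 = (\<lambda>x. if x \<in> R then Suc (A a_q 0 x) else A a_q 0 x) \<and>
              A' a_on 0 = (\<lambda>x. if x \<in> R then 0 else A a_on 0 x) \<and>
              (\<forall>z\<in>R. A' a_h 0 (lst z (A a_q 0 z)) = z) \<and>
              (\<forall>y. y \<notin> (\<lambda>z. lst z (A a_q 0 z)) ` R \<longrightarrow> A' a_h 0 y = A a_h 0 y) \<and>
              A' a_fz = A a_fz) \<and>
              (\<forall>x. x \<notin> reg_writes pop_code \<longrightarrow> r' x = r1 x) \<and> (\<forall>k. k \<notin> arr_writes pop_code \<longrightarrow> A' k = A k) \<and>
              (\<not> raw_writes pop_code \<longrightarrow> M' = M))"
              by (rule runs_mono[OF runs_frame[OF pop_eliminate_runs[OF tab, where r = r1 and R = R]]])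
                (use True es small inj1 inj2 r1 in \<open>auto simp: R_def pq\<close>)
            show ?thesis
            proof (rule runs_mono[OF pr], goal_cases)
              case (1 t r' A' M')
              then have f: "t \<le> 50 * (s - e) + 10" "r' r_s = e" "A' a_p 0 = (\<lambda>x. if x \<in> R then q x else p x)"
                "A' a_q 0 = (\<lambda>x. if x \<in> R then Suc (q x) else q x)" "A' a_on 0 = (\<lambda>x. if x \<in> R then 0 else on x)"
                "\<And>z. z \<in> R \<Longrightarrow> A' a_h 0 (lst z (q z)) = z"
                "\<And>y. y \<notin> (\<lambda>z. lst z (q z)) ` R \<Longrightarrow> A' a_h 0 y = h y" "A' a_fz 0 = fz"
                "r' r_n = n" "r' r_i = i" "A' a_stk 0 = stk" "A' a_lst = A a_lst" "A' a_rk = A a_rk"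
                by (simp_all add: r1 pq pop_code_def cong: if_cong)
              have "tables A'" by (rule tables_cong[OF tab f(12,13)])
              then show ?case using el[of "A' a_h 0"] f by (simp add: search_state_def)
            qed
          next
            case False
            then have d: "lst a (q a) = h a" "Suc e \<le> on (lst a (q a))" by (auto simp: u_def y_def split: if_splits)
            note fr = search_freeze[OF cyc d]
            have pr: "runs lo pop_code (r1, A, M) (\<lambda>t (r', A', M'). (t \<le> 30 * (r1 r_s - r1 r_e) + 10 \<and> r' r_s = r1 r_e \<and>
              A' a_fz 0 = (\<lambda>x. if x \<in> R then 1 else A a_fz 0 x) \<and> A' a_on 0 = (\<lambda>x. if x \<in> R then 0 else A a_on 0 x) \<and>
              A' a_p = A a_p \<and> A' a_q = A a_q \<and> A' a_h = A a_h) \<and>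
              (\<forall>x. x \<notin> reg_writes pop_code \<longrightarrow> r' x = r1 x) \<and> (\<forall>k. k \<notin> arr_writes pop_code \<longrightarrow> A' k = A k) \<and>
              (\<not> raw_writes pop_code \<longrightarrow> M' = M))"
              by (rule runs_mono[OF runs_frame[OF pop_freeze_runs[where r = r1 and R = R]]])
                (use False es r1 in \<open>auto simp: R_def pq\<close>)
            show ?thesis
            proof (rule runs_mono[OF pr], goal_cases)
              case (1 t r' A' M')
              then have f: "t \<le> 50 * (s - e) + 10" "r' r_s = e" "A' a_fz 0 = (\<lambda>x. if x \<in> R then 1 else fz x)"
                "A' a_on 0 = (\<lambda>x. if x \<in> R then 0 else on x)" "A' a_p 0 = p" "A' a_q 0 = q" "A' a_h 0 = h"
                "r' r_n = n" "r' r_i = i" "A' a_stk 0 = stk" "A' a_lst = A a_lst" "A' a_rk = A a_rk"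
                by (simp_all add: r1 pq pop_code_def cong: if_cong)
              have "tables A'" by (rule tables_cong[OF tab f(11,12)])
              then show ?case using fr f by (auto simp: search_state_def)
            qed
          qed
          then have main: "runs lo pop_code (r1, A, M) (\<lambda>t (r', A', M').
              search_state r' A' \<and> 66 + t + search_potential r' A' \<le> search_potential r A)"
            by (rule runs_mono) (auto simp: search_potential_def pq)
          show ?thesis
            using False acc uns e e2 s eb main
            by (cases "y = h a"; cases "e < on y")
              (simp_all add: search_step_def runs_simps r1_def u_def flip: pq)
        qed
      qed
    qed
  qed
qed

lemma search_code_runs:
  assumes tab: "tables A" and n: "r r_n = n" and da: "da_result (\<lambda>_. 0) False (A a_p 0) (A a_h 0)"
  shows "runs lo search_code (r, A, M) (\<lambda>t (r', A', M'). t \<le> 1000 * ((n + 1) * (n + 1)) \<and>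
      (\<exists>\<mu>. represents (A' a_p 0) (A' a_h 0) \<mu> \<and> partition \<mu>))"
proof -
  let ?init = "for_code r_x r_n (Put1 a_q (Var r_x) (Incr (Arr1 a_p (Var r_x))) ;; Put1 a_on (Var r_x) (Lit 0) ;; Put1 a_fz (Var r_x) (Lit 0))"
  define I where "I = (\<lambda>i (r :: regs) A' (M :: nat \<Rightarrow> nat). A' a_p = A a_p \<and>
    (\<forall>x<i. A' a_q 0 x = Suc (A a_p 0 x) \<and> A' a_on 0 x = 0 \<and> A' a_fz 0 x = (0::nat)))"
  have init: "runs lo ?init (r, A, M) (\<lambda>t (r', A', M'). t \<le> 6 + n * 30 \<and> I n r' A' M')"
    by (rule runs_for[where N = n and b = "\<lambda>_. 23" and I = I])
      (use n in \<open>auto simp: runs_simps less_Suc_eq I_def\<close>)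
  show ?thesis unfolding search_code_def
  proof (rule runs_then, rule runs_frame, rule init, goal_cases)
    case (1 t1 r1 A1 M1)
    then have c: "A1 a_p = A a_p" "\<And>x. x < n \<Longrightarrow> A1 a_q 0 x = Suc (A a_p 0 x)" "\<And>x. x < n \<Longrightarrow> A1 a_on 0 x = 0"
      "\<And>x. x < n \<Longrightarrow> A1 a_fz 0 x = 0" "A1 a_h = A a_h" "r1 r_n = n" "t1 \<le> 6 + n * 30"
      by (simp_all add: for_code_def n I_def)
    have tab1: "tables A1" by (rule tables_cong[OF tab]) (use 1 in \<open>simp_all add: for_code_def\<close>)
    obtain \<mu> where "search_inv \<mu> (A1 a_p 0) (A1 a_q 0) (A1 a_h 0) (A1 a_fz 0) (A1 a_on 0) (A1 a_stk 0) 0 0"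
      using search_init[OF da, of "A1 a_q 0" "A1 a_on 0" "A1 a_fz 0"] c by auto
    then have st: "search_state (r1(r_i := 0, r_s := 0)) A1" using tab1 c by (auto simp: search_state_def)
    have "search_pot (A1 a_q 0) (A1 a_fz 0) 0 0 \<le> 3 * (n * n) + 3 * n + n + n"
    proof -
      have "(\<Sum>z<n. n - A1 a_q 0 z) \<le> n * n"
        using sum_bounded_above[of "{..<n}" "\<lambda>z. n - A1 a_q 0 z" n] by simp
      moreover have "card {a. a < n \<and> A1 a_fz 0 a = 0} \<le> card {..<n}" by (intro card_mono) auto
      ultimately show ?thesis by (simp add: search_pot_def)
    qed
    then have pot: "search_potential (r1(r_i := 0, r_s := 0)) A1 \<le> 450 * (n * n) + 750 * n"
      by (simp add: search_potential_def)
    have "runs lo (Loop (Lt (Var r_i) (Var r_n)) search_step) (r1(r_i := 0, r_s := 0), A1, M1)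
      (\<lambda>t (r', A', M'). t \<le> 450 * (n * n) + 750 * n + 4 \<and>
        (\<exists>\<mu>. represents (A' a_p 0) (A' a_h 0) \<mu> \<and> partition \<mu>))"
    proof (rule runs_loop[where I = "\<lambda>r A M. search_state r A" and \<Phi> = search_potential])
      show "search_state (r1(r_i := 0, r_s := 0)) A1" using st .
    next
      fix r A M assume I: "search_state r A" and "val (Lt (Var r_i) (Var r_n)) r A \<noteq> 0"
      then have "r r_i < n" by (simp add: search_state_def split: if_splits)
      from search_step_runs[OF I this]
      show "runs lo search_step (r, A, M) (\<lambda>t (r', A', M'). search_state r' A' \<and>
         t + Suc (cost (Lt (Var r_i) (Var r_n))) + search_potential r' A' \<le> search_potential r A)"
        by (rule runs_mono) auto
    next
      fix t :: nat and r' A' M'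
      assume I: "search_state r' A'" and ex: "val (Lt (Var r_i) (Var r_n)) r' A' = 0"
        and t: "t + search_potential r' A' \<le> search_potential (r1(r_i := 0, r_s := 0)) A1 + Suc (cost (Lt (Var r_i) (Var r_n)))"
      obtain \<mu> where \<mu>: "search_inv \<mu> (A' a_p 0) (A' a_q 0) (A' a_h 0) (A' a_fz 0) (A' a_on 0) (A' a_stk 0) (r' r_s) (r' r_i)"
        using I by (auto simp: search_state_def)
      have "\<not> r' r_i < n" using I ex by (simp add: search_state_def split: if_splits)
      then have "partition \<mu>" using search_final[OF \<mu>] by simp
      moreover have "t \<le> 450 * (n * n) + 750 * n + 4" using t pot by simp
      ultimately show "case (r', A', M') of (r', A', M') \<Rightarrow> t \<le> 450 * (n * n) + 750 * n + 4 \<and>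
        (\<exists>\<mu>. represents (A' a_p 0) (A' a_h 0) \<mu> \<and> partition \<mu>)"
        using search_invD(1)[OF \<mu>] by auto
    qed
    then show ?case unfolding runs_simps
      by (simp, elim runs_mono, use c(7) in \<open>auto simp: algebra_simps\<close>)
  qed
qed

lemma reg_writes_search: "reg_writes search_code = {r_x, r_i, r_s, r_t, r_y, r_o, r_e, r_u, r_z}"
  and arr_writes_search: "arr_writes search_code = {a_q, a_on, a_fz, a_stk, a_h, a_p}"
  by (auto simp: search_code_def search_step_def pop_code_def for_code_def)

end

text \<open>\<open>a_nxt\<close> is the permutation whose cycles are walked: the first partition
  itself for the odd cycles, but the inverse of a candidate marriage, because the candidate reverses
  the wanted cycle.\<close>

definition next_succ_code :: cmd where
  "next_succ_code = for_code r_x r_n (Put1 a_nxt (Var r_x) (Arr a_lst (Var r_x) (Arr1 a_p (Var r_x))))"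

definition next_pred_code :: cmd where
  "next_pred_code = for_code r_x r_n (Put1 a_nxt (Var r_x) (Arr1 a_h (Var r_x)))"

text \<open>\<open>r_par\<close> holds the parity of the length, and \<open>r_min\<close> becomes
  zero when an agent below \<open>r_a\<close> is met, for a cycle is output only from its least
  agent.\<close>

definition walk_code :: cmd where
  "walk_code = for_code r_x r_n (Put1 a_inc (Var r_x) (Lit 0)) ;;
    Put1 a_inc (Var r_a) (Lit 1) ;; Assign r_len (Lit 1) ;; Assign r_par (Lit 1) ;; Assign r_min (Lit 1) ;;
    Assign r_w (Arr1 a_nxt (Var r_a)) ;;
    Loop (Neg (Eql (Var r_w) (Var r_a))) (
      Put1 a_inc (Var r_w) (Lit 1) ;; inc r_len ;; Assign r_par (Minus (Lit 1) (Var r_par)) ;;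
      Cond (Lt (Var r_w) (Var r_a)) (Assign r_min (Lit 0)) Nop ;;
      Assign r_w (Arr1 a_nxt (Var r_w)))"

definition out_code :: cmd where
  "out_code = WriteRaw (Var r_out) (Var r_len) ;; inc r_out ;; Assign r_w (Var r_a) ;;
    for_code r_k r_len (WriteRaw (Var r_out) (Var r_w) ;; inc r_out ;; Assign r_w (Arr1 a_nxt (Var r_w))) ;;
    inc r_cnt"

definition block_code :: cmd where
  "block_code = for_code r_y r_n (
     Cond (Conj (Arr1 a_inc (Var r_y)) (Conj (Lt (Arr a_rk (Var r_x) (Var r_y)) (Arr1 a_p (Var r_x)))
         (Lt (Arr a_rk (Var r_y) (Var r_x)) (Arr1 a_p (Var r_y)))))
       (Assign r_ok (Lit 0)) Nop)"

text \<open>Here \<open>a_p\<close> serves as the rank of \<open>\<zeta> x\<close> and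
  \<open>a_h\<close> as \<open>inv \<zeta> x\<close>. Only agents on the cycle start an inner loop,
  and each starts one, so the test is quadratic.\<close>

definition check_code :: cmd where
  "check_code = next_pred_code ;; walk_code ;; Assign r_ok (Var r_min) ;;
    for_code r_x r_n (
      Cond (Arr1 a_inc (Var r_x))
       (Cond (Lt (Arr1 a_p (Var r_x)) (Arr a_rk (Var r_x) (Arr1 a_h (Var r_x)))) (Assign r_ok (Lit 0)) Nop ;; block_code)
       (Cond (Lt (Arr a_rk (Var r_x) (Arr1 a_h (Var r_x))) (Arr1 a_p (Var r_x))) (Assign r_ok (Lit 0)) Nop)) ;;
    Cond (Var r_ok) out_code Nop"

definition cycle_words :: "nat list list \<Rightarrow> nat list" where
  "cycle_words L = concat (map (\<lambda>c. length c # c) L)"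

text \<open>Cell \<open>0\<close> is left for the number of cycles, which is known only at the end.
  The output overwrites the input, which has been copied into arrays by then.\<close>

definition emitted :: "nat list list \<Rightarrow> regs \<Rightarrow> (nat \<Rightarrow> nat) \<Rightarrow> bool" where
  "emitted L r M \<longleftrightarrow> r r_cnt = length L \<and> r r_out = Suc (length (cycle_words L)) \<and>
     (\<forall>i<length (cycle_words L). M (Suc i) = cycle_words L ! i)"

lemma emitted_cong: "emitted L r M \<Longrightarrow> r' r_cnt = r r_cnt \<Longrightarrow> r' r_out = r r_out \<Longrightarrow> emitted L r' M"
  by (simp add: emitted_def)

definition short_code :: cmd where
  "short_code = Assign r_ga (Var r_a) ;; Assign r_gi (Arr a_rk (Var r_a) (Var r_b)) ;;
    Assign r_gb (Var r_b) ;; Assign r_gj (Arr a_rk (Var r_b) (Var r_a)) ;; da_code ;;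
    Cond (Conj (Neg (Var r_f)) (Conj (Eql (Arr1 a_h (Var r_a)) (Var r_b)) (Eql (Arr1 a_h (Var r_b)) (Var r_a))))
      check_code Nop"

definition long_code :: cmd where
  "long_code = Assign r_ga (Var r_a) ;; Assign r_gi (Incr (Arr a_rk (Var r_a) (Var r_b))) ;;
    Assign r_gb (Var r_b) ;; Assign r_gj (Lit 0) ;; da_code ;;
    Cond (Neg (Var r_f))
      (Assign r_gj (Incr (Arr a_rk (Var r_b) (Arr1 a_h (Var r_b)))) ;; da_code ;;
       Cond (Conj (Neg (Var r_f)) (Eql (Arr1 a_h (Var r_a)) (Var r_b))) check_code Nop) Nop"

section \<open>Correctness and running time of the searches for one arc\<close>

context preference_table
begin

lemma next_succ_runs:
  assumes tab: "tables A" and n: "r r_n = n" and rep: "represents (A a_p 0) (A a_h 0) \<mu>"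
  shows "runs lo next_succ_code (r, A, M) (\<lambda>t (r', A', M'). t \<le> 6 + n * 20 \<and> (\<forall>x<n. A' a_nxt 0 x = \<mu> x))"
  unfolding next_succ_code_def
  by (rule runs_for[where N = n and b = "\<lambda>_. 13" and
        I = "\<lambda>i r A'  M. A' a_p = A a_p \<and> A' a_lst = A a_lst \<and> (\<forall>x<i. A' a_nxt 0 x = \<mu> x)"])
    (use n representsD(3,4)[OF rep] tablesD(1)[OF tab] in \<open>auto simp: runs_simps less_Suc_eq\<close>)

lemma next_pred_runs:
  assumes n: "r r_n = n" and rep: "represents (A a_p 0) (A a_h 0) \<mu>"
  shows "runs lo next_pred_code (r, A, M) (\<lambda>t (r', A', M'). t \<le> 6 + n * 20 \<and> (\<forall>x<n. A' a_nxt 0 x = inv \<mu> x))"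
  unfolding next_pred_code_def
  by (rule runs_for[where N = n and b = "\<lambda>_. 13" and
        I = "\<lambda>i r A'  M. A' a_h = A a_h \<and> (\<forall>x<i. A' a_nxt 0 x = inv \<mu> x)"])
    (use n representsD(5)[OF rep] in \<open>auto simp: runs_simps less_Suc_eq\<close>)

lemma walk_runs:
  assumes f: "f permutes {..<n}" and nxt: "\<And>x. x < n \<Longrightarrow> A a_nxt 0 x = f x" and n: "r r_n = n"
    and a: "r r_a = a" "a < n"
  shows "runs lo walk_code (r, A, M) (\<lambda>t (r', A', M'). t \<le> 80 * (n + 1) \<and> r' r_len = least_power f a \<and>
     (r' r_par \<noteq> 0 \<longleftrightarrow> odd (least_power f a)) \<and> (r' r_min \<noteq> 0 \<longleftrightarrow> least_on f a) \<and>
     (\<forall>x<n. A' a_inc 0 x \<noteq> 0 \<longleftrightarrow> x \<in> orbit f a))"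
proof -
  let ?L = "least_power f a"
  note cf = cycle_list_facts[OF f a(2)]
  have per: "permutation f" using permutes_permutation[OF f] .
  have L: "(f ^^ ?L) a = a" "0 < ?L" using least_power_of_permutation[OF per] by auto
  have Ln: "?L \<le> n" using cf(5,6) by simp
  have fn: "(f ^^ k) a < n" for k using permutes_funpow_in[OF f, of a k] a by simp
  have seg: "{(f ^^ i) a | i. i < ?L} = orbit f a" using orbit_altdef_bounded[OF L] by blast
  have clear: "runs lo (for_code r_x r_n (Put1 a_inc (Var r_x) (Lit 0))) (r, A, M)
    (\<lambda>t (r', A', M'). t \<le> 6 + n * 20 \<and> (\<forall>x<n. A' a_inc 0 x = 0))"
    by (rule runs_for[where N = n and b = "\<lambda>_. 13" and I = "\<lambda>i r A'  M. \<forall>x<i. A' a_inc 0 x = 0"])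
      (use n in \<open>auto simp: runs_simps less_Suc_eq\<close>)
  show ?thesis unfolding walk_code_def
  proof (rule runs_then, rule runs_frame, rule clear, goal_cases)
    case (1 t1 r1 A1 M1)
    then have c: "t1 \<le> 6 + n * 20" "\<And>x. x < n \<Longrightarrow> A1 a_inc 0 x = 0" "r1 r_n = n" "r1 r_a = a" "A1 a_nxt = A a_nxt"
      using n a by (simp_all add: for_code_def)
    define I where "I = (\<lambda>(r :: regs) A' (M :: nat \<Rightarrow> nat). \<exists>k. 1 \<le> k \<and> k \<le> ?L \<and> r r_len = k \<and> r r_w = (f ^^ k) a \<and> r r_a = a \<and>
      r r_par = k mod 2 \<and> (r r_min \<noteq> 0 \<longleftrightarrow> (\<forall>i<k. a \<le> (f ^^ i) a)) \<and> A' a_nxt = A a_nxt \<and>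
      (\<forall>x<n. A' a_inc 0 x \<noteq> (0::nat) \<longleftrightarrow> x \<in> {(f ^^ i) a | i. i < k}))"
    let ?r = "r1(r_len := 1, r_par := 1, r_min := 1, r_w := f a)"
    let ?A = "update A1 a_inc 0 a 1"
    have loop: "runs lo (Loop (Neg (Eql (Var r_w) (Var r_a))) (
      Put1 a_inc (Var r_w) (Lit 1) ;; inc r_len ;; Assign r_par (Minus (Lit 1) (Var r_par)) ;;
      Cond (Lt (Var r_w) (Var r_a)) (Assign r_min (Lit 0)) Nop ;;
      Assign r_w (Arr1 a_nxt (Var r_w)))) (?r, ?A, M1) (\<lambda>t (r', A', M'). t \<le> 50 * n + 6 \<and> r' r_len = ?L \<and>
     (r' r_par \<noteq> 0 \<longleftrightarrow> odd ?L) \<and> (r' r_min \<noteq> 0 \<longleftrightarrow> least_on f a) \<and>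
     (\<forall>x<n. A' a_inc 0 x \<noteq> 0 \<longleftrightarrow> x \<in> orbit f a))"
    proof (rule runs_loop[where I = I and \<Phi> = "\<lambda>r A. 50 * (?L - r r_len)"])
      show "I ?r ?A M1" unfolding I_def using c L(2) a(2) by (intro exI[of _ 1]) auto
    next
      fix r A' M assume "I r A' M" and test: "val (Neg (Eql (Var r_w) (Var r_a))) r A' \<noteq> 0"
      then obtain k where k: "1 \<le> k" "k \<le> ?L" "r r_len = k" "r r_w = (f ^^ k) a" "r r_a = a" "r r_par = k mod 2"
        "r r_min \<noteq> 0 \<longleftrightarrow> (\<forall>i<k. a \<le> (f ^^ i) a)" "A' a_nxt = A a_nxt"
        "\<forall>x<n. A' a_inc 0 x \<noteq> 0 \<longleftrightarrow> x \<in> {(f ^^ i) a | i. i < k}" by (auto simp: I_def)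
      have "(f ^^ k) a \<noteq> a" using test k by (simp split: if_splits)
      then have kL: "k < ?L" using k(2) L(1) by (metis le_neq_implies_less)
      have nx: "A' a_nxt 0 ((f ^^ k) a) = (f ^^ Suc k) a" using nxt[OF fn] k(8) by simp
      have par: "1 - k mod 2 = Suc k mod 2" by presburger
      have min1: "(\<forall>i<Suc k. a \<le> (f ^^ i) a) \<longleftrightarrow> (\<forall>i<k. a \<le> (f ^^ i) a) \<and> \<not> (f ^^ k) a < a"
        by (auto simp: less_Suc_eq)
      have set1: "{(f ^^ i) a | i. i < Suc k} = insert ((f ^^ k) a) {(f ^^ i) a | i. i < k}"
        by (auto simp: less_Suc_eq)
      have J: "I (r(r_len := Suc k, r_par := Suc k mod 2, r_min := m, r_w := (f ^^ Suc k) a)) (update A' a_inc 0 ((f ^^ k) a) 1) M"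
        if m: "m \<noteq> 0 \<longleftrightarrow> r r_min \<noteq> 0 \<and> \<not> (f ^^ k) a < a" for m
        unfolding I_def
      proof (intro exI[of _ "Suc k"] conjI allI impI)
        fix x assume "x < n"
        then show "(update A' a_inc 0 ((f ^^ k) a) 1 a_inc 0 x \<noteq> 0) = (x \<in> {(f ^^ i) a |i. i < Suc k})"
          using k(9) unfolding set1 by simp
      qed (use k kL m min1 in simp_all)
      show "runs lo (Put1 a_inc (Var r_w) (Lit 1) ;; inc r_len ;; Assign r_par (Minus (Lit 1) (Var r_par)) ;;
        Cond (Lt (Var r_w) (Var r_a)) (Assign r_min (Lit 0)) Nop ;;
        Assign r_w (Arr1 a_nxt (Var r_w))) (r, A', M)
        (\<lambda>t (r', A', M'). I r' A' M' \<and> t + Suc (cost (Neg (Eql (Var r_w) (Var r_a)))) + 50 * (?L - r' r_len) \<le> 50 * (?L - r r_len))"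
      proof (cases "(f ^^ k) a < a")
        case True
        have "I (r(r_len := Suc k, r_par := Suc k mod 2, r_min := 0, r_w := (f ^^ Suc k) a)) (update A' a_inc 0 ((f ^^ k) a) 1) M"
          using J[of 0] True by simp
        then show ?thesis using True k nx par kL by (simp add: runs_simps fun_upd_twist)
      next
        case False
        have "I (r(r_len := Suc k, r_par := Suc k mod 2, r_min := r r_min, r_w := (f ^^ Suc k) a)) (update A' a_inc 0 ((f ^^ k) a) 1) M"
          using J[of "r r_min"] False by simp
        moreover have "r(r_len := Suc k, r_par := Suc k mod 2, r_min := r r_min, r_w := (f ^^ Suc k) a) =
            r(r_len := Suc k, r_par := Suc k mod 2, r_w := (f ^^ Suc k) a)" by (simp add: fun_eq_iff)
        ultimately show ?thesis using False k nx par kL by (simp add: runs_simps)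
      qed
    next
      fix t :: nat and r' A' M'
      assume "I r' A' M'" and ex: "val (Neg (Eql (Var r_w) (Var r_a))) r' A' = 0"
        and t: "t + 50 * (?L - r' r_len) \<le> 50 * (?L - ?r r_len) + Suc (cost (Neg (Eql (Var r_w) (Var r_a))))"
      then obtain k where k: "1 \<le> k" "k \<le> ?L" "r' r_len = k" "r' r_w = (f ^^ k) a" "r' r_a = a" "r' r_par = k mod 2"
        "r' r_min \<noteq> 0 \<longleftrightarrow> (\<forall>i<k. a \<le> (f ^^ i) a)"
        "\<forall>x<n. A' a_inc 0 x \<noteq> 0 \<longleftrightarrow> x \<in> {(f ^^ i) a | i. i < k}" by (auto simp: I_def)
      have fk: "(f ^^ k) a = a" using ex k by (simp split: if_splits)
      have "?L \<le> k" using least_power_le[OF fk] k(1) by simp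
      then have kL: "k = ?L" using k(2) by simp
      have "least_on f a \<longleftrightarrow> (\<forall>i<?L. a \<le> (f ^^ i) a)" unfolding least_on_def seg[symmetric] by auto
      moreover have "t \<le> 50 * n + 6" using t Ln by simp
      ultimately show "case (r', A', M') of (r', A', M') \<Rightarrow> t \<le> 50 * n + 6 \<and> r' r_len = ?L \<and>
         (r' r_par \<noteq> 0 \<longleftrightarrow> odd ?L) \<and> (r' r_min \<noteq> 0 \<longleftrightarrow> least_on f a) \<and>
         (\<forall>x<n. A' a_inc 0 x \<noteq> 0 \<longleftrightarrow> x \<in> orbit f a)"
        using k(3,6,7,8) seg unfolding kL by (simp add: mod2_eq_if)
    qed
    have "A1 a_nxt 0 a = f a" using nxt[OF a(2)] c(5) by simp
    then show ?case using c(4) unfolding runs_simps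
      by (simp, intro runs_mono[OF loop[simplified]]) (use c(1) in auto)
  qed
qed

lemma walk_writes: "reg_writes walk_code = {r_x, r_len, r_par, r_min, r_w}" "arr_writes walk_code = {a_inc}" "\<not> raw_writes walk_code"
  and next_succ_writes: "reg_writes next_succ_code = {r_x}" "arr_writes next_succ_code = {a_nxt}" "\<not> raw_writes next_succ_code"
  and next_pred_writes: "reg_writes next_pred_code = {r_x}" "arr_writes next_pred_code = {a_nxt}" "\<not> raw_writes next_pred_code"
  and out_writes: "reg_writes out_code = {r_out, r_w, r_k, r_cnt}" "arr_writes out_code = {}"
  and block_writes: "reg_writes block_code = {r_y, r_ok}" "arr_writes block_code = {}" "\<not> raw_writes block_code"
  by (auto simp: walk_code_def next_succ_code_def next_pred_code_def out_code_def block_code_def for_code_def)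

lemma out_runs:
  assumes f: "f permutes {..<n}" and nxt: "\<And>x. x < n \<Longrightarrow> A a_nxt 0 x = f x"
    and a: "r r_a = a" "a < n" and len: "r r_len = least_power f a" and em: "emitted L r M"
    and room: "length (cycle_words L) + n + 2 \<le> lo"
  shows "runs lo out_code (r, A, M) (\<lambda>t (r', A', M'). t \<le> 40 * (n + 1) \<and> emitted (L @ [cycle_list f a]) r' M')"
proof -
  let ?l = "least_power f a" let ?w = "cycle_words L" let ?c = "cycle_list f a"
  note cf = cycle_list_facts[OF f a(2)]
  have lc: "length ?c = ?l" by (simp add: cycle_list_def)
  have ln: "?l \<le> n" using cf(5,6) by simp
  have fn: "(f ^^ k) a < n" for k using permutes_funpow_in[OF f, of a k] a by simp
  let ?r = "r(r_out := Suc (Suc (length ?w)), r_w := a)"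
  let ?M = "M(Suc (length ?w) := ?l)"
  define I where "I = (\<lambda>i (r' :: regs) (A' :: arrays) M'. r' r_out = Suc (Suc (length ?w)) + i \<and> r' r_w = (f ^^ i) a \<and>
    r' r_cnt = length L \<and> A' = A \<and> (\<forall>k<Suc (length ?w + i). M' (Suc k) = (?w @ ?l # ?c) ! k))"
  have loop: "runs lo (for_code r_k r_len (WriteRaw (Var r_out) (Var r_w) ;; inc r_out ;; Assign r_w (Arr1 a_nxt (Var r_w))))
    (?r, A, ?M) (\<lambda>t (r', A', M'). t \<le> 6 + n * 20 \<and> I ?l r' A' M')"
  proof (rule runs_for[where N = ?l and b = "\<lambda>_. 13" and I = I])
    show "I 0 ?r A ?M" using em by (auto simp: I_def emitted_def nth_append less_Suc_eq)
    show "I 0 (?r(r_k := 0)) A ?M" if "I 0 ?r A ?M" using that by (simp add: I_def)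
    show "?r r_len = ?l" using len by simp
    fix t :: nat and r' A' M' assume "I ?l r' A' M'" "t \<le> 6 + (\<Sum>i<?l. 13 + 7)"
    then show "case (r', A', M') of (r', A', M') \<Rightarrow> t \<le> 6 + n * 20 \<and> I ?l r' A' M'"
      using mult_le_mono1[OF ln, of 20] by simp
  next
    fix i r' A' M' assume I: "I i r' A' M'" and i: "i < ?l"
    have cn: "?c ! i = (f ^^ i) a" using i by (simp add: cycle_list_def)
    then have ni: "(?w @ ?l # ?c) ! Suc (length ?w + i) = (f ^^ i) a" by (simp add: nth_append)
    have J: "I (Suc i) (r'(r_out := Suc (Suc (length ?w) + Suc i), r_w := (f ^^ Suc i) a, r_k := Suc i)) A
      (M'(Suc (Suc (length ?w + i)) := (f ^^ i) a))"
      using I ni cn by (auto simp: I_def less_Suc_eq)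
    have lim: "Suc (Suc (length ?w + i)) < lo" using room i ln by simp
    show "runs lo (WriteRaw (Var r_out) (Var r_w) ;; inc r_out ;; Assign r_w (Arr1 a_nxt (Var r_w))) (r', A', M')
      (\<lambda>t (r', A', M'). I (Suc i) (r'(r_k := Suc i)) A' M' \<and> t \<le> 13)"
      using I i ni cn lim nxt[OF fn, of i] by (auto simp: runs_simps I_def less_Suc_eq)
  qed auto
  have "runs lo out_code (r, A, M) (\<lambda>t (r', A', M'). t \<le> 20 + (6 + n * 20) \<and> I ?l (r'(r_cnt := length L)) A' M' \<and> r' r_cnt = Suc (length L))"
    unfolding out_code_def runs_simps
    using em len a room by (simp add: emitted_def, intro runs_mono[OF loop]) (auto simp: I_def runs_simps)
  moreover have "cycle_words (L @ [?c]) = ?w @ ?l # ?c" by (simp add: cycle_words_def lc)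
  ultimately show ?thesis
    by (elim runs_mono) (auto simp: I_def emitted_def lc)
qed

lemma block_runs:
  assumes tab: "tables A" and n: "r r_n = n" and x: "r r_x = x" "x < n"
    and C: "\<And>y. y < n \<Longrightarrow> A a_inc 0 y \<noteq> 0 \<longleftrightarrow> y \<in> C"
  shows "runs lo block_code (r, A, M) (\<lambda>t (r', A', M'). t \<le> 6 + n * 40 \<and>
     (r' r_ok \<noteq> 0 \<longleftrightarrow> r r_ok \<noteq> 0 \<and> (\<forall>y<n. y \<in> C \<longrightarrow> \<not> (rk x y < A a_p 0 x \<and> rk y x < A a_p 0 y))))"
proof -
  define I where "I = (\<lambda>i (r' :: regs) A' (M' :: nat \<Rightarrow> nat). A' = A \<and> r' r_x = x \<and>
    (r' r_ok \<noteq> 0 \<longleftrightarrow> r r_ok \<noteq> 0 \<and> (\<forall>y<i. y \<in> C \<longrightarrow> \<not> (rk x y < A a_p 0 x \<and> rk y x < A a_p 0 y))))"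
  show ?thesis unfolding block_code_def
  proof (rule runs_for[where N = n and b = "\<lambda>_. 33" and I = I])
    fix i r A' M assume I: "I i r A' M" and i: "i < n" "r r_y = i" "r r_n = n"
    have e: "A a_rk x i = rk x i" "A a_rk i x = rk i x" using tablesD(2)[OF tab] x i by auto
    show "runs lo (Cond (Conj (Arr1 a_inc (Var r_y)) (Conj (Lt (Arr a_rk (Var r_x) (Var r_y)) (Arr1 a_p (Var r_x)))
         (Lt (Arr a_rk (Var r_y) (Var r_x)) (Arr1 a_p (Var r_y)))))
       (Assign r_ok (Lit 0)) Nop) (r, A', M) (\<lambda>t (r', A', M'). I (Suc i) (r'(r_y := Suc i)) A' M' \<and> t \<le> 33)"
    proof (cases "i \<in> C \<and> rk x i < A a_p 0 x \<and> rk i x < A a_p 0 i")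
      case True
      then have "\<exists>y<Suc i. y \<in> C \<and> rk x y < A a_p 0 x \<and> rk y x < A a_p 0 y" by auto
      then show ?thesis using True I i e C[OF i(1)] by (auto simp: runs_simps I_def)
    next
      case False
      then show ?thesis using I i e C[OF i(1)] by (auto simp: runs_simps I_def less_Suc_eq)
    qed
  qed (use n x in \<open>auto simp: I_def\<close>)
qed

lemma represents_unique: "represents p h \<mu> \<Longrightarrow> \<mu> = (\<lambda>x. if x < n then lst x (p x) else x)"
  using representsD[of p h \<mu>] by (auto simp: fun_eq_iff permutes_not_in)

lemma check_runs:
  assumes tab: "tables A" and n: "r r_n = n" and a: "r r_a = a" "a < n"
    and rep: "represents (A a_p 0) (A a_h 0) \<zeta>" and em: "emitted L r M"
    and room: "length (cycle_words L) + n + 2 \<le> lo"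
  shows "runs lo check_code (r, A, M) (\<lambda>t (r', A', M'). t \<le> 300 * ((n + 1) * (n + 1)) \<and>
    emitted (L @ (if check_ok \<zeta> a \<and> least_on (inv \<zeta>) a then [cycle_list (inv \<zeta>) a] else [])) r' M')"
  unfolding check_code_def
proof (rule runs_then, rule runs_frame, rule next_pred_runs, rule n, rule rep, goal_cases)
  case (1 t1 r1 A1 M1)
  let ?f = "inv \<zeta>" let ?C = "orbit (inv \<zeta>) a"
  have f: "?f permutes {..<n}" using representsD(2)[OF rep] permutes_inv by blast
  have c1: "t1 \<le> 6 + n * 20" "\<And>x. x < n \<Longrightarrow> A1 a_nxt 0 x = ?f x" "r1 r_n = n" "r1 r_a = a" "M1 = M"
    "A1 a_p = A a_p" "A1 a_h = A a_h" "r1 r_cnt = r r_cnt" "r1 r_out = r r_out"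
    using 1 n a by (simp_all add: next_pred_writes)
  have tab1: "tables A1" by (rule tables_cong[OF tab]) (use 1 in \<open>simp_all add: next_pred_writes\<close>)
  show ?case
  proof (rule runs_then, rule runs_frame, rule walk_runs[where f = "inv \<zeta>" and A = A1 and r = r1 and a = a],
      rule f, rule c1(2), assumption, rule c1(3), rule c1(4), rule a(2), goal_cases)
    case (1 t2 r2 A2 M2)
    have c2: "t2 \<le> 80 * (n + 1)" "r2 r_len = least_power ?f a" "r2 r_min \<noteq> 0 \<longleftrightarrow> least_on ?f a"
      "\<And>x. x < n \<Longrightarrow> A2 a_inc 0 x \<noteq> 0 \<longleftrightarrow> x \<in> ?C"
      "r2 r_n = n" "r2 r_a = a" "M2 = M" "A2 a_p = A a_p" "A2 a_h = A a_h" "r2 r_cnt = r r_cnt" "r2 r_out = r r_out"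
      "A2 a_nxt = A1 a_nxt"
      using 1 c1 by (simp_all add: walk_writes)
    have tab2: "tables A2" by (rule tables_cong[OF tab1]) (use 1 in \<open>simp_all add: walk_writes\<close>)
    define chk where "chk x \<longleftrightarrow> (x \<in> ?C \<longrightarrow> rk x (?f x) \<le> rk x (\<zeta> x) \<and>
      (\<forall>y<n. y \<in> ?C \<longrightarrow> \<not> (rk x y < rk x (\<zeta> x) \<and> rk y x < rk y (\<zeta> y)))) \<and>
      (x \<notin> ?C \<longrightarrow> rk x (\<zeta> x) \<le> rk x (?f x))" for x
    have ok: "check_ok \<zeta> a \<longleftrightarrow> (\<forall>x<n. chk x)" by (simp add: check_ok_def chk_def)
    define I where "I = (\<lambda>i (r' :: regs) A' (M' :: nat \<Rightarrow> nat). A' = A2 \<and> M' = M \<and>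
       (r' r_ok \<noteq> 0 \<longleftrightarrow> least_on ?f a \<and> (\<forall>x<i. chk x)))"
    let ?r = "r2(r_ok := r2 r_min)"
    let ?body = "Cond (Arr1 a_inc (Var r_x))
       (Cond (Lt (Arr1 a_p (Var r_x)) (Arr a_rk (Var r_x) (Arr1 a_h (Var r_x)))) (Assign r_ok (Lit 0)) Nop ;; block_code)
       (Cond (Lt (Arr a_rk (Var r_x) (Arr1 a_h (Var r_x))) (Arr1 a_p (Var r_x))) (Assign r_ok (Lit 0)) Nop)"
    have loop: "runs lo (for_code r_x r_n ?body) (?r, A2, M) (\<lambda>t (r', A', M'). t \<le> 6 + n * (60 + n * 40) \<and> I n r' A' M')"
    proof (rule runs_for[where N = n and b = "\<lambda>_. 50 + n * 40" and I = I])
      show "I 0 ?r A2 M" using c2 by (simp add: I_def)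
      show "I 0 (?r(r_x := 0)) A2 M" if "I 0 ?r A2 M" using that by (simp add: I_def)
      show "?r r_n = n" using c2 by simp
      fix t :: nat and r' A' M' assume "I n r' A' M'" "t \<le> 6 + (\<Sum>i<n. 50 + n * 40 + 7)"
      then show "case (r', A', M') of (r', A', M') \<Rightarrow> t \<le> 6 + n * (60 + n * 40) \<and> I n r' A' M'"
        by (simp add: algebra_simps)
    next
      fix x r' A' M' assume I: "I x r' A' M'" and x: "x < n" "r' r_x = x" "r' r_n = n"
      have p: "A2 a_p 0 y = rk y (\<zeta> y)" if "y < n" for y using representsD(8)[OF rep that] c2(8) by simp
      have h: "A2 a_h 0 x = ?f x" "?f x < n" using representsD(5,7)[OF rep x(1)] c2(9) by simp_all
      have e: "A2 a_rk x (?f x) = rk x (?f x)" using tablesD(2)[OF tab2] x h by simp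
      show "runs lo ?body (r', A', M') (\<lambda>t (r', A', M'). I (Suc x) (r'(r_x := Suc x)) A' M' \<and> t \<le> 50 + n * 40)"
      proof (cases "x \<in> ?C")
        case False
        have "chk x \<longleftrightarrow> \<not> rk x (?f x) < rk x (\<zeta> x)" using False by (auto simp: chk_def)
        then have "(\<forall>y<Suc x. chk y) \<longleftrightarrow> (\<forall>y<x. chk y) \<and> \<not> rk x (?f x) < rk x (\<zeta> x)" by (auto simp: less_Suc_eq)
        then show ?thesis using False I x e h p[OF x(1)] c2(4)[OF x(1)] by (simp add: runs_simps I_def)
      next
        case True
        define b where "b = (if rk x (\<zeta> x) < rk x (?f x) then r'(r_ok := 0) else r')"
        define bl where "bl \<longleftrightarrow> (\<forall>y<n. y \<in> ?C \<longrightarrow> \<not> (rk x y < A2 a_p 0 x \<and> rk y x < A2 a_p 0 y))"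
        have "bl \<longleftrightarrow> (\<forall>y<n. y \<in> ?C \<longrightarrow> \<not> (rk x y < rk x (\<zeta> x) \<and> rk y x < rk y (\<zeta> y)))"
          using p x(1) by (auto simp: bl_def)
        then have "chk x \<longleftrightarrow> \<not> rk x (\<zeta> x) < rk x (?f x) \<and> bl" using True by (auto simp: chk_def)
        then have ch: "(\<forall>y<Suc x. chk y) \<longleftrightarrow> (\<forall>y<x. chk y) \<and> \<not> rk x (\<zeta> x) < rk x (?f x) \<and> bl" by (auto simp: less_Suc_eq)
        have br: "b r_n = n" "b r_x = x" using x by (simp_all add: b_def)
        have "runs lo block_code (b, A2, M) (\<lambda>t (r', A', M'). (t \<le> 6 + n * 40 \<and>
            (r' r_ok \<noteq> 0 \<longleftrightarrow> b r_ok \<noteq> 0 \<and> bl)) \<and> A' = A2 \<and> M' = M)"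
          unfolding bl_def
          by (rule runs_mono[OF runs_frame[OF block_runs[OF tab2, where r = b and C = ?C]]])
            (use br x c2(4) in \<open>auto simp: block_writes fun_eq_iff\<close>)
        then have blk: "runs lo block_code (b, A2, M) (\<lambda>t (r', A', M'). I (Suc x) (r'(r_x := Suc x)) A' M' \<and> t \<le> 6 + n * 40)"
          by (rule runs_mono) (use I ch in \<open>auto simp: I_def b_def split: if_splits\<close>)
        have AM: "A' = A2" "M' = M" using I by (simp_all add: I_def)
        show ?thesis
        proof (cases "rk x (\<zeta> x) < rk x (?f x)")
          case lt: True
          then have "b = r'(r_ok := 0)" by (simp add: b_def)
          then show ?thesis using blk True lt AM x e h p[OF x(1)] c2(4)[OF x(1)]
            by (simp add: runs_simps) (erule runs_mono, simp)
        next
          case nlt: False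
          then have "b = r'" by (simp add: b_def)
          then show ?thesis using blk True nlt AM x e h p[OF x(1)] c2(4)[OF x(1)]
            by (simp add: runs_simps) (erule runs_mono, simp)
        qed
      qed
    qed (auto simp: block_writes)
    have fin: "runs lo (for_code r_x r_n ?body ;; Cond (Var r_ok) out_code Nop) (?r, A2, M)
      (\<lambda>t (r', A', M'). t \<le> (6 + n * (60 + n * 40)) + (40 * (n + 1) + 4) \<and>
        emitted (L @ (if check_ok \<zeta> a \<and> least_on (inv \<zeta>) a then [cycle_list (inv \<zeta>) a] else [])) r' M')"
    proof (rule runs_then, rule runs_frame, rule loop, goal_cases)
      case (1 t3 r3 A3 M3)
      have c3: "t3 \<le> 6 + n * (60 + n * 40)" "A3 = A2" "M3 = M" "r3 r_ok \<noteq> 0 \<longleftrightarrow> least_on ?f a \<and> check_ok \<zeta> a"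
        "r3 r_len = least_power ?f a" "r3 r_a = a" "r3 r_cnt = r r_cnt" "r3 r_out = r r_out"
        using 1 c2 ok by (simp_all add: for_code_def block_writes I_def)
      have em3: "emitted L r3 M" using emitted_cong[OF em] c3 by simp
      show ?case
      proof (cases "least_on ?f a \<and> check_ok \<zeta> a")
        case True
        have nx: "\<And>x. x < n \<Longrightarrow> A2 a_nxt 0 x = ?f x" using c1 c2 by simp
        have "runs lo out_code (r3, A2, M) (\<lambda>t (r', A', M'). t \<le> 40 * (n + 1) \<and> emitted (L @ [cycle_list ?f a]) r' M')"
          by (rule out_runs[where r = r3 and f = "inv \<zeta>" and A = A2 and a = a]) (use c3 f nx a em3 room in simp_all)
        then show ?thesis using True c3 by (simp add: runs_simps, elim runs_mono) auto
      next
        case False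
        then show ?thesis using c3 em3 by (auto simp: runs_simps)
      qed
    qed
    show ?case unfolding runs_simps(2) runs_simps(6)[of _ "Assign _ _"] c2(7) val.simps
      by (rule runs_mono[OF fin]) (use c1(1) c2(1) in \<open>auto simp: algebra_simps\<close>)
  qed
qed

lemma check_writes: "reg_writes check_code = {r_x, r_len, r_par, r_min, r_w, r_ok, r_y, r_out, r_k, r_cnt}"
  "arr_writes check_code = {a_nxt, a_inc}"
  by (auto simp: check_code_def next_pred_writes walk_writes out_writes block_writes for_code_def)

lemma short_runs:
  assumes \<pi>0: "partition \<pi>\<^sub>0" and tab: "tables A" and n: "r r_n = n" and a: "r r_a = a" "a < n" and b: "r r_b = b" "b < n"
    and ne: "a \<noteq> b" and odd: "a \<notin> odd_members \<pi>\<^sub>0" and em: "emitted L r M"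
    and room: "length (cycle_words L) + n + 2 \<le> lo"
  shows "runs lo short_code (r, A, M) (\<lambda>t (r', A', M'). t \<le> 700 * ((n + 1) * (n + 1)) \<and>
    (\<exists>L'. listing L' {C \<in> cycles_at a b. card C = 2} \<and> length L' \<le> 1 \<and> emitted (L @ L') r' M'))"
proof -
  have rk: "A a_rk a b = rk a b" "A a_rk b a = rk b a" "rk a b < n" "rk b a < n"
    using tablesD(2)[OF tab] a b rk_lt by auto
  let ?r = "r(r_ga := a, r_gi := rk a b, r_gb := b, r_gj := rk b a)"
  let ?N = "(n + 1) * (n + 1)"
  have "runs lo (da_code ;;
    Cond (Conj (Neg (Var r_f)) (Conj (Eql (Arr1 a_h (Var r_a)) (Var r_b)) (Eql (Arr1 a_h (Var r_b)) (Var r_a))))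
      check_code Nop) (?r, A, M) (\<lambda>t (r', A', M'). t \<le> 600 * ?N + 30 \<and>
    (\<exists>L'. listing L' {C \<in> cycles_at a b. card C = 2} \<and> length L' \<le> 1 \<and> emitted (L @ L') r' M'))"
  proof (rule runs_then, rule runs_frame, rule da_code_runs, goal_cases)
    case (8 t1 r1 A1 M1)
    have c1: "t1 \<le> 300 * ?N" "da_result (thresholds a (rk a b) b (rk b a)) (r1 r_f \<noteq> 0) (A1 a_p 0) (A1 a_h 0)"
      "r1 r_n = n" "r1 r_a = a" "r1 r_b = b" "r1 r_cnt = r r_cnt" "r1 r_out = r r_out" "M1 = M"
      using 8 n a b by (simp_all add: reg_writes_da arr_writes_da raw_writes_da)
    have tab1: "tables A1" by (rule tables_cong[OF tab]) (use 8 in \<open>simp_all add: arr_writes_da\<close>)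
    have em1: "emitted L r1 M" using emitted_cong[OF em] c1 by simp
    define \<zeta> where "\<zeta> = (\<lambda>x. if x < n then lst x (A1 a_p 0 x) else x)"
    define L' where "L' = (if \<not> r1 r_f \<noteq> 0 \<and> A1 a_h 0 a = b \<and> A1 a_h 0 b = a \<and> check_ok \<zeta> a \<and> least_on (inv \<zeta>) a
      then [cycle_list (inv \<zeta>) a] else [])"
    have ls: "listing L' {C \<in> cycles_at a b. card C = 2}"
      by (rule short_cycle_listing[OF \<pi>0 a(2) b(2) odd ne c1(2)]) (simp add: L'_def \<zeta>_def)
    show ?case
    proof (cases "r1 r_f = 0 \<and> A1 a_h 0 a = b \<and> A1 a_h 0 b = a")
      case True
      then obtain \<mu> where "represents (A1 a_p 0) (A1 a_h 0) \<mu>" using c1(2) by (auto simp: da_result_def)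
      then have rep: "represents (A1 a_p 0) (A1 a_h 0) \<zeta>" using represents_unique[of "A1 a_p 0" "A1 a_h 0" \<mu>] by (simp add: \<zeta>_def)
      have L'1: "L' = (if check_ok \<zeta> a \<and> least_on (inv \<zeta>) a then [cycle_list (inv \<zeta>) a] else [])"
        using True by (simp add: L'_def)
      have "runs lo check_code (r1, A1, M) (\<lambda>t (r', A', M'). t \<le> 300 * ?N \<and> emitted (L @ L') r' M')"
        unfolding L'1 by (rule check_runs[where r = r1 and A = A1 and a = a]) (use tab1 c1 a rep em1 room in simp_all)
      then have "runs lo check_code (r1, A1, M) (\<lambda>t (r', A', M'). t1 + (t + 20) \<le> 600 * ?N + 30 \<and>
          (\<exists>L'. listing L' {C \<in> cycles_at a b. card C = 2} \<and> length L' \<le> 1 \<and> emitted (L @ L') r' M'))"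
        by (rule runs_mono) (use c1(1) ls L'_def in \<open>auto intro!: exI[of _ L']\<close>)
      then show ?thesis using True c1 by (simp add: runs_simps) (erule runs_mono, simp)
    next
      case False
      then have "L' = []" by (auto simp: L'_def)
      then show ?thesis using False c1 ls em1 by (auto simp: runs_simps intro!: exI[of _ "[]"])
    qed
  qed (use tab n a b ne rk in auto)
  then show ?thesis unfolding short_code_def using a b rk
    by (simp add: runs_simps(2) runs_simps(6)[of _ "Assign _ _"]) (erule runs_mono, auto)
qed

lemma long_runs:
  assumes \<pi>0: "partition \<pi>\<^sub>0" and tab: "tables A" and n: "r r_n = n" and a: "r r_a = a" "a < n" and b: "r r_b = b" "b < n"
    and ne: "a \<noteq> b" and odd: "a \<notin> odd_members \<pi>\<^sub>0" and em: "emitted L r M"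
    and room: "length (cycle_words L) + n + 2 \<le> lo"
  shows "runs lo long_code (r, A, M) (\<lambda>t (r', A', M'). t \<le> 1000 * ((n + 1) * (n + 1)) \<and>
    (\<exists>L'. listing L' {C \<in> cycles_at a b. card C \<noteq> 2} \<and> length L' \<le> 1 \<and> emitted (L @ L') r' M'))"
proof -
  have rk: "A a_rk a b = rk a b" "rk a b < n" using tablesD(2)[OF tab] a b rk_lt by auto
  let ?r = "r(r_ga := a, r_gi := Suc (rk a b), r_gb := b, r_gj := 0)"
  let ?N = "(n + 1) * (n + 1)"
  let ?Q = "\<lambda>r' M'. \<exists>L'. listing L' {C \<in> cycles_at a b. card C \<noteq> 2} \<and> length L' \<le> 1 \<and> emitted (L @ L') r' M'"
  have "runs lo (da_code ;; Cond (Neg (Var r_f))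
      (Assign r_gj (Incr (Arr a_rk (Var r_b) (Arr1 a_h (Var r_b)))) ;; da_code ;;
       Cond (Conj (Neg (Var r_f)) (Eql (Arr1 a_h (Var r_a)) (Var r_b))) check_code Nop) Nop) (?r, A, M)
    (\<lambda>t (r', A', M'). t \<le> 900 * ?N + 60 \<and> ?Q r' M')"
  proof (rule runs_then, rule runs_frame, rule da_code_runs, goal_cases)
    case (8 t1 r1 A1 M1)
    have c1: "t1 \<le> 300 * ?N" "da_result (thresholds a (Suc (rk a b)) b 0) (r1 r_f \<noteq> 0) (A1 a_p 0) (A1 a_h 0)"
      "r1 r_n = n" "r1 r_a = a" "r1 r_b = b" "r1 r_cnt = r r_cnt" "r1 r_out = r r_out" "M1 = M"
      "r1 r_ga = a" "r1 r_gi = Suc (rk a b)" "r1 r_gb = b"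
      using 8 n a b by (simp_all add: reg_writes_da arr_writes_da raw_writes_da)
    have tab1: "tables A1" by (rule tables_cong[OF tab]) (use 8 in \<open>simp_all add: arr_writes_da\<close>)
    have em1: "emitted L r1 M" using emitted_cong[OF em] c1 by simp
    show ?case
    proof (cases "r1 r_f = 0")
      case False
      \<comment> \<open>The second run has not taken place; its results can be arbitrary, because
        \<open>long_cycle_listing\<close> constrains them only under
        \<open>\<not> fail1\<close>.\<close>
      have "listing [] {C \<in> cycles_at a b. card C \<noteq> 2}"
        by (rule long_cycle_listing[OF \<pi>0 a(2) b(2) odd ne c1(2), where fail = True and p = "\<lambda>_. 0" and h = "\<lambda>_. 0"]) (use False in auto)
      then show ?thesis using False c1 em1 by (auto simp: runs_simps intro!: exI[of _ "[]"])
    next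
      case ok1: True
      obtain \<mu> where rep1: "represents (A1 a_p 0) (A1 a_h 0) \<mu>" using c1(2) ok1 by (auto simp: da_result_def)
      let ?c = "A1 a_h 0 b"
      have c: "?c < n" using representsD(7)[OF rep1 b(2)] .
      have rk1: "A1 a_rk b ?c = rk b ?c" "rk b ?c < n" using tablesD(2)[OF tab1] b c rk_lt by auto
      have "runs lo (da_code ;; Cond (Conj (Neg (Var r_f)) (Eql (Arr1 a_h (Var r_a)) (Var r_b))) check_code Nop)
        (r1(r_gj := Suc (rk b ?c)), A1, M) (\<lambda>t (r', A', M'). t \<le> 600 * ?N + 20 \<and> ?Q r' M')"
      proof (rule runs_then, rule runs_frame, rule da_code_runs, goal_cases)
        case (8 t2 r2 A2 M2)
        have c2: "t2 \<le> 300 * ?N" "da_result (thresholds a (Suc (rk a b)) b (Suc (rk b ?c))) (r2 r_f \<noteq> 0) (A2 a_p 0) (A2 a_h 0)"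
          "r2 r_n = n" "r2 r_a = a" "r2 r_b = b" "r2 r_cnt = r r_cnt" "r2 r_out = r r_out" "M2 = M"
          using 8 c1 by (simp_all add: reg_writes_da arr_writes_da raw_writes_da)
        have tab2: "tables A2" by (rule tables_cong[OF tab1]) (use 8 in \<open>simp_all add: arr_writes_da\<close>)
        have em2: "emitted L r2 M" using emitted_cong[OF em] c2 by simp
        define \<zeta> where "\<zeta> = (\<lambda>x. if x < n then lst x (A2 a_p 0 x) else x)"
        define L' where "L' = (if \<not> r1 r_f \<noteq> 0 \<and> \<not> r2 r_f \<noteq> 0 \<and> A2 a_h 0 a = b \<and> check_ok \<zeta> a \<and> least_on (inv \<zeta>) a
          then [cycle_list (inv \<zeta>) a] else [])"
        have ls: "listing L' {C \<in> cycles_at a b. card C \<noteq> 2}"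
          by (rule long_cycle_listing[OF \<pi>0 a(2) b(2) odd ne c1(2) c2(2)]) (simp add: L'_def \<zeta>_def)
        show ?case
        proof (cases "r2 r_f = 0 \<and> A2 a_h 0 a = b")
          case True
          then obtain \<mu> where "represents (A2 a_p 0) (A2 a_h 0) \<mu>" using c2(2) by (auto simp: da_result_def)
          then have rep: "represents (A2 a_p 0) (A2 a_h 0) \<zeta>" using represents_unique[of "A2 a_p 0" "A2 a_h 0" \<mu>] by (simp add: \<zeta>_def)
          have L'1: "L' = (if check_ok \<zeta> a \<and> least_on (inv \<zeta>) a then [cycle_list (inv \<zeta>) a] else [])"
            using True ok1 by (simp add: L'_def)
          have "runs lo check_code (r2, A2, M) (\<lambda>t (r', A', M'). t \<le> 300 * ?N \<and> emitted (L @ L') r' M')"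
            unfolding L'1 by (rule check_runs[where r = r2 and A = A2 and a = a]) (use tab2 c2 a rep em2 room in simp_all)
          then have "runs lo check_code (r2, A2, M) (\<lambda>t (r', A', M'). t2 + (t + 15) \<le> 600 * ?N + 20 \<and> ?Q r' M')"
            by (rule runs_mono) (use c2(1) ls L'_def in \<open>auto intro!: exI[of _ L']\<close>)
          then show ?thesis using True c2 by (simp add: runs_simps) (erule runs_mono, simp)
        next
          case False
          then have "L' = []" by (auto simp: L'_def)
          then show ?thesis using False c2 ls em2 by (auto simp: runs_simps intro!: exI[of _ "[]"])
        qed
      qed (use tab1 c1 a b ne rk rk1 in auto)
      then have "runs lo (da_code ;; Cond (Conj (Neg (Var r_f)) (Eql (Arr1 a_h (Var r_a)) (Var r_b))) check_code Nop)
        (r1(r_gj := Suc (rk b ?c)), A1, M) (\<lambda>t (r', A', M'). t1 + (t + 20) \<le> 900 * ?N + 60 \<and> ?Q r' M')"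
        by (rule runs_mono) (use c1(1) in auto)
      then show ?thesis using ok1 c1 rk1
        by (simp add: runs_simps(1,2,7) runs_simps(6)[of _ "Assign _ _"]) (erule runs_mono, simp)
    qed
  qed (use tab n a b ne rk in auto)
  then show ?thesis unfolding long_code_def using a b rk
    by (simp add: runs_simps(2) runs_simps(6)[of _ "Assign _ _"]) (erule runs_mono, auto)
qed

end

text \<open>Input rows have \<open>n - 1\<close> entries; the agent itself is appended as the last
  one, and the ranks are tabulated on the way.\<close>

definition init_code :: cmd where
  "init_code = ReadRaw r_n (Lit 0) ;; Assign r_k (Minus (Var r_n) (Lit 1)) ;; Assign r_pos (Lit 1) ;;
    for_code r_a r_n (
      for_code r_j r_k (
        ReadRaw r_x (Var r_pos) ;;
        Put a_lst (Var r_a) (Var r_j) (Var r_x) ;;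
        Put a_rk (Var r_a) (Var r_x) (Var r_j) ;;
        inc r_pos) ;;
      Put a_lst (Var r_a) (Var r_k) (Var r_a) ;;
      Put a_rk (Var r_a) (Var r_a) (Var r_k))"

definition odd_code :: cmd where
  "odd_code = for_code r_a r_n (walk_code ;; Put1 a_odd (Var r_a) (Var r_par) ;;
     Cond (Conj (Var r_par) (Var r_min)) out_code Nop)"

definition pair_code :: cmd where
  "pair_code = Cond (Conj (Neg (Arr1 a_odd (Var r_a))) (Conj (Neg (Arr1 a_odd (Var r_b))) (Neg (Eql (Var r_a) (Var r_b)))))
     (short_code ;; long_code) Nop"

definition pairs_code :: cmd where
  "pairs_code = for_code r_a r_n (for_code r_b r_n pair_code)"

definition main_code :: cmd where
  "main_code = init_code ;; da_code ;; search_code ;; next_succ_code ;;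
    Assign r_cnt (Lit 0) ;; Assign r_out (Lit 1) ;; odd_code ;; pairs_code ;; WriteRaw (Lit 0) (Var r_cnt)"

section \<open>Assembling the program and summing the costs\<close>

context preference_table
begin

lemma init_runs:
  assumes M0: "M 0 = n" and M: "\<And>a j. a < n \<Longrightarrow> j < n - 1 \<Longrightarrow> M (Suc (a * (n - 1) + j)) = lst a j"
    and room: "n * n + 2 \<le> lo"
  shows "runs lo init_code (r, A, M) (\<lambda>t (r', A', M'). t \<le> 100 * ((n + 1) * (n + 1)) \<and> r' r_n = n \<and> tables A' \<and> M' = M)"
proof -
  define rows where "rows i A' \<longleftrightarrow> (\<forall>a<i. \<forall>j<n. A' a_lst a j = lst a j \<and> A' a_rk a j = rk a j)" for i and A' :: arrays
  define I where "I = (\<lambda>i (r' :: regs) A' M'. r' r_pos = Suc (i * (n - 1)) \<and> r' r_k = n - 1 \<and> rows i A' \<and> M' = M)"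
  let ?inner = "ReadRaw r_x (Var r_pos) ;; Put a_lst (Var r_a) (Var r_j) (Var r_x) ;;
        Put a_rk (Var r_a) (Var r_x) (Var r_j) ;; inc r_pos"
  have last: "lst a (n - 1) = a" if "a < n" for a using that rk_last lst_rk by metis
  have step: "runs lo (for_code r_j r_k ?inner ;; Put a_lst (Var r_a) (Var r_k) (Var r_a) ;;
      Put a_rk (Var r_a) (Var r_a) (Var r_k)) (r, A, M') (\<lambda>t (r', A', M'). I (Suc i) (r'(r_a := Suc i)) A' M' \<and> t \<le> 20 + n * 30)"
    if I: "I i r A M'" and i: "i < n" "r r_a = i" "r r_n = n" for i r A M'
  proof -
    define K where "K = (\<lambda>j (r' :: regs) A' M'. r' r_pos = Suc (i * (n - 1) + j) \<and> rows i A' \<and>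
        M' = M \<and> r' r_a = i \<and> (\<forall>k<j. A' a_lst i k = lst i k \<and> A' a_rk i (lst i k) = k))"
    have "runs lo (for_code r_j r_k ?inner) (r, A, M') (\<lambda>t (r', A', M'). t \<le> 6 + n * 30 \<and> K (n - 1) r' A' M')"
    proof (rule runs_for[where N = "n - 1" and b = "\<lambda>_. 23" and I = K])
      show "K 0 r A M'" using I i by (simp add: K_def I_def)
      show "K 0 (r(r_j := 0)) A M'" if "K 0 r A M'" using that by (simp add: K_def)
      show "r r_k = n - 1" using I by (simp add: I_def)
      fix t :: nat and r' A' M' assume "K (n - 1) r' A' M'" "t \<le> 6 + (\<Sum>i<n - 1. 23 + 7)"
      moreover have "(n - 1) * 30 \<le> n * 30" by simp
      ultimately show "case (r', A', M') of (r', A', M') \<Rightarrow> t \<le> 6 + n * 30 \<and> K (n - 1) r' A' M'" by simp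
    next
      fix j r' A' M' assume K: "K j r' A' M'" and j: "j < n - 1" "r' r_j = j" "r' r_k = n - 1"
      have x: "M (Suc (i * (n - 1) + j)) = lst i j" using M i j by simp
      have "i * (n - 1) + j < n * n"
      proof -
        have "i * (n - 1) + j < i * (n - 1) + n" using j by simp
        also have "\<dots> \<le> (n - 1) * n + n" using i by (intro add_mono mult_le_mono) auto
        also have "\<dots> = n * n" using i by (cases n) auto
        finally show ?thesis .
      qed
      then have lim: "Suc (i * (n - 1) + j) < lo" using room by simp
      have ne: "lst i k \<noteq> lst i j" if "k < j" for k
      proof -
        have "k < n" "j < n" using that j(1) by simp_all
        then show ?thesis using rk_lst[OF i(1)] that by (metis less_irrefl_nat)
      qed
      have rows: "rows i (update (update A' a_lst i j (lst i j)) a_rk i (lst i j) j)"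
        using K by (auto simp: K_def rows_def)
      have "\<forall>k<Suc j. ((A' a_lst i)(j := lst i j)) k = lst i k \<and> ((A' a_rk i)(lst i j := j)) (lst i k) = k"
        using K ne by (auto simp: K_def less_Suc_eq)
      then have "K (Suc j) (r'(r_x := lst i j, r_pos := Suc (Suc (i * (n - 1) + j)), r_j := Suc j))
          (update (update A' a_lst i j (lst i j)) a_rk i (lst i j) j) M"
        using rows K unfolding K_def by simp
      then show "runs lo ?inner (r', A', M') (\<lambda>t (r', A', M'). K (Suc j) (r'(r_j := Suc j)) A' M' \<and> t \<le> 23)"
        using K j x lim by (simp add: runs_simps K_def)
    qed auto
    then have inner: "runs lo (for_code r_j r_k ?inner) (r, A, M') (\<lambda>t (r', A', M'). (t \<le> 6 + n * 30 \<and> K (n - 1) r' A' M') \<and> r' r_k = n - 1)"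
      by (rule runs_mono[OF runs_frame]) (use I in \<open>auto simp: for_code_def I_def\<close>)
    show ?thesis
    proof (rule runs_then, rule inner, goal_cases)
      case (1 t1 r1 A1 M1)
      then have K: "K (n - 1) r1 A1 M1" "t1 \<le> 6 + n * 30" "r1 r_k = n - 1" by auto
      let ?A = "update (update A1 a_lst i (n - 1) i) a_rk i i (n - 1)"
      have l: "?A a_lst i j = lst i j" if "j < n" for j
      proof (cases "j = n - 1")
        case True then show ?thesis using last[OF i(1)] by simp
      next
        case False
        then have "j < n - 1" using that by simp
        then show ?thesis using K(1) False by (simp add: K_def)
      qed
      have rr: "?A a_rk i x = rk i x" if "x < n" for x
      proof (cases "x = i")
        case True then show ?thesis using rk_last[OF i(1)] by simp
      next
        case False
        have "rk i x \<noteq> n - 1" using False lst_rk[OF i(1) that] last[OF i(1)] by auto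
        then have "rk i x < n - 1" using rk_lt[OF i(1) that] by simp
        then have "A1 a_rk i (lst i (rk i x)) = rk i x" using K(1) by (simp add: K_def)
        then show ?thesis using False lst_rk[OF i(1) that] by simp
      qed
      have old: "?A a_lst a j = lst a j \<and> ?A a_rk a j = rk a j" if "a < i" "j < n" for a j
        using K(1) that by (simp add: K_def rows_def)
      have "rows (Suc i) ?A" unfolding rows_def using l rr old by (auto simp: less_Suc_eq)
      moreover have "Suc (i * (n - 1) + (n - 1)) = Suc (Suc i * (n - 1))" by simp
      ultimately show ?case using K by (simp add: runs_simps K_def I_def)
    qed
  qed
  have loop: "runs lo (for_code r_a r_n (for_code r_j r_k ?inner ;; Put a_lst (Var r_a) (Var r_k) (Var r_a) ;;
      Put a_rk (Var r_a) (Var r_a) (Var r_k))) (r(r_n := n, r_k := n - 1, r_pos := 1), A, M)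
      (\<lambda>t (r', A', M'). t \<le> 6 + n * (27 + n * 30) \<and> I n r' A' M')"
  proof (rule runs_for[where N = n and b = "\<lambda>_. 20 + n * 30" and I = I])
    fix t :: nat and r' A' M' assume "I n r' A' M'" "t \<le> 6 + (\<Sum>i<n. 20 + n * 30 + 7)"
    then show "case (r', A', M') of (r', A', M') \<Rightarrow> t \<le> 6 + n * (27 + n * 30) \<and> I n r' A' M'" by simp
  qed (use step in \<open>auto simp: I_def rows_def for_code_def\<close>)
  have "runs lo (for_code r_a r_n (for_code r_j r_k ?inner ;; Put a_lst (Var r_a) (Var r_k) (Var r_a) ;;
      Put a_rk (Var r_a) (Var r_a) (Var r_k))) (r(r_n := n, r_k := n - 1, r_pos := 1), A, M)
      (\<lambda>t (r', A', M'). (t \<le> 6 + n * (27 + n * 30) \<and> I n r' A' M') \<and> r' r_n = n)"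
    by (rule runs_mono[OF runs_frame[OF loop]]) (auto simp: for_code_def)
  note loop' = this
  have "runs lo init_code (r, A, M) (\<lambda>t (r', A', M'). (t \<le> 10 + (6 + n * (27 + n * 30)) \<and> I n r' A' M') \<and> r' r_n = n)"
    unfolding init_code_def runs_simps(2,4) runs_simps(6)[of _ "Assign _ _"] runs_simps(6)[of _ "ReadRaw _ _"]
      val.simps cost.simps
    using room M0 by (simp, intro runs_mono[OF loop'[simplified]]) auto
  then show ?thesis by (rule runs_mono) (auto simp: I_def rows_def tables_def algebra_simps)
qed

lemma cycle_words_length:
  assumes "listing L S" shows "length (cycle_words L) \<le> length L * (n + 1)"
proof -
  have "\<forall>c\<in>set L. length c \<le> n" using assms by (simp add: listing_def)
  then show ?thesis by (induction L) (auto simp: cycle_words_def)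
qed

lemma odd_runs:
  assumes \<pi>0: "partition \<pi>\<^sub>0" and nxt: "\<And>x. x < n \<Longrightarrow> A a_nxt 0 x = \<pi>\<^sub>0 x" and n: "r r_n = n"
    and em: "r r_cnt = 0" "r r_out = 1" and room: "n * (n + 1) + n + 2 \<le> lo"
  shows "runs lo odd_code (r, A, M) (\<lambda>t (r', A', M'). t \<le> 200 * ((n + 1) * (n + 1)) \<and>
     (\<forall>x<n. A' a_odd 0 x \<noteq> 0 \<longleftrightarrow> x \<in> odd_members \<pi>\<^sub>0) \<and>
     (\<exists>L. listing L (\<Union>a<n. odd_cycles_at a) \<and> length L \<le> n \<and> emitted L r' M'))"
proof -
  note p0 = partition_permutes[OF \<pi>0]
  define I where "I = (\<lambda>i (r' :: regs) A' M'. A' a_nxt = A a_nxt \<and>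
     (\<forall>x<i. A' a_odd 0 x \<noteq> (0::nat) \<longleftrightarrow> x \<in> odd_members \<pi>\<^sub>0) \<and>
     (\<exists>L. listing L (\<Union>a<i. odd_cycles_at a) \<and> length L \<le> i \<and> emitted L r' M'))"
  show ?thesis unfolding odd_code_def
  proof (rule runs_for[where N = n and b = "\<lambda>_. 150 * (n + 1)" and I = I])
    have "emitted [] r M" using em by (simp add: emitted_def cycle_words_def)
    then show "I 0 r A M" using listing_Nil by (auto simp: I_def intro!: exI[of _ "[]"])
    show "I 0 (r(r_a := 0)) A M" if "I 0 r A M" using that by (auto simp: I_def emitted_def)
    fix t :: nat and r' A' M' assume "I n r' A' M'" "t \<le> 6 + (\<Sum>i<n. 150 * (n + 1) + 7)"
    then show "case (r', A', M') of (r', A', M') \<Rightarrow> t \<le> 200 * ((n + 1) * (n + 1)) \<and>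
     (\<forall>x<n. A' a_odd 0 x \<noteq> 0 \<longleftrightarrow> x \<in> odd_members \<pi>\<^sub>0) \<and>
     (\<exists>L. listing L (\<Union>a<n. odd_cycles_at a) \<and> length L \<le> n \<and> emitted L r' M')"
      by (auto simp: I_def algebra_simps)
  next
    fix a r A1 M assume I: "I a r A1 M" and a: "a < n" "r r_a = a" "r r_n = n"
    obtain L where L: "listing L (\<Union>a<a. odd_cycles_at a)" "length L \<le> a" "emitted L r M" using I by (auto simp: I_def)
    have nx: "\<And>x. x < n \<Longrightarrow> A1 a_nxt 0 x = \<pi>\<^sub>0 x" using I nxt by (simp add: I_def)
    note cf = cycle_list_facts[OF p0 a(1)]
    define L' where "L' = (if a \<in> odd_members \<pi>\<^sub>0 \<and> least_on \<pi>\<^sub>0 a then [cycle_list \<pi>\<^sub>0 a] else [])"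
    have L': "listing L' (odd_cycles_at a)" unfolding L'_def by (rule odd_cycle_listing[OF \<pi>0 a(1)])
    have "(\<Union>a<a. odd_cycles_at a) \<inter> odd_cycles_at a = {}"
    proof -
      have "odd_cycles_at a' \<inter> odd_cycles_at a = {}" if "a' < a" for a'
        using that by (intro odd_cycles_disjoint[OF \<pi>0]) simp
      then show ?thesis by blast
    qed
    then have LL: "listing (L @ L') (\<Union>a<Suc a. odd_cycles_at a)"
      using listing_append[OF L(1) L'] by (simp add: lessThan_Suc Un_commute)
    have len: "length (L @ L') \<le> Suc a" using L(2) by (simp add: L'_def)
    have "length (cycle_words L) \<le> n * (n + 1)"
      using cycle_words_length[OF L(1)] mult_le_mono1[of "length L" n "n + 1"] L(2) a(1) by simp
    then have rm: "length (cycle_words L) + n + 2 \<le> lo" using room by simp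
    have fin: "runs lo c s (\<lambda>t (r', A', M'). t0 + t \<le> 150 * (n + 1) \<and> I (Suc a) (r'(r_a := Suc a)) A' M')"
      if "runs lo c s (\<lambda>t (r', A', M'). t0 + t \<le> 150 * (n + 1) \<and> A' a_nxt = A a_nxt \<and>
        (\<forall>x<Suc a. A' a_odd 0 x \<noteq> (0::nat) \<longleftrightarrow> x \<in> odd_members \<pi>\<^sub>0) \<and> emitted (L @ L') r' M')" for c s t0
      using that by (rule runs_mono) (use LL len in \<open>auto simp: I_def emitted_def intro!: exI[of _ "L @ L'"]\<close>)
    show "runs lo (walk_code ;; Put1 a_odd (Var r_a) (Var r_par) ;; Cond (Conj (Var r_par) (Var r_min)) out_code Nop) (r, A1, M)
        (\<lambda>t (r', A', M'). I (Suc a) (r'(r_a := Suc a)) A' M' \<and> t \<le> 150 * (n + 1))"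
    proof (rule runs_then, rule runs_frame, rule walk_runs[where f = \<pi>\<^sub>0 and A = A1 and r = r and a = a],
        rule p0, rule nx, assumption, rule a, rule a, rule a, goal_cases)
      case (1 t1 r1 A2 M1)
      have c: "t1 \<le> 80 * (n + 1)" "r1 r_len = least_power \<pi>\<^sub>0 a" "r1 r_par \<noteq> 0 \<longleftrightarrow> a \<in> odd_members \<pi>\<^sub>0"
        "r1 r_min \<noteq> 0 \<longleftrightarrow> least_on \<pi>\<^sub>0 a" "r1 r_a = a" "M1 = M" "A2 a_nxt = A1 a_nxt" "A2 a_odd = A1 a_odd"
        "r1 r_cnt = r r_cnt" "r1 r_out = r r_out"
        using 1 a cf(5) by (simp_all add: walk_writes odd_members_def)
      have em1: "emitted L r1 M" using emitted_cong[OF L(3)] c by simp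
      let ?A = "update A2 a_odd 0 a (r1 r_par)"
      have A: "?A a_nxt = A a_nxt" "\<forall>x<Suc a. ?A a_odd 0 x \<noteq> 0 \<longleftrightarrow> x \<in> odd_members \<pi>\<^sub>0"
        using I c by (auto simp: I_def less_Suc_eq)
      show ?case
      proof (cases "r1 r_par \<noteq> 0 \<and> r1 r_min \<noteq> 0")
        case True
        then have L'1: "L' = [cycle_list \<pi>\<^sub>0 a]" using c by (simp add: L'_def)
        have "runs lo out_code (r1, ?A, M) (\<lambda>t (r', A', M'). t \<le> 40 * (n + 1) \<and> emitted (L @ L') r' M')"
          unfolding L'1
          by (rule out_runs[where r = r1 and f = \<pi>\<^sub>0 and A = ?A and a = a]) (use c p0 nx a em1 rm in simp_all)
        then have "runs lo out_code (r1, ?A, M) (\<lambda>t (r', A', M'). (t1 + 15) + t \<le> 150 * (n + 1) \<and> A' a_nxt = A a_nxt \<and>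
            (\<forall>x<Suc a. A' a_odd 0 x \<noteq> (0::nat) \<longleftrightarrow> x \<in> odd_members \<pi>\<^sub>0) \<and> emitted (L @ L') r' M')"
          by (rule runs_mono[OF runs_frame]) (use c(1) A in \<open>auto simp: out_writes\<close>)
        from fin[OF this] show ?thesis using True c(5,6) by (simp add: runs_simps) (erule runs_mono, simp)
      next
        case False
        then have "L' = []" using c by (auto simp: L'_def)
        then have "runs lo Nop (r1, ?A, M) (\<lambda>t (r', A', M'). (t1 + 15) + t \<le> 150 * (n + 1) \<and> A' a_nxt = A a_nxt \<and>
            (\<forall>x<Suc a. A' a_odd 0 x \<noteq> (0::nat) \<longleftrightarrow> x \<in> odd_members \<pi>\<^sub>0) \<and> emitted (L @ L') r' M')"
          using em1 c(1) A by (simp add: runs_simps(1))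
        from fin[OF this] show ?thesis using False c(5,6) by (auto simp: runs_simps)
      qed
    qed
  qed (use n in \<open>auto simp: walk_writes out_writes\<close>)
qed

text \<open>A pair that touches an odd cycle is dismissed by a constant test. For the others, the
  short and the long search contribute \<open>700\<close> and \<open>1000\<close>.\<close>

definition pair_time :: "nat set \<Rightarrow> nat \<Rightarrow> nat \<Rightarrow> nat" where
  "pair_time S a b = (if a \<notin> S \<and> b \<notin> S then 1700 * ((n + 1) * (n + 1)) else 0) + 20"

lemma short_writes: "reg_writes short_code \<inter> {r_n, r_a, r_b} = {}" "arr_writes short_code \<inter> {a_lst, a_rk, a_odd} = {}"
  and long_writes: "reg_writes long_code \<inter> {r_n, r_a, r_b} = {}" "arr_writes long_code \<inter> {a_lst, a_rk, a_odd} = {}"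
  by (auto simp: short_code_def long_code_def reg_writes_da arr_writes_da check_writes)

lemma pair_runs:
  assumes \<pi>0: "partition \<pi>\<^sub>0" and tab: "tables A" and n: "r r_n = n" and a: "r r_a = a" "a < n" and b: "r r_b = b" "b < n"
    and odd: "\<And>x. x < n \<Longrightarrow> A a_odd 0 x \<noteq> 0 \<longleftrightarrow> x \<in> odd_members \<pi>\<^sub>0" and em: "emitted L r M"
    and L: "listing L S" and room: "(length L + 1) * (n + 1) + n + 2 \<le> lo" and S: "S \<inter> cycles_at a b = {}"
  shows "runs lo pair_code (r, A, M) (\<lambda>t (r', A', M'). t \<le> pair_time (odd_members \<pi>\<^sub>0) a b \<and>
    (\<exists>L'. listing L' (S \<union> cycles_at a b) \<and> length L' \<le> length L + 2 \<and> emitted L' r' M'))"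
proof (cases "a \<notin> odd_members \<pi>\<^sub>0 \<and> b \<notin> odd_members \<pi>\<^sub>0 \<and> a \<noteq> b")
  case False
  \<comment> \<open>Nothing is lost by skipping: the arcs of an even stable cycle join distinct
    agents, and none of them lies on an odd cycle.\<close>
  then have "cycles_at a b = {}" using even_cycle_arc[OF \<pi>0] by blast
  then show ?thesis using False odd[OF a(2)] odd[OF b(2)] a b L em
    by (auto simp: pair_code_def runs_simps pair_time_def intro!: exI[of _ L])
next
  case True
  let ?N = "(n + 1) * (n + 1)"
  let ?Q = "\<lambda>r' M'. \<exists>L'. listing L' (S \<union> cycles_at a b) \<and> length L' \<le> length L + 2 \<and> emitted L' r' M'"
  have rm: "length (cycle_words L') + n + 2 \<le> lo" if "listing L' S'" "length L' \<le> length L + 1" for L' S'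
  proof -
    have "length (cycle_words L') \<le> (length L + 1) * (n + 1)"
      using cycle_words_length[OF that(1)] mult_le_mono1[OF that(2), of "n + 1"] by linarith
    then show ?thesis using room by simp
  qed
  have split: "cycles_at a b = {C \<in> cycles_at a b. card C = 2} \<union> {C \<in> cycles_at a b. card C \<noteq> 2}" by blast
  have "runs lo (short_code ;; long_code) (r, A, M) (\<lambda>t (r', A', M'). t \<le> 1700 * ?N \<and> ?Q r' M')"
  proof (rule runs_then, rule runs_frame,
      rule short_runs[where \<pi>\<^sub>0 = \<pi>\<^sub>0 and a = a and b = b and L = L and r = r and A = A], goal_cases)
    case (12 t1 r1 A1 M1)
    have fr: "r1 x = r x" if "x \<in> {r_n, r_a, r_b}" for x using 12 that short_writes(1) by auto
    have frA: "A1 k = A k" if "k \<in> {a_lst, a_rk, a_odd}" for k using 12 that short_writes(2) by auto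
    have t1: "t1 \<le> 700 * ?N" using 12 by simp
    obtain L1 where L1: "listing L1 {C \<in> cycles_at a b. card C = 2}" "length L1 \<le> 1" "emitted (L @ L1) r1 M1"
      using 12 by auto
    have LL1: "listing (L @ L1) (S \<union> {C \<in> cycles_at a b. card C = 2})"
      using S by (intro listing_append[OF L L1(1)]) blast
    have tab1: "tables A1" by (rule tables_cong[OF tab]) (use frA in simp_all)
    have "runs lo long_code (r1, A1, M1) (\<lambda>t (r', A', M'). t \<le> 1000 * ?N \<and>
      (\<exists>L'. listing L' {C \<in> cycles_at a b. card C \<noteq> 2} \<and> length L' \<le> 1 \<and> emitted ((L @ L1) @ L') r' M'))"
      by (rule long_runs[where \<pi>\<^sub>0 = \<pi>\<^sub>0 and a = a and b = b and r = r1 and A = A1])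
        (use \<pi>0 tab1 fr n a b True L1 rm[OF LL1] in simp_all)
    then show ?case
    proof (rule runs_mono, goal_cases)
      case (1 t r' A' M')
      then obtain L2 where L2: "listing L2 {C \<in> cycles_at a b. card C \<noteq> 2}" "length L2 \<le> 1" "emitted ((L @ L1) @ L2) r' M'"
        and t: "t \<le> 1000 * ?N" by auto
      have "listing ((L @ L1) @ L2) ((S \<union> {C \<in> cycles_at a b. card C = 2}) \<union> {C \<in> cycles_at a b. card C \<noteq> 2})"
        using S by (intro listing_append[OF LL1 L2(1)]) blast
      then have "listing ((L @ L1) @ L2) (S \<union> cycles_at a b)" using split by (simp add: Un_assoc)
      moreover have "t1 + t \<le> 1700 * ?N" using t t1 by simp
      ultimately show ?case using L1(2) L2 by (auto intro!: exI[of _ "(L @ L1) @ L2"])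
    qed
  qed (use \<pi>0 tab n a b True em rm[OF L] in simp_all)
  then show ?thesis using True odd[OF a(2)] odd[OF b(2)] a b
    by (simp add: pair_code_def runs_simps(7) pair_time_def) (erule runs_mono, auto)
qed

lemma pairs_runs:
  assumes \<pi>0: "partition \<pi>\<^sub>0" and tab: "tables A" and n: "r r_n = n"
    and odd: "\<And>x. x < n \<Longrightarrow> A a_odd 0 x \<noteq> 0 \<longleftrightarrow> x \<in> odd_members \<pi>\<^sub>0"
    and em: "emitted L0 r M" "listing L0 (\<Union>a<n. odd_cycles_at a)" "length L0 \<le> n"
    and room: "(n + 2 * (n * n) + 1) * (n + 1) + n + 2 \<le> lo"
  shows "runs lo pairs_code (r, A, M) (\<lambda>t (r', A', M').
     t \<le> 6 + (\<Sum>a<n. 6 + (\<Sum>b<n. pair_time (odd_members \<pi>\<^sub>0) a b + 7) + 7) \<and>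
     (\<exists>L. listing L stable_cycle_set \<and> length L \<le> n + 2 * (n * n) \<and> emitted L r' M'))"
proof -
  let ?T = "pair_time (odd_members \<pi>\<^sub>0)"
  let ?O = "\<Union>a<n. odd_cycles_at a"
  define E where "E a b = ?O \<union> (\<Union>a'<a. \<Union>b'<n. cycles_at a' b') \<union> (\<Union>b'<b. cycles_at a b')" for a b
  \<comment> \<open>The count allows one odd cycle for each agent and two even cycles for each pair
    already treated.\<close>
  define J where "J = (\<lambda>a b (r' :: regs) A' M'. tables A' \<and> (\<forall>x<n. A' a_odd 0 x \<noteq> (0::nat) \<longleftrightarrow> x \<in> odd_members \<pi>\<^sub>0) \<and>
     (\<exists>L. listing L (E a b) \<and> length L \<le> n + 2 * (n * a) + 2 * b \<and> emitted L r' M'))"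
  have J_cong: "J a b (r'(r_a := v)) A' M' = J a b r' A' M'" "J a b (r'(r_b := v)) A' M' = J a b r' A' M'" for a b r' v A' M'
    by (simp_all add: J_def emitted_def)
  have E0: "E (Suc a) 0 = E a n" for a by (auto simp: E_def less_Suc_eq)
  have J0: "J (Suc a) 0 r' A' M'" if "J a n r' A' M'" for a r' A' M'
    using that unfolding J_def E0 by (auto simp: algebra_simps)
  have wr: "reg_writes pair_code \<inter> {r_n, r_a, r_b} = {}" "arr_writes pair_code \<inter> {a_lst, a_rk, a_odd} = {}"
    using short_writes long_writes by (auto simp: pair_code_def)
  have inner: "runs lo (for_code r_b r_n pair_code) (r, A, M) (\<lambda>t (r', A', M'). J (Suc a) 0 (r'(r_a := Suc a)) A' M' \<and>
      t \<le> 6 + (\<Sum>b<n. ?T a b + 7))"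
    if J: "J a 0 r A M" and a: "a < n" "r r_a = a" "r r_n = n" for a r A M
  proof (rule runs_for[where N = n and b = "?T a" and I = "\<lambda>b r A M. J a b r A M \<and> r r_a = a"])
    show "J a 0 r A M \<and> r r_a = a" using J a by simp
    show "J a 0 (r(r_b := 0)) A M \<and> (r(r_b := 0)) r_a = a" if "J a 0 r A M \<and> r r_a = a" using that J_cong by simp
    show "r r_n = n" using a by simp
    show "r_b \<notin> reg_writes pair_code" "r_n \<notin> reg_writes pair_code" using wr(1) by auto
    fix t :: nat and r' A' M' assume "J a n r' A' M' \<and> r' r_a = a" "t \<le> 6 + (\<Sum>i<n. ?T a i + 7)"
    then show "case (r', A', M') of (r', A', M') \<Rightarrow> J (Suc a) 0 (r'(r_a := Suc a)) A' M' \<and> t \<le> 6 + (\<Sum>b<n. ?T a b + 7)"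
      using J0 J_cong by simp
  next
    fix b r A' M' assume H: "J a b r A' M' \<and> r r_a = a" and b: "b < n" "r r_b = b" "r r_n = n"
    then have tab': "tables A'" and odd': "\<And>x. x < n \<Longrightarrow> A' a_odd 0 x \<noteq> 0 \<longleftrightarrow> x \<in> odd_members \<pi>\<^sub>0"
      by (simp_all add: J_def)
    obtain L where L: "listing L (E a b)" "length L \<le> n + 2 * (n * a) + 2 * b" "emitted L r M'"
      using H by (auto simp: J_def)
    have S: "E a b \<inter> cycles_at a b = {}"
    proof -
      have "odd_cycles_at x \<inter> cycles_at a b = {}" for x by (rule odd_even_disjoint[OF \<pi>0])
      moreover have "cycles_at a' b' \<inter> cycles_at a b = {}" if "(a', b') \<noteq> (a, b)" for a' b'
        using cycles_at_disjoint[OF \<pi>0, of a' b' a b] that by blast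
      moreover have "(a', b') \<noteq> (a, b)" if "a' < a" for a' b' using that by simp
      moreover have "(a, b') \<noteq> (a, b)" if "b' < b" for b' using that by simp
      ultimately show ?thesis unfolding E_def by blast
    qed
    have Esuc: "E a b \<union> cycles_at a b = E a (Suc b)" by (auto simp: E_def less_Suc_eq)
    have "2 * (n * a) + 2 * b \<le> 2 * (n * n)"
    proof -
      have "n * a + b \<le> n * a + n" using b by simp
      also have "\<dots> \<le> n * n" using mult_le_mono2[of "Suc a" n n] a(1) by simp
      finally show ?thesis by simp
    qed
    then have "length L + 1 \<le> n + 2 * (n * n) + 1" using L(2) by simp
    then have "(length L + 1) * (n + 1) \<le> (n + 2 * (n * n) + 1) * (n + 1)" by (rule mult_le_mono1)
    then have rm: "(length L + 1) * (n + 1) + n + 2 \<le> lo" using room by simp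
    have "runs lo pair_code (r, A', M') (\<lambda>t (r', A', M'). t \<le> ?T a b \<and>
       (\<exists>L'. listing L' (E a b \<union> cycles_at a b) \<and> length L' \<le> length L + 2 \<and> emitted L' r' M'))"
      by (rule pair_runs[where r = r and A = A' and a = a and b = b]) (use \<pi>0 tab' odd' H a b L S rm in simp_all)
    then have "runs lo pair_code (r, A', M') (\<lambda>t (r', A'', M'). (t \<le> ?T a b \<and>
       (\<exists>L'. listing L' (E a b \<union> cycles_at a b) \<and> length L' \<le> length L + 2 \<and> emitted L' r' M')) \<and>
       (\<forall>x\<in>{r_n, r_a, r_b}. r' x = r x) \<and> (\<forall>k\<in>{a_lst, a_rk, a_odd}. A'' k = A' k))"
      by (rule runs_mono[OF runs_frame]) (use wr in auto)
    then show "runs lo pair_code (r, A', M') (\<lambda>t (r', A', M').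
        (J a (Suc b) (r'(r_b := Suc b)) A' M' \<and> (r'(r_b := Suc b)) r_a = a) \<and> t \<le> ?T a b)"
    proof (rule runs_mono, goal_cases)
      case (1 t r' A'' M'')
      then obtain L' where L': "listing L' (E a (Suc b))" "length L' \<le> length L + 2" "emitted L' r' M''"
        unfolding Esuc by auto
      have "tables A''" by (rule tables_cong[OF tab']) (use 1 in simp_all)
      moreover have "length L' \<le> n + 2 * (n * a) + 2 * Suc b" using L'(2) L(2) by simp
      ultimately have "J a (Suc b) r' A'' M''" unfolding J_def using L' 1 odd' by auto
      then show ?case using 1 H J_cong by simp
    qed
  qed simp
  show ?thesis unfolding pairs_code_def
  proof (rule runs_for[where N = n and b = "\<lambda>a. 6 + (\<Sum>b<n. ?T a b + 7)" and I = "\<lambda>a. J a 0"])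
    have "E 0 0 = ?O" by (simp add: E_def)
    then show "J 0 0 r A M" using tab odd em by (auto simp: J_def)
    show "J 0 0 (r(r_a := 0)) A M" if "J 0 0 r A M" using that J_cong by simp
    show "r_a \<notin> reg_writes (for_code r_b r_n pair_code)" "r_n \<notin> reg_writes (for_code r_b r_n pair_code)"
      using wr(1) by (auto simp: for_code_def)
    show "r r_n = n" using n .
    show "runs lo (for_code r_b r_n pair_code) (r, A, M) (\<lambda>t (r', A', M'). J (Suc i) 0 (r'(r_a := Suc i)) A' M' \<and>
        t \<le> 6 + (\<Sum>b<n. ?T i b + 7))" if "J i 0 r A M" "i < n" "r r_a = i" "r r_n = n" for i r A M
      using inner[OF that] .
    fix t :: nat and r' A' M' assume J: "J n 0 r' A' M'" and t: "t \<le> 6 + (\<Sum>a<n. 6 + (\<Sum>b<n. ?T a b + 7) + 7)"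
    have "E n 0 = stable_cycle_set" unfolding stable_cycle_set_decompose[OF \<pi>0] by (auto simp: E_def)
    then show "case (r', A', M') of (r', A', M') \<Rightarrow> t \<le> 6 + (\<Sum>a<n. 6 + (\<Sum>b<n. ?T a b + 7) + 7) \<and>
      (\<exists>L. listing L stable_cycle_set \<and> length L \<le> n + 2 * (n * n) \<and> emitted L r' M')"
      using J t by (auto simp: J_def)
  qed simp
qed

text \<open>Only pairs with both agents outside \<open>S\<close> are expensive, and there are
  \<open>(n - card S)\<^sup>2\<close> of them. The summand \<open>40\<close> absorbs the constant
  cost of all pairs and the loop overhead.\<close>

lemma pair_time_sum:
  assumes S: "S \<subseteq> {..<n}"
  shows "(\<Sum>a<n. 6 + (\<Sum>b<n. pair_time S a b + 7) + 7) \<le> ((n - card S)\<^sup>2 * 1700 + 40) * ((n + 1) * (n + 1))"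
proof -
  let ?N = "(n + 1) * (n + 1)"
  have c: "card ({..<n} - S) = n - card S" using S finite_subset[OF S] by (simp add: card_Diff_subset)
  have sum: "(\<Sum>b<n. if b \<notin> S then K else 0) = (n - card S) * K" for K :: nat
  proof -
    have "(\<Sum>b<n. if b \<notin> S then K else 0) = (\<Sum>b\<in>{..<n} - S. K)"
      by (rule sum.mono_neutral_cong_right) auto
    then show ?thesis using c by simp
  qed
  have inner: "(\<Sum>b<n. pair_time S a b + 7) = (if a \<notin> S then (n - card S) * (1700 * ?N) else 0) + 27 * n" for a
  proof -
    have "(\<Sum>b<n. pair_time S a b + 7) = (\<Sum>b<n. (if b \<notin> S then (if a \<notin> S then 1700 * ?N else 0) else 0) + 27)"
      by (rule sum.cong) (auto simp: pair_time_def)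
    also have "\<dots> = (n - card S) * (if a \<notin> S then 1700 * ?N else 0) + 27 * n"
      by (simp add: sum.distrib sum mult.commute)
    finally show ?thesis by simp
  qed
  have "(\<Sum>a<n. 6 + (\<Sum>b<n. pair_time S a b + 7) + 7) =
      (\<Sum>a<n. (if a \<notin> S then (n - card S) * (1700 * ?N) else 0) + (27 * n + 13))"
    unfolding inner by (rule sum.cong) auto
  also have "\<dots> = (n - card S) * ((n - card S) * (1700 * ?N)) + n * (27 * n + 13)"
    by (simp add: sum.distrib sum)
  also have "\<dots> \<le> (n - card S)\<^sup>2 * 1700 * ?N + 40 * ?N"
  proof (rule add_mono)
    show "(n - card S) * ((n - card S) * (1700 * ?N)) \<le> (n - card S)\<^sup>2 * 1700 * ?N"
      by (simp only: power2_eq_square mult.assoc order_refl)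
    show "n * (27 * n + 13) \<le> 40 * ?N" by (simp add: algebra_simps)
  qed
  also have "\<dots> = ((n - card S)\<^sup>2 * 1700 + 40) * ?N" by (rule distrib_right[symmetric])
  finally show ?thesis .
qed

lemma main_runs:
  assumes M0: "M 0 = n" and M: "\<And>a j. a < n \<Longrightarrow> j < n - 1 \<Longrightarrow> M (Suc (a * (n - 1) + j)) = lst a j"
    and room: "(n + 2 * (n * n) + 1) * (n + 1) + n + 2 \<le> lo"
  shows "runs lo main_code (\<lambda>_. 0, A, M) (\<lambda>t (r', A', M'). \<exists>\<pi>\<^sub>0 L. partition \<pi>\<^sub>0 \<and>
     t \<le> 2000 * ((n + 1) * (n + 1)) * ((n - card (odd_members \<pi>\<^sub>0))\<^sup>2 + 1) \<and>
     listing L stable_cycle_set \<and> length (output_words L) \<le> lo \<and> (\<forall>i<length (output_words L). M' i = output_words L ! i))"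
  unfolding main_code_def
proof (rule runs_then, rule runs_frame, rule init_runs, rule M0, rule M, assumption, assumption, goal_cases)
  case 1
  show ?case using room by (simp add: algebra_simps)
next
  case (2 t1 r1 A1 M1)
  let ?N = "(n + 1) * (n + 1)"
  have c1: "t1 \<le> 100 * ?N" "r1 r_n = n" "tables A1" and fr1: "\<And>x. x \<notin> reg_writes init_code \<Longrightarrow> r1 x = 0"
    using 2 by auto
  have z1: "r1 r_ga = 0" "r1 r_gi = 0" "r1 r_gb = 0" "r1 r_gj = 0"
    by (rule fr1, simp add: init_code_def for_code_def)+
  have th: "thresholds 0 0 0 0 = (\<lambda>_. 0)" by (simp add: thresholds_def fun_eq_iff)
  have da: "runs lo da_code (r1, A1, M1) (\<lambda>s (r', A', M'). s \<le> 300 * ?N \<and>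
      da_result (\<lambda>_. 0) (r' r_f \<noteq> 0) (A' a_p 0) (A' a_h 0))"
    using da_code_runs[of A1 r1 lo M1] c1 z1 th by simp
  show ?case
  proof (rule runs_then, rule runs_frame, rule da, goal_cases)
    case (1 t2 r2 A2 M2)
    have c2: "t2 \<le> 300 * ?N" "r2 r_n = n" and d: "da_result (\<lambda>_. 0) (r2 r_f \<noteq> 0) (A2 a_p 0) (A2 a_h 0)"
      using 1 c1 by (simp_all add: reg_writes_da)
    have tab2: "tables A2" by (rule tables_cong[OF c1(3)]) (use 1 in \<open>simp_all add: arr_writes_da\<close>)
    \<comment> \<open>With all bounds zero, \<open>da_result\<close> excludes failure.\<close>
    have "r2 r_f = 0" using d by (auto simp: da_result_def split: if_splits)
    then have d2: "da_result (\<lambda>_. 0) False (A2 a_p 0) (A2 a_h 0)" using d by simp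
    show ?case
    proof (rule runs_then, rule runs_frame, rule search_code_runs, rule tab2, rule c2(2), rule d2, goal_cases)
      case (1 t3 r3 A3 M3)
      have c3: "t3 \<le> 1000 * ?N" "r3 r_n = n" using 1 c2 by (simp_all add: reg_writes_search)
      have tab3: "tables A3" by (rule tables_cong[OF tab2]) (use 1 in \<open>simp_all add: arr_writes_search\<close>)
      obtain \<pi>\<^sub>0 where rep: "represents (A3 a_p 0) (A3 a_h 0) \<pi>\<^sub>0" and \<pi>0: "partition \<pi>\<^sub>0" using 1 by auto
      let ?S = "odd_members \<pi>\<^sub>0"
      show ?case
      proof (rule runs_then, rule runs_frame, rule next_succ_runs, rule tab3, rule c3(2), rule rep, goal_cases)
        case (1 t4 r4 A4 M4)
        have c4: "t4 \<le> 6 + n * 20" "r4 r_n = n" and nxt: "\<And>x. x < n \<Longrightarrow> A4 a_nxt 0 x = \<pi>\<^sub>0 x"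
          using 1 c3 by (simp_all add: next_succ_writes)
        have tab4: "tables A4" by (rule tables_cong[OF tab3]) (use 1 in \<open>simp_all add: next_succ_writes\<close>)
        let ?r = "r4(r_cnt := 0, r_out := 1)"
        have "n * (n + 1) + n + 2 \<le> lo" using room by (simp add: algebra_simps)
        then have odd: "runs lo odd_code (?r, A4, M4) (\<lambda>t (r', A', M'). t \<le> 200 * ?N \<and>
            (\<forall>x<n. A' a_odd 0 x \<noteq> 0 \<longleftrightarrow> x \<in> ?S) \<and>
            (\<exists>L. listing L (\<Union>a<n. odd_cycles_at a) \<and> length L \<le> n \<and> emitted L r' M'))"
          using odd_runs[OF \<pi>0, of A4 ?r lo M4] nxt c4(2) by simp
        have "runs lo (odd_code ;; pairs_code ;; WriteRaw (Lit 0) (Var r_cnt)) (?r, A4, M4)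
          (\<lambda>t (r', A', M'). t \<le> 210 * ?N + ((n - card ?S)\<^sup>2 * 1700 + 40) * ?N \<and>
            (\<exists>L. listing L stable_cycle_set \<and> length (output_words L) \<le> lo \<and> (\<forall>i<length (output_words L). M' i = output_words L ! i)))"
        proof (rule runs_then, rule runs_frame, rule odd, goal_cases)
          case (1 t5 r5 A5 M5)
          have c5: "t5 \<le> 200 * ?N" "r5 r_n = n" and odd5: "\<And>x. x < n \<Longrightarrow> A5 a_odd 0 x \<noteq> 0 \<longleftrightarrow> x \<in> ?S"
            using 1 c4 by (auto simp: odd_code_def for_code_def walk_writes out_writes)
          have tab5: "tables A5"
            by (rule tables_cong[OF tab4]) (use 1 in \<open>simp_all add: odd_code_def for_code_def walk_writes out_writes\<close>)
          obtain L0 where L0: "listing L0 (\<Union>a<n. odd_cycles_at a)" "length L0 \<le> n" "emitted L0 r5 M5" using 1 by auto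
          show ?case
          proof (rule runs_then, rule pairs_runs[where A = A5 and r = r5], rule \<pi>0, rule tab5, rule c5(2), rule odd5,
              assumption, rule L0, rule L0, rule L0, rule room, goal_cases)
            case (1 t6 r6 A6 M6)
            then obtain L where L: "listing L stable_cycle_set" "emitted L r6 M6" "length L \<le> n + 2 * (n * n)" and
              t6: "t6 \<le> 6 + (\<Sum>a<n. 6 + (\<Sum>b<n. pair_time ?S a b + 7) + 7)" by auto
            have "t6 \<le> 6 + ((n - card ?S)\<^sup>2 * 1700 + 40) * ?N"
              by (rule order_trans[OF t6], rule add_left_mono, rule pair_time_sum) (auto simp: odd_members_def)
            then have t: "t5 + (t6 + 3) \<le> 210 * ?N + ((n - card ?S)\<^sup>2 * 1700 + 40) * ?N"
              using c5(1) by simp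
            define M7 where "M7 = M6(0 := r6 r_cnt)"
            have out: "M7 i = output_words L ! i" if "i < length (output_words L)" for i
              using that L(2) by (cases i) (auto simp: M7_def emitted_def output_words_def cycle_words_def)
            have "length (output_words L) \<le> Suc (length L * (n + 1))"
              using cycle_words_length[OF L(1)] by (simp add: output_words_def cycle_words_def)
            also have "\<dots> \<le> Suc ((n + 2 * (n * n)) * (n + 1))" using L(3) by (simp del: mult_Suc_right add_Suc_right)
            also have "\<dots> \<le> lo" using room by simp
            finally have "length (output_words L) \<le> lo" .
            then show ?case using t out L(1) room by (auto simp: runs_simps M7_def[symmetric] intro!: exI[of _ L])
          qed
        qed
        then show ?case unfolding runs_simps(2) runs_simps(6)[of _ "Assign _ _"]
        proof (simp, elim runs_mono, goal_cases)
          case (1 t r' A' M')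
          then obtain L where L: "listing L stable_cycle_set" "length (output_words L) \<le> lo"
            "\<forall>i<length (output_words L). M' i = output_words L ! i" by auto
          have "t1 + (t2 + (t3 + (t4 + (4 + t)))) \<le> 2000 * ?N * ((n - card ?S)\<^sup>2 + 1)"
          proof -
            let ?m = "(n - card ?S)\<^sup>2"
            have "t \<le> 250 * ?N + ?m * 1700 * ?N" using conjunct1[OF 1(2)] by (simp add: algebra_simps)
            moreover have "6 + n * 20 + 4 \<le> 30 * ?N" by simp
            ultimately have "t1 + (t2 + (t3 + (t4 + (4 + t)))) \<le> 1700 * ?N + ?m * 1700 * ?N"
              using c1(1) c2(1) c3(1) c4(1) by linarith
            also have "1700 * N + m * 1700 * N \<le> 2000 * N * (m + 1)" for N m :: nat by (simp add: algebra_simps)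
            finally show ?thesis .
          qed
          then show ?case using \<pi>0 L by (auto simp: algebra_simps)
        qed
      qed
    qed
  qed
qed

end

section \<open>The theorem\<close>

lemma nth_concat_const:
  assumes "\<forall>ys\<in>set yss. length ys = m" "i < length yss" "j < m"
  shows "i * m + j < length (concat yss) \<and> concat yss ! (i * m + j) = yss ! i ! j"
  using assms
proof (induction yss arbitrary: i)
  case (Cons ys yss)
  show ?case
  proof (cases i)
    case 0 then show ?thesis using Cons.prems by (simp add: nth_append)
  next
    case (Suc i')
    then show ?thesis using Cons.IH[of i'] Cons.prems by (simp add: nth_append)
  qed
qed simp

definition entry :: "(nat \<Rightarrow> nat list) \<Rightarrow> nat \<Rightarrow> nat \<Rightarrow> nat" where
  "entry P a j = (P a @ [a]) ! j"

definition rank :: "(nat \<Rightarrow> nat list) \<Rightarrow> nat \<Rightarrow> nat \<Rightarrow> nat" where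
  "rank P a = inv_into {..<length (P a @ [a])} ((!) (P a @ [a]))"

lemma main_code_ok: "cmd_ok main_code"
  by (simp add: main_code_def init_code_def da_code_def bound_code_def da_step_def search_code_def search_step_def
        pop_code_def next_succ_code_def next_pred_code_def walk_code_def out_code_def block_code_def check_code_def
        short_code_def long_code_def odd_code_def pair_code_def pairs_code_def for_code_def)

context
  fixes n :: nat and P :: "nat \<Rightarrow> nat list"
  assumes I: "sr_instance {0..<n} P"
begin

lemma row:
  assumes "a < n"
  shows "distinct (P a @ [a])" "set (P a @ [a]) = {..<n}" "length (P a @ [a]) = n" "length (P a) = n - 1"
proof -
  show d: "distinct (P a @ [a])" and s: "set (P a @ [a]) = {..<n}"
    using I assms by (auto simp: sr_instance_def)
  show l: "length (P a @ [a]) = n" using distinct_card[OF d] s by simp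
  then show "length (P a) = n - 1" by simp
qed

lemma instance_table: "preference_table n (entry P) (rank P)"
proof
  fix a j x assume a: "a < n"
  have bij: "bij_betw ((!) (P a @ [a])) {..<n} {..<n}"
    by (rule bij_betw_nth[OF row(1)[OF a]]) (simp_all only: row(2,3)[OF a])
  show "entry P a j < n" if "j < n"
    using bij_betw_apply[OF bij] that by (simp add: entry_def)
  show "rank P a x < n" if "x < n"
    using bij_betw_apply[OF bij_betw_inv_into[OF bij]] row(3)[OF a] that by (simp add: rank_def)
  show "entry P a (rank P a x) = x" if "x < n"
    using bij_betw_inv_into_right[OF bij] row(3)[OF a] that by (simp add: rank_def entry_def)
  show inv: "rank P a (entry P a j) = j" if "j < n" for j
    using bij_betw_inv_into_left[OF bij] row(3)[OF a] that by (simp add: rank_def entry_def)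
  have "entry P a (n - 1) = a" using row(4)[OF a] by (simp add: entry_def nth_append)
  then show "rank P a a = n - 1" using inv[of "n - 1"] a by simp
qed

interpretation T: preference_table n "entry P" "rank P" by (rule instance_table)

lemma prefers_rank:
  assumes "a < n" "x < n" "y < n"
  shows "prefers P a x y \<longleftrightarrow> rank P a x < rank P a y"
proof
  assume "prefers P a x y"
  then obtain i j where "i < j" "j < n" "entry P a i = x" "entry P a j = y"
    unfolding prefers_def row(3)[OF assms(1)] entry_def by blast
  then show "rank P a x < rank P a y" using T.rk_lst[OF assms(1)] by auto
next
  assume "rank P a x < rank P a y"
  then show "prefers P a x y"
    unfolding prefers_def row(3)[OF assms(1)]
    using T.rk_lt[OF assms(1,3)] T.lst_rk[OF assms(1,2)] T.lst_rk[OF assms(1,3)]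
    by (intro exI[of _ "rank P a x"] exI[of _ "rank P a y"]) (simp add: entry_def)
qed

lemma stable_partition_iff: "stable_partition {0..<n} P \<pi> \<longleftrightarrow> T.partition \<pi>"
proof (cases "\<pi> permutes {..<n}")
  case True
  have lt: "\<pi> a < n" "inv \<pi> a < n" if "a < n" for a
    using permutes_in_image[OF True, of a] permutes_in_image[OF permutes_inv[OF True], of a] that by auto
  have 1: "prefers P a (\<pi> a) (inv \<pi> a) \<or> \<pi> a = inv \<pi> a \<longleftrightarrow> rank P a (\<pi> a) \<le> rank P a (inv \<pi> a)" if "a < n" for a
    using prefers_rank[OF that lt[OF that]] T.rk_eq_iff[OF that lt[OF that]] by auto
  have 2: "(a \<noteq> b \<longrightarrow> \<not> (prefers P a b (inv \<pi> a) \<and> prefers P b a (inv \<pi> b))) \<longleftrightarrow>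
      \<not> (rank P a b < rank P a (inv \<pi> a) \<and> rank P b a < rank P b (inv \<pi> b))" if "a < n" "b < n" for a b
  proof (cases "a = b")
    case True
    then show ?thesis using T.rk_self[of a "inv \<pi> a"] lt[OF that(1)] that by auto
  next
    case False
    then show ?thesis using prefers_rank[OF that lt(2)[OF that(1)]] prefers_rank[OF that(2,1) lt(2)[OF that(2)]] by simp
  qed
  show ?thesis unfolding stable_partition_def T.partition_def atLeast0LessThan
    using True 1 2 by simp
qed (simp add: stable_partition_def T.partition_def atLeast0LessThan)

lemma stable_cycles_eq: "stable_cycles {0..<n} P = T.stable_cycle_set"
  by (simp add: stable_cycles_def T.stable_cycle_set_def stable_partition_iff)

lemma odd_agents_eq: "T.partition \<pi> \<Longrightarrow> odd_agents {0..<n} P = T.odd_members \<pi>"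
  unfolding odd_agents_def odd_cycles_def stable_cycles_eq by (rule T.odd_members_Field[symmetric])

lemma input_cell:
  assumes "a < n" "j < n - 1"
  shows "Suc (a * (n - 1) + j) < length (input_words n P)"
    "input_words n P ! Suc (a * (n - 1) + j) = entry P a j"
proof -
  have "\<forall>ys\<in>set (map P [0..<n]). length ys = n - 1" using row(4) by auto
  from nth_concat_const[OF this, of a j] assms
  show "Suc (a * (n - 1) + j) < length (input_words n P)"
    "input_words n P ! Suc (a * (n - 1) + j) = entry P a j"
    using row(4)[OF assms(1)] by (simp_all add: input_words_def entry_def nth_append)
qed

lemma input_words_bounds: "length (input_words n P) \<le> n * n + 1" "w \<in> set (input_words n P) \<Longrightarrow> w \<le> n"
proof -
  have "length (concat (map P [0..<k])) \<le> k * n" if "k \<le> n" for k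
    using that
  proof (induction k)
    case (Suc k)
    then show ?case using row(4)[of k] by simp
  qed simp
  then show "length (input_words n P) \<le> n * n + 1" by (simp add: input_words_def)
  have "x < n" if "a < n" "x \<in> set (P a)" for a x using row(2)[OF that(1)] that(2) by auto
  then show "w \<in> set (input_words n P) \<Longrightarrow> w \<le> n"
    by (auto simp: input_words_def intro: less_imp_le)
qed

text \<open>All values stay below \<open>2100 * lo\<close>, hence all addresses below \<open>2 ^ 29 * lo\<^sup>2\<close>.\<close>

lemma main_code_exec:
  defines "lo \<equiv> (n + 2) ^ 4"
  shows "\<exists>t s L \<pi>. exec ((n + 2) ^ 37) (code main_code) ((\<lambda>_. 0)(limit_reg := lo, temp_reg := u, temp_reg + 1 := w),
      snd (initial_state (input_words n P))) t s \<and>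
    outputs s (output_words L) \<and> T.listing L T.stable_cycle_set \<and> T.partition \<pi> \<and>
    t \<le> 40000 * ((n + 1) * (n + 1)) * ((n - card (T.odd_members \<pi>))\<^sup>2 + 1)"
proof -
  let ?M = "snd (initial_state (input_words n P))"
  let ?s = "(\<lambda>_. 0, \<lambda>_ _ _. 0, ?M) :: hstate"
  let ?\<sigma> = "((\<lambda>_. 0)(limit_reg := lo, temp_reg := u, temp_reg + 1 := w), ?M) :: state"
  have len: "length (input_words n P) \<le> lo"
    using input_words_bounds(1) by (rule order_trans) (simp add: lo_def power4_eq_xxxx algebra_simps)
  have Mle: "?M i \<le> n" for i
    using input_words_bounds(2)[OF nth_mem] by (simp add: initial_state_def)
  \<comment> \<open>The output needs only cubic space; the fourth power in \<open>lo\<close> is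
    chosen because \<open>lo\<close> also has to dominate the running time up to a constant.\<close>
  have room: "(n + 2 * (n * n) + 1) * (n + 1) + n + 2 \<le> lo"
    by (simp add: lo_def power4_eq_xxxx algebra_simps)
  have M0: "?M 0 = n" by (simp add: initial_state_def input_words_def)
  have M: "?M (Suc (a * (n - 1) + j)) = entry P a j" if "a < n" "j < n - 1" for a j
    using input_cell[OF that] by (simp add: initial_state_def)
  obtain t r' A' M' \<pi> L where h: "hexec lo main_code ?s t (r', A', M')" and \<pi>: "T.partition \<pi>"
    and t: "t \<le> 2000 * ((n + 1) * (n + 1)) * ((n - card (T.odd_members \<pi>))\<^sup>2 + 1)"
    and L: "T.listing L T.stable_cycle_set" "length (output_words L) \<le> lo"
      "\<forall>i<length (output_words L). M' i = output_words L ! i"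
    using T.main_runs[OF M0 M room, of "\<lambda>_ _ _. 0"] unfolding runs_def by auto
  have ref: "refines lo ?s ?\<sigma>"
    using len by (auto simp: refines_def address_def initial_state_def)
  \<comment> \<open>Initially all values are at most \<open>n\<close>; \<open>64\<close> is added
    because the size bound must dominate the literals of the program.\<close>
  have bd: "bounded_by (n + 64) ?s" using Mle by (auto simp: bounded_by_def intro: trans_le_add1)
  have "n + 64 + t \<le> 2100 * lo"
  proof -
    have "(n - card (T.odd_members \<pi>))\<^sup>2 + 1 \<le> (n + 1) * (n + 1)"
    proof -
      have "(n - card (T.odd_members \<pi>))\<^sup>2 \<le> n\<^sup>2" by (intro power_mono) auto
      then show ?thesis by (simp add: power2_eq_square)
    qed
    then have "2000 * ((n + 1) * (n + 1)) * ((n - card (T.odd_members \<pi>))\<^sup>2 + 1) \<le> 2000 * ((n + 1) * (n + 1)) * ((n + 1) * (n + 1))"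
      by (rule mult_le_mono2)
    then have "t \<le> 2000 * ((n + 1) * (n + 1)) * ((n + 1) * (n + 1))" using t by linarith
    also have "\<dots> \<le> 2000 * lo" by (simp add: lo_def power4_eq_xxxx algebra_simps)
    finally have "t \<le> 2000 * lo" .
    moreover have "n + 64 \<le> 100 * lo" by (simp add: lo_def power4_eq_xxxx algebra_simps)
    ultimately show ?thesis by simp
  qed
  \<comment> \<open>The coefficient \<open>282240000\<close> of \<open>lo * lo\<close> stays below
    \<open>2 ^ 29\<close> with room for the lower terms. As \<open>2 ^ 29\<close> is at most
    \<open>(n + 2) ^ 29\<close> and \<open>lo * lo\<close> is \<open>(n + 2) ^ 8\<close>, the
    exponent \<open>37\<close> results.\<close>
  moreover have "lo + (4 * (2100 * lo) * (2100 * lo) + 2100 * lo + 1) * num_arrays < (n + 2) ^ 37"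
  proof -
    have lo1: "1 \<le> lo" by (simp add: lo_def)
    have sq: "lo \<le> lo * lo" "1 \<le> lo * lo" using lo1 by simp_all
    have "lo + (4 * (2100 * lo) * (2100 * lo) + 2100 * lo + 1) * num_arrays = 282240000 * (lo * lo) + 33601 * lo + 16"
      by simp
    also have "\<dots> < 536870912 * (lo * lo)"
      using sq by linarith
    also have "\<dots> = 2 ^ 29 * (lo * lo)" by simp
    also have "\<dots> \<le> (n + 2) ^ 29 * (lo * lo)" by (intro mult_le_mono1 power_mono) auto
    also have "\<dots> = (n + 2) ^ 37" by (simp add: lo_def flip: power_add)
    finally show ?thesis .
  qed
  ultimately obtain u' \<sigma>' where e: "exec ((n + 2) ^ 37) (code main_code) ?\<sigma> u' \<sigma>'" "u' \<le> 20 * t"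
    "refines lo (r', A', M') \<sigma>'"
    using exec_code[OF h main_code_ok ref bd le_add2] by blast
  have "outputs \<sigma>' (output_words L)"
    using e(3) L(2,3) by (auto simp: outputs_def refines_def)
  moreover have "u' \<le> 40000 * ((n + 1) * (n + 1)) * ((n - card (T.odd_members \<pi>))\<^sup>2 + 1)"
  proof -
    have "x \<le> 20 * t \<Longrightarrow> t \<le> 2000 * N * k \<Longrightarrow> x \<le> 40000 * N * k" for x N k :: nat by simp
    then show ?thesis using e(2) t by blast
  qed
  ultimately show ?thesis using e(1) L(1) \<pi> by blast
qed

text \<open>The compiled code expects the start of the array area in \<open>limit_reg\<close>; two
  squarings of \<open>n + 2\<close> produce it. What remains in the temporary registers is harmless,
  as \<open>refines\<close> does not mention them.\<close>

lemma prologue_exec: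
  "exec ((n + 2) ^ 37) (Seq (Load temp_reg 0) (Seq (Const (temp_reg + 1) 2) (Seq (Add temp_reg temp_reg (temp_reg + 1))
     (Seq (Mult temp_reg temp_reg temp_reg) (Mult limit_reg temp_reg temp_reg)))))
   (initial_state (input_words n P)) 5
   ((\<lambda>_. 0)(limit_reg := (n + 2) ^ 4, temp_reg := (n + 2)\<^sup>2, temp_reg + 1 := 2), snd (initial_state (input_words n P)))"
proof -
  let ?M = "snd (initial_state (input_words n P))" and ?W = "(n + 2) ^ 37"
  let ?r1 = "(\<lambda>_. 0)(temp_reg := n) :: nat \<Rightarrow> nat"
  let ?r2 = "?r1(temp_reg + 1 := 2)" let ?r3 = "?r2(temp_reg := n + 2)" let ?r4 = "?r3(temp_reg := (n + 2)\<^sup>2)"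
  have W: "(n + 2) ^ k < ?W" if "k < 37" for k by (rule power_strict_increasing) (use that in auto)
  have 1: "exec ?W (Load temp_reg 0) (initial_state (input_words n P)) 1 (?r1, ?M)"
    using exec.Load[of ?W temp_reg 0 "\<lambda>_. 0" ?M] by (simp add: initial_state_def input_words_def)
  have 2: "exec ?W (Const (temp_reg + 1) 2) (?r1, ?M) 1 (?r2, ?M)"
    by (rule exec.Const) (use W[of 1] in simp)
  have 3: "exec ?W (Add temp_reg temp_reg (temp_reg + 1)) (?r2, ?M) 1 (?r3, ?M)"
    using exec.Add[of ?r2 temp_reg "temp_reg + 1" ?W temp_reg ?M] W[of 1] by simp
  have 4: "exec ?W (Mult temp_reg temp_reg temp_reg) (?r3, ?M) 1 (?r4, ?M)"
    using exec.Mult[of ?r3 temp_reg temp_reg ?W temp_reg ?M] W[of 2] by (simp add: power2_eq_square)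
  have sq: "(n + 2)\<^sup>2 * (n + 2)\<^sup>2 = (n + 2) ^ 4" by (simp flip: power_add)
  have 5: "exec ?W (Mult limit_reg temp_reg temp_reg) (?r4, ?M) 1 (?r4(limit_reg := (n + 2) ^ 4), ?M)"
    using exec.Mult[of ?r4 temp_reg temp_reg ?W limit_reg ?M] W[of 4] by (simp add: sq)
  have "?r4(limit_reg := (n + 2) ^ 4) = (\<lambda>_. 0)(limit_reg := (n + 2) ^ 4, temp_reg := (n + 2)\<^sup>2, temp_reg + 1 := 2)"
    by (simp add: fun_eq_iff)
  moreover have "1 + (1 + (1 + (1 + 1))) = (5 :: nat)" by simp
  ultimately show ?thesis
    using exec.Seq[OF 1 exec.Seq[OF 2 exec.Seq[OF 3 exec.Seq[OF 4 5]]]] by (simp only:)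
qed

end

text \<open>A positive \<open>m\<close> lets \<open>m\<^sup>2 * n\<^sup>2\<close> absorb the cost of
  order \<open>n\<^sup>2\<close> that does not depend on \<open>m\<close>; the same estimate with
  \<open>n\<close> in place of \<open>m\<close> gives the fourth power. The factors \<open>4\<close>
  and \<open>2\<close> for rounding up turn \<open>40000\<close> into \<open>320000\<close>, and the
  rest of \<open>400000\<close> covers the prologue.\<close>

lemma time_bound:
  fixes n m t :: nat
  assumes t: "t \<le> 5 + 40000 * ((n + 1) * (n + 1)) * (m\<^sup>2 + 1)" and m: "m \<le> n"
  shows "0 < m \<Longrightarrow> t \<le> 400000 * (m\<^sup>2 * (n\<^sup>2 + m))" "0 < n \<Longrightarrow> t \<le> 400000 * n ^ 4"
proof -
  have n4: "(n + 1) * (n + 1) \<le> 4 * n\<^sup>2" if "0 < n"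
  proof -
    have "(n + 1) * (n + 1) \<le> (2 * n) * (2 * n)" using that by (intro mult_le_mono) auto
    then show ?thesis by (simp add: power2_eq_square)
  qed
  have *: "t \<le> 400000 * (k\<^sup>2 * n\<^sup>2)" if k: "0 < k" "m \<le> k" and n: "0 < n" for k
  proof -
    have "1 \<le> k\<^sup>2" "m\<^sup>2 \<le> k\<^sup>2" using k by (simp, intro power_mono) auto
    then have "m\<^sup>2 + 1 \<le> 2 * k\<^sup>2" by linarith
    then have "40000 * ((n + 1) * (n + 1)) * (m\<^sup>2 + 1) \<le> 40000 * (4 * n\<^sup>2) * (2 * k\<^sup>2)"
      by (intro mult_le_mono n4 n order_refl)
    moreover have "1 \<le> k\<^sup>2 * n\<^sup>2" using k n by simp
    moreover have "40000 * (4 * n\<^sup>2) * (2 * k\<^sup>2) = 320000 * (k\<^sup>2 * n\<^sup>2)" by simp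
    ultimately show ?thesis using t by linarith
  qed
  show "t \<le> 400000 * (m\<^sup>2 * (n\<^sup>2 + m))" if "0 < m"
    using *[of m] that m by (simp add: algebra_simps)
  show "t \<le> 400000 * n ^ 4" if "0 < n"
    using *[of n] that m by (simp flip: power_add)
qed

theorem theorem34:
  shows "\<exists>(p :: com) (k :: nat) (c :: nat).
    \<forall>(n :: nat) (P :: nat \<Rightarrow> nat list). sr_instance {0..<n} P \<longrightarrow>
      (\<exists>t s L. exec ((n + 2) ^ k) p (initial_state (input_words n P)) t s \<and>
         outputs s (output_words L) \<and>
         enumerates_cycles L (stable_cycles {0..<n} P) \<and>
         (let n\<^sub>2 = card (odd_agents {0..<n} P); n\<^sub>1 = n - n\<^sub>2 in
            (n\<^sub>1 > 0 \<longrightarrow> t \<le> c * (n\<^sub>1\<^sup>2 * (n\<^sup>2 + n\<^sub>1))) \<and>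
            (n > 0 \<longrightarrow> t \<le> c * n ^ 4)))"
\<comment> \<open>The schematic witnesses are fixed by the final \<open>show\<close>: the prologue
  followed by the compiled program, then \<open>37\<close> and \<open>400000\<close>.\<close>
proof (rule exI, rule exI, rule exI, intro allI impI)
  fix n :: nat and P :: "nat \<Rightarrow> nat list"
  assume I: "sr_instance {0..<n} P"
  interpret T: preference_table n "entry P" "rank P" by (rule instance_table[OF I])
  obtain t s L \<pi> where e: "exec ((n + 2) ^ 37) (code main_code)
      ((\<lambda>_. 0)(limit_reg := (n + 2) ^ 4, temp_reg := (n + 2)\<^sup>2, temp_reg + 1 := 2), snd (initial_state (input_words n P))) t s"
    and out: "outputs s (output_words L)" and L: "T.listing L T.stable_cycle_set" and \<pi>: "T.partition \<pi>"
    and t: "t \<le> 40000 * ((n + 1) * (n + 1)) * ((n - card (T.odd_members \<pi>))\<^sup>2 + 1)"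
    using main_code_exec[OF I] by blast
  have "enumerates_cycles L (stable_cycles {0..<n} P)"
    using L unfolding stable_cycles_eq[OF I] enumerates_cycles_def T.listing_def by blast
  moreover have "let n\<^sub>2 = card (odd_agents {0..<n} P); n\<^sub>1 = n - n\<^sub>2 in
      (n\<^sub>1 > 0 \<longrightarrow> 5 + t \<le> 400000 * (n\<^sub>1\<^sup>2 * (n\<^sup>2 + n\<^sub>1))) \<and> (n > 0 \<longrightarrow> 5 + t \<le> 400000 * n ^ 4)"
    using time_bound[of "5 + t" n "n - card (T.odd_members \<pi>)"] t
    unfolding odd_agents_eq[OF I \<pi>] Let_def by simp
  ultimately show "\<exists>t s L. exec ((n + 2) ^ 37)
      (Seq (Seq (Load temp_reg 0) (Seq (Const (temp_reg + 1) 2) (Seq (Add temp_reg temp_reg (temp_reg + 1))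
        (Seq (Mult temp_reg temp_reg temp_reg) (Mult limit_reg temp_reg temp_reg))))) (code main_code))
      (initial_state (input_words n P)) t s \<and> outputs s (output_words L) \<and>
         enumerates_cycles L (stable_cycles {0..<n} P) \<and>
         (let n\<^sub>2 = card (odd_agents {0..<n} P); n\<^sub>1 = n - n\<^sub>2 in
            (n\<^sub>1 > 0 \<longrightarrow> t \<le> 400000 * (n\<^sub>1\<^sup>2 * (n\<^sup>2 + n\<^sub>1))) \<and>
            (n > 0 \<longrightarrow> t \<le> 400000 * n ^ 4))"
    using exec.Seq[OF prologue_exec[OF I] e] out by blast
qed

end
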